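(* Let $K/\mathbb{Q}$ be an infinite Galois extension such that $\mathrm{Gal}(K/\mathbb{Q})$ has exponent $b$, and let $\{K_m\}_m$ be the family of all finite Galois subextensions of $K/\mathbb{Q}$. Let $n$ be a positive integer and suppose that for every $m$, every prime number $p$ and every valuation $v$ of $K_m$ above $p$, the group $\mathrm{Gal}(K_{m,v}/\mathbb{Q}_p)$ is soluble of derived length at most $n$. Then for every prime $p$ and every valuation $w$ of $K$ extending the $p$-adic valuation, $[K_w:\mathbb{Q}_p]\le \prod_{i=0}^{n}A(i)$, where $A(0)=b^3$ and $A(i+1)=b^{\left(\prod_{j=0}^{i}A(j)\right)+2}$ for $i\ge 0$.
   Context: $K_{m,v}$ and $K_w$ denote completions with respect to the given valuations. A soluble group $G$ has derived length $n$ if $n$ is the length of a shortest series $1=G_0\lhd G_1\lhd\cdots\lhd G_n=G$ with every factor $G_{i+1}/G_i$ abelian. *)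

theory Defs
  imports "HOL-Algebra.Algebra" "HOL-Library.Extended_Real"
begin

text \<open>A field extension $E/k$ is a field \<open>E\<close> together with a subfield \<open>k\<close> of \<open>E\<close>.
  A subset \<open>F\<close> of \<open>K\<close> that is a subfield is turned into a field as \<open>K\<lparr>carrier := F\<rparr>\<close>.\<close>

definition normal_extension :: "('a, 'm) ring_scheme \<Rightarrow> 'a set \<Rightarrow> bool" where
  "normal_extension E k \<longleftrightarrow>
     (\<forall>x\<in>carrier E. ring.algebraic E k x) \<and>
     (\<forall>f\<in>carrier (univ_poly E k).
        pirreducible\<^bsub>E\<^esub> k f \<and> (\<exists>x. ring.is_root E f x) \<longrightarrow> ring.splitted E f)"

text \<open>An algebraic element is separable iff it is a simple root of its minimal polynomial;
  this is independent of the field in which multiplicities are computed.\<close>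

definition separable_extension :: "('a, 'm) ring_scheme \<Rightarrow> 'a set \<Rightarrow> bool" where
  "separable_extension E k \<longleftrightarrow>
     (\<forall>x\<in>carrier E. ring.algebraic E k x \<and> ring.alg_mult E (ring.Irr E k x) x = 1)"

definition galois_extension :: "('a, 'm) ring_scheme \<Rightarrow> 'a set \<Rightarrow> bool" where
  "galois_extension E k \<longleftrightarrow>
     field E \<and> subfield k E \<and> normal_extension E k \<and> separable_extension E k"

text \<open>The group of field automorphisms of \<open>E\<close> fixing \<open>k\<close> pointwise, under composition. As in
  \<^const>\<open>AutoGroup\<close>, automorphisms are extensional functions on the carrier.\<close>

definition Gal :: "('a, 'm) ring_scheme \<Rightarrow> 'a set \<Rightarrow> ('a \<Rightarrow> 'a) monoid" where
  "Gal E k = BijGroup (carrier E)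
     \<lparr>carrier := {\<sigma> \<in> ring_iso E E \<inter> Bij (carrier E). \<forall>x\<in>k. \<sigma> x = x}\<rparr>"

definition has_exponent :: "('a, 'm) monoid_scheme \<Rightarrow> nat \<Rightarrow> bool" where
  "has_exponent G b \<longleftrightarrow>
     0 < b \<and> (\<forall>x\<in>carrier G. x [^]\<^bsub>G\<^esub> b = \<one>\<^bsub>G\<^esub>) \<and>
     (\<forall>k. 0 < k \<and> (\<forall>x\<in>carrier G. x [^]\<^bsub>G\<^esub> k = \<one>\<^bsub>G\<^esub>) \<longrightarrow> b \<le> k)"

definition abelian_series :: "('a, 'm) monoid_scheme \<Rightarrow> nat \<Rightarrow> (nat \<Rightarrow> 'a set) \<Rightarrow> bool" where
  "abelian_series G n H \<longleftrightarrow>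
     H 0 = {\<one>\<^bsub>G\<^esub>} \<and> H n = carrier G \<and>
     (\<forall>i<n. subgroup (H (Suc i)) G \<and> H i \<lhd> G\<lparr>carrier := H (Suc i)\<rparr> \<and>
            comm_group (G\<lparr>carrier := H (Suc i)\<rparr> Mod H i))"

text \<open>Meaningful only for \<^const>\<open>solvable\<close> groups, for which such a series exists.\<close>

definition derived_length :: "('a, 'm) monoid_scheme \<Rightarrow> nat" where
  "derived_length G = (LEAST n. \<exists>H. abelian_series G n H)"

definition field_char_zero :: "('a, 'm) ring_scheme \<Rightarrow> bool" where
  "field_char_zero E \<longleftrightarrow> field E \<and> (\<forall>n::nat. 0 < n \<longrightarrow> [n] \<cdot>\<^bsub>E\<^esub> \<one>\<^bsub>E\<^esub> \<noteq> \<zero>\<^bsub>E\<^esub>)"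

definition rat_embed :: "('a, 'm) ring_scheme \<Rightarrow> rat \<Rightarrow> 'a" where
  "rat_embed E q =
     ([fst (quotient_of q)] \<cdot>\<^bsub>E\<^esub> \<one>\<^bsub>E\<^esub>) \<otimes>\<^bsub>E\<^esub> inv\<^bsub>E\<^esub> ([snd (quotient_of q)] \<cdot>\<^bsub>E\<^esub> \<one>\<^bsub>E\<^esub>)"

definition rationals :: "('a, 'm) ring_scheme \<Rightarrow> 'a set" where
  "rationals E = range (rat_embed E)"

text \<open>Valuations are additive, with values in the reals together with \<open>\<infinity>\<close>. Only
  their values on the carrier matter.\<close>

definition valuation :: "('a, 'm) ring_scheme \<Rightarrow> ('a \<Rightarrow> ereal) \<Rightarrow> bool" where
  "valuation E v \<longleftrightarrow>
     (\<forall>x\<in>carrier E. v x \<noteq> -\<infinity> \<and> (v x = \<infinity> \<longleftrightarrow> x = \<zero>\<^bsub>E\<^esub>)) \<and>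
     (\<forall>x\<in>carrier E. \<forall>y\<in>carrier E. v (x \<otimes>\<^bsub>E\<^esub> y) = v x + v y) \<and>
     (\<forall>x\<in>carrier E. \<forall>y\<in>carrier E. min (v x) (v y) \<le> v (x \<oplus>\<^bsub>E\<^esub> y))"

definition padic_valuation :: "nat \<Rightarrow> rat \<Rightarrow> ereal" where
  "padic_valuation p q =
     (if q = 0 then \<infinity>
      else ereal (real (multiplicity (int p) (fst (quotient_of q)))
                  - real (multiplicity (int p) (snd (quotient_of q)))))"

definition extends_padic :: "('a, 'm) ring_scheme \<Rightarrow> ('a \<Rightarrow> ereal) \<Rightarrow> nat \<Rightarrow> bool" where
  "extends_padic E v p \<longleftrightarrow> (\<forall>q. v (rat_embed E q) = padic_valuation p q)"

text \<open>A valuation lies above \<open>p\<close> if its restriction to the rationals is equivalent to the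
  \<open>p\<close>-adic one, so that no normalisation is imposed.\<close>

definition lies_above :: "('a, 'm) ring_scheme \<Rightarrow> ('a \<Rightarrow> ereal) \<Rightarrow> nat \<Rightarrow> bool" where
  "lies_above E v p \<longleftrightarrow>
     (\<exists>c::real. 0 < c \<and> (\<forall>q. v (rat_embed E q) = ereal c * padic_valuation p q))"

definition cauchy_seqs :: "('a, 'm) ring_scheme \<Rightarrow> ('a \<Rightarrow> ereal) \<Rightarrow> (nat \<Rightarrow> 'a) set" where
  "cauchy_seqs E v =
     {s. (\<forall>i. s i \<in> carrier E) \<and>
         (\<forall>C::real. \<exists>N. \<forall>i\<ge>N. \<forall>j\<ge>N. ereal C < v (s i \<ominus>\<^bsub>E\<^esub> s j))}"

definition null_seqs :: "('a, 'm) ring_scheme \<Rightarrow> ('a \<Rightarrow> ereal) \<Rightarrow> (nat \<Rightarrow> 'a) set" where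
  "null_seqs E v = {s. (\<forall>i. s i \<in> carrier E) \<and> (\<lambda>i. v (s i)) \<longlonglongrightarrow> \<infinity>}"

definition cauchy_ring :: "('a, 'm) ring_scheme \<Rightarrow> ('a \<Rightarrow> ereal) \<Rightarrow> (nat \<Rightarrow> 'a) ring" where
  "cauchy_ring E v =
     \<lparr>carrier = cauchy_seqs E v,
      monoid.mult = (\<lambda>s t i. s i \<otimes>\<^bsub>E\<^esub> t i), monoid.one = (\<lambda>i. \<one>\<^bsub>E\<^esub>),
      ring.zero = (\<lambda>i. \<zero>\<^bsub>E\<^esub>), ring.add = (\<lambda>s t i. s i \<oplus>\<^bsub>E\<^esub> t i)\<rparr>"

definition completion :: "('a, 'm) ring_scheme \<Rightarrow> ('a \<Rightarrow> ereal) \<Rightarrow> (nat \<Rightarrow> 'a) set ring" where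
  "completion E v = cauchy_ring E v Quot null_seqs E v"

text \<open>The field of \<open>p\<close>-adic numbers as a subfield of the completion of \<open>E\<close> at a valuation \<open>v\<close>
  above \<open>p\<close>: the image of the completion of the rationals under the canonical embedding, which
  sends the class of a Cauchy sequence of rationals to its class in the completion of \<open>E\<close>.\<close>

definition padics_in :: "('a, 'm) ring_scheme \<Rightarrow> ('a \<Rightarrow> ereal) \<Rightarrow> (nat \<Rightarrow> 'a) set set" where
  "padics_in E v =
     (\<lambda>s. null_seqs E v +>\<^bsub>cauchy_ring E v\<^esub> s) ` cauchy_seqs (E\<lparr>carrier := rationals E\<rparr>) v"

fun degree_factor :: "nat \<Rightarrow> nat \<Rightarrow> nat" where
  "degree_factor b 0 = b ^ 3"
| "degree_factor b (Suc i) = b ^ ((\<Prod>j\<in>{0..i}. degree_factor b j) + 2)"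

end

theory Submission imports Defs begin

text \<open>
  Class field theory is not needed. A field \<open>M\<close> of finite degree \<open>D\<close> over \<open>\<rat>\<^sub>p\<close> contains a compact
  lattice, and a Herbrand quotient count on the principal units shows that \<open>M\<^sup>\<times>/(M\<^sup>\<times>)\<^sup>b\<close> has at most
  \<open>b\<^bsup>D+2\<^esup>\<close> elements. If \<open>M\<close> contains the \<open>b\<close>-th roots of unity, Kummer theory bounds the degree of an abelian
  extension of \<open>M\<close> of exponent \<open>b\<close> by the same number. For a finite Galois subextension \<open>F\<close> and \<open>v = w|F\<close>
  the Galois group of \<open>F\<^sub>v/\<rat>\<^sub>p\<close> has exponent dividing \<open>b\<close>, because its elements preserve the dense subfield
  \<open>F\<close> and extend to \<open>K\<close>. After adjoining the \<open>b\<close>-th roots of unity (degree at most \<open>b\<close>), the abelian series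
  of length \<open>n\<close> becomes a tower of \<open>n\<close> Kummer extensions, which bounds \<open>[F\<^sub>v : \<rat>\<^sub>p]\<close> independently of \<open>F\<close>.
  Elements of \<open>K\<close> independent over \<open>\<rat>\<^sub>p\<close> in \<open>K\<^sub>w\<close> are independent in some \<open>F\<^sub>v\<close>, so the \<open>\<rat>\<^sub>p\<close>-span of \<open>K\<close> in
  \<open>K\<^sub>w\<close> has bounded dimension; by compactness it is closed, hence it is all of \<open>K\<^sub>w\<close>.
\<close>

section \<open>Complete lattices over a uniformizer\<close>

text \<open>The obstacle is the unit group of a finite extension M of Q_p, usually reached through
  its valuation ring, residue field and ramification index. Here M carries only a lattice
  \<open>I\<close>: an additive group stable under \<open>\<pi>\<close> (later the integer p, which
  need not be a prime element of M) whose subgroups \<open>\<pi>\<close>^n I form a separated,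
  complete filtration with finitely many classes at each step. Compactness and successive
  approximation follow from these data alone, and a basis of M over Q_p supplies a lattice.

  The constants have the following origin. In b^(D+2) one factor b counts exponents of p modulo b,
  one counts b-th roots of unity, and b^D bounds (p^t)^D, where p^t is the exact power of p dividing
  b and t is the precision lost on division by b. In the tower, A(i+1) is this count with D bounded
  by the product of the preceding factors. A(0) = b^3 generously covers the degree, at most b, of
  the field generated by the b-th roots of unity.\<close>

locale padic_lattice = field R for R (structure) +
  fixes \<pi> :: 'a and I :: "'a set" and q :: nat
  assumes pi_closed [simp]: "\<pi> \<in> carrier R"
    and pi_nonzero: "\<pi> \<noteq> \<zero>"
    and subgrp: "subgroup I (add_monoid R)"
    and pi_mult: "x \<in> I \<Longrightarrow> \<pi> \<otimes> x \<in> I"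
    and separated: "\<lbrakk>\<And>n::nat. x \<in> (\<lambda>y. \<pi> [^] n \<otimes> y) ` I\<rbrakk> \<Longrightarrow> x = \<zero>"
    and complete: "\<lbrakk>\<And>i. s i \<in> carrier R; \<And>i::nat. s (Suc i) \<ominus> s i \<in> (\<lambda>y. \<pi> [^] i \<otimes> y) ` I\<rbrakk>
       \<Longrightarrow> \<exists>x\<in>carrier R. \<forall>i::nat. x \<ominus> s i \<in> (\<lambda>y. \<pi> [^] i \<otimes> y) ` I"
    and cover: "\<exists>T. finite T \<and> card T \<le> q \<and> T \<subseteq> I \<and> (\<forall>x\<in>I. \<exists>t\<in>T. x \<ominus> t \<in> (\<otimes>) \<pi> ` I)"
begin

definition lv :: "nat \<Rightarrow> 'a set" where "lv n = (\<lambda>y. \<pi> [^] n \<otimes> y) ` I"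

lemma I_carrier: "x \<in> I \<Longrightarrow> x \<in> carrier R"
  using subgroup.subset[OF subgrp] by auto

lemma lv_0: "lv 0 = I"
  unfolding lv_def using I_carrier by (force simp: image_iff)

lemma lv_carrier: "x \<in> lv n \<Longrightarrow> x \<in> carrier R"
  unfolding lv_def using I_carrier by auto

lemma zero_I: "\<zero> \<in> I"
  using subgroup.one_closed[OF subgrp] by simp

lemma I_add: "x \<in> I \<Longrightarrow> y \<in> I \<Longrightarrow> x \<oplus> y \<in> I"
  using subgroup.m_closed[OF subgrp] by simp

lemma I_neg: "x \<in> I \<Longrightarrow> \<ominus> x \<in> I"
  using subgroup.m_inv_closed[OF subgrp] by (simp add: a_inv_def)

lemma lv_zero: "\<zero> \<in> lv n"
  unfolding lv_def using zero_I by (force simp: image_iff)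

lemma lv_add: assumes "x \<in> lv n" "y \<in> lv n" shows "x \<oplus> y \<in> lv n"
proof -
  obtain a b where "a \<in> I" "b \<in> I" "x = \<pi> [^] n \<otimes> a" "y = \<pi> [^] n \<otimes> b"
    using assms unfolding lv_def by auto
  then have "x \<oplus> y = \<pi> [^] n \<otimes> (a \<oplus> b)" "a \<oplus> b \<in> I"
    using I_add I_carrier by (auto simp: r_distr)
  then show ?thesis unfolding lv_def by auto
qed

lemma lv_neg: assumes "x \<in> lv n" shows "\<ominus> x \<in> lv n"
proof -
  obtain a where "a \<in> I" "x = \<pi> [^] n \<otimes> a"
    using assms unfolding lv_def by auto
  then have "\<ominus> x = \<pi> [^] n \<otimes> (\<ominus> a)" "\<ominus> a \<in> I"
    using I_neg I_carrier by (auto simp: r_minus)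
  then show ?thesis unfolding lv_def by auto
qed

lemma lv_sub: "x \<in> lv n \<Longrightarrow> y \<in> lv n \<Longrightarrow> x \<ominus> y \<in> lv n"
  unfolding a_minus_def using lv_add lv_neg by auto

lemma lv_trans:
  assumes "x \<ominus> y \<in> lv n" "y \<ominus> z \<in> lv n" and [simp]: "x \<in> carrier R" "y \<in> carrier R" "z \<in> carrier R"
  shows "x \<ominus> z \<in> lv n"
proof -
  have "x \<ominus> z = (x \<ominus> y) \<oplus> (y \<ominus> z)" using assms(3-5) by algebra
  then show ?thesis using lv_add assms by auto
qed

lemma lv_sym:
  assumes "x \<ominus> y \<in> lv n" and [simp]: "x \<in> carrier R" "y \<in> carrier R"
  shows "y \<ominus> x \<in> lv n"
proof -
  have "y \<ominus> x = \<ominus> (x \<ominus> y)" using assms(2,3) by algebra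
  then show ?thesis using lv_neg assms by auto
qed

text \<open>Multiplication by \<open>\<pi> [^] m\<close> is injective in a field, so it matches
  level \<open>n\<close> with level \<open>m + n\<close>. This does the work of dividing by a power
  of the uniformizer.\<close>

lemma lv_shift: assumes "x \<in> carrier R" shows "\<pi> [^] m \<otimes> x \<in> lv (m + n) \<longleftrightarrow> x \<in> lv n"
proof
  assume "\<pi> [^] m \<otimes> x \<in> lv (m + n)"
  then obtain a where a: "a \<in> I" "\<pi> [^] m \<otimes> x = \<pi> [^] (m + n) \<otimes> a" unfolding lv_def by auto
  then have "\<pi> [^] m \<otimes> x = \<pi> [^] m \<otimes> (\<pi> [^] n \<otimes> a)"
    using I_carrier by (simp add: nat_pow_mult[symmetric] m_assoc)
  moreover have "\<pi> [^] m \<noteq> \<zero>" by (induction m) (use pi_nonzero integral[of _ \<pi>] in \<open>force+\<close>)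
  ultimately have "x = \<pi> [^] n \<otimes> a"
    using m_lcancel[of "\<pi> [^] m" x "\<pi> [^] n \<otimes> a"] a I_carrier assms by simp
  then show "x \<in> lv n" using a unfolding lv_def by auto
next
  assume "x \<in> lv n"
  then obtain a where "a \<in> I" "x = \<pi> [^] n \<otimes> a" unfolding lv_def by auto
  then have "\<pi> [^] m \<otimes> x = \<pi> [^] (m + n) \<otimes> a"
    using I_carrier by (simp add: nat_pow_mult[symmetric] m_assoc)
  then show "\<pi> [^] m \<otimes> x \<in> lv (m + n)" using \<open>a \<in> I\<close> unfolding lv_def by auto
qed

lemma pi_pow_I: "x \<in> I \<Longrightarrow> \<pi> [^] (n::nat) \<otimes> x \<in> I"
proof (induction n)
  case 0 then show ?case using I_carrier by simp
next
  case (Suc n)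
  have "\<pi> [^] Suc n \<otimes> x = \<pi> \<otimes> (\<pi> [^] n \<otimes> x)"
    using I_carrier[OF Suc.prems] by (simp add: m_assoc m_comm m_lcomm)
  then show ?case using Suc pi_mult by auto
qed

lemma lv_mono: assumes "m \<le> n" shows "lv n \<subseteq> lv m"
proof
  fix x assume "x \<in> lv n"
  then obtain a where a: "a \<in> I" "x = \<pi> [^] n \<otimes> a" unfolding lv_def by auto
  then have "x = \<pi> [^] m \<otimes> (\<pi> [^] (n - m) \<otimes> a)"
    using I_carrier assms by (simp add: m_assoc[symmetric] nat_pow_mult)
  then show "x \<in> lv m" using pi_pow_I[OF a(1)] unfolding lv_def by auto
qed

lemma lv_I: "x \<in> lv n \<Longrightarrow> x \<in> I"
  using lv_mono[of 0 n] lv_0 by auto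

lemma lv_separated: "(\<And>n. x \<in> lv n) \<Longrightarrow> x = \<zero>"
  using separated unfolding lv_def by auto

text \<open>By separatedness a nonzero \<open>x\<close> drops out of the filtration. The last level
  containing it gives the exponent, and the cofactor cannot lie in \<open>lv 1\<close>. Elements of
  \<open>I - lv 1\<close> take the place of units.\<close>

lemma primitive_part:
  assumes x: "x \<in> I" "x \<noteq> \<zero>"
  shows "\<exists>y\<in>I - lv 1. \<exists>m::nat. x = \<pi> [^] m \<otimes> y"
proof -
  obtain k where k: "x \<notin> lv k" using lv_separated x(2) by blast
  let ?m = "LEAST k. x \<notin> lv k"
  have m: "x \<notin> lv ?m" using k by (rule LeastI)
  then have "?m \<noteq> 0" using x(1) lv_0 by metis
  then obtain m' where m': "?m = Suc m'" using not0_implies_Suc by blast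
  then have "x \<in> lv m'" using not_less_Least[of m' "\<lambda>k. x \<notin> lv k"] by simp
  then obtain y where y: "y \<in> I" "x = \<pi> [^] m' \<otimes> y" unfolding lv_def by auto
  have "y \<notin> lv 1" using lv_shift[of y m' 1] m y I_carrier unfolding m' by auto
  then show ?thesis using y by blast
qed

lemma lv_complete:
  assumes "\<And>i. s i \<in> carrier R" "\<And>i. s (Suc i) \<ominus> s i \<in> lv i"
  shows "\<exists>x\<in>carrier R. \<forall>i. x \<ominus> s i \<in> lv i"
  using complete[of s] assms unfolding lv_def by auto

text \<open>The representatives are expansions of length \<open>n\<close> in powers of
  \<open>\<pi>\<close> with digits from the cover of \<open>I\<close>, hence the bound
  \<open>q ^ n\<close>.\<close>

lemma lv_cover: "\<exists>T. finite T \<and> card T \<le> q ^ n \<and> T \<subseteq> lv m \<and> (\<forall>x\<in>lv m. \<exists>t\<in>T. x \<ominus> t \<in> lv (m + n))"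
proof (induction n)
  case 0
  show ?case by (rule exI[of _ "{\<zero>}"]) (auto simp: lv_zero a_minus_def lv_carrier)
next
  case (Suc n)
  then obtain T where T: "finite T" "card T \<le> q ^ n" "T \<subseteq> lv m" "\<And>x. x \<in> lv m \<Longrightarrow> \<exists>t\<in>T. x \<ominus> t \<in> lv (m + n)"
    by auto
  obtain T1 where T1: "finite T1" "card T1 \<le> q" "T1 \<subseteq> I" "\<And>x. x \<in> I \<Longrightarrow> \<exists>t\<in>T1. x \<ominus> t \<in> (\<otimes>) \<pi> ` I"
    using cover by auto
  let ?f = "\<lambda>(t, u). t \<oplus> \<pi> [^] (m + n) \<otimes> u"
  let ?U = "?f ` (T \<times> T1)"
  have "finite ?U" using T T1 by auto
  moreover have "card ?U \<le> q ^ Suc n"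
    using card_image_le[of "T \<times> T1" ?f] T(1,2) T1(1,2) mult_le_mono[OF T1(2) T(2)]
    by (simp add: card_cartesian_product mult.commute)
  moreover have "?U \<subseteq> lv m"
  proof (clarsimp)
    fix t u assume "t \<in> T" "u \<in> T1"
    then have "t \<in> lv m" "\<pi> [^] (m + n) \<otimes> u \<in> lv m"
      using T(3) T1(3) lv_mono[of m "m + n"] lv_def[of "m + n"] by auto
    then show "t \<oplus> \<pi> [^] (m + n) \<otimes> u \<in> lv m" by (rule lv_add)
  qed
  moreover have "\<exists>t\<in>?U. x \<ominus> t \<in> lv (m + Suc n)" if x: "x \<in> lv m" for x
  proof -
    obtain t where t: "t \<in> T" "x \<ominus> t \<in> lv (m + n)" using T(4)[OF x] by auto
    then obtain a where a: "a \<in> I" "x \<ominus> t = \<pi> [^] (m + n) \<otimes> a" unfolding lv_def by auto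
    obtain u where u: "u \<in> T1" "a \<ominus> u \<in> (\<otimes>) \<pi> ` I" using T1(4)[OF a(1)] by auto
    then have "a \<ominus> u \<in> lv 1" unfolding lv_def by simp
    have cc: "a \<in> carrier R" "u \<in> carrier R" "x \<in> carrier R" "t \<in> carrier R" "\<pi> [^] (m + n) \<in> carrier R"
      using a u T1 T t x I_carrier lv_carrier by auto
    have "x \<ominus> (t \<oplus> \<pi> [^] (m + n) \<otimes> u) = (x \<ominus> t) \<ominus> \<pi> [^] (m + n) \<otimes> u"
      using cc by algebra
    also have "\<dots> = \<pi> [^] (m + n) \<otimes> (a \<ominus> u)"
      unfolding a(2) using cc by algebra
    also have "\<dots> \<in> lv (m + n + 1)" using lv_shift[of "a \<ominus> u" "m + n" 1] \<open>a \<ominus> u \<in> lv 1\<close> cc by simp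
    finally show ?thesis using t(1) u(1) by (force)
  qed
  ultimately show ?case by blast
qed

text \<open>Sequential compactness of \<open>I\<close>: refining the finite covers level by level
  keeps infinitely many indices in one class, and completeness turns the nested classes into a
  point.\<close>

lemma accumulation_point:
  assumes s: "\<And>k::nat. s k \<in> I"
  shows "\<exists>x\<in>I. \<forall>n. infinite {k. s k \<ominus> x \<in> lv n}"
proof -
  have sc: "\<And>k. s k \<in> carrier R" using s I_carrier by auto
  have "\<exists>y. \<forall>n. (y n \<in> I \<and> infinite {k. s k \<ominus> y n \<in> lv n}) \<and> y (Suc n) \<ominus> y n \<in> lv n"
  proof (rule dependent_nat_choice)
    have "{k. s k \<ominus> \<zero> \<in> lv 0} = UNIV" using s sc by (auto simp: lv_0 a_minus_def)
    then show "\<exists>x. x \<in> I \<and> infinite {k. s k \<ominus> x \<in> lv 0}" using zero_I by (metis infinite_UNIV_nat)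
  next
    fix y n assume y: "y \<in> I \<and> infinite {k. s k \<ominus> y \<in> lv n}"
    obtain T where T: "finite T" "T \<subseteq> lv 0" "\<And>x. x \<in> lv 0 \<Longrightarrow> \<exists>t\<in>T. x \<ominus> t \<in> lv (Suc n)"
      using lv_cover[of "Suc n" 0] by auto
    then have "\<forall>k. \<exists>t. t \<in> T \<and> s k \<ominus> t \<in> lv (Suc n)" using s lv_0 by blast
    then obtain f where f: "\<And>k. f k \<in> T" "\<And>k. s k \<ominus> f k \<in> lv (Suc n)" by metis
    let ?A = "{k. s k \<ominus> y \<in> lv n}"
    \<comment> \<open>Pigeonhole: finitely many classes modulo \<open>lv (Suc n)\<close> meet the
      infinite index set \<open>?A\<close>, so one of them keeps infinitely many indices, and its
      centre is within \<open>lv n\<close> of the previous one.\<close>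
    have "finite (f ` ?A)" using f T(1) by (meson finite_subset image_subsetI)
    then obtain k0 where k0: "k0 \<in> ?A" "infinite {a \<in> ?A. f a = f k0}"
      using pigeonhole_infinite[of ?A f] y by auto
    have fI: "f k0 \<in> I" using f T lv_0 by auto
    have "f k0 \<ominus> y \<in> lv n"
    proof (rule lv_trans)
      show "f k0 \<ominus> s k0 \<in> lv n"
        using lv_sym[OF f(2)[of k0]] sc fI I_carrier lv_mono[of n "Suc n"] by auto
      show "s k0 \<ominus> y \<in> lv n" using k0 by auto
    qed (use fI y sc I_carrier in auto)
    moreover have "infinite {k. s k \<ominus> f k0 \<in> lv (Suc n)}"
    proof (rule infinite_super[OF _ k0(2)])
      show "{a \<in> ?A. f a = f k0} \<subseteq> {k. s k \<ominus> f k0 \<in> lv (Suc n)}" using f(2) by (auto, metis)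
    qed
    ultimately show "\<exists>z. (z \<in> I \<and> infinite {k. s k \<ominus> z \<in> lv (Suc n)}) \<and> z \<ominus> y \<in> lv n"
      using fI by blast
  qed
  then obtain y where y: "\<And>n. y n \<in> I" "\<And>n. infinite {k. s k \<ominus> y n \<in> lv n}" "\<And>n. y (Suc n) \<ominus> y n \<in> lv n"
    by blast
  have yc: "\<And>n. y n \<in> carrier R" using y I_carrier by auto
  obtain x where x: "x \<in> carrier R" "\<And>i. x \<ominus> y i \<in> lv i"
    using lv_complete[of y, OF yc y(3)] by blast
  have "x = (x \<ominus> y 0) \<oplus> y 0" using x(1) yc[of 0] by algebra
  then have "x \<in> I" using x(2)[of 0] y(1)[of 0] lv_0 I_add by metis
  moreover have "infinite {k. s k \<ominus> x \<in> lv n}" for n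
  proof (rule infinite_super[OF _ y(2)[of n]])
    show "{k. s k \<ominus> y n \<in> lv n} \<subseteq> {k. s k \<ominus> x \<in> lv n}"
      using lv_trans[OF _ lv_sym[OF x(2) x(1) yc]] sc yc x(1) by auto
  qed
  ultimately show ?thesis by blast
qed

text \<open>Banach's fixed point principle for the filtration. A gain of one level per application
  makes the iterates of \<open>\<zero>\<close> Cauchy, and separatedness identifies their limit with
  its image.\<close>

lemma contraction:
  assumes f: "\<And>x. x \<in> lv m \<Longrightarrow> f x \<in> lv m"
    and c: "\<And>x y n. \<lbrakk>x \<in> lv m; y \<in> lv m; x \<ominus> y \<in> lv n\<rbrakk> \<Longrightarrow> f x \<ominus> f y \<in> lv (Suc n)"
  shows "\<exists>x\<in>lv m. f x = x"
proof -
  define s where "s n = (f ^^ n) \<zero>" for n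
  have sm: "s n \<in> lv m" for n by (induction n) (auto simp: s_def lv_zero f)
  have d: "s (Suc n) \<ominus> s n \<in> lv n" for n
  proof (induction n)
    case 0
    have "s 1 \<ominus> s 0 \<in> lv m" using sm lv_sub by auto
    then show ?case using lv_mono[of 0 m] by auto
  next
    case (Suc n)
    then show ?case using c[OF sm[of "Suc n"] sm[of n]] by (simp add: s_def)
  qed
  obtain x where x: "x \<in> carrier R" "\<And>i. x \<ominus> s i \<in> lv i"
    using lv_complete[of s] d lv_carrier[OF sm] by blast
  have sc[simp]: "s i \<in> carrier R" for i using lv_carrier[OF sm] .
  have "x = (x \<ominus> s m) \<oplus> s m" using x(1) sc[of m] by algebra
  then have xm: "x \<in> lv m" using lv_add x(2)[of m] sm by metis
  have fxc: "f x \<in> carrier R" using f[OF xm] lv_carrier by auto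
  have "f x \<ominus> x \<in> lv n" for n
  proof (rule lv_trans)
    show "f x \<ominus> s (Suc n) \<in> lv n"
      using c[OF xm sm x(2)[of n]] lv_mono[of n "Suc n"] by (auto simp: s_def)
    show "s (Suc n) \<ominus> x \<in> lv n"
      using lv_sym[OF x(2)[of "Suc n"]] x(1) lv_mono[of n "Suc n"] by auto
  qed (use fxc x in auto)
  then have "f x \<ominus> x = \<zero>" by (rule lv_separated)
  then have "f x = x" using fxc x(1) by (simp add: r_right_minus_eq)
  then show ?thesis using xm by blast
qed

end

section \<open>Roots of unity and principal units\<close>

lemma (in field) pow_nonzero: "x \<in> carrier R \<Longrightarrow> x \<noteq> \<zero> \<Longrightarrow> x [^] (n::nat) \<noteq> \<zero>"
  by (induction n) (use integral[of _ x] in \<open>force+\<close>)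

lemma (in field) card_roots_of_unity:
  assumes "0 < b"
  shows "finite {x \<in> carrier R. x [^] b = \<one>}" "card {x \<in> carrier R. x [^] b = \<one>} \<le> b"
proof -
  \<comment> \<open>The coefficient list of X^b - 1: \<open>monom \<one> (b - 1)\<close> stands for
    X^(b-1), and appending an entry multiplies by X and adds a constant.\<close>
  let ?p = "monom \<one> (b - 1) @ [\<ominus> \<one>]"
  have p: "?p \<in> carrier (poly_ring R)"
    unfolding univ_poly_carrier[symmetric] polynomial_def monom_def by auto
  have ev: "eval ?p x = x [^] b \<ominus> \<one>" if "x \<in> carrier R" for x
    using eval_append_aux[of "monom \<one> (b - 1)" "\<ominus> \<one>" x] eval_monom[of \<one> x "b - 1"] that assms
      monom_in_carrier[of \<one> "b - 1"] nat_pow_Suc[of x "b - 1"]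
    by (simp add: a_minus_def)
  have sub: "{x \<in> carrier R. x [^] b = \<one>} \<subseteq> set_mset (roots ?p)"
    using roots_mem_iff_is_root[OF p] ev unfolding is_root_def
    by (auto simp: a_minus_def r_neg monom_def)
  then show "finite {x \<in> carrier R. x [^] b = \<one>}" using finite_set_mset finite_subset by blast
  have "card (set_mset (roots ?p)) \<le> size (roots ?p)"
    by (metis mset_set_set_mset_msubset size_mset_mono size_mset_set)
  also have "\<dots> \<le> degree ?p" by (rule size_roots_le_degree[OF p])
  also have "degree ?p = b" using assms by (simp add: monom_def)
  finally show "card {x \<in> carrier R. x [^] b = \<one>} \<le> b"
    using card_mono[OF finite_set_mset sub] by linarith
qed

text \<open>\<open>I\<close> may fail to contain \<open>\<one>\<close>: it will be a lattice shrunk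
  until it is closed under products. Units are therefore sought in 1 + \<open>lv n\<close> and not
  in \<open>I\<close> itself. The number \<open>t\<close> measures the precision lost on division by
  \<open>b\<close>.\<close>

locale mult_lattice = padic_lattice +
  fixes b t :: nat
  assumes I_mult: "\<lbrakk>x \<in> I; y \<in> I\<rbrakk> \<Longrightarrow> x \<otimes> y \<in> I"
    and exhausting: "x \<in> carrier R \<Longrightarrow> \<exists>n::nat. \<pi> [^] n \<otimes> x \<in> I"
    and b_pos: "0 < b"
    and b_nonzero: "[b] \<cdot> \<one> \<noteq> \<zero>"
    and b_div: "x \<in> I \<Longrightarrow> \<exists>y\<in>I. ([b] \<cdot> \<one>) \<otimes> y = \<pi> [^] t \<otimes> x"
begin

lemma lv_mult: assumes "x \<in> lv m" "y \<in> lv n" shows "x \<otimes> y \<in> lv (m + n)"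
proof -
  obtain a c where ac: "a \<in> I" "c \<in> I" "x = \<pi> [^] m \<otimes> a" "y = \<pi> [^] n \<otimes> c"
    using assms unfolding lv_def by auto
  have cc: "a \<in> carrier R" "c \<in> carrier R" "\<pi> [^] m \<in> carrier R" "\<pi> [^] n \<in> carrier R"
    using ac I_carrier by auto
  have "x \<otimes> y = (\<pi> [^] m \<otimes> \<pi> [^] n) \<otimes> (a \<otimes> c)"
    unfolding ac using cc by algebra
  then show ?thesis using I_mult[OF ac(1,2)] unfolding lv_def nat_pow_mult[OF pi_closed] by auto
qed

lemma lv_mult_left: "x \<in> lv m \<Longrightarrow> y \<in> I \<Longrightarrow> x \<otimes> y \<in> lv m"
  using lv_mult[of x m y 0] lv_0 by simp

lemma lv_mult_right: "x \<in> I \<Longrightarrow> y \<in> lv m \<Longrightarrow> x \<otimes> y \<in> lv m"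
  using lv_mult[of x 0 y m] lv_0 by simp

lemma lv_mult_nat: "x \<in> lv m \<Longrightarrow> ([(k::nat)] \<cdot> \<one>) \<otimes> x \<in> lv m"
proof (induction k)
  case 0 then show ?case using lv_zero lv_carrier by simp
next
  case (Suc k)
  have "([Suc k] \<cdot> \<one>) \<otimes> x = ([k] \<cdot> \<one>) \<otimes> x \<oplus> x"
    using lv_carrier[OF Suc.prems] by (simp add: l_distr)
  then show ?case using Suc lv_add by auto
qed

abbreviation \<beta> :: 'a where "\<beta> \<equiv> [b] \<cdot> \<one>"

lemma beta_Units: "\<beta> \<in> Units R"
  using b_nonzero field_Units by auto

lemma lv_div: assumes "x \<in> lv (n + t)" shows "inv \<beta> \<otimes> x \<in> lv n"
proof -
  obtain a where a: "a \<in> I" "x = \<pi> [^] (n + t) \<otimes> a" using assms unfolding lv_def by auto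
  obtain y where y: "y \<in> I" "\<beta> \<otimes> y = \<pi> [^] t \<otimes> a" using b_div[OF a(1)] by auto
  have cc: "a \<in> carrier R" "y \<in> carrier R" "\<pi> [^] n \<in> carrier R" "\<beta> \<in> carrier R" "inv \<beta> \<in> carrier R" "\<pi> [^] t \<in> carrier R"
    using a y I_carrier beta_Units by auto
  have "x = \<pi> [^] n \<otimes> (\<pi> [^] t \<otimes> a)"
    unfolding a(2) nat_pow_mult[OF pi_closed, symmetric] using cc by algebra
  then have "inv \<beta> \<otimes> x = (inv \<beta> \<otimes> \<beta>) \<otimes> (\<pi> [^] n \<otimes> y)"
    unfolding y(2)[symmetric] using cc by algebra
  then have "inv \<beta> \<otimes> x = \<pi> [^] n \<otimes> y" using beta_Units cc by simp
  then show ?thesis using y(1) unfolding lv_def by auto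
qed

text \<open>The principal units of level \<open>n\<close>. From level one on they form a group, by
  \<open>U_inverse\<close>; at level zero inverses may be missing.\<close>

definition U :: "nat \<Rightarrow> 'a set" where "U n = {x \<in> carrier R. x \<ominus> \<one> \<in> lv n}"

lemma U_carrier: "x \<in> U n \<Longrightarrow> x \<in> carrier R" unfolding U_def by auto

lemma U_one: "\<one> \<in> U n"
  unfolding U_def using lv_zero by (simp add: a_minus_def r_neg)

lemma U_intro: "x \<in> lv n \<Longrightarrow> \<one> \<oplus> x \<in> U n"
proof -
  assume x: "x \<in> lv n"
  have "\<one> \<oplus> x \<ominus> \<one> = x" using lv_carrier[OF x] by algebra
  then show ?thesis using x lv_carrier[OF x] unfolding U_def by auto
qed

lemma U_elim: assumes "x \<in> U n" obtains w where "w \<in> lv n" "x = \<one> \<oplus> w"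
proof
  show "x \<ominus> \<one> \<in> lv n" using assms unfolding U_def by auto
  have "x \<in> carrier R" using assms U_carrier by auto
  then show "x = \<one> \<oplus> (x \<ominus> \<one>)" by algebra
qed

lemma lv_mult_U: assumes "x \<in> lv m" "u \<in> U n" shows "x \<otimes> u \<in> lv m"
proof -
  obtain w where w: "w \<in> lv n" "u = \<one> \<oplus> w" using U_elim assms by blast
  have "x \<otimes> u = x \<oplus> x \<otimes> w" unfolding w(2) using lv_carrier assms(1) w(1) by (simp add: r_distr)
  then show ?thesis using lv_mult_left[OF assms(1) lv_I[OF w(1)]] assms(1) lv_add by auto
qed

lemma U_mult: assumes "x \<in> U n" "y \<in> U n" shows "x \<otimes> y \<in> U n"
proof -
  have cc: "x \<in> carrier R" "y \<in> carrier R" using assms U_carrier by auto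
  have "x \<otimes> y \<ominus> \<one> = (x \<ominus> \<one>) \<otimes> y \<oplus> (y \<ominus> \<one>)" using cc by algebra
  then show ?thesis using lv_mult_U[of "x \<ominus> \<one>" n y n] lv_add assms cc unfolding U_def by auto
qed

lemma U_pow: "x \<in> U n \<Longrightarrow> x [^] (k::nat) \<in> U n"
  by (induction k) (auto simp: U_one U_mult)

text \<open>The inverse of 1 + w is 1 + z with z = -w - wz. Since \<open>w\<close> lies in a level
  at least one, the right-hand side is a contraction in z.\<close>

lemma U_inverse: assumes "x \<in> U n" "1 \<le> n" shows "\<exists>y\<in>U n. x \<otimes> y = \<one>"
proof -
  obtain w where w: "w \<in> lv n" "x = \<one> \<oplus> w" using U_elim assms by blast
  have wc: "w \<in> carrier R" using w lv_carrier by auto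
  have "\<exists>z\<in>lv n. \<ominus> w \<ominus> w \<otimes> z = z"
  proof (rule contraction)
    fix z assume "z \<in> lv n"
    then show "\<ominus> w \<ominus> w \<otimes> z \<in> lv n"
      using lv_sub lv_neg w(1) lv_mult_left[OF w(1)] lv_I by auto
  next
    fix z z' m assume z: "z \<in> lv n" "z' \<in> lv n" "z \<ominus> z' \<in> lv m"
    have "(\<ominus> w \<ominus> w \<otimes> z) \<ominus> (\<ominus> w \<ominus> w \<otimes> z') = \<ominus> (w \<otimes> (z \<ominus> z'))"
      using wc lv_carrier[OF z(1)] lv_carrier[OF z(2)] by algebra
    moreover have "w \<otimes> (z \<ominus> z') \<in> lv (n + m)" using lv_mult w(1) z(3) by auto
    ultimately show "(\<ominus> w \<ominus> w \<otimes> z) \<ominus> (\<ominus> w \<ominus> w \<otimes> z') \<in> lv (Suc m)"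
      using lv_neg lv_mono[of "Suc m" "n + m"] assms(2) by auto
  qed
  then obtain z where z: "z \<in> lv n" "\<ominus> w \<ominus> w \<otimes> z = z" by blast
  have zc: "z \<in> carrier R" using z lv_carrier by auto
  have "x \<otimes> (\<one> \<oplus> z) = \<one> \<oplus> w \<oplus> w \<otimes> z \<oplus> z" unfolding w(2) using wc zc by algebra
  also have "\<dots> = \<one> \<oplus> w \<oplus> w \<otimes> z \<oplus> (\<ominus> w \<ominus> w \<otimes> z)" using z(2) by simp
  also have "\<dots> = \<one>" using wc zc by algebra
  finally show ?thesis using U_intro[OF z(1)] by auto
qed

lemma U_nonzero: "x \<in> U n \<Longrightarrow> 1 \<le> n \<Longrightarrow> x \<noteq> \<zero>"
  using U_inverse[of x n] U_carrier by force

text \<open>The first-order Taylor formula: the cofactor of x - y is a sum of \<open>k\<close>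
  products of powers of \<open>x\<close> and \<open>y\<close>, each congruent to one modulo
  \<open>lv n\<close>.\<close>

lemma pow_diff:
  assumes x: "x \<in> U n" and y: "y \<in> U n"
  shows "\<exists>e\<in>lv n. x [^] k \<ominus> y [^] k = (x \<ominus> y) \<otimes> (([(k::nat)] \<cdot> \<one>) \<oplus> e)"
proof (induction k)
  case 0
  show ?case using U_carrier[OF x] U_carrier[OF y]
    by (intro bexI[OF _ lv_zero]) (auto simp: a_minus_def r_neg)
next
  case (Suc k)
  then obtain e where e: "e \<in> lv n" "x [^] k \<ominus> y [^] k = (x \<ominus> y) \<otimes> (([(k::nat)] \<cdot> \<one>) \<oplus> e)" by auto
  obtain e1 where e1: "e1 \<in> lv n" "x [^] k = \<one> \<oplus> e1" using U_elim[OF U_pow[OF x]] by blast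
  obtain e2 where e2: "e2 \<in> lv n" "y = \<one> \<oplus> e2" using U_elim[OF y] by blast
  have cc: "x \<in> carrier R" "y \<in> carrier R" "e \<in> carrier R" "e1 \<in> carrier R" "e2 \<in> carrier R"
    "[k] \<cdot> \<one> \<in> carrier R" "x [^] k \<in> carrier R" "y [^] k \<in> carrier R"
    using x y e e1 e2 lv_carrier U_carrier by auto
  have "x [^] Suc k \<ominus> y [^] Suc k = (x \<ominus> y) \<otimes> x [^] k \<oplus> (x [^] k \<ominus> y [^] k) \<otimes> y"
    unfolding nat_pow_Suc using cc by algebra
  also have "\<dots> = (x \<ominus> y) \<otimes> (x [^] k \<oplus> (([k] \<cdot> \<one>) \<oplus> e) \<otimes> y)"
    unfolding e(2) using cc by algebra
  also have "x [^] k \<oplus> (([k] \<cdot> \<one>) \<oplus> e) \<otimes> y = (([k] \<cdot> \<one>) \<oplus> \<one>) \<oplus> (e1 \<oplus> e \<otimes> y \<oplus> ([k] \<cdot> \<one>) \<otimes> e2)"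
    unfolding e1(2) using cc e2(2) by algebra
  finally have "x [^] Suc k \<ominus> y [^] Suc k = (x \<ominus> y) \<otimes> (([Suc k] \<cdot> \<one>) \<oplus> (e1 \<oplus> e \<otimes> y \<oplus> ([k] \<cdot> \<one>) \<otimes> e2))"
    by (simp add: a_comm)
  moreover have "e1 \<oplus> e \<otimes> y \<oplus> ([k] \<cdot> \<one>) \<otimes> e2 \<in> lv n"
    using lv_add e1(1) e2(1) lv_mult_U[OF e(1) y] lv_mult_nat by auto
  ultimately show ?case by blast
qed

text \<open>Newton's iteration for z^b = a with the derivative frozen at its value
  \<open>\<beta>\<close> at one. On level \<open>Suc t\<close> the error term of
  \<open>pow_diff\<close> gains t + 1 levels, division by \<open>\<beta>\<close> consumes t of them,
  and the remaining one makes the map contract. The extra \<open>t\<close> in the level of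
  \<open>a\<close> keeps the first iterate in \<open>lv (Suc t)\<close>.\<close>

lemma U_root:
  assumes a: "a \<in> U (Suc t + t)"
  shows "\<exists>z\<in>U (Suc t). z [^] b = a"
proof -
  let ?s = "Suc t"
  let ?f = "\<lambda>z. z \<ominus> inv \<beta> \<otimes> ((\<one> \<oplus> z) [^] b \<ominus> a)"
  have ic: "inv \<beta> \<in> carrier R" "\<beta> \<in> carrier R" "inv \<beta> \<otimes> \<beta> = \<one>" "a \<in> carrier R"
    using beta_Units a U_carrier by auto
  have d: "?f x \<ominus> ?f y \<in> lv (Suc n)" if xy: "x \<in> lv ?s" "y \<in> lv ?s" "x \<ominus> y \<in> lv n" for x y n
  proof -
    obtain e where e: "e \<in> lv ?s" "(\<one> \<oplus> x) [^] b \<ominus> (\<one> \<oplus> y) [^] b = ((\<one> \<oplus> x) \<ominus> (\<one> \<oplus> y)) \<otimes> (\<beta> \<oplus> e)"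
      using pow_diff[OF U_intro[OF xy(1)] U_intro[OF xy(2)], of b] by blast
    have cc: "x \<in> carrier R" "y \<in> carrier R" "e \<in> carrier R" "(\<one> \<oplus> x) [^] b \<in> carrier R" "(\<one> \<oplus> y) [^] b \<in> carrier R"
      using xy e lv_carrier by auto
    have "?f x \<ominus> ?f y = (x \<ominus> y) \<ominus> inv \<beta> \<otimes> ((\<one> \<oplus> x) [^] b \<ominus> (\<one> \<oplus> y) [^] b)"
      using cc ic by algebra
    also have "\<dots> = (x \<ominus> y) \<ominus> (inv \<beta> \<otimes> \<beta>) \<otimes> (x \<ominus> y) \<ominus> inv \<beta> \<otimes> ((x \<ominus> y) \<otimes> e)"
      unfolding e(2) using cc ic(1,2) by algebra
    also have "\<dots> = \<ominus> (inv \<beta> \<otimes> ((x \<ominus> y) \<otimes> e))"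
      unfolding ic(3) using cc ic by algebra
    finally have eq: "?f x \<ominus> ?f y = \<ominus> (inv \<beta> \<otimes> ((x \<ominus> y) \<otimes> e))" .
    have "(x \<ominus> y) \<otimes> e \<in> lv (Suc n + t)" using lv_mult[OF xy(3) e(1)] by simp
    then show ?thesis unfolding eq using lv_div lv_neg by blast
  qed
  have f0: "?f \<zero> \<in> lv ?s"
  proof -
    have "a \<ominus> \<one> \<in> lv (?s + t)" using a unfolding U_def by auto
    then have "inv \<beta> \<otimes> (a \<ominus> \<one>) \<in> lv ?s" by (rule lv_div)
    moreover have "?f \<zero> = inv \<beta> \<otimes> (a \<ominus> \<one>)"
    proof -
      have "(\<one> \<oplus> \<zero>) [^] b = \<one>" by simp
      then show ?thesis using ic by (simp only:) algebra
    qed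
    ultimately show ?thesis by simp
  qed
  have "\<exists>z\<in>lv ?s. ?f z = z"
  proof (rule contraction[OF _ d])
    fix z assume z: "z \<in> lv ?s"
    have zc: "z \<in> carrier R" using z lv_carrier by auto
    have "z \<ominus> \<zero> \<in> lv ?s" using z lv_sub lv_zero by auto
    then have "?f z \<ominus> ?f \<zero> \<in> lv ?s" using d[OF z lv_zero, of ?s] lv_mono[of ?s "Suc ?s"] by auto
    moreover have "?f z = (?f z \<ominus> ?f \<zero>) \<oplus> ?f \<zero>"
    proof -
      have "?f z \<in> carrier R" "?f \<zero> \<in> carrier R" using zc ic by auto
      then show ?thesis by algebra
    qed
    ultimately show "?f z \<in> lv ?s" using f0 lv_add by metis
  qed
  then obtain z where z: "z \<in> lv ?s" "?f z = z" by blast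
  have cc: "z \<in> carrier R" "(\<one> \<oplus> z) [^] b \<in> carrier R" using z lv_carrier by auto
  \<comment> \<open>Multiplying the fixed point equation by \<open>\<beta>\<close> clears the
    inverse and leaves (1 + z)^b = a.\<close>
  have "\<beta> \<otimes> (z \<ominus> ?f z) = (inv \<beta> \<otimes> \<beta>) \<otimes> ((\<one> \<oplus> z) [^] b \<ominus> a)"
    using cc ic(1,2,4) by algebra
  then have "(\<one> \<oplus> z) [^] b \<ominus> a = \<zero>" unfolding ic(3) z(2) using cc ic by (simp add: a_minus_def r_neg)
  then have "(\<one> \<oplus> z) [^] b = a" using cc ic by (simp add: r_right_minus_eq)
  then show ?thesis using U_intro[OF z(1)] by auto
qed

lemma pi_pow_nonzero: "\<pi> [^] (n::nat) \<noteq> \<zero>"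
  using pow_nonzero pi_nonzero by simp

text \<open>By compactness: if the inverses of primitive elements had unbounded denominators, a
  sequence of bad elements would accumulate at some \<open>x\<close>. That \<open>x\<close> is
  primitive, hence invertible with some denominator \<open>n\<close>, and the elements close to it
  are \<open>x\<close> times a principal unit, so they share this denominator.\<close>

lemma bounded_inverse: "\<exists>J. \<forall>x\<in>I - lv 1. \<exists>y\<in>I. x \<otimes> y = \<pi> [^] (J::nat)"
proof (rule ccontr)
  assume "\<not> ?thesis"
  then have "\<forall>J. \<exists>x. x \<in> I - lv 1 \<and> (\<forall>y\<in>I. x \<otimes> y \<noteq> \<pi> [^] (J::nat))" by blast
  from choice[OF this] obtain s where s': "\<forall>j::nat. s j \<in> I - lv 1 \<and> (\<forall>y\<in>I. s j \<otimes> y \<noteq> \<pi> [^] j)" ..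
  then have s: "\<And>j. s j \<in> I - lv 1" "\<And>j y. y \<in> I \<Longrightarrow> s j \<otimes> y \<noteq> \<pi> [^] j" by auto
  have sc: "\<And>j. s j \<in> carrier R" using s I_carrier by auto
  obtain x where x: "x \<in> I" "\<And>n. infinite {k. s k \<ominus> x \<in> lv n}"
    using accumulation_point[of s] s by blast
  have xc: "x \<in> carrier R" using x I_carrier by auto
  have "x \<notin> lv 1"
  proof
    assume "x \<in> lv 1"
    obtain k where k: "s k \<ominus> x \<in> lv 1" using x(2)[of 1] not_finite_existsD by auto
    have "s k = (s k \<ominus> x) \<oplus> x" using sc[of k] xc by algebra
    then show False using lv_add[OF k \<open>x \<in> lv 1\<close>] s(1)[of k] by auto
  qed
  then have "x \<noteq> \<zero>" using lv_zero by auto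
  then have xU: "x \<in> Units R" "inv x \<in> carrier R" using xc field_Units by auto
  obtain n :: nat where n: "\<pi> [^] n \<otimes> inv x \<in> I" using exhausting[OF xU(2)] by auto
  let ?yy = "\<pi> [^] n \<otimes> inv x"
  have "x \<otimes> ?yy = \<pi> [^] n \<otimes> (x \<otimes> inv x)"
    using xU(2) xc nat_pow_closed[OF pi_closed, of n] by algebra
  then have xy: "x \<otimes> ?yy = \<pi> [^] n" using xU(1) by simp
  \<comment> \<open>Agreement modulo level \<open>n + 1\<close> is what makes s k / x a principal
    unit of level one; \<open>n < k\<close> leaves room to raise the exponent from \<open>n\<close>
    to \<open>k\<close>.\<close>
  obtain k where k: "s k \<ominus> x \<in> lv (n + 1)" "n < k"
    using x(2)[of "n+1"] unfolding infinite_nat_iff_unbounded by auto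
  obtain d where d: "d \<in> I" "s k \<ominus> x = \<pi> [^] (n + 1) \<otimes> d" using k(1) unfolding lv_def by auto
  let ?w = "\<pi> \<otimes> (d \<otimes> ?yy)"
  have dc: "d \<in> carrier R" "?yy \<in> carrier R" "\<pi> [^] n \<in> carrier R" "s k \<in> carrier R" using d I_carrier xU sc by auto
  have "?w \<in> lv 1" unfolding lv_def using I_mult[OF d(1) n] by simp
  then have w: "\<one> \<oplus> ?w \<in> U 1" by (rule U_intro)
  have "s k = x \<oplus> (s k \<ominus> x)" using dc xc by algebra
  also have "s k \<ominus> x = x \<otimes> ?w"
  proof -
    have "s k \<ominus> x = \<pi> [^] n \<otimes> \<pi> \<otimes> d" unfolding d(2) by simp
    also have "\<dots> = (x \<otimes> ?yy) \<otimes> \<pi> \<otimes> d" unfolding xy ..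
    also have "\<dots> = x \<otimes> ?w" using dc(1,2) xc pi_closed by algebra
    finally show ?thesis .
  qed
  also have "x \<oplus> x \<otimes> ?w = x \<otimes> (\<one> \<oplus> ?w)" using dc(1,2) xc pi_closed by algebra
  finally have sk: "s k = x \<otimes> (\<one> \<oplus> ?w)" .
  obtain u where u: "u \<in> U 1" "(\<one> \<oplus> ?w) \<otimes> u = \<one>" using U_inverse[OF w] by auto
  \<comment> \<open>The padding \<open>\<pi> [^] (k - n)\<close> turns the denominator
    \<open>n\<close> into \<open>k\<close>, exactly the one that \<open>s k\<close> was chosen to
    avoid.\<close>
  let ?y = "\<pi> [^] (k - n) \<otimes> (?yy \<otimes> u)"
  have "?yy \<otimes> u \<in> I" by (rule lv_mult_U[of ?yy 0 u 1, unfolded lv_0, OF n u(1)])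
  then have "?y \<in> I" by (rule pi_pow_I)
  moreover have "s k \<otimes> ?y = \<pi> [^] k"
  proof -
    have cc: "\<one> \<oplus> ?w \<in> carrier R" "u \<in> carrier R" "\<pi> [^] (k - n) \<in> carrier R" using w u U_carrier by auto
    have "s k \<otimes> ?y = \<pi> [^] (k - n) \<otimes> ((x \<otimes> ?yy) \<otimes> ((\<one> \<oplus> ?w) \<otimes> u))"
      unfolding sk using cc xc dc(2) by algebra
    also have "\<dots> = \<pi> [^] (k - n) \<otimes> \<pi> [^] n" unfolding xy u(2) by simp
    also have "\<dots> = \<pi> [^] k" using k(2) by (simp add: nat_pow_mult)
    finally show ?thesis .
  qed
  ultimately show False using s(2) by blast
qed

end

section \<open>The index of powers in the multiplicative group\<close>

lemma card_le_card_mult_of_fibres: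
  assumes "finite Z" "f ` A \<subseteq> Z" "\<And>z. z \<in> Z \<Longrightarrow> finite {a \<in> A. f a = z} \<and> card {a \<in> A. f a = z} \<le> k"
  shows "card A \<le> card Z * k"
proof -
  have "A = (\<Union>z\<in>Z. {a \<in> A. f a = z})" using assms(2) by auto
  then have "card A \<le> (\<Sum>z\<in>Z. card {a \<in> A. f a = z})" using card_UN_le[OF assms(1)] by metis
  also have "\<dots> \<le> card Z * k" using sum_bounded_above[of Z "\<lambda>z. card {a \<in> A. f a = z}" k] assms(3) by simp
  finally show ?thesis .
qed

context mult_lattice
begin

text \<open>Equality in the quotient of the unit group by \<open>\<pi>\<close> and the units congruent to \<open>1\<close> modulo \<open>\<pi> [^] (t + 1)\<close>.\<close>

definition urel :: "'a \<Rightarrow> 'a \<Rightarrow> bool" where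
  "urel x y \<longleftrightarrow> (\<exists>(i::nat) (j::nat). \<exists>u\<in>U (Suc t). \<pi> [^] i \<otimes> x = \<pi> [^] j \<otimes> y \<otimes> u)"

lemma urelI: "u \<in> U (Suc t) \<Longrightarrow> \<pi> [^] (i::nat) \<otimes> x = \<pi> [^] (j::nat) \<otimes> y \<otimes> u \<Longrightarrow> urel x y"
  unfolding urel_def by auto

lemma urel_trans:
  assumes "urel x y" "urel y z" and c: "x \<in> carrier R" "y \<in> carrier R" "z \<in> carrier R"
  shows "urel x z"
proof -
  obtain i j u where u: "u \<in> U (Suc t)" "\<pi> [^] (i::nat) \<otimes> x = \<pi> [^] (j::nat) \<otimes> y \<otimes> u"
    using assms unfolding urel_def by auto
  obtain i' j' v where v: "v \<in> U (Suc t)" "\<pi> [^] (i'::nat) \<otimes> y = \<pi> [^] (j'::nat) \<otimes> z \<otimes> v"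
    using assms unfolding urel_def by auto
  have cc: "u \<in> carrier R" "v \<in> carrier R" "\<pi> [^] i \<in> carrier R" "\<pi> [^] j \<in> carrier R"
     "\<pi> [^] i' \<in> carrier R" "\<pi> [^] j' \<in> carrier R"
    using u v U_carrier by auto
  have "\<pi> [^] (i' + i) \<otimes> x = \<pi> [^] i' \<otimes> (\<pi> [^] i \<otimes> x)"
    unfolding nat_pow_mult[OF pi_closed, symmetric] using cc c by algebra
  also have "\<dots> = \<pi> [^] j \<otimes> (\<pi> [^] i' \<otimes> y) \<otimes> u" unfolding u(2) using cc c by algebra
  also have "\<dots> = (\<pi> [^] j \<otimes> \<pi> [^] j') \<otimes> z \<otimes> (u \<otimes> v)" unfolding v(2) using cc c by algebra
  finally show ?thesis
    using urelI[OF U_mult[OF u(1) v(1)], of "i' + i" x "j + j'" z] by (simp add: nat_pow_mult)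
qed

lemma primitive_multiple:
  assumes x: "x \<in> carrier R" "x \<noteq> \<zero>"
  shows "\<exists>x'\<in>I - lv 1. \<exists>(n::nat) (m::nat). \<pi> [^] n \<otimes> x = \<pi> [^] m \<otimes> x'"
proof -
  obtain n :: nat where n: "\<pi> [^] n \<otimes> x \<in> I" using exhausting[OF x(1)] by blast
  have "\<pi> [^] n \<otimes> x \<noteq> \<zero>" using pi_pow_nonzero x integral[of "\<pi> [^] n" x] by auto
  then show ?thesis using primitive_part[OF n] by blast
qed

text \<open>If yz = \<open>\<pi>\<close>^J, then x' = y + \<open>\<pi>\<close>^(J+t+1) a equals y (1
  + z \<open>\<pi>\<close>^(t+1) a). So for primitive elements congruence modulo
  \<open>lv (J + Suc t)\<close> already puts the quotient into \<open>U (Suc t)\<close>, and there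
  are finitely many residue classes.\<close>

lemma finite_urel_cover:
  "\<exists>Y. finite Y \<and> Y \<subseteq> carrier R - {\<zero>} \<and> (\<forall>x\<in>carrier R - {\<zero>}. \<exists>y\<in>Y. urel x y)"
proof -
  obtain J :: nat where J: "\<And>x. x \<in> I - lv 1 \<Longrightarrow> \<exists>y\<in>I. x \<otimes> y = \<pi> [^] J"
    using bounded_inverse by auto
  let ?N = "J + Suc t"
  obtain T where T: "finite T" "T \<subseteq> lv 0" "\<And>x. x \<in> lv 0 \<Longrightarrow> \<exists>\<tau>\<in>T. x \<ominus> \<tau> \<in> lv ?N"
    using lv_cover[of ?N 0] by auto
  let ?P = "\<lambda>\<tau> x. x \<in> I - lv 1 \<and> x \<ominus> \<tau> \<in> lv ?N"
  \<comment> \<open>One primitive element is chosen in each residue class that contains any.\<close>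
  let ?Y = "(\<lambda>\<tau>. SOME x. ?P \<tau> x) ` {\<tau> \<in> T. \<exists>x. ?P \<tau> x}"
  have P: "?P \<tau> (SOME x. ?P \<tau> x)" if "\<exists>x. ?P \<tau> x" for \<tau> using someI_ex[OF that] .
  have "finite ?Y" using T by auto
  moreover have "?Y \<subseteq> carrier R - {\<zero>}"
  proof
    fix y assume "y \<in> ?Y"
    then have "y \<in> I - lv 1" using P by auto
    then show "y \<in> carrier R - {\<zero>}" using I_carrier lv_zero[of 1] by auto
  qed
  moreover have "\<exists>y\<in>?Y. urel x y" if x: "x \<in> carrier R - {\<zero>}" for x
  proof -
    obtain x' n m where x': "x' \<in> I - lv 1" "\<pi> [^] (n::nat) \<otimes> x = \<pi> [^] (m::nat) \<otimes> x'"
      using primitive_multiple[of x] x by auto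
    obtain \<tau> where \<tau>: "\<tau> \<in> T" "x' \<ominus> \<tau> \<in> lv ?N" using T(3)[of x'] x'(1) lv_0 by auto
    define y where "y = (SOME x. ?P \<tau> x)"
    have yP: "?P \<tau> y" using P[of \<tau>] x'(1) \<tau>(2) unfolding y_def by blast
    have yY: "y \<in> ?Y" using x'(1) \<tau> unfolding y_def by blast
    obtain z where z: "z \<in> I" "y \<otimes> z = \<pi> [^] J" using J[of y] yP by auto
    have cc: "x' \<in> carrier R" "y \<in> carrier R" "z \<in> carrier R" "\<tau> \<in> carrier R" "x \<in> carrier R"
      "\<pi> [^] m \<in> carrier R"
      using x' yP z \<tau>(1) T(2) x I_carrier lv_carrier by auto
    have "x' \<ominus> y \<in> lv ?N" using lv_trans[OF \<tau>(2) lv_sym[OF conjunct2[OF yP]]] cc by auto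
    then obtain a where a: "a \<in> I" "x' \<ominus> y = \<pi> [^] ?N \<otimes> a" unfolding lv_def by auto
    let ?d = "\<pi> [^] Suc t \<otimes> a"
    have d: "?d \<in> lv (Suc t)" "?d \<in> carrier R" "a \<in> carrier R" "\<pi> [^] Suc t \<in> carrier R" "\<pi> [^] J \<in> carrier R"
      using a I_carrier unfolding lv_def by auto
    have "x' \<ominus> y = y \<otimes> (z \<otimes> ?d)"
    proof -
      have "x' \<ominus> y = \<pi> [^] J \<otimes> ?d" unfolding a(2) nat_pow_mult[OF pi_closed, symmetric] using d(3-) by (simp only: m_assoc)
      also have "\<dots> = y \<otimes> (z \<otimes> ?d)" unfolding z(2)[symmetric] using cc(2,3) d(2) by (simp only: m_assoc)
      finally show ?thesis .
    qed
    moreover have "x' = y \<oplus> (x' \<ominus> y)" using cc(1,2) by algebra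
    ultimately have "x' = y \<oplus> y \<otimes> (z \<otimes> ?d)" by metis
    also have "\<dots> = y \<otimes> (\<one> \<oplus> z \<otimes> ?d)" using cc(2,3) d(2) by (simp add: r_distr)
    finally have "\<pi> [^] n \<otimes> x = \<pi> [^] m \<otimes> y \<otimes> (\<one> \<oplus> z \<otimes> ?d)"
      unfolding x'(2) using cc d(2) by (simp add: m_assoc)
    moreover have "\<one> \<oplus> z \<otimes> ?d \<in> U (Suc t)" by (rule U_intro[OF lv_mult_right[OF z(1) d(1)]])
    ultimately show ?thesis using yY urelI by blast
  qed
  ultimately show ?thesis by (intro exI[of _ ?Y] conjI ballI)
qed

text \<open>In a cover of least cardinality no two members are related: if \<open>urel y y'\<close>
  held for distinct members, everything covered by \<open>y\<close> would be covered by
  \<open>y'\<close>, and \<open>y\<close> could be dropped.\<close>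

lemma urel_representatives:
  "\<exists>Y. finite Y \<and> Y \<noteq> {} \<and> Y \<subseteq> carrier R - {\<zero>} \<and> (\<forall>x\<in>carrier R - {\<zero>}. \<exists>y\<in>Y. urel x y)
    \<and> (\<forall>y\<in>Y. \<forall>y'\<in>Y. urel y y' \<longrightarrow> y = y')"
proof -
  let ?P = "\<lambda>Y. finite Y \<and> Y \<subseteq> carrier R - {\<zero>} \<and> (\<forall>x\<in>carrier R - {\<zero>}. \<exists>y\<in>Y. urel x y)"
  obtain Y0 where "?P Y0" using finite_urel_cover by blast
  then obtain Y where Y: "?P Y" "\<And>Y'. ?P Y' \<Longrightarrow> card Y \<le> card Y'"
    using ex_has_least_nat[of ?P Y0 card] by blast
  have "Y \<noteq> {}" using Y(1) one_not_zero by auto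
  moreover have "y = y'" if "y \<in> Y" "y' \<in> Y" "urel y y'" for y y'
  proof (rule ccontr)
    assume ne: "y \<noteq> y'"
    have "\<exists>z\<in>Y - {y}. urel x z" if x: "x \<in> carrier R - {\<zero>}" for x
    proof -
      obtain z where z: "z \<in> Y" "urel x z" using Y(1) x by blast
      show ?thesis
      proof (cases "z = y")
        case True
        then have "urel x y'" using urel_trans[of x y y'] z x \<open>urel y y'\<close> \<open>y \<in> Y\<close> \<open>y' \<in> Y\<close> Y(1) by auto
        then show ?thesis using ne \<open>y' \<in> Y\<close> by auto
      qed (use z in auto)
    qed
    then have "?P (Y - {y})" using Y(1) by auto
    then show False using Y(2)[of "Y - {y}"] \<open>y \<in> Y\<close> Y(1) by (metis card_Diff1_less linorder_not_le)
  qed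
  ultimately show ?thesis using Y(1) by blast
qed

text \<open>Up to b-th powers the exponent of \<open>\<pi>\<close> matters only modulo
  \<open>b\<close>, which gives \<open>e\<close>, and a unit in \<open>U (Suc t)\<close> matters
  only modulo \<open>U (Suc t + t)\<close>, whose elements are b-th powers by \<open>U_root\<close>;
  that gives \<open>\<tau>\<close>.\<close>

lemma power_class:
  assumes T: "\<And>x. x \<in> lv (Suc t) \<Longrightarrow> \<exists>\<tau>\<in>T. x \<ominus> \<tau> \<in> lv (Suc t + t)" "T \<subseteq> lv (Suc t)"
    and x: "x \<in> carrier R" "y \<in> carrier R" "urel x y"
  shows "\<exists>e<b. \<exists>\<tau>\<in>T. \<exists>(i::nat) (j::nat). \<exists>u\<in>U (Suc t).
    (\<pi> [^] i) [^] b \<otimes> x = (\<pi> [^] j) [^] b \<otimes> (\<pi> [^] e \<otimes> y \<otimes> (\<one> \<oplus> \<tau>)) \<otimes> u [^] b"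
proof -
  obtain i j u where u: "u \<in> U (Suc t)" "\<pi> [^] (i::nat) \<otimes> x = \<pi> [^] (j::nat) \<otimes> y \<otimes> u"
    using x(3) unfolding urel_def by auto
  obtain z where z: "z \<in> lv (Suc t)" "u = \<one> \<oplus> z" using U_elim[OF u(1)] by blast
  obtain \<tau> where \<tau>: "\<tau> \<in> T" "z \<ominus> \<tau> \<in> lv (Suc t + t)" using T(1)[OF z(1)] by auto
  obtain r where r: "r \<in> U (Suc t)" "(\<one> \<oplus> \<tau>) \<otimes> r = \<one>"
    using U_inverse[OF U_intro[of \<tau> "Suc t"]] \<tau> T(2) by auto
  have cc: "u \<in> carrier R" "z \<in> carrier R" "\<tau> \<in> carrier R" "r \<in> carrier R"
    using u z \<tau> r T(2) lv_carrier U_carrier by auto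
  have "u \<otimes> r \<ominus> (\<one> \<oplus> \<tau>) \<otimes> r = (z \<ominus> \<tau>) \<otimes> r" unfolding z(2) using cc(2-) by algebra
  then have "u \<otimes> r \<in> U (Suc t + t)" using lv_mult_U[OF \<tau>(2) r(1)] cc unfolding r(2) U_def by auto
  then obtain v where v: "v \<in> U (Suc t)" "v [^] b = u \<otimes> r" using U_root by blast
  have vc: "v \<in> carrier R" "v [^] b \<in> carrier R" using U_carrier[OF v(1)] by auto
  have uv: "u = (\<one> \<oplus> \<tau>) \<otimes> v [^] b"
  proof -
    have "(\<one> \<oplus> \<tau>) \<otimes> v [^] b = ((\<one> \<oplus> \<tau>) \<otimes> r) \<otimes> u" unfolding v(2) using cc(1,3,4) by algebra
    then show ?thesis unfolding r(2) using cc by simp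
  qed
  \<comment> \<open>Multiplying by \<open>\<pi> [^] ?k\<close> completes \<open>\<pi> [^] i\<close>
    to a b-th power on the left; on the right the exponent is divided by \<open>b\<close> with
    remainder \<open>?e\<close>.\<close>
  let ?k = "i * (b - 1)"
  let ?e = "(?k + j) mod b" and ?j = "(?k + j) div b"
  have ik: "?k + i = i * b" using b_pos by (cases b) (auto simp: algebra_simps)
  have jk: "?k + j = ?j * b + ?e" by simp
  have pp: "\<pi> [^] (n::nat) \<in> carrier R" for n by simp
  have "(\<pi> [^] i) [^] b \<otimes> x = \<pi> [^] ?k \<otimes> (\<pi> [^] i \<otimes> x)"
    unfolding nat_pow_pow[OF pi_closed] ik[symmetric] nat_pow_mult[OF pi_closed, symmetric]
    using x pp by (simp add: m_assoc)
  also have "\<dots> = \<pi> [^] (?k + j) \<otimes> (y \<otimes> u)"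
    unfolding u(2) nat_pow_mult[OF pi_closed, symmetric] using x cc pp by (simp add: m_assoc)
  also have "\<dots> = (\<pi> [^] ?j) [^] b \<otimes> \<pi> [^] ?e \<otimes> (y \<otimes> ((\<one> \<oplus> \<tau>) \<otimes> v [^] b))"
    unfolding nat_pow_pow[OF pi_closed] nat_pow_mult[OF pi_closed] uv using jk by simp
  also have "\<dots> = (\<pi> [^] ?j) [^] b \<otimes> (\<pi> [^] ?e \<otimes> y \<otimes> (\<one> \<oplus> \<tau>)) \<otimes> v [^] b"
    using x(2) cc(3) vc(2) pp[of ?e] nat_pow_closed[OF pp[of ?j], of b] by algebra
  finally show ?thesis using \<tau>(1) v(1) b_pos mod_less_divisor by blast
qed

text \<open>The Herbrand quotient argument: on the subgroup generated by \<open>\<pi>\<close> and \<open>U (t + 1)\<close> the index of the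
  \<open>b\<close>-th powers is visible, and passing to an overgroup of finite index costs at most the \<open>b\<close>-torsion.\<close>

theorem card_power_classes:
  assumes S: "S \<subseteq> carrier R - {\<zero>}" "finite S"
    and sep: "\<And>x y c. \<lbrakk>x \<in> S; y \<in> S; c \<in> carrier R; x = y \<otimes> c [^] b\<rbrakk> \<Longrightarrow> x = y"
  shows "card S \<le> b * b * q ^ t"
proof -
  obtain Y where Y: "finite Y" "Y \<noteq> {}" "Y \<subseteq> carrier R - {\<zero>}" "\<And>x. x \<in> carrier R - {\<zero>} \<Longrightarrow> \<exists>y\<in>Y. urel x y"
    "\<And>y y'. \<lbrakk>y \<in> Y; y' \<in> Y; urel y y'\<rbrakk> \<Longrightarrow> y = y'"
    using urel_representatives by metis
  obtain T where T: "finite T" "card T \<le> q ^ t" "T \<subseteq> lv (Suc t)" "\<And>x. x \<in> lv (Suc t) \<Longrightarrow> \<exists>\<tau>\<in>T. x \<ominus> \<tau> \<in> lv (Suc t + t)"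
    using lv_cover[of t "Suc t"] by auto
  define rep where "rep = (\<lambda>(y, e::nat, \<tau>). \<pi> [^] e \<otimes> y \<otimes> (\<one> \<oplus> \<tau>))"
  define Z where "Z = Y \<times> {..<b} \<times> T"
  \<comment> \<open>Agreement up to b-th powers of elements of the subgroup generated by
    \<open>\<pi>\<close> and \<open>U (Suc t)\<close> only. This is finer than agreement up to all
    b-th powers and is the relation for which \<open>Z\<close> is known to be a complete set of
    labels.\<close>
  define Q where "Q x z \<longleftrightarrow> z \<in> Z \<and> (\<exists>(i::nat) (j::nat). \<exists>u\<in>U (Suc t). (\<pi> [^] i) [^] b \<otimes> x = (\<pi> [^] j) [^] b \<otimes> rep z \<otimes> u [^] b)" for x z
  have rep_c: "rep z \<in> carrier R" if z: "z \<in> Z" for z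
  proof -
    obtain y e \<tau> where "z = (y, e, \<tau>)" "y \<in> Y" "\<tau> \<in> T" using z unfolding Z_def by (cases z) auto
    moreover from this have "y \<in> carrier R" "\<tau> \<in> carrier R" using Y(3) T(3) lv_carrier by blast+
    ultimately show ?thesis unfolding rep_def by simp
  qed
  have ex: "\<exists>z. Q x z" if x: "x \<in> carrier R - {\<zero>}" for x
  proof -
    obtain y where y: "y \<in> Y" "urel x y" using Y(4)[OF x] by auto
    have yc: "y \<in> carrier R" "x \<in> carrier R" using y Y(3) x by auto
    obtain e \<tau> i j u where h: "e < b" "\<tau> \<in> T" "u \<in> U (Suc t)"
      "(\<pi> [^] (i::nat)) [^] b \<otimes> x = (\<pi> [^] (j::nat)) [^] b \<otimes> (\<pi> [^] e \<otimes> y \<otimes> (\<one> \<oplus> \<tau>)) \<otimes> u [^] b"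
      using power_class[OF T(4) T(3) yc(2,1) y(2)] by blast
    then have "Q x (y, e, \<tau>)" unfolding Q_def Z_def rep_def using y(1) by auto
    then show ?thesis ..
  qed
  define cls where "cls x = (SOME z. Q x z)" for x
  have cls: "Q x (cls x)" if "x \<in> carrier R - {\<zero>}" for x
    unfolding cls_def using someI_ex[OF ex[OF that]] .
  have same: "\<exists>(i::nat) (j::nat). \<exists>u\<in>U (Suc t). (\<pi> [^] i) [^] b \<otimes> x = (\<pi> [^] j) [^] b \<otimes> x' \<otimes> u [^] b"
    if xx: "x \<in> carrier R - {\<zero>}" "x' \<in> carrier R - {\<zero>}" "cls x = cls x'" for x x'
  proof -
    let ?z = "rep (cls x)"
    obtain i j u where u: "u \<in> U (Suc t)" "(\<pi> [^] (i::nat)) [^] b \<otimes> x = (\<pi> [^] (j::nat)) [^] b \<otimes> ?z \<otimes> u [^] b"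
      using cls[OF xx(1)] unfolding Q_def by auto
    obtain i' j' v where v: "v \<in> U (Suc t)" "(\<pi> [^] (i'::nat)) [^] b \<otimes> x' = (\<pi> [^] (j'::nat)) [^] b \<otimes> ?z \<otimes> v [^] b"
      using cls[OF xx(2)] xx(3) unfolding Q_def by auto
    obtain r where r: "r \<in> U (Suc t)" "v \<otimes> r = \<one>" using U_inverse[OF v(1)] by auto
    have zc: "?z \<in> carrier R" using rep_c cls[OF xx(1)] unfolding Q_def by auto
    have cc: "u \<in> carrier R" "v \<in> carrier R" "r \<in> carrier R" using u v r U_carrier by auto
    have pc: "(\<pi> [^] (n::nat)) [^] b \<in> carrier R" for n by simp
    have bc: "u [^] b \<in> carrier R" "v [^] b \<in> carrier R" "r [^] b \<in> carrier R" using cc by auto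
    have vr: "v [^] b \<otimes> r [^] b = \<one>" using r(2) cc by (metis nat_pow_distrib nat_pow_one)
    have add: "(\<pi> [^] (m + n)) [^] b = (\<pi> [^] m) [^] b \<otimes> (\<pi> [^] n) [^] b" for m n :: nat
      using nat_pow_distrib[of "\<pi> [^] m" "\<pi> [^] n" b] by (simp add: nat_pow_mult)
    have "(\<pi> [^] (j' + i)) [^] b \<otimes> x = (\<pi> [^] j') [^] b \<otimes> ((\<pi> [^] i) [^] b \<otimes> x)"
      unfolding add using pc xx by (simp add: m_assoc)
    also have "\<dots> = (\<pi> [^] j) [^] b \<otimes> ((\<pi> [^] j') [^] b \<otimes> ?z \<otimes> \<one>) \<otimes> u [^] b"
      unfolding u(2) using pc[of j] pc[of j'] bc zc by algebra
    also have "\<dots> = (\<pi> [^] j) [^] b \<otimes> ((\<pi> [^] j') [^] b \<otimes> ?z \<otimes> v [^] b) \<otimes> (u [^] b \<otimes> r [^] b)"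
      unfolding vr[symmetric] using pc[of j] pc[of j'] bc zc by algebra
    also have "\<dots> = (\<pi> [^] (j + i')) [^] b \<otimes> x' \<otimes> (u \<otimes> r) [^] b"
      unfolding v(2)[symmetric] add nat_pow_distrib[OF cc(1,3)] using pc[of j] pc[of i'] bc xx by (simp add: m_assoc)
    finally show ?thesis using U_mult[OF u(1) r(1)] by blast
  qed
  let ?\<mu> = "{x \<in> carrier R. x [^] b = \<one>}"
  \<comment> \<open>The auxiliary factor \<open>Y\<close> absorbs the unknown index of the subgroup:
    the fibres of \<open>g\<close> on \<open>S \<times> Y\<close> have at most \<open>b\<close>
    elements, and the size of \<open>Y\<close> occurs on both sides of the resulting inequality and
    cancels.\<close>
  define g where "g = (\<lambda>(x, y). cls (x \<otimes> y [^] b))"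
  have W: "x \<otimes> y [^] b \<in> carrier R - {\<zero>}" if "x \<in> S" "y \<in> Y" for x y
    using that S(1) Y(3) pow_nonzero[of y b] integral[of x "y [^] b"] by auto
  \<comment> \<open>Equal labels make x / x' a b-th power, so \<open>sep\<close> gives x = x'. The
    cancelled equation then says that \<open>y\<close> and \<open>y'\<close> agree up to the
    subgroup and a b-th root of unity.\<close>
  have key: "x = x' \<and> (\<exists>\<mu>\<in>?\<mu>. \<exists>(i::nat) (j::nat). \<exists>u\<in>U (Suc t). \<pi> [^] i \<otimes> y = \<pi> [^] j \<otimes> y' \<otimes> u \<otimes> \<mu>)"
    if h: "x \<in> S" "x' \<in> S" "y \<in> Y" "y' \<in> Y" "g (x, y) = g (x', y')" for x x' y y'
  proof -
    obtain i j u where u: "u \<in> U (Suc t)"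
      "(\<pi> [^] (i::nat)) [^] b \<otimes> (x \<otimes> y [^] b) = (\<pi> [^] (j::nat)) [^] b \<otimes> (x' \<otimes> y' [^] b) \<otimes> u [^] b"
      using same[OF W[OF h(1,3)] W[OF h(2,4)]] h(5) unfolding g_def by auto
    let ?A = "\<pi> [^] i \<otimes> y" and ?B = "\<pi> [^] j \<otimes> y' \<otimes> u"
    have cc: "x \<in> carrier R" "x' \<in> carrier R" "y \<in> carrier R" "y' \<in> carrier R" "u \<in> carrier R" "x \<noteq> \<zero>" "x' \<noteq> \<zero>" "y \<noteq> \<zero>" "y' \<noteq> \<zero>"
      using h S(1) Y(3) u U_carrier by auto
    have u0: "u \<noteq> \<zero>" using U_nonzero[OF u(1)] by simp
    have AB: "?A \<in> Units R" "?B \<in> Units R"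
      using cc u0 pi_pow_nonzero integral[of "\<pi> [^] i" y] integral[of "\<pi> [^] j \<otimes> y'" u] integral[of "\<pi> [^] j" y'] field_Units by auto
    have ABc: "?A \<in> carrier R" "?B \<in> carrier R" using AB by auto
    have eq: "x \<otimes> ?A [^] b = x' \<otimes> ?B [^] b"
    proof -
      have p: "\<pi> [^] i \<in> carrier R" "\<pi> [^] j \<in> carrier R" by auto
      have q: "(\<pi> [^] i) [^] b \<in> carrier R" "(\<pi> [^] j) [^] b \<in> carrier R" "y [^] b \<in> carrier R" "y' [^] b \<in> carrier R" "u [^] b \<in> carrier R" using cc by auto
      have "x \<otimes> ?A [^] b = (\<pi> [^] i) [^] b \<otimes> (x \<otimes> y [^] b)"
        unfolding nat_pow_distrib[OF p(1) cc(3)] using q cc(1) by algebra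
      also have "\<dots> = x' \<otimes> ((\<pi> [^] j) [^] b \<otimes> y' [^] b \<otimes> u [^] b)"
        unfolding u(2) using q cc(2) by algebra
      also have "\<dots> = x' \<otimes> ?B [^] b"
        using nat_pow_distrib[OF p(2) cc(4), of b] nat_pow_distrib[of "\<pi> [^] j \<otimes> y'" u b] cc by simp
      finally show ?thesis .
    qed
    have iA: "inv ?A \<in> carrier R" "?A \<otimes> inv ?A = \<one>" using AB by auto
    have iB: "inv ?B \<in> carrier R" "?B \<otimes> inv ?B = \<one>" using AB by auto
    have powA: "?A [^] b \<otimes> (inv ?A) [^] b = \<one>" "?B [^] b \<otimes> (inv ?B) [^] b = \<one>"
      unfolding nat_pow_distrib[OF ABc(1) iA(1), symmetric] nat_pow_distrib[OF ABc(2) iB(1), symmetric] iA(2) iB(2)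
      by simp_all
    have "x = (x \<otimes> ?A [^] b) \<otimes> (inv ?A) [^] b"
      using powA cc ABc iA by (simp add: m_assoc)
    also have "\<dots> = x' \<otimes> (?B \<otimes> inv ?A) [^] b"
      unfolding eq nat_pow_distrib[OF ABc(2) iA(1)] using cc ABc iA by (simp add: m_assoc)
    finally have xx: "x = x'" using sep[OF h(1,2), of "?B \<otimes> inv ?A"] ABc iA by blast
    have "?A [^] b = ?B [^] b" using eq unfolding xx using m_lcancel[of x' "?A [^] b" "?B [^] b"] cc ABc by auto
    then have "(inv ?B \<otimes> ?A) [^] b = \<one>"
      using nat_pow_distrib[OF iB(1) ABc(1), of b] powA(2) ABc iB by (simp add: m_comm)
    moreover have "?A = ?B \<otimes> (inv ?B \<otimes> ?A)" using ABc iB by (simp add: m_assoc[symmetric])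
    ultimately show ?thesis using xx u(1) ABc iB by (metis (mono_tags, lifting) m_closed mem_Collect_eq)
  qed
  have fib: "finite {a \<in> S \<times> Y. g a = z} \<and> card {a \<in> S \<times> Y. g a = z} \<le> b" for z
  proof (cases "{a \<in> S \<times> Y. g a = z} = {}")
    case False
    then obtain x0 y0 where 0: "x0 \<in> S" "y0 \<in> Y" "g (x0, y0) = z" by auto
    let ?F = "{a \<in> S \<times> Y. g a = z}"
    define L where "L a \<mu> \<longleftrightarrow> \<mu> \<in> ?\<mu> \<and> x0 = fst a \<and> (\<exists>(i::nat) (j::nat). \<exists>u\<in>U (Suc t). \<pi> [^] i \<otimes> y0 = \<pi> [^] j \<otimes> snd a \<otimes> u \<otimes> \<mu>)" for a \<mu>
    have "\<forall>a\<in>?F. \<exists>\<mu>. L a \<mu>"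
    proof
      fix a assume "a \<in> ?F"
      then obtain x y where a: "a = (x, y)" "x \<in> S" "y \<in> Y" "g (x, y) = z" by auto
      show "\<exists>\<mu>. L a \<mu>"
        using key[OF 0(1) a(2) 0(2) a(3)] 0(3) a(1,4) unfolding L_def by auto
    qed
    then obtain m where m: "\<And>a. a \<in> ?F \<Longrightarrow> m a \<in> ?\<mu> \<and> x0 = fst a \<and> (\<exists>(i::nat) (j::nat). \<exists>u\<in>U (Suc t). \<pi> [^] i \<otimes> y0 = \<pi> [^] j \<otimes> snd a \<otimes> u \<otimes> m a)"
      unfolding L_def[symmetric] using bchoice[of ?F L] by blast
    \<comment> \<open>Within a fibre the first component is fixed, and each second component is
      linked to \<open>y0\<close> by a root of unity. Two members with the same root have related
      second components, hence equal ones.\<close>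
    have "inj_on m ?F"
    proof (rule inj_onI)
      fix a a' assume a: "a \<in> ?F" "a' \<in> ?F" "m a = m a'"
      obtain i j u where u: "u \<in> U (Suc t)" "\<pi> [^] (i::nat) \<otimes> y0 = \<pi> [^] (j::nat) \<otimes> snd a \<otimes> u \<otimes> m a" using m[OF a(1)] by blast
      obtain i' j' v where v: "v \<in> U (Suc t)" "\<pi> [^] (i'::nat) \<otimes> y0 = \<pi> [^] (j'::nat) \<otimes> snd a' \<otimes> v \<otimes> m a" using m[OF a(2)] a(3) by auto
      obtain r where r: "r \<in> U (Suc t)" "u \<otimes> r = \<one>" using U_inverse[OF u(1)] by auto
      have cc: "snd a \<in> carrier R" "snd a' \<in> carrier R" "u \<in> carrier R" "v \<in> carrier R" "m a \<in> carrier R" "y0 \<in> carrier R" "r \<in> carrier R"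
        using a Y(3) U_carrier u v r m[OF a(1)] 0(2) by auto
      have pc: "\<pi> [^] (n::nat) \<in> carrier R" for n by simp
      have m0: "m a \<noteq> \<zero>" using m[OF a(1)] b_pos by (auto simp: nat_pow_zero)
      have "\<pi> [^] i' \<otimes> (\<pi> [^] j \<otimes> snd a \<otimes> u \<otimes> m a) = \<pi> [^] i \<otimes> (\<pi> [^] j' \<otimes> snd a' \<otimes> v \<otimes> m a)"
        unfolding u(2)[symmetric] v(2)[symmetric] using pc cc by (simp add: m_lcomm)
      then have "m a \<otimes> (\<pi> [^] i' \<otimes> \<pi> [^] j \<otimes> snd a \<otimes> u) = m a \<otimes> (\<pi> [^] i \<otimes> \<pi> [^] j' \<otimes> snd a' \<otimes> v)"
        using pc cc by (simp add: m_ac)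
      then have "\<pi> [^] i' \<otimes> \<pi> [^] j \<otimes> snd a \<otimes> u = \<pi> [^] i \<otimes> \<pi> [^] j' \<otimes> snd a' \<otimes> v"
        using m_lcancel[OF m0 cc(5)] pc cc by auto
      then have "\<pi> [^] i' \<otimes> \<pi> [^] j \<otimes> snd a \<otimes> (u \<otimes> r) = \<pi> [^] i \<otimes> \<pi> [^] j' \<otimes> snd a' \<otimes> (v \<otimes> r)"
        using pc cc by (simp add: m_assoc[symmetric])
      then have "\<pi> [^] (i' + j) \<otimes> snd a = \<pi> [^] (i + j') \<otimes> snd a' \<otimes> (v \<otimes> r)"
        unfolding r(2) using pc cc by (simp add: nat_pow_mult)
      then have "urel (snd a) (snd a')" using urelI[OF U_mult[OF v(1) r(1)]] by blast
      then have "snd a = snd a'" using Y(5) a by auto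
      then show "a = a'" using m[OF a(1)] m[OF a(2)] by (metis prod.collapse)
    qed
    moreover have "m ` ?F \<subseteq> ?\<mu>" using m by blast
    ultimately show ?thesis
      using card_inj_on_le[of m ?F ?\<mu>] inj_on_finite[of m ?F ?\<mu>] card_roots_of_unity[OF b_pos] by linarith
  next
    case True
    show ?thesis unfolding True by simp
  qed
  have "card (S \<times> Y) \<le> card Z * b"
  proof (rule card_le_card_mult_of_fibres[of Z g, OF _ _ fib])
    show "finite Z" unfolding Z_def using Y T by auto
    show "g ` (S \<times> Y) \<subseteq> Z" using cls[OF W] unfolding g_def Q_def by auto
  qed
  \<comment> \<open>The two factors \<open>b\<close> are the residues of the exponent of
    \<open>\<pi>\<close>, counted in \<open>Z\<close>, and the roots of unity, counted in the
    fibres.\<close>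
  then have "card S * card Y \<le> card Y * (b * card T) * b"
    unfolding Z_def by (simp add: card_cartesian_product)
  then have "card Y * card S \<le> card Y * (b * b * card T)" by (simp add: algebra_simps)
  then have "card S \<le> b * b * card T" using Y(1,2) by (simp add: card_gt_0_iff)
  also have "\<dots> \<le> b * b * q ^ t" using T(2) by simp
  finally show ?thesis .
qed

end

section \<open>Lattices in finite-dimensional extensions\<close>

lemma lattice_trivial:
  fixes R (structure)
  assumes "field R" "\<pi> \<in> carrier R" "\<pi> \<noteq> \<zero>\<^bsub>R\<^esub>"
  shows "padic_lattice R \<pi> {\<zero>\<^bsub>R\<^esub>} 1"
proof -
  interpret field R by fact
  have im: "(\<lambda>y. \<pi> [^] (n::nat) \<otimes> y) ` {\<zero>} = {\<zero>}" for n using assms(2) by simp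
  show ?thesis
  proof (intro padic_lattice.intro padic_lattice_axioms.intro, goal_cases)
    case 4 show ?case by (simp add: subgroup_def a_inv_def[symmetric])
  next
    case (7 s)
    then have eq: "s (Suc i) = s i" for i using r_right_minus_eq[of "s (Suc i)" "s i"] im by auto
    have "s i = s 0" for i by (induction i) (auto simp: eq)
    then have "s 0 \<ominus> s i = \<zero>" for i using 7(1)[of 0] by (metis a_minus_def r_neg)
    then show ?case using 7(1)[of 0] unfolding im by auto
  next
    case 8 show ?case by (rule exI[of _ "{\<zero>}"]) (use assms(2) in \<open>auto simp: a_minus_def\<close>)
  qed (use assms im field_axioms in auto)
qed

text \<open>By \<open>indep\<close> the sum of A u and \<open>I\<close> is direct, so coordinates
  are unique and separatedness, completeness and covers can be checked on each coordinate; the sizes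
  of the covers multiply.\<close>

lemma lattice_extend:
  assumes A: "padic_lattice R \<pi> A p" and I: "padic_lattice R \<pi> I q" and u: "u \<in> carrier R"
    and indep: "\<And>a w. \<lbrakk>a \<in> A; w \<in> I; a \<otimes>\<^bsub>R\<^esub> u \<oplus>\<^bsub>R\<^esub> w = \<zero>\<^bsub>R\<^esub>\<rbrakk> \<Longrightarrow> a = \<zero>\<^bsub>R\<^esub> \<and> w = \<zero>\<^bsub>R\<^esub>"
  shows "padic_lattice R \<pi> {a \<otimes>\<^bsub>R\<^esub> u \<oplus>\<^bsub>R\<^esub> w | a w. a \<in> A \<and> w \<in> I} (p * q)"
proof -
  interpret A: padic_lattice R \<pi> A p by fact
  interpret I: padic_lattice R \<pi> I q by fact
  let ?J = "{a \<otimes>\<^bsub>R\<^esub> u \<oplus>\<^bsub>R\<^esub> w | a w. a \<in> A \<and> w \<in> I}"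
  have lvJ: "(\<lambda>y. \<pi> [^]\<^bsub>R\<^esub> n \<otimes>\<^bsub>R\<^esub> y) ` ?J = {a \<otimes>\<^bsub>R\<^esub> u \<oplus>\<^bsub>R\<^esub> w | a w. a \<in> A.lv n \<and> w \<in> I.lv n}" for n :: nat
  proof -
    have eq: "\<pi> [^]\<^bsub>R\<^esub> n \<otimes>\<^bsub>R\<^esub> (a \<otimes>\<^bsub>R\<^esub> u \<oplus>\<^bsub>R\<^esub> w) = (\<pi> [^]\<^bsub>R\<^esub> n \<otimes>\<^bsub>R\<^esub> a) \<otimes>\<^bsub>R\<^esub> u \<oplus>\<^bsub>R\<^esub> \<pi> [^]\<^bsub>R\<^esub> n \<otimes>\<^bsub>R\<^esub> w" if "a \<in> A" "w \<in> I" for a w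
      using A.I_carrier[OF that(1)] I.I_carrier[OF that(2)] u by (simp add: A.r_distr A.m_assoc)
    show ?thesis
    proof (intro equalityI subsetI)
      fix x assume "x \<in> (\<lambda>y. \<pi> [^]\<^bsub>R\<^esub> n \<otimes>\<^bsub>R\<^esub> y) ` ?J"
      then obtain a w where "a \<in> A" "w \<in> I" "x = \<pi> [^]\<^bsub>R\<^esub> n \<otimes>\<^bsub>R\<^esub> (a \<otimes>\<^bsub>R\<^esub> u \<oplus>\<^bsub>R\<^esub> w)" by auto
      then show "x \<in> {a \<otimes>\<^bsub>R\<^esub> u \<oplus>\<^bsub>R\<^esub> w | a w. a \<in> A.lv n \<and> w \<in> I.lv n}"
        using eq unfolding A.lv_def I.lv_def by blast
    next
      fix x assume "x \<in> {a \<otimes>\<^bsub>R\<^esub> u \<oplus>\<^bsub>R\<^esub> w | a w. a \<in> A.lv n \<and> w \<in> I.lv n}"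
      then obtain a w where aw: "a \<in> A" "w \<in> I" "x = (\<pi> [^]\<^bsub>R\<^esub> n \<otimes>\<^bsub>R\<^esub> a) \<otimes>\<^bsub>R\<^esub> u \<oplus>\<^bsub>R\<^esub> \<pi> [^]\<^bsub>R\<^esub> n \<otimes>\<^bsub>R\<^esub> w"
        unfolding A.lv_def I.lv_def by blast
      then have "x = \<pi> [^]\<^bsub>R\<^esub> n \<otimes>\<^bsub>R\<^esub> (a \<otimes>\<^bsub>R\<^esub> u \<oplus>\<^bsub>R\<^esub> w)" using eq by simp
      then show "x \<in> (\<lambda>y. \<pi> [^]\<^bsub>R\<^esub> n \<otimes>\<^bsub>R\<^esub> y) ` ?J" using aw(1,2) by blast
    qed
  qed
  have uniq: "a = a' \<and> w = w'" if h: "a \<in> A" "a' \<in> A" "w \<in> I" "w' \<in> I" "a \<otimes>\<^bsub>R\<^esub> u \<oplus>\<^bsub>R\<^esub> w = a' \<otimes>\<^bsub>R\<^esub> u \<oplus>\<^bsub>R\<^esub> w'" for a a' w w'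
  proof -
    have cc: "a \<in> carrier R" "a' \<in> carrier R" "w \<in> carrier R" "w' \<in> carrier R"
      using h A.I_carrier I.I_carrier by auto
    have m: "a \<ominus>\<^bsub>R\<^esub> a' \<in> A" "w \<ominus>\<^bsub>R\<^esub> w' \<in> I"
      using h A.lv_sub[of _ 0] I.lv_sub[of _ 0] A.lv_0 I.lv_0 by auto
    have "(a \<ominus>\<^bsub>R\<^esub> a') \<otimes>\<^bsub>R\<^esub> u \<oplus>\<^bsub>R\<^esub> (w \<ominus>\<^bsub>R\<^esub> w') = (a \<otimes>\<^bsub>R\<^esub> u \<oplus>\<^bsub>R\<^esub> w) \<ominus>\<^bsub>R\<^esub> (a' \<otimes>\<^bsub>R\<^esub> u \<oplus>\<^bsub>R\<^esub> w')"
      using cc u by algebra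
    also have "\<dots> = \<zero>\<^bsub>R\<^esub>" unfolding h(5) using cc u by (simp add: a_minus_def A.r_neg)
    finally have "a \<ominus>\<^bsub>R\<^esub> a' = \<zero>\<^bsub>R\<^esub> \<and> w \<ominus>\<^bsub>R\<^esub> w' = \<zero>\<^bsub>R\<^esub>" using indep m by blast
    then show ?thesis using cc by (simp add: A.r_right_minus_eq)
  qed
  show ?thesis
  proof (intro padic_lattice.intro padic_lattice_axioms.intro, goal_cases)
    case 1 show ?case by (rule A.field_axioms)
  next
    case 2 show ?case by simp
  next
    case 3 show ?case by (rule A.pi_nonzero)
  next
    case 4
    show ?case
    proof (rule A.add.subgroupI)
      show "?J \<subseteq> carrier R" using A.I_carrier I.I_carrier u by auto
      show "?J \<noteq> {}" using A.zero_I I.zero_I by blast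
    next
      fix x assume "x \<in> ?J"
      then obtain a w where aw: "a \<in> A" "w \<in> I" "x = a \<otimes>\<^bsub>R\<^esub> u \<oplus>\<^bsub>R\<^esub> w" by auto
      then have "\<ominus>\<^bsub>R\<^esub> x = (\<ominus>\<^bsub>R\<^esub> a) \<otimes>\<^bsub>R\<^esub> u \<oplus>\<^bsub>R\<^esub> (\<ominus>\<^bsub>R\<^esub> w)"
        using A.I_carrier[OF aw(1)] I.I_carrier[OF aw(2)] u by (simp add: A.minus_add A.l_minus)
      then show "\<ominus>\<^bsub>R\<^esub> x \<in> ?J" using A.I_neg[OF aw(1)] I.I_neg[OF aw(2)] by blast
    next
      fix x y assume "x \<in> ?J" "y \<in> ?J"
      then obtain a w a' w' where aw: "a \<in> A" "w \<in> I" "x = a \<otimes>\<^bsub>R\<^esub> u \<oplus>\<^bsub>R\<^esub> w" "a' \<in> A" "w' \<in> I" "y = a' \<otimes>\<^bsub>R\<^esub> u \<oplus>\<^bsub>R\<^esub> w'" by auto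
      have "x \<oplus>\<^bsub>R\<^esub> y = (a \<oplus>\<^bsub>R\<^esub> a') \<otimes>\<^bsub>R\<^esub> u \<oplus>\<^bsub>R\<^esub> (w \<oplus>\<^bsub>R\<^esub> w')"
        unfolding aw(3,6) using aw A.I_carrier I.I_carrier u by (simp add: A.l_distr A.a_ac)
      then show "x \<oplus>\<^bsub>R\<^esub> y \<in> ?J" using A.I_add[OF aw(1,4)] I.I_add[OF aw(2,5)] by blast
    qed
  next
    case (5 x)
    then obtain a w where aw: "a \<in> A" "w \<in> I" "x = a \<otimes>\<^bsub>R\<^esub> u \<oplus>\<^bsub>R\<^esub> w" by auto
    then have "\<pi> \<otimes>\<^bsub>R\<^esub> x = (\<pi> \<otimes>\<^bsub>R\<^esub> a) \<otimes>\<^bsub>R\<^esub> u \<oplus>\<^bsub>R\<^esub> \<pi> \<otimes>\<^bsub>R\<^esub> w"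
      using A.I_carrier[OF aw(1)] I.I_carrier[OF aw(2)] u by (simp add: A.r_distr A.m_assoc)
    then show ?case using A.pi_mult[OF aw(1)] I.pi_mult[OF aw(2)] by blast
  next
    case (6 x)
    then have ex: "\<exists>a\<in>A.lv n. \<exists>w\<in>I.lv n. x = a \<otimes>\<^bsub>R\<^esub> u \<oplus>\<^bsub>R\<^esub> w" for n :: nat unfolding lvJ by blast
    obtain a w where aw: "a \<in> A.lv 0" "w \<in> I.lv 0" "x = a \<otimes>\<^bsub>R\<^esub> u \<oplus>\<^bsub>R\<^esub> w" using ex by blast
    have "a \<in> A.lv n \<and> w \<in> I.lv n" for n
    proof -
      obtain a' w' where aw': "a' \<in> A.lv n" "w' \<in> I.lv n" "x = a' \<otimes>\<^bsub>R\<^esub> u \<oplus>\<^bsub>R\<^esub> w'" using ex by blast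
      then have "a = a' \<and> w = w'" using uniq A.lv_I I.lv_I aw by metis
      then show ?thesis using aw' by simp
    qed
    then have "a = \<zero>\<^bsub>R\<^esub>" "w = \<zero>\<^bsub>R\<^esub>" using A.lv_separated I.lv_separated by auto
    then show ?case using aw(3) u by simp
  next
    case (7 s)
    then have "\<forall>i. \<exists>a w. a \<in> A.lv i \<and> w \<in> I.lv i \<and> s (Suc i) \<ominus>\<^bsub>R\<^esub> s i = a \<otimes>\<^bsub>R\<^esub> u \<oplus>\<^bsub>R\<^esub> w" unfolding lvJ by blast
    then obtain a w where aw: "\<And>i. a i \<in> A.lv i" "\<And>i. w i \<in> I.lv i" "\<And>i. s (Suc i) \<ominus>\<^bsub>R\<^esub> s i = a i \<otimes>\<^bsub>R\<^esub> u \<oplus>\<^bsub>R\<^esub> w i"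
      by metis
    have awc: "a i \<in> carrier R" "w i \<in> carrier R" for i using aw A.lv_carrier I.lv_carrier by blast+
    \<comment> \<open>The terms \<open>s i\<close> need not lie in \<open>?J\<close>, only their
      increments do. The coordinate sequences are therefore rebuilt by summing the coordinates of
      the increments, starting from zero.\<close>
    define f where "f = rec_nat \<zero>\<^bsub>R\<^esub> (\<lambda>i y. y \<oplus>\<^bsub>R\<^esub> a i)"
    define g where "g = rec_nat \<zero>\<^bsub>R\<^esub> (\<lambda>i y. y \<oplus>\<^bsub>R\<^esub> w i)"
    have f: "f 0 = \<zero>\<^bsub>R\<^esub>" "f (Suc i) = f i \<oplus>\<^bsub>R\<^esub> a i" for i unfolding f_def by auto
    have g: "g 0 = \<zero>\<^bsub>R\<^esub>" "g (Suc i) = g i \<oplus>\<^bsub>R\<^esub> w i" for i unfolding g_def by auto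
    have fc: "f i \<in> carrier R" for i by (induction i) (use f awc in auto)
    have gc: "g i \<in> carrier R" for i by (induction i) (use g awc in auto)
    have "f (Suc i) \<ominus>\<^bsub>R\<^esub> f i = a i" for i unfolding f using fc[of i] awc[of i] by algebra
    then obtain fl where fl: "fl \<in> carrier R" "\<And>i. fl \<ominus>\<^bsub>R\<^esub> f i \<in> A.lv i" using A.lv_complete[of f] fc aw(1) by auto
    have "g (Suc i) \<ominus>\<^bsub>R\<^esub> g i = w i" for i unfolding g using gc[of i] awc[of i] by algebra
    then obtain gl where gl: "gl \<in> carrier R" "\<And>i. gl \<ominus>\<^bsub>R\<^esub> g i \<in> I.lv i" using I.lv_complete[of g] gc aw(2) by auto
    have sc: "s i \<in> carrier R" for i using 7 by auto
    have s: "s i = s 0 \<oplus>\<^bsub>R\<^esub> f i \<otimes>\<^bsub>R\<^esub> u \<oplus>\<^bsub>R\<^esub> g i" for i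
    proof (induction i)
      case 0 show ?case using f g sc u by simp
    next
      case (Suc i)
      have "s (Suc i) = s i \<oplus>\<^bsub>R\<^esub> (s (Suc i) \<ominus>\<^bsub>R\<^esub> s i)" using sc[of i] sc[of "Suc i"] by algebra
      also have "\<dots> = s 0 \<oplus>\<^bsub>R\<^esub> f i \<otimes>\<^bsub>R\<^esub> u \<oplus>\<^bsub>R\<^esub> g i \<oplus>\<^bsub>R\<^esub> (a i \<otimes>\<^bsub>R\<^esub> u \<oplus>\<^bsub>R\<^esub> w i)"
        unfolding aw(3) Suc.IH[symmetric] ..
      also have "\<dots> = s 0 \<oplus>\<^bsub>R\<^esub> f (Suc i) \<otimes>\<^bsub>R\<^esub> u \<oplus>\<^bsub>R\<^esub> g (Suc i)"
        unfolding f g using sc[of 0] fc[of i] gc[of i] awc[of i] u by algebra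
      finally show ?case .
    qed
    let ?x = "s 0 \<oplus>\<^bsub>R\<^esub> fl \<otimes>\<^bsub>R\<^esub> u \<oplus>\<^bsub>R\<^esub> gl"
    have "?x \<ominus>\<^bsub>R\<^esub> s i \<in> (\<lambda>y. \<pi> [^]\<^bsub>R\<^esub> i \<otimes>\<^bsub>R\<^esub> y) ` ?J" for i
    proof -
      have "?x \<ominus>\<^bsub>R\<^esub> (s 0 \<oplus>\<^bsub>R\<^esub> f i \<otimes>\<^bsub>R\<^esub> u \<oplus>\<^bsub>R\<^esub> g i) = (fl \<ominus>\<^bsub>R\<^esub> f i) \<otimes>\<^bsub>R\<^esub> u \<oplus>\<^bsub>R\<^esub> (gl \<ominus>\<^bsub>R\<^esub> g i)"
        using sc[of 0] fc[of i] gc[of i] fl(1) gl(1) u by algebra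
      then have "?x \<ominus>\<^bsub>R\<^esub> s i = (fl \<ominus>\<^bsub>R\<^esub> f i) \<otimes>\<^bsub>R\<^esub> u \<oplus>\<^bsub>R\<^esub> (gl \<ominus>\<^bsub>R\<^esub> g i)" using s[of i] by simp
      then show ?thesis unfolding lvJ using fl(2) gl(2) by blast
    qed
    moreover have "?x \<in> carrier R" using sc fl gl u by simp
    ultimately show ?case by blast
  next
    case 8
    have JJ: "(\<lambda>y. \<pi> \<otimes>\<^bsub>R\<^esub> y) ` ?J = {a \<otimes>\<^bsub>R\<^esub> u \<oplus>\<^bsub>R\<^esub> w | a w. a \<in> A.lv 1 \<and> w \<in> I.lv 1}"
      using lvJ[of 1] by simp
    obtain T where T: "finite T" "card T \<le> p" "T \<subseteq> A" "\<And>x. x \<in> A \<Longrightarrow> \<exists>t\<in>T. x \<ominus>\<^bsub>R\<^esub> t \<in> A.lv 1"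
      using A.cover unfolding A.lv_def by auto
    obtain T' where T': "finite T'" "card T' \<le> q" "T' \<subseteq> I" "\<And>x. x \<in> I \<Longrightarrow> \<exists>t\<in>T'. x \<ominus>\<^bsub>R\<^esub> t \<in> I.lv 1"
      using I.cover unfolding I.lv_def by auto
    let ?f = "\<lambda>(a, w). a \<otimes>\<^bsub>R\<^esub> u \<oplus>\<^bsub>R\<^esub> w"
    have "finite (?f ` (T \<times> T'))" using T T' by auto
    moreover have "card (?f ` (T \<times> T')) \<le> p * q"
      using card_image_le[of "T \<times> T'" ?f] T(1,2) T'(1,2) mult_le_mono[OF T(2) T'(2)]
      by (simp add: card_cartesian_product)
    moreover have "?f ` (T \<times> T') \<subseteq> ?J" using T(3) T'(3) by auto
    moreover have "\<exists>t\<in>?f ` (T \<times> T'). x \<ominus>\<^bsub>R\<^esub> t \<in> (\<lambda>y. \<pi> \<otimes>\<^bsub>R\<^esub> y) ` ?J" if "x \<in> ?J" for x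
    proof -
      obtain a w where aw: "a \<in> A" "w \<in> I" "x = a \<otimes>\<^bsub>R\<^esub> u \<oplus>\<^bsub>R\<^esub> w" using \<open>x \<in> ?J\<close> by auto
      obtain t t' where t: "t \<in> T" "a \<ominus>\<^bsub>R\<^esub> t \<in> A.lv 1" "t' \<in> T'" "w \<ominus>\<^bsub>R\<^esub> t' \<in> I.lv 1" using T(4)[OF aw(1)] T'(4)[OF aw(2)] by auto
      have cc: "a \<in> carrier R" "w \<in> carrier R" "t \<in> carrier R" "t' \<in> carrier R" using aw t T(3) T'(3) A.I_carrier I.I_carrier by blast+
      have "x \<ominus>\<^bsub>R\<^esub> ?f (t, t') = (a \<ominus>\<^bsub>R\<^esub> t) \<otimes>\<^bsub>R\<^esub> u \<oplus>\<^bsub>R\<^esub> (w \<ominus>\<^bsub>R\<^esub> t')"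
        unfolding aw(3) prod.case using cc u by algebra
      then have "x \<ominus>\<^bsub>R\<^esub> ?f (t, t') \<in> (\<lambda>y. \<pi> \<otimes>\<^bsub>R\<^esub> y) ` ?J" unfolding JJ using t(2,4) by blast
      then show ?thesis using t(1,3) by blast
    qed
    ultimately show ?case by (intro exI[of _ "?f ` (T \<times> T')"] conjI ballI)
  qed
qed

text \<open>The filtration of \<open>lv c\<close> is that of \<open>I\<close> shifted by
  \<open>c\<close>, and the covers keep their size because they exist between any two neighbouring
  levels.\<close>

lemma (in padic_lattice) lattice_scale: "padic_lattice R \<pi> (lv c) q"
proof -
  have im: "(\<lambda>y. \<pi> [^] n \<otimes> y) ` lv c = lv (c + n)" for n :: nat
  proof -
    have "\<pi> [^] n \<otimes> (\<pi> [^] c \<otimes> y) = \<pi> [^] (c + n) \<otimes> y" if "y \<in> I" for y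
      using I_carrier[OF that] by (simp add: m_assoc[symmetric] nat_pow_mult add.commute)
    then show ?thesis unfolding lv_def image_image by (auto simp: image_iff)
  qed
  have im1: "(\<lambda>y. \<pi> \<otimes> y) ` lv c = lv (c + 1)" using im[of 1] by simp
  show ?thesis
  proof (intro padic_lattice.intro padic_lattice_axioms.intro, goal_cases)
    case 1 show ?case by (rule field_axioms)
  next
    case 4
    show ?case
    proof (rule add.subgroupI)
      show "lv c \<subseteq> carrier R" using lv_carrier by auto
      show "lv c \<noteq> {}" using lv_zero by auto
    qed (use lv_neg lv_add in auto)
  next
    case (5 x)
    then have "\<pi> \<otimes> x \<in> lv (c + 1)" using im1 by auto
    then show ?case using lv_mono[of c "c + 1"] by auto
  next
    case (6 x)
    show ?case
    proof (rule lv_separated)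
      fix n show "x \<in> lv n" using 6[of n] lv_mono[of n "c + n"] unfolding im by auto
    qed
  next
    case (7 s)
    have "s (Suc i) \<ominus> s i \<in> lv i" for i using 7(2)[of i] lv_mono[of i "c + i"] unfolding im by auto
    then obtain x where x: "x \<in> carrier R" "\<And>i. x \<ominus> s i \<in> lv i" using lv_complete[of s] 7(1) by blast
    \<comment> \<open>The limit is known to be close to \<open>s (i + c)\<close> at level
      \<open>i + c\<close>; the increments between \<open>s i\<close> and \<open>s (i + c)\<close>
      lie in that level as well.\<close>
    have "x \<ominus> s i \<in> lv (c + i)" for i
    proof -
      have st: "s (i + k) \<ominus> s i \<in> lv (c + i)" for k
      proof (induction k)
        case 0 show ?case using 7(1)[of i] lv_zero by (simp add: a_minus_def r_neg)
      next
        case (Suc k)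
        have "s (Suc (i + k)) \<ominus> s (i + k) \<in> lv (c + i)"
          using 7(2)[of "i + k"] lv_mono[of "c + i" "c + (i + k)"] unfolding im by auto
        then show ?case using lv_trans[OF _ Suc.IH] 7(1) by auto
      qed
      have "x \<ominus> s (i + c) \<in> lv (c + i)" using x(2)[of "i + c"] by (simp add: add.commute)
      then show ?thesis using lv_trans[OF _ st[of c]] 7(1) x(1) by auto
    qed
    then show ?case using x(1) unfolding im by auto
  next
    case 8
    show ?case using lv_cover[of 1 c] unfolding im1 by simp
  qed (use pi_nonzero in auto)
qed

text \<open>A limit differs from \<open>s 0\<close> by an element of \<open>I\<close>, so it stays
  in any subfield that contains \<open>I\<close> and the sequence.\<close>

lemma (in padic_lattice) lattice_restrict:
  assumes E: "subfield E R" and "I \<subseteq> E" "\<pi> \<in> E"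
  shows "padic_lattice (R\<lparr>carrier := E\<rparr>) \<pi> I q"
proof -
  note sub = subfieldE(1)[OF E]
  interpret F: field "R\<lparr>carrier := E\<rparr>" by (rule subfield_iff(2)[OF E])
  have EC: "E \<subseteq> carrier R" by (rule subringE(1)[OF sub])
  have minus: "x \<ominus>\<^bsub>R\<lparr>carrier := E\<rparr>\<^esub> y = x \<ominus> y" if "x \<in> E" "y \<in> E" for x y
  proof -
    have "\<ominus>\<^bsub>R\<lparr>carrier := E\<rparr>\<^esub> y = \<ominus> y"
      using F.minus_equality[of "\<ominus> y" y] that subringE(5)[OF sub] EC l_neg by auto
    then show ?thesis by (simp add: a_minus_def)
  qed
  have pw: "\<pi> [^]\<^bsub>R\<lparr>carrier := E\<rparr>\<^esub> n = \<pi> [^] (n::nat)" for n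
    by (simp add: nat_pow_def)
  have im: "(\<lambda>y. \<pi> [^] (n::nat) \<otimes> y) ` I = lv n" for n unfolding lv_def ..
  have lvE: "lv n \<subseteq> E" for n using lv_I assms(2) by auto
  show ?thesis
  proof (intro padic_lattice.intro padic_lattice_axioms.intro, goal_cases)
    case 1 show ?case by (rule F.field_axioms)
  next
    case 2 show ?case using assms by simp
  next
    case 3 show ?case using pi_nonzero by simp
  next
    case 4
    show ?case
    proof (rule F.add.subgroupI)
      fix a assume a: "a \<in> I"
      have "\<ominus>\<^bsub>R\<lparr>carrier := E\<rparr>\<^esub> a = \<ominus> a"
        using F.minus_equality[of "\<ominus> a" a] a assms(2) subringE(5)[OF sub] EC l_neg by auto
      then show "\<ominus>\<^bsub>R\<lparr>carrier := E\<rparr>\<^esub> a \<in> I" using I_neg[OF a] by simp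
    qed (use assms(2) zero_I I_add in auto)
  next
    case (5 x) then show ?case using pi_mult by simp
  next
    case (6 x) then show ?case using separated by (simp add: pw)
  next
    case (7 s)
    have sE: "s i \<in> E" for i using 7(1) by simp
    have sc: "s i \<in> carrier R" for i using sE EC by auto
    have "s (Suc i) \<ominus> s i \<in> lv i" for i using 7(2)[of i] by (simp add: pw minus[OF sE sE] im)
    then obtain x where x: "x \<in> carrier R" "\<And>i. x \<ominus> s i \<in> lv i" using lv_complete[of s] sc by blast
    have "x = (x \<ominus> s 0) \<oplus> s 0" using x(1) sc[of 0] by algebra
    then have "x \<in> E" using x(2)[of 0] lvE sE[of 0] subringE(7)[OF sub] by (metis subsetD)
    then show ?case using x(2) by (auto simp: pw minus[OF _ sE] im)
  next
    case 8
    obtain T where T: "finite T" "card T \<le> q" "T \<subseteq> I" "\<And>x. x \<in> I \<Longrightarrow> \<exists>t\<in>T. x \<ominus> t \<in> (\<otimes>) \<pi> ` I"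
      using cover by auto
    have "\<exists>t\<in>T. x \<ominus>\<^bsub>R\<lparr>carrier := E\<rparr>\<^esub> t \<in> (\<otimes>) \<pi> ` I" if "x \<in> I" for x
      using T(4)[OF that] that T(3) assms(2) minus by (metis subsetD)
    then show ?case using T(1-3) by auto
  qed
qed

text \<open>\<open>k0\<close> and \<open>A\<close> are copies of Q_p and Z_p inside a larger field
  \<open>R\<close>. The uniformizer is the image of the integer p, and \<open>A\<close> has at most
  p classes modulo it. \<open>A_unit\<close> records that integers prime to p are units of
  Z_p.\<close>

locale padic_base = padic_lattice R "[p] \<cdot>\<^bsub>R\<^esub> \<one>\<^bsub>R\<^esub>" A p for R (structure) and p :: nat and A +
  fixes k0 :: "'a set"
  assumes k0: "subfield k0 R"
    and A_sub: "A \<subseteq> k0"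
    and A_one: "\<one> \<in> A"
    and A_mult: "\<lbrakk>x \<in> A; y \<in> A\<rbrakk> \<Longrightarrow> x \<otimes> y \<in> A"
    and A_frac: "x \<in> k0 \<Longrightarrow> \<exists>n::nat. ([p] \<cdot> \<one>) [^] n \<otimes> x \<in> A"
    and p_prime: "Factorial_Ring.prime p"
    and A_unit: "coprime c p \<Longrightarrow> \<exists>y\<in>A. ([(c::nat)] \<cdot> \<one>) \<otimes> y = \<one>"
    and char_zero: "0 < (n::nat) \<Longrightarrow> [n] \<cdot> \<one> \<noteq> \<zero>"
begin

abbreviation \<pi> :: 'a where "\<pi> \<equiv> [p] \<cdot> \<one>"

text \<open>The \<open>A\<close>-module spanned by a list. The recursion follows
  \<open>lattice_extend\<close>, so that independence of the list makes each step a direct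
  sum.\<close>

primrec lat :: "'a list \<Rightarrow> 'a set" where
  "lat [] = {\<zero>}"
| "lat (u # us) = {a \<otimes> u \<oplus> w | a w. a \<in> A \<and> w \<in> lat us}"

lemma k0_carrier: "x \<in> k0 \<Longrightarrow> x \<in> carrier R" using subfieldE(3)[OF k0] by auto

lemma pi_A: "\<pi> \<in> A" using pi_mult[OF A_one] by simp

lemma pi_pow_A: "\<pi> [^] (n::nat) \<in> A" using pi_pow_I[OF A_one, of n] by simp

lemma lat_Span: "set us \<subseteq> carrier R \<Longrightarrow> lat us \<subseteq> Span k0 us"
proof (induction us)
  case (Cons u us)
  show ?case
  proof
    fix x assume "x \<in> lat (u # us)"
    then obtain a w where "a \<in> A" "w \<in> lat us" "x = a \<otimes> u \<oplus> w" by auto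
    then show "x \<in> Span k0 (u # us)"
      using Cons A_sub line_extension_mem_iff[of x k0 u "Span k0 us"] by auto
  qed
qed auto

lemma lat_carrier: "set us \<subseteq> carrier R \<Longrightarrow> x \<in> lat us \<Longrightarrow> x \<in> carrier R"
  using lat_Span[of us] Span_in_carrier[of k0 us] k0_carrier by blast

text \<open>A relation a u + w = 0 with \<open>a\<close> nonzero could be divided by
  \<open>a\<close> in the field \<open>k0\<close> and would put \<open>u\<close> into the span of
  the remaining vectors.\<close>

lemma lat_lattice: "independent k0 us \<Longrightarrow> padic_lattice R \<pi> (lat us) (p ^ length us)"
proof (induction us)
  case Nil
  show ?case using lattice_trivial[OF field_axioms pi_closed pi_nonzero] by simp
next
  case (Cons u us)
  have u: "u \<in> carrier R" "u \<notin> Span k0 us" "independent k0 us"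
    using independent_backwards[OF Cons.prems] by auto
  have us: "set us \<subseteq> carrier R" using independent_in_carrier[OF u(3)] .
  have "padic_lattice R \<pi> {a \<otimes> u \<oplus> w | a w. a \<in> A \<and> w \<in> lat us} (p * p ^ length us)"
  proof (rule lattice_extend[OF padic_lattice_axioms Cons.IH[OF u(3)] u(1)])
    fix a w assume aw: "a \<in> A" "w \<in> lat us" "a \<otimes> u \<oplus> w = \<zero>"
    have c: "a \<in> carrier R" "w \<in> carrier R" using aw us lat_carrier I_carrier by auto
    have "a = \<zero>"
    proof (rule ccontr)
      assume "a \<noteq> \<zero>"
      have "a \<otimes> u = \<ominus> w" using aw(3) c u(1) minus_equality[of "a \<otimes> u" w] by simp
      then have "a \<otimes> u \<in> Span k0 us" using lat_Span[OF us] aw(2) Span_subgroup_props(4)[OF k0 us] by auto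
      then show False using Span_m_inv_simprule[OF k0 us, of a u] \<open>a \<noteq> \<zero>\<close> aw(1) A_sub u(1,2) by auto
    qed
    then show "a = \<zero> \<and> w = \<zero>" using aw(3) c u(1) by auto
  qed
  then show ?case by simp
qed

lemma lat_min:
  assumes "\<zero> \<in> M" "\<And>x y. \<lbrakk>x \<in> M; y \<in> M\<rbrakk> \<Longrightarrow> x \<oplus> y \<in> M" "\<And>a u. \<lbrakk>a \<in> A; u \<in> set us\<rbrakk> \<Longrightarrow> a \<otimes> u \<in> M"
  shows "lat us \<subseteq> M"
  using assms(3) by (induction us) (use assms(1,2) in auto)

lemma lat_zero: "set us \<subseteq> carrier R \<Longrightarrow> \<zero> \<in> lat us"
  by (induction us) (auto intro!: exI[of _ \<zero>] simp: zero_I)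

lemma lat_smult: "set us \<subseteq> carrier R \<Longrightarrow> c \<in> A \<Longrightarrow> x \<in> lat us \<Longrightarrow> c \<otimes> x \<in> lat us"
proof (induction us arbitrary: x)
  case Nil then show ?case using I_carrier by auto
next
  case (Cons u us)
  then obtain a w where aw: "a \<in> A" "w \<in> lat us" "x = a \<otimes> u \<oplus> w" by auto
  have "c \<otimes> x = (c \<otimes> a) \<otimes> u \<oplus> c \<otimes> w"
    using aw Cons.prems lat_carrier[of us w] I_carrier by (simp add: r_distr m_assoc)
  moreover have "c \<otimes> w \<in> lat us" using Cons aw by auto
  ultimately show ?case using A_mult[OF Cons.prems(2) aw(1)] by auto
qed

lemma lat_add: "set us \<subseteq> carrier R \<Longrightarrow> x \<in> lat us \<Longrightarrow> y \<in> lat us \<Longrightarrow> x \<oplus> y \<in> lat us"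
proof (induction us arbitrary: x y)
  case (Cons u us)
  then obtain a w a' w' where aw: "a \<in> A" "w \<in> lat us" "x = a \<otimes> u \<oplus> w" "a' \<in> A" "w' \<in> lat us" "y = a' \<otimes> u \<oplus> w'" by auto
  have "x \<oplus> y = (a \<oplus> a') \<otimes> u \<oplus> (w \<oplus> w')"
    unfolding aw(3,6) using aw Cons.prems(1) lat_carrier[of us] I_carrier by (simp add: l_distr a_ac)
  moreover have "w \<oplus> w' \<in> lat us" using Cons aw by auto
  ultimately show ?case using I_add[OF aw(1,4)] by auto
qed auto

lemma lat_pi_mono:
  assumes "set us \<subseteq> carrier R" "x \<in> carrier R" "\<pi> [^] m \<otimes> x \<in> lat us" "m \<le> (n::nat)"
  shows "\<pi> [^] n \<otimes> x \<in> lat us"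
proof -
  have "\<pi> [^] (n - m) \<otimes> (\<pi> [^] m \<otimes> x) = \<pi> [^] n \<otimes> x"
    using assms by (simp add: m_assoc[symmetric] nat_pow_mult)
  then show ?thesis using lat_smult[OF assms(1) pi_pow_A[of "n - m"] assms(3)] by simp
qed

lemma lat_exhausting: "set us \<subseteq> carrier R \<Longrightarrow> x \<in> Span k0 us \<Longrightarrow> \<exists>n::nat. \<pi> [^] n \<otimes> x \<in> lat us"
proof (induction us arbitrary: x)
  case Nil then show ?case by auto
next
  case (Cons u us)
  then obtain k v where kv: "k \<in> k0" "v \<in> Span k0 us" "x = k \<otimes> u \<oplus> v"
    using line_extension_mem_iff[of x k0 u "Span k0 us"] by auto
  have c: "k \<in> carrier R" "v \<in> carrier R" "u \<in> carrier R" "set us \<subseteq> carrier R"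
    using kv Cons.prems(1) k0_carrier Span_in_carrier[of k0 us] by auto
  obtain n where n: "\<pi> [^] (n::nat) \<otimes> k \<in> A" using A_frac[OF kv(1)] by auto
  obtain m where m: "\<pi> [^] (m::nat) \<otimes> v \<in> lat us" using Cons.IH[OF c(4) kv(2)] by auto
  have "\<pi> [^] (m + n) \<otimes> x = (\<pi> [^] (m + n) \<otimes> k) \<otimes> u \<oplus> \<pi> [^] (m + n) \<otimes> v"
    unfolding kv(3) using c by (simp add: r_distr m_assoc)
  moreover have "\<pi> [^] (m + n) \<otimes> k = \<pi> [^] m \<otimes> (\<pi> [^] n \<otimes> k)"
    using c by (simp add: nat_pow_mult[symmetric] m_assoc)
  moreover have "\<pi> [^] m \<otimes> (\<pi> [^] n \<otimes> k) \<in> A" by (rule A_mult[OF pi_pow_A n])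
  ultimately show ?case using lat_pi_mono[OF c(4,2) m, of "m + n"] by (intro exI[of _ "m + n"]) auto
qed

text \<open>One power of \<open>\<pi>\<close> clears the denominators of the finitely many products
  of generators, and bilinearity carries this to the whole lattice.\<close>

lemma lat_mult_bound:
  assumes us: "set us \<subseteq> carrier R" and "\<And>u v. u \<in> set us \<Longrightarrow> v \<in> set us \<Longrightarrow> u \<otimes> v \<in> Span k0 us"
  shows "\<exists>c::nat. \<forall>x\<in>lat us. \<forall>y\<in>lat us. \<pi> [^] c \<otimes> (x \<otimes> y) \<in> lat us"
proof -
  let ?P = "set us \<times> set us"
  have "\<forall>z\<in>?P. \<exists>n::nat. \<pi> [^] n \<otimes> (fst z \<otimes> snd z) \<in> lat us"
    using lat_exhausting[OF us] assms(2) by auto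
  then obtain f where f: "\<And>z. z \<in> ?P \<Longrightarrow> \<pi> [^] (f z :: nat) \<otimes> (fst z \<otimes> snd z) \<in> lat us" by metis
  define k where "k = Max (insert 0 (f ` ?P))"
  have c: "\<pi> [^] k \<otimes> (u \<otimes> v) \<in> lat us" if "u \<in> set us" "v \<in> set us" for u v
  proof (rule lat_pi_mono[OF us])
    show "\<pi> [^] f (u, v) \<otimes> (u \<otimes> v) \<in> lat us" using f[of "(u, v)"] that by simp
    show "f (u, v) \<le> k" using that unfolding k_def by (intro Max_ge) auto
    show "u \<otimes> v \<in> carrier R" using that us by auto
  qed
  have pc: "\<pi> [^] k \<in> carrier R" by simp
  \<comment> \<open>Bilinear extension in two passes by \<open>lat_min\<close>: first the left
    factor runs through the lattice with the right one a generator, then the right factor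
    does.\<close>
  have 1: "lat us \<subseteq> {x \<in> carrier R. \<pi> [^] k \<otimes> (x \<otimes> v) \<in> lat us}" if v: "v \<in> set us" for v
  proof (rule lat_min)
    have vc: "v \<in> carrier R" using v us by auto
    show "\<zero> \<in> {x \<in> carrier R. \<pi> [^] k \<otimes> (x \<otimes> v) \<in> lat us}" using lat_zero[OF us] vc pc by simp
    show "x \<oplus> y \<in> {x \<in> carrier R. \<pi> [^] k \<otimes> (x \<otimes> v) \<in> lat us}"
      if "x \<in> {x \<in> carrier R. \<pi> [^] k \<otimes> (x \<otimes> v) \<in> lat us}" "y \<in> {x \<in> carrier R. \<pi> [^] k \<otimes> (x \<otimes> v) \<in> lat us}" for x y
      using that lat_add[OF us] vc pc by (auto simp: l_distr r_distr)
    show "a \<otimes> u \<in> {x \<in> carrier R. \<pi> [^] k \<otimes> (x \<otimes> v) \<in> lat us}" if "a \<in> A" "u \<in> set us" for a u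
    proof -
      have cc: "a \<in> carrier R" "u \<in> carrier R" using that us I_carrier by auto
      have "\<pi> [^] k \<otimes> (a \<otimes> u \<otimes> v) = a \<otimes> (\<pi> [^] k \<otimes> (u \<otimes> v))" using cc vc pc by algebra
      then show ?thesis using lat_smult[OF us that(1) c[OF that(2) v]] cc by auto
    qed
  qed
  have 2: "lat us \<subseteq> {y \<in> carrier R. \<pi> [^] k \<otimes> (x \<otimes> y) \<in> lat us}" if x: "x \<in> lat us" for x
  proof (rule lat_min)
    have xc: "x \<in> carrier R" using x us lat_carrier by auto
    show "\<zero> \<in> {y \<in> carrier R. \<pi> [^] k \<otimes> (x \<otimes> y) \<in> lat us}" using lat_zero[OF us] xc pc by simp
    show "y \<oplus> z \<in> {y \<in> carrier R. \<pi> [^] k \<otimes> (x \<otimes> y) \<in> lat us}"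
      if "y \<in> {y \<in> carrier R. \<pi> [^] k \<otimes> (x \<otimes> y) \<in> lat us}" "z \<in> {y \<in> carrier R. \<pi> [^] k \<otimes> (x \<otimes> y) \<in> lat us}" for y z
      using that lat_add[OF us] xc pc by (auto simp: r_distr)
    show "a \<otimes> v \<in> {y \<in> carrier R. \<pi> [^] k \<otimes> (x \<otimes> y) \<in> lat us}" if "a \<in> A" "v \<in> set us" for a v
    proof -
      have cc: "a \<in> carrier R" "v \<in> carrier R" using that us I_carrier by auto
      have "\<pi> [^] k \<otimes> (x \<otimes> (a \<otimes> v)) = a \<otimes> (\<pi> [^] k \<otimes> (x \<otimes> v))" using cc xc pc by algebra
      moreover have "\<pi> [^] k \<otimes> (x \<otimes> v) \<in> lat us" using 1[OF that(2)] x by auto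
      ultimately show ?thesis using lat_smult[OF us that(1)] cc by auto
    qed
  qed
  show ?thesis using 2 by blast
qed

lemma nat_mult_one: "[(m * n)] \<cdot> \<one> = ([(m::nat)] \<cdot> \<one>) \<otimes> ([(n::nat)] \<cdot> \<one>)"
  by (simp add: add_pow_ldistr add.nat_pow_pow mult.commute)

lemma nat_pow_one_eq: "[(p ^ t)] \<cdot> \<one> = \<pi> [^] (t::nat)"
  by (induction t) (auto simp: nat_mult_one m_comm)

text \<open>A basis spans a lattice whose products have denominators at most \<open>\<pi>\<close>^c;
  shrinking it to level \<open>c\<close> makes it closed under products. Writing b as p^t b' with b'
  a unit of \<open>A\<close> gives the divisibility that \<open>mult_lattice\<close> asks
  for.\<close>

theorem card_power_classes_subfield:
  assumes E: "subfield E R" "dimension d k0 E" and b: "0 < b"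
    and S: "S \<subseteq> E - {\<zero>}" "finite S"
    and sep: "\<And>x y c. \<lbrakk>x \<in> S; y \<in> S; c \<in> E; x = y \<otimes> c [^] b\<rbrakk> \<Longrightarrow> x = y"
  shows "card S \<le> b ^ (d + 2)"
proof -
  obtain us where us: "set us \<subseteq> carrier R" "independent k0 us" "length us = d" "Span k0 us = E"
    using exists_base[OF k0 E(2)] by auto
  note sub = subfieldE(1)[OF E(1)]
  have usE: "set us \<subseteq> E" using Span_base_incl[OF k0 us(1)] us(4) by auto
  have k0E: "k0 \<subseteq> E"
  proof
    fix x assume x: "x \<in> k0"
    have "x \<otimes> \<one> \<in> Span k0 us" using Span_smult_closed[OF k0 us(1) x] us(4) subringE(3)[OF sub] by auto
    then show "x \<in> E" using us(4) k0_carrier[OF x] by simp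
  qed
  obtain c :: nat where c: "\<And>x y. x \<in> lat us \<Longrightarrow> y \<in> lat us \<Longrightarrow> \<pi> [^] c \<otimes> (x \<otimes> y) \<in> lat us"
    using lat_mult_bound[OF us(1)] us(4) usE subringE(6)[OF sub] by blast
  \<comment> \<open>The p-adic valuation of \<open>b\<close>, which is the loss of precision in
    extracting b-th roots.\<close>
  define t where "t = multiplicity p b"
  obtain b' where b': "b = p ^ t * b'" "\<not> p dvd b'"
    unfolding t_def using b p_prime by (metis multiplicity_decompose' not_prime_unit gr_implies_not0)
  have cop: "coprime b' p" using prime_imp_coprime[OF p_prime b'(2)] coprime_commute by blast
  obtain r where r: "r \<in> A" "([b'] \<cdot> \<one>) \<otimes> r = \<one>" using A_unit[OF cop] by auto
  interpret L: padic_lattice R \<pi> "lat us" "p ^ d" using lat_lattice[OF us(2)] us(3) by simp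
  interpret L2: padic_lattice R \<pi> "L.lv c" "p ^ d" by (rule L.lattice_scale)
  have lvE: "L.lv c \<subseteq> E" using L.lv_I lat_Span[OF us(1)] us(4) by blast
  have piE: "\<pi> \<in> E" using pi_A A_sub k0E by auto
  interpret L3: padic_lattice "R\<lparr>carrier := E\<rparr>" \<pi> "L.lv c" "p ^ d" by (rule L2.lattice_restrict[OF E(1) lvE piE])
  have pw: "x [^]\<^bsub>R\<lparr>carrier := E\<rparr>\<^esub> n = x [^] (n::nat)" for n x by (simp add: nat_pow_def)
  have ap: "[n] \<cdot>\<^bsub>R\<lparr>carrier := E\<rparr>\<^esub> x = [(n::nat)] \<cdot> x" for n x by (simp add: add_pow_def nat_pow_def)
  interpret M: mult_lattice "R\<lparr>carrier := E\<rparr>" \<pi> "L.lv c" "p ^ d" b t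
  proof (unfold_locales, goal_cases)
    case (1 x y)
    then obtain x' y' where xy: "x' \<in> lat us" "y' \<in> lat us" "x = \<pi> [^] c \<otimes> x'" "y = \<pi> [^] c \<otimes> y'"
      unfolding L.lv_def by auto
    have cc: "x' \<in> carrier R" "y' \<in> carrier R" "\<pi> [^] c \<in> carrier R" using xy lat_carrier us(1) by auto
    have "x \<otimes> y = \<pi> [^] c \<otimes> (\<pi> [^] c \<otimes> (x' \<otimes> y'))" unfolding xy(3,4) using cc by algebra
    then show ?case using c[OF xy(1,2)] unfolding L.lv_def by auto
  next
    case (2 x)
    then have x: "x \<in> Span k0 us" "x \<in> carrier R" using us(4) subringE(1)[OF sub] by auto
    obtain n where n: "\<pi> [^] (n::nat) \<otimes> x \<in> lat us" using lat_exhausting[OF us(1) x(1)] by auto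
    have "\<pi> [^] (c + n) \<otimes> x = \<pi> [^] c \<otimes> (\<pi> [^] n \<otimes> x)" using x by (simp add: nat_pow_mult[symmetric] m_assoc)
    then have "\<pi> [^] (c + n) \<otimes> x \<in> L.lv c" using n unfolding L.lv_def by auto
    then show ?case by (auto simp: pw)
  next
    case 3 show ?case by fact
  next
    case 4 show ?case using char_zero[OF b] by (simp add: ap)
  next
    case (5 x)
    have xc: "x \<in> carrier R" "r \<in> carrier R" using 5 L.lv_carrier r I_carrier by auto
    obtain x' where x': "x' \<in> lat us" "x = \<pi> [^] c \<otimes> x'" using 5 unfolding L.lv_def by auto
    have "r \<otimes> x = \<pi> [^] c \<otimes> (r \<otimes> x')" unfolding x'(2) using xc lat_carrier[OF us(1) x'(1)] by (simp add: m_lcomm)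
    then have "r \<otimes> x \<in> L.lv c" using lat_smult[OF us(1) r(1) x'(1)] unfolding L.lv_def by auto
    moreover have "([b] \<cdot> \<one>) \<otimes> (r \<otimes> x) = \<pi> [^] t \<otimes> x"
    proof -
      have b'c: "[b'] \<cdot> \<one> \<in> carrier R" "\<pi> [^] t \<in> carrier R" by auto
      have "([b] \<cdot> \<one>) \<otimes> (r \<otimes> x) = (\<pi> [^] t \<otimes> ([b'] \<cdot> \<one>)) \<otimes> (r \<otimes> x)"
        by (subst b'(1)) (simp only: nat_mult_one nat_pow_one_eq)
      also have "\<dots> = \<pi> [^] t \<otimes> (([b'] \<cdot> \<one>) \<otimes> r) \<otimes> x" using b'c xc by algebra
      finally show ?thesis unfolding r(2) using xc by simp
    qed
    ultimately show ?case by (auto simp: pw ap)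
  qed
  have "card S \<le> b * b * (p ^ d) ^ t"
  proof (rule M.card_power_classes)
    show "S \<subseteq> carrier (R\<lparr>carrier := E\<rparr>) - {\<zero>\<^bsub>R\<lparr>carrier := E\<rparr>\<^esub>}" using S by simp
  qed (use S sep in \<open>auto simp: pw\<close>)
  \<comment> \<open>The lattice has at most p^d classes modulo p, and p^t divides b; this exchange
    of exponents removes the prime from the bound.\<close>
  also have "(p ^ d) ^ t = (p ^ t) ^ d" by (simp add: power_mult[symmetric] mult.commute)
  also have "\<dots> \<le> b ^ d"
  proof (rule power_mono)
    show "p ^ t \<le> b" using b b'(1) by (metis dvd_imp_le dvd_triv_left)
  qed simp
  finally show ?thesis by (simp add: power2_eq_square power_add mult.commute)
qed

end

section \<open>Kummer theory\<close>

lemma (in ring) Span_dimension_le: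
  assumes K: "subfield K R" and "set us \<subseteq> carrier R"
  shows "\<exists>d\<le>length us. dimension d K (Span K us)"
  using assms(2)
proof (induction us)
  case (Cons u us)
  then have us: "set us \<subseteq> carrier R" "u \<in> carrier R" by auto
  obtain d where d: "d \<le> length us" "dimension d K (Span K us)" using Cons by auto
  show ?case
  proof (cases "u \<in> Span K us")
    case True
    have "set (u # us) \<subseteq> Span K us" using True Span_base_incl[OF K us(1)] by auto
    then have "Span K (u # us) = Span K us"
      using mono_Span_subset[OF K _ us(1)] mono_Span[OF K us] by blast
    then show ?thesis using d by (intro exI[of _ d]) auto
  next
    case False
    then show ?thesis using Suc_dim[OF us(2) False d(2)] d(1) by (intro exI[of _ "Suc d"]) auto
  qed
qed auto

text \<open>Since 0 < i < b, the equation x^i = 1 has fewer than \<open>b\<close> roots, so some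
  b-th root of unity \<open>\<eta>0\<close> violates it. Multiplication by \<open>\<eta>0\<close>
  permutes the summands and multiplies the sum by a factor different from one.\<close>

lemma (in field) finsum_roots_of_unity_pow:
  assumes card: "card {x \<in> carrier R. x [^] b = \<one>} = b" and i: "0 < i" "i < (b::nat)"
  shows "(\<Oplus>\<eta>\<in>{x \<in> carrier R. x [^] b = \<one>}. \<eta> [^] i) = \<zero>"
proof -
  let ?\<mu> = "{x \<in> carrier R. x [^] b = \<one>}"
  have "\<not> ?\<mu> \<subseteq> {x \<in> carrier R. x [^] i = \<one>}"
    using card_mono[OF card_roots_of_unity(1)[OF i(1)], of ?\<mu>] card_roots_of_unity(2)[OF i(1)] card i(2) by linarith
  then obtain \<eta>0 where e: "\<eta>0 \<in> carrier R" "\<eta>0 [^] b = \<one>" "\<eta>0 [^] i \<noteq> \<one>" by auto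
  have e0: "\<eta>0 \<noteq> \<zero>" using e i nat_pow_zero[of b] by auto
  define s where "s = (\<Oplus>\<eta>\<in>?\<mu>. \<eta> [^] i)"
  have sc: "s \<in> carrier R" unfolding s_def by (rule finsum_closed) auto
  have fin: "finite ?\<mu>" using card_roots_of_unity(1)[of b] i by auto
  have inj: "inj_on ((\<otimes>) \<eta>0) ?\<mu>" using m_lcancel[OF e0 e(1)] by (auto intro!: inj_onI)
  have sub: "(\<otimes>) \<eta>0 ` ?\<mu> \<subseteq> ?\<mu>" using e by (auto simp: nat_pow_distrib)
  have im: "(\<otimes>) \<eta>0 ` ?\<mu> = ?\<mu>" using endo_inj_surj[OF fin sub inj] .
  have "\<eta>0 [^] i \<otimes> s = (\<Oplus>\<eta>\<in>?\<mu>. \<eta>0 [^] i \<otimes> \<eta> [^] i)"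
    unfolding s_def using finsum_rdistr[OF fin, of "\<eta>0 [^] i" "\<lambda>\<eta>. \<eta> [^] i"] e by auto
  also have "\<dots> = (\<Oplus>\<eta>\<in>?\<mu>. (\<eta>0 \<otimes> \<eta>) [^] i)"
    by (rule finsum_cong') (use e in \<open>auto simp: nat_pow_distrib\<close>)
  also have "\<dots> = (\<Oplus>\<eta>\<in>(\<otimes>) \<eta>0 ` ?\<mu>. \<eta> [^] i)"
    by (subst finsum_reindex[OF _ inj]) (use e in auto)
  also have "\<dots> = s" unfolding im s_def ..
  finally have "(\<eta>0 [^] i \<ominus> \<one>) \<otimes> s = \<zero>" using e sc by (simp add: a_minus_def l_distr l_minus r_neg)
  moreover have "\<eta>0 [^] i \<ominus> \<one> \<noteq> \<zero>" using e by (simp add: r_right_minus_eq)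
  ultimately have "s = \<zero>" using integral[of "\<eta>0 [^] i \<ominus> \<one>" s] e sc by auto
  then show ?thesis unfolding s_def .
qed

text \<open>An abelian extension E/M of exponent dividing \<open>b\<close>, encoded by a finite set
  of commuting endomorphisms of \<open>E\<close> with fixed field \<open>M\<close>. The maps in
  \<open>G\<close> may coincide on \<open>E\<close>, so a step of the tower fits in directly,
  without forming the quotient of two Galois groups.\<close>

locale kummer = field R for R (structure) +
  fixes E M :: "'a set" and G :: "('a \<Rightarrow> 'a) set" and b :: nat
  assumes E: "subfield E R" and M: "subfield M R" and ME: "M \<subseteq> E"
    and fin: "finite G"
    and hom: "\<phi> \<in> G \<Longrightarrow> \<phi> \<in> ring_hom (R\<lparr>carrier := E\<rparr>) (R\<lparr>carrier := E\<rparr>)"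
    and commute: "\<lbrakk>\<phi> \<in> G; \<tau> \<in> G; x \<in> E\<rbrakk> \<Longrightarrow> \<phi> (\<tau> x) = \<tau> (\<phi> x)"
    and order: "\<lbrakk>\<phi> \<in> G; x \<in> E\<rbrakk> \<Longrightarrow> (\<phi> ^^ b) x = x"
    and fixed: "x \<in> E \<Longrightarrow> (\<And>\<phi>. \<phi> \<in> G \<Longrightarrow> \<phi> x = x) \<Longrightarrow> x \<in> M"
    and fixes_M: "\<lbrakk>\<phi> \<in> G; x \<in> M\<rbrakk> \<Longrightarrow> \<phi> x = x"
    and b_pos: "0 < b" and b_nonzero: "[b] \<cdot> \<one> \<noteq> \<zero>"
    and card_roots: "card {x \<in> carrier R. x [^] b = \<one>} = b"
    and roots_M: "{x \<in> carrier R. x [^] b = \<one>} \<subseteq> M"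
begin

abbreviation \<mu> :: "'a set" where "\<mu> \<equiv> {x \<in> carrier R. x [^] b = \<one>}"

lemma E_carrier: "x \<in> E \<Longrightarrow> x \<in> carrier R" using subfieldE(3)[OF E] by auto

lemmas E_props = subringE[OF subfieldE(1)[OF E]]
lemmas M_props = subringE[OF subfieldE(1)[OF M]]

lemma sigma_closed: "\<phi> \<in> G \<Longrightarrow> x \<in> E \<Longrightarrow> \<phi> x \<in> E"
  using ring_hom_closed[OF hom] by force
lemma sigma_add: "\<phi> \<in> G \<Longrightarrow> x \<in> E \<Longrightarrow> y \<in> E \<Longrightarrow> \<phi> (x \<oplus> y) = \<phi> x \<oplus> \<phi> y"
  using ring_hom_add[OF hom] by force
lemma sigma_mult: "\<phi> \<in> G \<Longrightarrow> x \<in> E \<Longrightarrow> y \<in> E \<Longrightarrow> \<phi> (x \<otimes> y) = \<phi> x \<otimes> \<phi> y"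
  using ring_hom_mult[OF hom] by force
lemma sigma_one: "\<phi> \<in> G \<Longrightarrow> \<phi> \<one> = \<one>"
  using ring_hom_one[OF hom] by force
lemma sigma_zero: "\<phi> \<in> G \<Longrightarrow> \<phi> \<zero> = \<zero>"
  using fixes_M M_props(2) by auto
lemma E_pow: "x \<in> E \<Longrightarrow> x [^] (n::nat) \<in> E"
  by (induction n) (use E_props in auto)
lemma sigma_pow: "\<phi> \<in> G \<Longrightarrow> x \<in> E \<Longrightarrow> \<phi> (x [^] (n::nat)) = \<phi> x [^] n"
  by (induction n) (auto simp: sigma_one sigma_mult E_pow)
lemma sigma_pow_closed: "\<phi> \<in> G \<Longrightarrow> x \<in> E \<Longrightarrow> (\<phi> ^^ n) x \<in> E"
  by (induction n) (auto simp: sigma_closed)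

lemma finsum_E:
  assumes "finite T" "\<And>i. i \<in> T \<Longrightarrow> f i \<in> E"
  shows "finsum R f T \<in> E \<and> (\<forall>\<phi>\<in>G. \<phi> (finsum R f T) = finsum R (\<lambda>i. \<phi> (f i)) T)"
  using assms
proof (induction T)
  case empty then show ?case using E_props(2) sigma_zero by auto
next
  case (insert i T)
  have c: "f \<in> T \<rightarrow> carrier R" "f i \<in> carrier R" using insert E_carrier by auto
  have eq: "finsum R f (insert i T) = f i \<oplus> finsum R f T" using insert c by (simp add: finsum_insert)
  have eq2: "finsum R (\<lambda>i. \<phi> (f i)) (insert i T) = \<phi> (f i) \<oplus> finsum R (\<lambda>i. \<phi> (f i)) T" if "\<phi> \<in> G" for \<phi>
    using insert sigma_closed[OF that] E_carrier by (subst finsum_insert) auto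
  show ?case unfolding eq using insert E_props(7) eq2 by (auto simp: sigma_add)
qed

text \<open>The eigenvalue of \<open>\<phi>\<close> at a nonzero \<open>x\<close> is the inverse of
  \<open>\<eta>\<close>; placing the root of unity on this side suits the shift of indices in
  \<open>w\<close>.\<close>

definition eigen :: "('a \<Rightarrow> 'a) \<Rightarrow> 'a \<Rightarrow> bool" where
  "eigen \<phi> x \<longleftrightarrow> (\<exists>\<eta>\<in>\<mu>. \<eta> \<otimes> \<phi> x = x)"

text \<open>The Lagrange resolvent of \<open>y\<close> for \<open>\<phi>\<close> and the root of
  unity \<open>\<eta>\<close>.\<close>

definition w :: "('a \<Rightarrow> 'a) \<Rightarrow> 'a \<Rightarrow> 'a \<Rightarrow> 'a" where
  "w \<phi> y \<eta> = (\<Oplus>i\<in>{..<b}. \<eta> [^] i \<otimes> (\<phi> ^^ i) y)"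

lemma mu_M: "\<eta> \<in> \<mu> \<Longrightarrow> \<eta> [^] (i::nat) \<in> M"
  using roots_M by (induction i) (use M_props in auto)

lemma term_E: "\<lbrakk>\<phi> \<in> G; y \<in> E; \<eta> \<in> \<mu>\<rbrakk> \<Longrightarrow> \<eta> [^] (i::nat) \<otimes> (\<phi> ^^ i) y \<in> E"
  using E_props(6) sigma_pow_closed mu_M ME by blast

lemma w_E: "\<lbrakk>\<phi> \<in> G; y \<in> E; \<eta> \<in> \<mu>\<rbrakk> \<Longrightarrow> w \<phi> y \<eta> \<in> E"
  unfolding w_def by (rule conjunct1[OF finsum_E[OF finite_lessThan]]) (rule term_E)

text \<open>Applying \<open>\<phi>\<close> and multiplying by \<open>\<eta>\<close> moves every term
  of the resolvent to the next index. The term of index \<open>b\<close> equals that of index zero,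
  as both \<open>\<eta>\<close>^b and the b-th iterate of \<open>\<phi>\<close> are trivial, so the
  sum is unchanged.\<close>

lemma w_eigen:
  assumes s: "\<phi> \<in> G" and y: "y \<in> E" and e: "\<eta> \<in> \<mu>"
  shows "eigen \<phi> (w \<phi> y \<eta>)"
proof -
  let ?t = "\<lambda>i::nat. \<eta> [^] i \<otimes> (\<phi> ^^ i) y"
  have ec: "\<eta> \<in> carrier R" "\<eta> \<in> M" "\<eta> \<in> E" using e roots_M ME by auto
  have tE: "?t i \<in> E" for i using term_E[OF s y e] .
  have tc: "?t i \<in> carrier R" for i using tE E_carrier by auto
  have tS: "\<eta> [^] i \<otimes> \<eta> \<otimes> \<phi> ((\<phi> ^^ i) y) \<in> carrier R" for i using tc[of "Suc i"] by simp
  have "\<eta> \<otimes> \<phi> (w \<phi> y \<eta>) = \<eta> \<otimes> (\<Oplus>i\<in>{..<b}. \<phi> (?t i))"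
    unfolding w_def using finsum_E[of "{..<b}" ?t] tE s by simp
  also have "\<dots> = (\<Oplus>i\<in>{..<b}. \<eta> \<otimes> \<phi> (?t i))"
    by (rule finsum_rdistr) (use ec sigma_closed[OF s] tE E_carrier in auto)
  also have "\<dots> = (\<Oplus>i\<in>{..<b}. ?t (Suc i))"
  proof (rule finsum_cong'[OF refl Pi_I])
    show "?t (Suc i) \<in> carrier R" for i by (rule tc)
    show "\<eta> \<otimes> \<phi> (?t i) = ?t (Suc i)" for i
    proof -
      have "\<phi> (?t i) = \<eta> [^] i \<otimes> \<phi> ((\<phi> ^^ i) y)"
        using sigma_mult[OF s, of "\<eta> [^] i" "(\<phi> ^^ i) y"] mu_M[OF e] ME fixes_M[OF s] sigma_pow_closed[OF s y] by auto
      moreover have "\<eta> \<otimes> (\<eta> [^] i \<otimes> x) = (\<eta> [^] i \<otimes> \<eta>) \<otimes> x" if "x \<in> carrier R" for x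
        using that ec(1) nat_pow_closed[OF ec(1), of i] by algebra
      ultimately show ?thesis
        using sigma_closed[OF s sigma_pow_closed[OF s y]] E_carrier by simp
    qed
  qed
  also have "\<dots> = (\<Oplus>i\<in>{..<b}. ?t i)"
  proof -
    obtain b' where b': "b = Suc b'" using b_pos gr0_implies_Suc by blast
    have t0: "?t b = ?t 0" using order[OF s y] e y E_carrier by simp
    have shift: "(\<Oplus>i\<in>{..<n}. ?t (Suc i)) \<oplus> ?t 0 = (\<Oplus>i\<in>{..<Suc n}. ?t i)" for n
    proof (induction n)
      case 0 show ?case using tc[of 0] by (simp add: lessThan_Suc)
    next
      case (Suc n)
      have 1: "(\<Oplus>i\<in>{..<Suc n}. ?t (Suc i)) = ?t (Suc n) \<oplus> (\<Oplus>i\<in>{..<n}. ?t (Suc i))"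
        unfolding lessThan_Suc by (rule finsum_insert) (use tc tS in auto)
      have 2: "(\<Oplus>i\<in>{..<Suc (Suc n)}. ?t i) = ?t (Suc n) \<oplus> (\<Oplus>i\<in>{..<Suc n}. ?t i)"
        unfolding lessThan_Suc[of "Suc n"] by (rule finsum_insert) (use tc tS in auto)
      have 3: "(\<Oplus>i\<in>{..<n}. ?t (Suc i)) \<in> carrier R" by (rule finsum_closed) (use tc tS in auto)
      show ?case unfolding 1 2 Suc.IH[symmetric] by (rule a_assoc[OF tc 3 tc])
    qed
    have "(\<Oplus>i\<in>{..<b}. ?t (Suc i)) = ?t b \<oplus> (\<Oplus>i\<in>{..<b'}. ?t (Suc i))"
      unfolding b' lessThan_Suc by (rule finsum_insert) (use tc tS in auto)
    also have "\<dots> = (\<Oplus>i\<in>{..<b'}. ?t (Suc i)) \<oplus> ?t 0"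
      unfolding t0 by (rule a_comm[OF tc[of 0] finsum_closed]) (use tc tS in auto)
    also have "\<dots> = (\<Oplus>i\<in>{..<b}. ?t i)" unfolding b' by (rule shift)
    finally show ?thesis .
  qed
  finally have "\<eta> \<otimes> \<phi> (w \<phi> y \<eta>) = w \<phi> y \<eta>" unfolding w_def .
  then show ?thesis unfolding eigen_def using e by blast
qed

text \<open>Because \<open>\<tau>\<close> commutes with \<open>\<phi>\<close> and fixes the roots of
  unity, each term of the resolvent inherits the eigenvalue of \<open>y\<close>. Earlier eigenvector
  properties thus survive the treatment of a further automorphism.\<close>

lemma w_eigen_other:
  assumes s: "\<phi> \<in> G" "\<tau> \<in> G" and y: "y \<in> E" and e: "\<eta> \<in> \<mu>" and "eigen \<tau> y"
  shows "eigen \<tau> (w \<phi> y \<eta>)"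
proof -
  obtain \<theta> where th: "\<theta> \<in> \<mu>" "\<theta> \<otimes> \<tau> y = y" using assms(5) unfolding eigen_def by auto
  let ?t = "\<lambda>i::nat. \<eta> [^] i \<otimes> (\<phi> ^^ i) y"
  have thM: "\<theta> \<in> M" "\<theta> \<in> E" "\<theta> \<in> carrier R" using th roots_M ME by auto
  have tE: "?t i \<in> E" for i using term_E[OF s(1) y e] .
  have comm: "\<tau> ((\<phi> ^^ i) y) = (\<phi> ^^ i) (\<tau> y)" for i
    by (induction i) (use commute[OF s(1,2), symmetric] sigma_pow_closed[OF s(1) y] in auto)
  have smul: "\<theta> \<otimes> (\<phi> ^^ i) z = (\<phi> ^^ i) (\<theta> \<otimes> z)" if "z \<in> E" for i z
    by (induction i) (use sigma_mult[OF s(1) thM(2) sigma_pow_closed[OF s(1) that]] fixes_M[OF s(1) thM(1)] in \<open>auto, metis\<close>)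
  have "\<theta> \<otimes> \<tau> (w \<phi> y \<eta>) = \<theta> \<otimes> (\<Oplus>i\<in>{..<b}. \<tau> (?t i))"
    unfolding w_def using finsum_E[of "{..<b}" ?t] tE s by simp
  also have "\<dots> = (\<Oplus>i\<in>{..<b}. \<theta> \<otimes> \<tau> (?t i))"
    by (rule finsum_rdistr) (use thM sigma_closed[OF s(2)] tE E_carrier in auto)
  also have "\<dots> = (\<Oplus>i\<in>{..<b}. ?t i)"
  proof (rule finsum_cong')
    show "\<theta> \<otimes> \<tau> (?t i) = ?t i" for i
    proof -
      have pc: "\<eta> [^] i \<in> M" "\<eta> [^] i \<in> E" "\<eta> [^] i \<in> carrier R" using mu_M[OF e] ME e by auto
      have "\<tau> (?t i) = \<eta> [^] i \<otimes> \<tau> ((\<phi> ^^ i) y)"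
        using sigma_mult[OF s(2) pc(2) sigma_pow_closed[OF s(1) y]] fixes_M[OF s(2) pc(1)] by simp
      then have "\<theta> \<otimes> \<tau> (?t i) = \<eta> [^] i \<otimes> (\<theta> \<otimes> (\<phi> ^^ i) (\<tau> y))"
        unfolding comm using thM pc sigma_pow_closed[OF s(1) sigma_closed[OF s(2) y]] E_carrier by (simp add: m_lcomm)
      then show ?thesis unfolding smul[OF sigma_closed[OF s(2) y]] th(2) .
    qed
  qed (use tE E_carrier in auto)
  finally show ?thesis unfolding eigen_def w_def using th(1) by blast
qed

text \<open>Orthogonality of characters: summation over \<open>\<eta>\<close> kills every index
  except zero, where it contributes the number \<open>b\<close> of roots. As \<open>b\<close> is
  invertible, \<open>y\<close> can be recovered from its resolvents.\<close>

lemma sum_w: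
  assumes s: "\<phi> \<in> G" and y: "y \<in> E"
  shows "(\<Oplus>\<eta>\<in>\<mu>. w \<phi> y \<eta>) = ([b] \<cdot> \<one>) \<otimes> y"
proof -
  have finmu: "finite \<mu>" using card_roots_of_unity(1)[OF b_pos] .
  have pc: "(\<phi> ^^ i) y \<in> carrier R" for i using sigma_pow_closed[OF s y] E_carrier by auto
  have "(\<Oplus>\<eta>\<in>\<mu>. w \<phi> y \<eta>) = (\<Oplus>i\<in>{..<b}. \<Oplus>\<eta>\<in>\<mu>. \<eta> [^] i \<otimes> (\<phi> ^^ i) y)"
    if "n = b" for n
    unfolding w_def
  proof -
    have "(\<Oplus>\<eta>\<in>\<mu>. \<Oplus>i\<in>{..<k}. \<eta> [^] i \<otimes> (\<phi> ^^ i) y) = (\<Oplus>i\<in>{..<k}. \<Oplus>\<eta>\<in>\<mu>. \<eta> [^] i \<otimes> (\<phi> ^^ i) y)" for k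
    proof (induction k)
      case 0 show ?case by (simp add: finsum_zero)
    next
      case (Suc k)
      have "(\<Oplus>\<eta>\<in>\<mu>. \<Oplus>i\<in>{..<Suc k}. \<eta> [^] i \<otimes> (\<phi> ^^ i) y)
         = (\<Oplus>\<eta>\<in>\<mu>. \<eta> [^] k \<otimes> (\<phi> ^^ k) y \<oplus> (\<Oplus>i\<in>{..<k}. \<eta> [^] i \<otimes> (\<phi> ^^ i) y))"
        unfolding lessThan_Suc
        by (rule finsum_cong') (use pc in \<open>auto intro!: finsum_insert finsum_closed\<close>)
      also have "\<dots> = (\<Oplus>\<eta>\<in>\<mu>. \<eta> [^] k \<otimes> (\<phi> ^^ k) y) \<oplus> (\<Oplus>\<eta>\<in>\<mu>. \<Oplus>i\<in>{..<k}. \<eta> [^] i \<otimes> (\<phi> ^^ i) y)"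
        by (rule finsum_addf) (use pc in \<open>auto intro!: finsum_closed\<close>)
      also have "\<dots> = (\<Oplus>i\<in>{..<Suc k}. \<Oplus>\<eta>\<in>\<mu>. \<eta> [^] i \<otimes> (\<phi> ^^ i) y)"
        unfolding Suc.IH lessThan_Suc
        by (rule finsum_insert[symmetric]) (use pc in \<open>auto intro!: finsum_closed\<close>)
      finally show ?case .
    qed
    then show "(\<Oplus>\<eta>\<in>\<mu>. \<Oplus>i\<in>{..<b}. \<eta> [^] i \<otimes> (\<phi> ^^ i) y) = (\<Oplus>i\<in>{..<b}. \<Oplus>\<eta>\<in>\<mu>. \<eta> [^] i \<otimes> (\<phi> ^^ i) y)" .
  qed
  then have "(\<Oplus>\<eta>\<in>\<mu>. w \<phi> y \<eta>) = (\<Oplus>i\<in>{..<b}. \<Oplus>\<eta>\<in>\<mu>. \<eta> [^] i \<otimes> (\<phi> ^^ i) y)" by blast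
  also have "\<dots> = (\<Oplus>i\<in>{..<b}. if i = 0 then ([b] \<cdot> \<one>) \<otimes> y else \<zero>)"
  proof (rule finsum_cong')
    fix i assume i: "i \<in> {..<b}"
    have "(\<Oplus>\<eta>\<in>\<mu>. \<eta> [^] i \<otimes> (\<phi> ^^ i) y) = (\<Oplus>\<eta>\<in>\<mu>. \<eta> [^] i) \<otimes> (\<phi> ^^ i) y"
      by (rule finsum_ldistr[OF finmu, symmetric]) (use pc in auto)
    also have "\<dots> = (if i = 0 then ([b] \<cdot> \<one>) \<otimes> y else \<zero>)"
    proof (cases "i = 0")
      case True
      have "(\<Oplus>\<eta>\<in>\<mu>. \<one>) = [b] \<cdot> \<one>" using add.finprod_const[of \<one> \<mu>] card_roots by (simp add: add_pow_def)
      then show ?thesis using True by simp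
    next
      case False
      then show ?thesis using finsum_roots_of_unity_pow[OF card_roots, of i] i pc by simp
    qed
    finally show "(\<Oplus>\<eta>\<in>\<mu>. \<eta> [^] i \<otimes> (\<phi> ^^ i) y) = (if i = 0 then ([b] \<cdot> \<one>) \<otimes> y else \<zero>)" .
  qed (use y E_carrier in auto)
  also have "\<dots> = ([b] \<cdot> \<one>) \<otimes> y"
  proof -
    have "(\<Oplus>i\<in>{..<b}. if (0::nat) = i then ([b] \<cdot> \<one>) \<otimes> y else \<zero>) = ([b] \<cdot> \<one>) \<otimes> y"
      using finsum_singleton[of 0 "{..<b}" "\<lambda>i::nat. ([b] \<cdot> \<one>) \<otimes> y"] b_pos y E_carrier by auto
    then show ?thesis by (simp add: eq_commute[of 0])
  qed
  finally show ?thesis .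
qed

text \<open>Simultaneous diagonalization by induction on the automorphisms: a vector that is an
  eigenvector for the remaining ones is, up to the factor \<open>b\<close>, the sum of its
  resolvents for \<open>\<phi>\<close>, and these are eigenvectors for all.\<close>

lemma eigenvectors_generate:
  assumes V: "\<zero> \<in> V" "\<And>x y. x \<in> V \<Longrightarrow> y \<in> V \<Longrightarrow> x \<oplus> y \<in> V" "\<And>m x. m \<in> M \<Longrightarrow> x \<in> V \<Longrightarrow> m \<otimes> x \<in> V"
    and eig: "\<And>x. x \<in> E \<Longrightarrow> (\<And>\<phi>. \<phi> \<in> set \<phi>s \<Longrightarrow> eigen \<phi> x) \<Longrightarrow> x \<in> V" and "set \<phi>s \<subseteq> G"
  shows "E \<subseteq> V"
  using eig assms(5)
proof (induction \<phi>s)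
  case Nil then show ?case by auto
next
  case (Cons \<phi> \<phi>s)
  show ?case
  proof (rule Cons.IH)
    fix y assume y: "y \<in> E" "\<And>\<tau>. \<tau> \<in> set \<phi>s \<Longrightarrow> eigen \<tau> y"
    have s: "\<phi> \<in> G" "set \<phi>s \<subseteq> G" using Cons.prems by auto
    have wV: "w \<phi> y \<eta> \<in> V" if "\<eta> \<in> \<mu>" for \<eta>
    proof (rule Cons.prems(1)[OF w_E[OF s(1) y(1) that]])
      fix \<tau> assume "\<tau> \<in> set (\<phi> # \<phi>s)"
      then show "eigen \<tau> (w \<phi> y \<eta>)"
        using w_eigen[OF s(1) y(1) that] w_eigen_other[OF s(1) _ y(1) that] y(2) s(2) by auto
    qed
    have finmu: "finite \<mu>" using card_roots_of_unity(1)[OF b_pos] .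
    have "finsum R (w \<phi> y) T \<in> V" if "T \<subseteq> \<mu>" for T
      using finite_subset[OF that finmu] that
    proof (induction T)
      case (insert t T)
      have "finsum R (w \<phi> y) (insert t T) = w \<phi> y t \<oplus> finsum R (w \<phi> y) T"
        by (rule finsum_insert) (use insert w_E[OF s(1) y(1)] E_carrier in auto)
      then show ?case using insert V(2) wV by auto
    qed (use V(1) in auto)
    then have "finsum R (w \<phi> y) \<mu> \<in> V" by blast
    then have "([b] \<cdot> \<one>) \<otimes> y \<in> V" using sum_w[OF s(1) y(1)] by simp
    moreover have bM: "[b] \<cdot> \<one> \<in> M - {\<zero>}"
    proof -
      have "[k] \<cdot> \<one> \<in> M" for k :: nat by (induction k) (use M_props in auto)
      then show ?thesis using b_nonzero by auto
    qed
    moreover have "inv ([b] \<cdot> \<one>) \<in> M" "inv ([b] \<cdot> \<one>) \<otimes> ([b] \<cdot> \<one>) = \<one>" using subfield_m_inv[OF M bM] by auto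
    ultimately have "inv ([b] \<cdot> \<one>) \<otimes> (([b] \<cdot> \<one>) \<otimes> y) \<in> V" using V(3) by blast
    moreover have "inv ([b] \<cdot> \<one>) \<otimes> (([b] \<cdot> \<one>) \<otimes> y) = y"
    proof -
      have c: "inv ([b] \<cdot> \<one>) \<in> carrier R" "[b] \<cdot> \<one> \<in> carrier R" "y \<in> carrier R"
        using subfield_m_inv(1)[OF M bM] M_props(1) y(1) E_carrier by auto
      show ?thesis unfolding m_assoc[OF c, symmetric] subfield_m_inv(3)[OF M bM] using c by simp
    qed
    ultimately show "y \<in> V" by simp
  qed (use Cons.prems in auto)
qed

text \<open>A common eigenvector has its b-th power in \<open>M\<close>, being fixed by
  \<open>G\<close>. A largest set of such elements whose b-th powers are inequivalent modulo b-th
  powers of \<open>M\<close> has at most \<open>B\<close> elements, and it spans: any further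
  eigenvector differs from a member by an element of \<open>M\<close>, since the roots of unity lie
  there.\<close>

theorem kummer_dimension:
  assumes B: "\<And>S. \<lbrakk>S \<subseteq> M - {\<zero>}; finite S; \<And>x y c. \<lbrakk>x \<in> S; y \<in> S; c \<in> M; x = y \<otimes> c [^] b\<rbrakk> \<Longrightarrow> x = y\<rbrakk> \<Longrightarrow> card S \<le> B"
  shows "\<exists>d\<le>B. dimension d M E"
proof -
  let ?T = "{x \<in> E - {\<zero>}. x [^] b \<in> M}"
  define P where "P S \<longleftrightarrow> finite S \<and> S \<subseteq> ?T \<and> (\<forall>x\<in>S. \<forall>y\<in>S. \<forall>c\<in>M. x [^] b = y [^] b \<otimes> c [^] b \<longrightarrow> x = y)" for S
  have bound: "card S \<le> B" if "P S" for S
  proof -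
    have inj: "inj_on (\<lambda>x. x [^] b) S"
    proof (rule inj_onI)
      fix x y assume h: "x \<in> S" "y \<in> S" "x [^] b = y [^] b"
      then have "x [^] b = y [^] b \<otimes> \<one> [^] b" using that E_carrier unfolding P_def by auto
      then show "x = y" using that h M_props(3) unfolding P_def by blast
    qed
    have "card ((\<lambda>x. x [^] b) ` S) \<le> B"
    proof (rule B)
      show "(\<lambda>x. x [^] b) ` S \<subseteq> M - {\<zero>}" using that pow_nonzero E_carrier unfolding P_def by auto
      show "finite ((\<lambda>x. x [^] b) ` S)" using that unfolding P_def by auto
      show "x = y" if h: "x \<in> (\<lambda>x. x [^] b) ` S" "y \<in> (\<lambda>x. x [^] b) ` S" "c \<in> M" "x = y \<otimes> c [^] b" for x y c
        using h \<open>P S\<close> unfolding P_def by blast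
    qed
    then show ?thesis using card_image[OF inj] by simp
  qed
  have "P {}" unfolding P_def by auto
  then obtain S where S: "P S" "\<And>S'. P S' \<Longrightarrow> card S' \<le> card S"
    using ex_has_greatest_nat[of P "{}" card "Suc B"] bound by (metis le_imp_less_Suc)
  have ST: "finite S" "S \<subseteq> ?T" using S(1) unfolding P_def by auto
  obtain us where us: "set us = S" "length us = card S" using finite_list[OF ST(1)] distinct_card
    by (metis finite_distinct_list ST(1))
  have usc: "set us \<subseteq> carrier R" using us ST E_carrier by auto
  have eqE: "E \<subseteq> Span M us"
  proof -
    obtain \<phi>s where \<phi>s: "set \<phi>s = G" using finite_list[OF fin] by blast
    show ?thesis
    proof (rule eigenvectors_generate[of _ \<phi>s])
      show "\<zero> \<in> Span M us" "\<And>x y. x \<in> Span M us \<Longrightarrow> y \<in> Span M us \<Longrightarrow> x \<oplus> y \<in> Span M us"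
        using Span_subgroup_props[OF M usc] by auto
      show "\<And>m x. m \<in> M \<Longrightarrow> x \<in> Span M us \<Longrightarrow> m \<otimes> x \<in> Span M us"
        using Span_smult_closed[OF M usc] by auto
      show "set \<phi>s \<subseteq> G" using \<phi>s by simp
      fix z assume z: "z \<in> E" "\<And>\<phi>. \<phi> \<in> set \<phi>s \<Longrightarrow> eigen \<phi> z"
      have zc: "z \<in> carrier R" using z E_carrier by auto
      have zM: "z [^] b \<in> M"
      proof (rule fixed[OF E_pow[OF z(1)]])
        fix \<phi> assume s: "\<phi> \<in> G"
        obtain \<eta> where e: "\<eta> \<in> \<mu>" "\<eta> \<otimes> \<phi> z = z" using z(2) s \<phi>s unfolding eigen_def by auto
        have "z [^] b = \<eta> [^] b \<otimes> \<phi> z [^] b"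
          using nat_pow_distrib[of \<eta> "\<phi> z" b] e sigma_closed[OF s z(1)] E_carrier by auto
        then show "\<phi> (z [^] b) = z [^] b"
          unfolding sigma_pow[OF s z(1)] using e sigma_closed[OF s z(1)] E_carrier by auto
      qed
      show "z \<in> Span M us"
      proof (cases "z = \<zero>")
        case True then show ?thesis using Span_subgroup_props(2)[OF M usc] by simp
      next
        case False
        have zT: "z \<in> ?T" using z(1) False zM by auto
        have "\<exists>x\<in>S. \<exists>c\<in>M. z [^] b = x [^] b \<otimes> c [^] b"
        proof (rule ccontr)
          assume no: "\<not> ?thesis"
          have one: "z [^] b = z [^] b \<otimes> \<one> [^] b" using zc by simp
          have "z \<notin> S" using no one M_props(3) by blast
          \<comment> \<open>The other direction of the equivalence, by inverting \<open>c\<close>;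
            \<open>P\<close> asks for inequivalence in both orders.\<close>
          have no': "x [^] b \<noteq> z [^] b \<otimes> c [^] b" if "x \<in> S" "c \<in> M" for x c
          proof
            assume eq: "x [^] b = z [^] b \<otimes> c [^] b"
            have xc: "x \<in> carrier R" "x \<noteq> \<zero>" "c \<in> carrier R" using that ST E_carrier M_props(1) by auto
            have "c \<noteq> \<zero>"
            proof
              assume "c = \<zero>"
              then have "x [^] b = \<zero>" using eq zc b_pos by (simp add: nat_pow_zero)
              then show False using pow_nonzero[OF xc(1,2)] by auto
            qed
            then have ic: "inv c \<in> M" "c \<otimes> inv c = \<one>" using subfield_m_inv[OF M, of c] that by auto
            have icc: "inv c \<in> carrier R" using ic M_props(1) by auto
            have "x [^] b \<otimes> (inv c) [^] b = z [^] b \<otimes> (c \<otimes> inv c) [^] b"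
              unfolding eq using xc zc icc by (simp add: nat_pow_distrib m_assoc)
            then have "z [^] b = x [^] b \<otimes> (inv c) [^] b" unfolding ic(2) using zc by simp
            then show False using no that ic by blast
          qed
          have "P (insert z S)" unfolding P_def using ST zT no no' S(1)[unfolded P_def] by auto
          then show False using S(2)[of "insert z S"] \<open>z \<notin> S\<close> ST(1) by auto
        qed
        then obtain x c where xc: "x \<in> S" "c \<in> M" "z [^] b = x [^] b \<otimes> c [^] b" by auto
        have cc: "x \<in> carrier R" "c \<in> carrier R" "x \<noteq> \<zero>" using xc ST E_carrier M_props(1) by auto
        have y0: "x \<otimes> c \<noteq> \<zero>"
        proof
          assume "x \<otimes> c = \<zero>"
          then have "z [^] b = \<zero> [^] b" using xc(3) nat_pow_distrib[OF cc(1,2), of b] by simp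
          then show False using pow_nonzero[OF zc False, of b] b_pos by (simp add: nat_pow_zero)
        qed
        let ?y = "x \<otimes> c"
        have yU: "?y \<in> Units R" using y0 cc field_Units by auto
        have yi: "inv ?y \<in> carrier R" "?y \<otimes> inv ?y = \<one>" using yU by auto
        \<comment> \<open>The quotient of \<open>z\<close> by x c has b-th power one, so it is a
          root of unity and belongs to \<open>M\<close>.\<close>
        have "(z \<otimes> inv ?y) [^] b = (?y \<otimes> inv ?y) [^] b"
          unfolding nat_pow_distrib[OF zc yi(1)] xc(3) using cc yi(1) nat_pow_distrib[OF cc(1,2), of b] nat_pow_distrib[of ?y "inv ?y" b] by auto
        then have "z \<otimes> inv ?y \<in> \<mu>" unfolding yi(2) using zc yi by auto
        then have m: "z \<otimes> inv ?y \<in> M" "z \<otimes> inv ?y \<in> carrier R" using roots_M by auto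
        have "(c \<otimes> (z \<otimes> inv ?y)) \<otimes> x = z \<otimes> (?y \<otimes> inv ?y)"
          using cc zc yi(1) by algebra
        then have "z = (c \<otimes> (z \<otimes> inv ?y)) \<otimes> x" unfolding yi(2) using zc by simp
        moreover have "x \<in> Span M us" using Span_base_incl[OF M usc] us xc(1) by auto
        ultimately show ?thesis using Span_smult_closed[OF M usc] M_props(6) xc(2) m(1) by metis
      qed
    qed
  qed
  have "Span M us \<subseteq> E"
  proof -
    have "subalgebra M E R"
      using E_props M ME subring.axioms(1)[OF subfieldE(1)[OF E]] unfolding subalgebra_def subalgebra_axioms_def by auto
    then show ?thesis using subalgebra_Span_incl[OF M] us ST by auto
  qed
  then have "E = Span M us" using eqE by auto
  moreover obtain d where "d \<le> length us" "dimension d M (Span M us)" using Span_dimension_le[OF M usc] by blast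
  ultimately show ?thesis using us(2) bound[OF S(1)] le_trans by metis
qed

end

section \<open>Galois groups and towers of Kummer extensions\<close>

lemma Gal_simps:
  "\<phi> \<in> carrier (Gal E k) \<longleftrightarrow> \<phi> \<in> ring_iso E E \<and> \<phi> \<in> Bij (carrier E) \<and> (\<forall>x\<in>k. \<phi> x = x)"
  "\<one>\<^bsub>Gal E k\<^esub> = (\<lambda>x\<in>carrier E. x)"
  by (auto simp: Gal_def BijGroup_def)

lemma Gal_mult:
  "\<lbrakk>\<phi> \<in> carrier (Gal E k); \<tau> \<in> carrier (Gal E k)\<rbrakk> \<Longrightarrow> \<phi> \<otimes>\<^bsub>Gal E k\<^esub> \<tau> = compose (carrier E) \<phi> \<tau>"
  by (auto simp: Gal_def BijGroup_def)

lemma Gal_hom: "\<phi> \<in> carrier (Gal E k) \<Longrightarrow> \<phi> \<in> ring_hom E E"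
  by (auto simp: Gal_simps ring_iso_def)

lemma Gal_fix: "\<phi> \<in> carrier (Gal E k) \<Longrightarrow> x \<in> k \<Longrightarrow> \<phi> x = x"
  by (auto simp: Gal_simps)

lemma GalI:
  assumes "\<phi> \<in> ring_hom E E" "bij_betw \<phi> (carrier E) (carrier E)" "\<And>x. x \<in> k \<Longrightarrow> \<phi> x = x" "k \<subseteq> carrier E"
    and "field E"
  shows "restrict \<phi> (carrier E) \<in> carrier (Gal E k)"
proof -
  interpret field E by fact
  have "restrict \<phi> (carrier E) \<in> ring_hom E E"
    using assms(1) by (auto simp: ring_hom_def)
  moreover have "bij_betw (restrict \<phi> (carrier E)) (carrier E) (carrier E)"
    using assms(2) by (simp cong: bij_betw_cong)
  ultimately show ?thesis using assms(3,4) unfolding Gal_simps ring_iso_def Bij_def by auto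
qed

lemma group_Gal:
  assumes "field E" "k \<subseteq> carrier E"
  shows "group (Gal E k)"
proof -
  interpret E: field E by fact
  interpret B: group "BijGroup (carrier E)" by (rule group_BijGroup)
  let ?H = "{\<phi> \<in> ring_iso E E \<inter> Bij (carrier E). \<forall>x\<in>k. \<phi> x = x}"
  have "subgroup ?H (BijGroup (carrier E))"
  proof (rule B.subgroupI)
    show "?H \<subseteq> carrier (BijGroup (carrier E))" by (auto simp: BijGroup_def)
    have "(\<lambda>x\<in>carrier E. x) \<in> ?H"
      using GalI[of "\<lambda>x. x" E k] assms by (auto simp: Gal_def ring_hom_def bij_betw_def)
    then show "?H \<noteq> {}" by blast
  next
    fix \<phi> assume s: "\<phi> \<in> ?H"
    then have b: "bij_betw \<phi> (carrier E) (carrier E)" "\<phi> \<in> ring_hom E E" "\<phi> \<in> Bij (carrier E)" by (auto simp: ring_iso_def)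
    have i: "inv_into (carrier E) \<phi> \<in> ring_hom E E"
    proof (rule ring_hom_memI)
      have cl: "inv_into (carrier E) \<phi> x \<in> carrier E" if "x \<in> carrier E" for x
        using that b(1) by (metis bij_betw_imp_surj_on inv_into_into)
      have si: "\<phi> (inv_into (carrier E) \<phi> x) = x" if "x \<in> carrier E" for x
        using that b(1) bij_betw_inv_into_right by metis
      have is': "inv_into (carrier E) \<phi> (\<phi> x) = x" if "x \<in> carrier E" for x
        using that b(1) bij_betw_inv_into_left by metis
      show "inv_into (carrier E) \<phi> x \<in> carrier E" if "x \<in> carrier E" for x by (rule cl[OF that])
      fix x y assume xy: "x \<in> carrier E" "y \<in> carrier E"
      show "inv_into (carrier E) \<phi> (x \<otimes>\<^bsub>E\<^esub> y) = inv_into (carrier E) \<phi> x \<otimes>\<^bsub>E\<^esub> inv_into (carrier E) \<phi> y"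
        using is'[of "inv_into (carrier E) \<phi> x \<otimes>\<^bsub>E\<^esub> inv_into (carrier E) \<phi> y"] ring_hom_mult[OF b(2) cl[OF xy(1)] cl[OF xy(2)]] si xy cl
        by simp
      show "inv_into (carrier E) \<phi> (x \<oplus>\<^bsub>E\<^esub> y) = inv_into (carrier E) \<phi> x \<oplus>\<^bsub>E\<^esub> inv_into (carrier E) \<phi> y"
        using is'[of "inv_into (carrier E) \<phi> x \<oplus>\<^bsub>E\<^esub> inv_into (carrier E) \<phi> y"] ring_hom_add[OF b(2) cl[OF xy(1)] cl[OF xy(2)]] si xy cl
        by simp
    next
      show "inv_into (carrier E) \<phi> \<one>\<^bsub>E\<^esub> = \<one>\<^bsub>E\<^esub>"
        using bij_betw_inv_into_left[OF b(1) E.one_closed] ring_hom_one[OF b(2)] by simp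
    qed
    have fx: "inv_into (carrier E) \<phi> x = x" if "x \<in> k" for x
      using bij_betw_inv_into_left[OF b(1), of x] s that assms(2) by auto
    have "restrict (inv_into (carrier E) \<phi>) (carrier E) \<in> carrier (Gal E k)"
      by (rule GalI[OF i bij_betw_inv_into[OF b(1)] fx assms(2,1)])
    then show "inv\<^bsub>BijGroup (carrier E)\<^esub> \<phi> \<in> ?H" using inv_BijGroup[OF b(3)] by (auto simp: Gal_def)
  next
    fix \<phi> \<tau> assume h: "\<phi> \<in> ?H" "\<tau> \<in> ?H"
    then have "compose (carrier E) \<phi> \<tau> \<in> Bij (carrier E)" using compose_Bij by auto
    moreover have "\<phi> \<circ> \<tau> \<in> ring_hom E E"
      using h ring_hom_trans[of \<tau> E E \<phi> E] by (auto simp: ring_iso_def)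
    then have "compose (carrier E) \<phi> \<tau> \<in> ring_hom E E" by (auto simp: ring_hom_def compose_def)
    ultimately have "compose (carrier E) \<phi> \<tau> \<in> ?H" using h assms(2) by (auto simp: ring_iso_def Bij_def compose_def)
    then show "\<phi> \<otimes>\<^bsub>BijGroup (carrier E)\<^esub> \<tau> \<in> ?H" using h by (auto simp: BijGroup_def)
  qed
  then show ?thesis unfolding Gal_def by (rule subgroup.subgroup_is_group) (rule B.is_group)
qed

text \<open>Translates exponents of the Galois group into iterates of maps, the form in which the
  exponent condition can be moved between fields.\<close>

lemma Gal_pow_apply:
  assumes "field E" "k \<subseteq> carrier E" "\<phi> \<in> carrier (Gal E k)" "x \<in> carrier E"
  shows "(\<phi> [^]\<^bsub>Gal E k\<^esub> (n::nat)) x = (\<phi> ^^ n) x"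
proof -
  interpret group "Gal E k" by (rule group_Gal[OF assms(1,2)])
  show ?thesis using assms(4)
  proof (induction n arbitrary: x)
    case 0 then show ?case by (simp add: Gal_simps)
  next
    case (Suc n)
    have c: "\<phi> x \<in> carrier E" using ring_hom_closed[OF Gal_hom[OF assms(3)] Suc.prems] .
    have "(\<phi> [^]\<^bsub>Gal E k\<^esub> Suc n) x = (\<phi> [^]\<^bsub>Gal E k\<^esub> n) (\<phi> x)"
      using Gal_mult[OF nat_pow_closed[OF assms(3)] assms(3), of n] Suc.prems by (simp add: compose_def)
    then show ?case using Suc.IH[OF c] by (simp add: funpow_swap1)
  qed
qed

section \<open>Fixed fields, abelian chains and the tower they cut out\<close>

definition fixed_field :: "('a, 'm) ring_scheme \<Rightarrow> ('a \<Rightarrow> 'a) set \<Rightarrow> 'a set" where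
  "fixed_field E S = {x \<in> carrier E. \<forall>\<phi>\<in>S. \<phi> x = x}"

lemma fixed_fieldD:
  "x \<in> fixed_field E S \<Longrightarrow> x \<in> carrier E" "x \<in> fixed_field E S \<Longrightarrow> \<phi> \<in> S \<Longrightarrow> \<phi> x = x"
  unfolding fixed_field_def by blast+

lemma fixed_fieldI:
  "x \<in> carrier E \<Longrightarrow> (\<And>\<phi>. \<phi> \<in> S \<Longrightarrow> \<phi> x = x) \<Longrightarrow> x \<in> fixed_field E S"
  unfolding fixed_field_def by blast

lemma ring_hom_carrier_restrict:
  assumes "h \<in> ring_hom R S" "E \<subseteq> carrier R" "h ` E \<subseteq> F"
  shows "h \<in> ring_hom (R\<lparr>carrier := E\<rparr>) (S\<lparr>carrier := F\<rparr>)"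
proof (rule ring_hom_memI)
  show "h x \<in> carrier (S\<lparr>carrier := F\<rparr>)" if "x \<in> carrier (R\<lparr>carrier := E\<rparr>)" for x using that assms(3) by auto
next
  fix x y assume "x \<in> carrier (R\<lparr>carrier := E\<rparr>)" "y \<in> carrier (R\<lparr>carrier := E\<rparr>)"
  then have xy: "x \<in> carrier R" "y \<in> carrier R" using assms(2) by auto
  show "h (x \<otimes>\<^bsub>R\<lparr>carrier := E\<rparr>\<^esub> y) = h x \<otimes>\<^bsub>S\<lparr>carrier := F\<rparr>\<^esub> h y" using ring_hom_mult[OF assms(1) xy] by simp
  show "h (x \<oplus>\<^bsub>R\<lparr>carrier := E\<rparr>\<^esub> y) = h x \<oplus>\<^bsub>S\<lparr>carrier := F\<rparr>\<^esub> h y" using ring_hom_add[OF assms(1) xy] by simp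
next
  show "h \<one>\<^bsub>R\<lparr>carrier := E\<rparr>\<^esub> = \<one>\<^bsub>S\<lparr>carrier := F\<rparr>\<^esub>" using ring_hom_one[OF assms(1)] by simp
qed

lemma fixed_field_subfield:
  assumes "field E" and S: "\<And>\<phi>. \<phi> \<in> S \<Longrightarrow> \<phi> \<in> ring_hom E E"
  shows "subfield (fixed_field E S) E"
proof -
  interpret field E by fact
  have h: "ring_hom_cring E E \<phi>" if "\<phi> \<in> S" for \<phi> by (rule ring_hom_cringI[OF is_cring is_cring S[OF that]])
  show ?thesis
  proof (rule subfieldI'[OF subringI])
    show "fixed_field E S \<subseteq> carrier E" by (auto simp: fixed_field_def)
    show "\<one>\<^bsub>E\<^esub> \<in> fixed_field E S" using ring_hom_one S by (auto simp: fixed_field_def)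
    show "\<ominus>\<^bsub>E\<^esub> x \<in> fixed_field E S" if "x \<in> fixed_field E S" for x
    proof -
      have "\<phi> (\<ominus>\<^bsub>E\<^esub> x) = \<ominus>\<^bsub>E\<^esub> x" if "\<phi> \<in> S" for \<phi>
      proof -
        have "\<phi> x = x" "x \<in> carrier E" using \<open>x \<in> fixed_field E S\<close> that unfolding fixed_field_def by blast+
        then show ?thesis using ring_hom_cring.hom_a_inv[OF h[OF that], of x] by simp
      qed
      then show ?thesis using that by (simp add: fixed_field_def)
    qed
    show "x \<otimes>\<^bsub>E\<^esub> y \<in> fixed_field E S" "x \<oplus>\<^bsub>E\<^esub> y \<in> fixed_field E S" if "x \<in> fixed_field E S" "y \<in> fixed_field E S" for x y
    proof -
      have c: "x \<in> carrier E" "y \<in> carrier E" using fixed_fieldD(1)[OF that(1)] fixed_fieldD(1)[OF that(2)] .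
      show "x \<otimes>\<^bsub>E\<^esub> y \<in> fixed_field E S"
        by (rule fixed_fieldI) (use c in simp, metis ring_hom_mult[OF S c] fixed_fieldD(2)[OF that(1)] fixed_fieldD(2)[OF that(2)])
      show "x \<oplus>\<^bsub>E\<^esub> y \<in> fixed_field E S"
        by (rule fixed_fieldI) (use c in simp, metis ring_hom_add[OF S c] fixed_fieldD(2)[OF that(1)] fixed_fieldD(2)[OF that(2)])
    qed
    fix x assume x: "x \<in> fixed_field E S - {\<zero>\<^bsub>E\<^esub>}"
    then have u: "x \<in> Units E" "x \<in> carrier E" using field_Units by (auto simp: fixed_field_def)
    have "\<phi> (inv\<^bsub>E\<^esub> x) = inv\<^bsub>E\<^esub> x" if p: "\<phi> \<in> S" for \<phi>
    proof -
      have "x \<otimes>\<^bsub>E\<^esub> \<phi> (inv\<^bsub>E\<^esub> x) = \<phi> (x \<otimes>\<^bsub>E\<^esub> inv\<^bsub>E\<^esub> x)"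
        using ring_hom_mult[OF S[OF p], of x "inv\<^bsub>E\<^esub> x"] u x p by (auto simp: fixed_field_def)
      also have "\<dots> = \<one>\<^bsub>E\<^esub>" using u ring_hom_one[OF S[OF p]] by simp
      finally show ?thesis
        using comm_inv_char[of x "\<phi> (inv\<^bsub>E\<^esub> x)"] u ring_hom_closed[OF S[OF p], of "inv\<^bsub>E\<^esub> x"] by auto
    qed
    then show "inv\<^bsub>E\<^esub> x \<in> fixed_field E S" using u by (auto simp: fixed_field_def)
  qed
qed

lemma degree_factor_pos: "0 < b \<Longrightarrow> 0 < degree_factor b i"
  by (cases i) auto

text \<open>The elementwise content of an abelian series.\<close>

definition abelian_chain :: "('a, 'm) monoid_scheme \<Rightarrow> nat \<Rightarrow> (nat \<Rightarrow> 'a set) \<Rightarrow> bool" where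
  "abelian_chain G n H \<longleftrightarrow> H 0 = {\<one>\<^bsub>G\<^esub>} \<and> H n = carrier G \<and>
     (\<forall>i<n. subgroup (H (Suc i)) G \<and> H i \<subseteq> H (Suc i) \<and>
        (\<forall>x\<in>H (Suc i). \<forall>c\<in>H i. \<exists>c'\<in>H i. c \<otimes>\<^bsub>G\<^esub> x = x \<otimes>\<^bsub>G\<^esub> c') \<and>
        (\<forall>x\<in>H (Suc i). \<forall>y\<in>H (Suc i). \<exists>c\<in>H i. x \<otimes>\<^bsub>G\<^esub> y = c \<otimes>\<^bsub>G\<^esub> (y \<otimes>\<^bsub>G\<^esub> x)))"

lemma abelian_chain_of_series:
  assumes "group G" "abelian_series G n H"
  shows "abelian_chain G n H"
  unfolding abelian_chain_def
proof (intro conjI allI impI)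
  interpret G: group G by fact
  show "H 0 = {\<one>\<^bsub>G\<^esub>}" "H n = carrier G" using assms(2) unfolding abelian_series_def by auto
  fix i assume "i < n"
  then have ser: "subgroup (H (Suc i)) G" "H i \<lhd> G\<lparr>carrier := H (Suc i)\<rparr>" "comm_group (G\<lparr>carrier := H (Suc i)\<rparr> Mod H i)"
    using assms(2) unfolding abelian_series_def by auto
  interpret N: normal "H i" "G\<lparr>carrier := H (Suc i)\<rparr>" by fact
  interpret Q: comm_group "G\<lparr>carrier := H (Suc i)\<rparr> Mod H i" by fact
  show "subgroup (H (Suc i)) G" by fact
  show "H i \<subseteq> H (Suc i)" using N.subset by simp
  show "\<forall>x\<in>H (Suc i). \<forall>c\<in>H i. \<exists>c'\<in>H i. c \<otimes>\<^bsub>G\<^esub> x = x \<otimes>\<^bsub>G\<^esub> c'"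
  proof (intro ballI)
    fix x c assume "x \<in> H (Suc i)" "c \<in> H i"
    then have "c \<otimes>\<^bsub>G\<^esub> x \<in> H i #>\<^bsub>G\<lparr>carrier := H (Suc i)\<rparr>\<^esub> x" by (auto simp: r_coset_def)
    also have "\<dots> = x <#\<^bsub>G\<lparr>carrier := H (Suc i)\<rparr>\<^esub> H i" using N.coset_eq \<open>x \<in> H (Suc i)\<close> by simp
    finally show "\<exists>c'\<in>H i. c \<otimes>\<^bsub>G\<^esub> x = x \<otimes>\<^bsub>G\<^esub> c'" by (auto simp: l_coset_def)
  qed
  show "\<forall>x\<in>H (Suc i). \<forall>y\<in>H (Suc i). \<exists>c\<in>H i. x \<otimes>\<^bsub>G\<^esub> y = c \<otimes>\<^bsub>G\<^esub> (y \<otimes>\<^bsub>G\<^esub> x)"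
  proof (intro ballI)
    fix x y assume h: "x \<in> H (Suc i)" "y \<in> H (Suc i)"
    let ?C = "\<lambda>z. H i #>\<^bsub>G\<lparr>carrier := H (Suc i)\<rparr>\<^esub> z"
    have mem: "?C z \<in> carrier (G\<lparr>carrier := H (Suc i)\<rparr> Mod H i)" if "z \<in> H (Suc i)" for z
      using that by (auto simp: FactGroup_def RCOSETS_def)
    have mult: "?C z \<otimes>\<^bsub>G\<lparr>carrier := H (Suc i)\<rparr> Mod H i\<^esub> ?C z' = ?C (z \<otimes>\<^bsub>G\<^esub> z')" if "z \<in> H (Suc i)" "z' \<in> H (Suc i)" for z z'
      using N.rcos_sum[of z z'] that by (simp add: FactGroup_def)
    have "?C (x \<otimes>\<^bsub>G\<^esub> y) = ?C (y \<otimes>\<^bsub>G\<^esub> x)"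
      using Q.m_comm[OF mem[OF h(1)] mem[OF h(2)]] mult h by simp
    moreover have "x \<otimes>\<^bsub>G\<^esub> y \<in> ?C (x \<otimes>\<^bsub>G\<^esub> y)"
      using N.rcos_self[of "x \<otimes>\<^bsub>G\<^esub> y"] h subgroup.m_closed[OF ser(1)] N.subgroup_axioms by auto
    ultimately show "\<exists>c\<in>H i. x \<otimes>\<^bsub>G\<^esub> y = c \<otimes>\<^bsub>G\<^esub> (y \<otimes>\<^bsub>G\<^esub> x)" by (auto simp: r_coset_def)
  qed
qed

text \<open>The fixed fields of the chain climb from \<open>k\<close> at index \<open>n\<close> to
  \<open>R\<close> at index zero. Commutators of \<open>H (Suc i)\<close> lie in \<open>H i\<close>
  and so act trivially on its fixed field, which makes each step a Kummer extension. Its degree is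
  bounded by the power classes of the field below, whose own degree is bounded by induction.\<close>

lemma (in padic_base) kummer_tower:
  fixes n b :: nat and H
  assumes k: "subfield k R" and dk: "dimension d k0 k" "d \<le> b ^ 3" and k0k: "k0 \<subseteq> k"
    and b: "0 < b" and mu: "card {x \<in> carrier R. x [^] b = \<one>} = b" "{x \<in> carrier R. x [^] b = \<one>} \<subseteq> k"
    and fin: "finite (carrier (Gal R k))" and fxd: "fixed_field R (carrier (Gal R k)) = k"
    and exponent: "\<And>\<phi> x. \<phi> \<in> carrier (Gal R k) \<Longrightarrow> x \<in> carrier R \<Longrightarrow> (\<phi> ^^ b) x = x"
    and series: "abelian_chain (Gal R k) n H"
  shows "\<exists>e\<le>(\<Prod>i=0..n. degree_factor b i). dimension e k0 (carrier R)"
proof -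
  have kc: "k \<subseteq> carrier R" by (rule subfieldE(3)[OF k])
  interpret G: group "Gal R k" by (rule group_Gal[OF field_axioms kc])
  let ?G = "Gal R k"
  let ?F = "\<lambda>i. fixed_field R (H i)"
  have ser: "H 0 = {\<one>\<^bsub>?G\<^esub>}" "H n = carrier ?G"
    "\<And>i. i < n \<Longrightarrow> subgroup (H (Suc i)) ?G \<and> H i \<subseteq> H (Suc i)"
    "\<And>i x c. \<lbrakk>i < n; x \<in> H (Suc i); c \<in> H i\<rbrakk> \<Longrightarrow> \<exists>c'\<in>H i. c \<otimes>\<^bsub>?G\<^esub> x = x \<otimes>\<^bsub>?G\<^esub> c'"
    "\<And>i x y. \<lbrakk>i < n; x \<in> H (Suc i); y \<in> H (Suc i)\<rbrakk> \<Longrightarrow> \<exists>c\<in>H i. x \<otimes>\<^bsub>?G\<^esub> y = c \<otimes>\<^bsub>?G\<^esub> (y \<otimes>\<^bsub>?G\<^esub> x)"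
    using series unfolding abelian_chain_def by blast+
  have sg: "subgroup (H i) ?G" if "i \<le> n" for i
  proof (cases i)
    case 0 then show ?thesis using ser(1) G.triv_subgroup by simp
  next
    case (Suc j) then show ?thesis using ser(3)[of j] that by simp
  qed
  have HG: "\<phi> \<in> carrier ?G" if "i \<le> n" "\<phi> \<in> H i" for i \<phi> using subgroup.mem_carrier[OF sg[OF that(1)] that(2)] .
  have sf: "subfield (?F i) R" if "i \<le> n" for i
    by (rule fixed_field_subfield[OF field_axioms]) (use HG[OF that] Gal_hom in auto)
  have Fc: "?F i \<subseteq> carrier R" for i by (auto simp: fixed_field_def)
  have kF: "k \<subseteq> ?F i" if "i \<le> n" for i using Gal_fix[OF HG[OF that]] kc by (auto simp: fixed_field_def)
  \<comment> \<open>The index \<open>n - j\<close> reverses the chain: larger groups have smaller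
    fixed fields, and degrees are estimated from the bottom upwards.\<close>
  have "\<exists>e\<le>(\<Prod>i=0..j. degree_factor b i). dimension e k0 (?F (n - j))" if "j \<le> n" for j
    using that
  proof (induction j)
    case 0
    have "?F n = k" using fxd ser(2) by simp
    then show ?case using dk by auto
  next
    case (Suc j)
    then obtain e where e: "e \<le> (\<Prod>i=0..j. degree_factor b i)" "dimension e k0 (?F (n - j))" by auto
    define i where "i = n - Suc j"
    have i: "i < n" "n - j = Suc i" "n - Suc j = i" using Suc.prems unfolding i_def by auto
    have le: "i \<le> n" "Suc i \<le> n" using i by auto
    have sub: "H i \<subseteq> H (Suc i)" using ser(3)[OF i(1)] by simp
    have apply_mult: "(\<phi> \<otimes>\<^bsub>?G\<^esub> \<tau>) x = \<phi> (\<tau> x)" if "\<phi> \<in> H (Suc i)" "\<tau> \<in> H (Suc i)" "x \<in> carrier R" for \<phi> \<tau> x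
      using Gal_mult[OF HG[OF le(2) that(1)] HG[OF le(2) that(2)]] that(3) by (simp add: compose_def)
    \<comment> \<open>Normality of \<open>H i\<close> in \<open>H (Suc i)\<close>: moving
      \<open>\<tau>\<close> past \<open>\<phi>\<close> yields another element of \<open>H i\<close>,
      which fixes \<open>x\<close>.\<close>
    have closed: "\<phi> x \<in> ?F i" if h: "\<phi> \<in> H (Suc i)" "x \<in> ?F i" for \<phi> x
    proof -
      have xc: "x \<in> carrier R" using h Fc by auto
      have "\<tau> (\<phi> x) = \<phi> x" if t: "\<tau> \<in> H i" for \<tau>
      proof -
        obtain \<tau>' where t': "\<tau>' \<in> H i" "\<tau> \<otimes>\<^bsub>?G\<^esub> \<phi> = \<phi> \<otimes>\<^bsub>?G\<^esub> \<tau>'" using ser(4)[OF i(1) h(1) t] by blast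
        have "\<tau> (\<phi> x) = (\<tau> \<otimes>\<^bsub>?G\<^esub> \<phi>) x" by (rule apply_mult[symmetric]) (use t h(1) sub xc in auto)
        also have "\<dots> = \<phi> (\<tau>' x)" unfolding t'(2) by (rule apply_mult) (use t' h(1) sub xc in auto)
        finally have "\<tau> (\<phi> x) = \<phi> (\<tau>' x)" .
        moreover have "\<tau>' x = x" using h(2) t'(1) unfolding fixed_field_def by blast
        ultimately show ?thesis by simp
      qed
      moreover have "\<phi> x \<in> carrier R" using ring_hom_closed[OF Gal_hom[OF HG[OF le(2) h(1)]] xc] .
      ultimately show ?thesis by (simp add: fixed_field_def)
    qed
    interpret Km: kummer R "?F i" "?F (Suc i)" "H (Suc i)" b
    proof (intro kummer.intro kummer_axioms.intro)
      show "field R" by (rule field_axioms)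
      show "subfield (?F i) R" "subfield (?F (Suc i)) R" using sf le by auto
      show "?F (Suc i) \<subseteq> ?F i" using sub by (auto simp: fixed_field_def)
      show "finite (H (Suc i))" using fin subgroup.subset[OF sg[OF le(2)]] finite_subset by blast
      show "\<phi> \<in> ring_hom (R\<lparr>carrier := ?F i\<rparr>) (R\<lparr>carrier := ?F i\<rparr>)" if "\<phi> \<in> H (Suc i)" for \<phi>
        by (rule ring_hom_carrier_restrict[OF Gal_hom[OF HG[OF le(2) that]] Fc]) (use closed[OF that] in blast)
      \<comment> \<open>The two orders differ by an element \<open>\<rho>\<close> of
        \<open>H i\<close>, which fixes \<open>\<tau> (\<phi> x)\<close> because that lies in the
        same fixed field again.\<close>
      show "\<phi> (\<tau> x) = \<tau> (\<phi> x)" if h: "\<phi> \<in> H (Suc i)" "\<tau> \<in> H (Suc i)" "x \<in> ?F i" for \<phi> \<tau> x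
      proof -
        obtain \<rho> where r: "\<rho> \<in> H i" "\<phi> \<otimes>\<^bsub>?G\<^esub> \<tau> = \<rho> \<otimes>\<^bsub>?G\<^esub> (\<tau> \<otimes>\<^bsub>?G\<^esub> \<phi>)" using ser(5)[OF i(1) h(1,2)] by blast
        have xc: "x \<in> carrier R" using h Fc by auto
        have "\<tau> \<otimes>\<^bsub>?G\<^esub> \<phi> \<in> H (Suc i)" using h subgroup.m_closed[OF sg[OF le(2)]] by auto
        then have "(\<phi> \<otimes>\<^bsub>?G\<^esub> \<tau>) x = \<rho> ((\<tau> \<otimes>\<^bsub>?G\<^esub> \<phi>) x)"
          unfolding r(2) by (intro apply_mult) (use r sub xc in auto)
        then have "\<phi> (\<tau> x) = \<rho> (\<tau> (\<phi> x))"
          unfolding apply_mult[OF h(1,2) xc] apply_mult[OF h(2,1) xc] .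
        also have "\<dots> = \<tau> (\<phi> x)" using closed[OF h(2) closed[OF h(1,3)]] r(1) unfolding fixed_field_def by blast
        finally show ?thesis .
      qed
      show "(\<phi> ^^ b) x = x" if "\<phi> \<in> H (Suc i)" "x \<in> ?F i" for \<phi> x
        using exponent[OF HG[OF le(2) that(1)]] that(2) Fc by auto
      show "x \<in> ?F (Suc i)" if "x \<in> ?F i" "\<And>\<phi>. \<phi> \<in> H (Suc i) \<Longrightarrow> \<phi> x = x" for x
        using that by (auto simp: fixed_field_def)
      show "\<phi> x = x" if "\<phi> \<in> H (Suc i)" "x \<in> ?F (Suc i)" for \<phi> x
        using that by (auto simp: fixed_field_def)
      show "0 < b" by fact
      show "[b] \<cdot> \<one> \<noteq> \<zero>" by (rule char_zero[OF b])
      show "card {x \<in> carrier R. x [^] b = \<one>} = b" by fact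
      show "{x \<in> carrier R. x [^] b = \<one>} \<subseteq> ?F (Suc i)" using mu(2) kF[OF le(2)] by auto
    qed
    have eF: "dimension e k0 (?F (Suc i))" using e(2) i(2) by simp
    have "\<exists>m\<le>b ^ (e + 2). dimension m (?F (Suc i)) (?F i)"
      by (rule Km.kummer_dimension, rule card_power_classes_subfield[OF sf[OF le(2)] eF b])
    then obtain m where m: "m \<le> b ^ (e + 2)" "dimension m (?F (Suc i)) (?F i)" by blast
    have dim: "dimension (e * m) k0 (?F i)" by (rule telescopic_base[OF k0 sf[OF le(2)] eF m(2)])
    let ?P = "\<Prod>i=0..j. degree_factor b i"
    \<comment> \<open>The new factor b^(?P + 2) is \<open>degree_factor b (Suc j)\<close>; replacing
      \<open>e\<close> by its bound \<open>?P\<close> in the exponent produces the recursion of the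
      constants.\<close>
    have "e * m \<le> ?P * b ^ (?P + 2)"
    proof (rule mult_le_mono[OF e(1)])
      have "m \<le> b ^ (e + 2)" by fact
      also have "\<dots> \<le> b ^ (?P + 2)" using e(1) b by (intro power_increasing) auto
      finally show "m \<le> b ^ (?P + 2)" .
    qed
    also have "\<dots> = (\<Prod>i=0..Suc j. degree_factor b i)" by simp
    finally show ?case using dim i(3) by auto
  qed
  from this[of n] obtain e where "e \<le> (\<Prod>i=0..n. degree_factor b i)" "dimension e k0 (?F 0)" by auto
  moreover have "?F 0 = carrier R" by (auto simp: fixed_field_def ser(1) Gal_simps)
  ultimately show ?thesis by auto
qed

section \<open>Extension of homomorphisms\<close>

text \<open>A homomorphism from a subfield of \<open>R\<close> to \<open>S\<close>, encoded by its
  graph, so that extension of homomorphisms is inclusion of sets and Zorn's lemma applies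
  directly.\<close>

definition hom_graph :: "('a, 'm) ring_scheme \<Rightarrow> ('b, 'n) ring_scheme \<Rightarrow> ('a \<times> 'b) set \<Rightarrow> bool" where
  "hom_graph R S G \<longleftrightarrow> subfield (Domain G) R \<and> Range G \<subseteq> carrier S \<and> single_valued G \<and>
     (\<one>\<^bsub>R\<^esub>, \<one>\<^bsub>S\<^esub>) \<in> G \<and>
     (\<forall>x y x' y'. (x, y) \<in> G \<longrightarrow> (x', y') \<in> G \<longrightarrow>
        (x \<oplus>\<^bsub>R\<^esub> x', y \<oplus>\<^bsub>S\<^esub> y') \<in> G \<and> (x \<otimes>\<^bsub>R\<^esub> x', y \<otimes>\<^bsub>S\<^esub> y') \<in> G)"

lemma hom_graph_of_hom:
  assumes "subfield E R" "h \<in> ring_hom (R\<lparr>carrier := E\<rparr>) S"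
  shows "hom_graph R S ((\<lambda>x. (x, h x)) ` E)"
proof -
  have D: "Domain ((\<lambda>x. (x, h x)) ` E) = E" by auto
  note s = subringE[OF subfieldE(1)[OF assms(1)]]
  show ?thesis unfolding hom_graph_def D
    using assms s ring_hom_closed[OF assms(2)] ring_hom_mult[OF assms(2)] ring_hom_add[OF assms(2)] ring_hom_one[OF assms(2)]
    by (auto simp: single_valued_def)
qed

lemma hom_of_hom_graph:
  assumes "hom_graph R S G"
  obtains h where "h \<in> ring_hom (R\<lparr>carrier := Domain G\<rparr>) S" "G = (\<lambda>x. (x, h x)) ` Domain G"
proof
  define h where "h x = (SOME y. (x, y) \<in> G)" for x
  have sv: "single_valued G" and cl: "\<And>x y x' y'. (x, y) \<in> G \<Longrightarrow> (x', y') \<in> G \<Longrightarrow>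
        (x \<oplus>\<^bsub>R\<^esub> x', y \<oplus>\<^bsub>S\<^esub> y') \<in> G \<and> (x \<otimes>\<^bsub>R\<^esub> x', y \<otimes>\<^bsub>S\<^esub> y') \<in> G"
    and one: "(\<one>\<^bsub>R\<^esub>, \<one>\<^bsub>S\<^esub>) \<in> G" and ran: "Range G \<subseteq> carrier S"
    using assms unfolding hom_graph_def by blast+
  have hG: "(x, h x) \<in> G" if "x \<in> Domain G" for x
    using that unfolding h_def by (metis DomainE someI)
  have eq: "y = h x" if "(x, y) \<in> G" for x y
    using hG[of x] that sv unfolding single_valued_def by blast
  show "G = (\<lambda>x. (x, h x)) ` Domain G"
    using hG eq by auto
  show "h \<in> ring_hom (R\<lparr>carrier := Domain G\<rparr>) S"
  proof (rule ring_hom_memI)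
    show "h x \<in> carrier S" if "x \<in> carrier (R\<lparr>carrier := Domain G\<rparr>)" for x
      using hG[of x] that ran by auto
    show "h \<one>\<^bsub>R\<lparr>carrier := Domain G\<rparr>\<^esub> = \<one>\<^bsub>S\<^esub>" using eq[OF one] by simp
    fix x y assume xy: "x \<in> carrier (R\<lparr>carrier := Domain G\<rparr>)" "y \<in> carrier (R\<lparr>carrier := Domain G\<rparr>)"
    then have "(x, h x) \<in> G" "(y, h y) \<in> G" using hG by auto
    then have "(x \<oplus>\<^bsub>R\<^esub> y, h x \<oplus>\<^bsub>S\<^esub> h y) \<in> G" "(x \<otimes>\<^bsub>R\<^esub> y, h x \<otimes>\<^bsub>S\<^esub> h y) \<in> G" using cl by blast+
    then show "h (x \<otimes>\<^bsub>R\<lparr>carrier := Domain G\<rparr>\<^esub> y) = h x \<otimes>\<^bsub>S\<^esub> h y"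
       "h (x \<oplus>\<^bsub>R\<lparr>carrier := Domain G\<rparr>\<^esub> y) = h x \<oplus>\<^bsub>S\<^esub> h y" using eq by simp_all
  qed
qed

lemma hom_graph_Union:
  assumes "C \<noteq> {}" and C: "\<And>G. G \<in> C \<Longrightarrow> hom_graph R S G" and chain: "\<And>G G'. G \<in> C \<Longrightarrow> G' \<in> C \<Longrightarrow> G \<subseteq> G' \<or> G' \<subseteq> G"
    and R: "field R"
  shows "hom_graph R S (\<Union>C)"
proof -
  interpret field R by fact
  have two: "\<exists>G\<in>C. a \<in> G \<and> b \<in> G" if "a \<in> \<Union>C" "b \<in> \<Union>C" for a b
    using that chain by blast
  have cl: "(x \<oplus>\<^bsub>R\<^esub> x', y \<oplus>\<^bsub>S\<^esub> y') \<in> \<Union>C \<and> (x \<otimes>\<^bsub>R\<^esub> x', y \<otimes>\<^bsub>S\<^esub> y') \<in> \<Union>C" if xy: "(x, y) \<in> \<Union>C" "(x', y') \<in> \<Union>C" for x y x' y'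
  proof -
    obtain G where "G \<in> C" "(x, y) \<in> G" "(x', y') \<in> G" using two[OF xy] by blast
    then show ?thesis using C[of G] unfolding hom_graph_def by blast
  qed
  have sv: "single_valued (\<Union>C)"
  proof (rule single_valuedI)
    fix x y z assume xy: "(x, y) \<in> \<Union>C" "(x, z) \<in> \<Union>C"
    obtain G where "G \<in> C" "(x, y) \<in> G" "(x, z) \<in> G" using two[OF xy] by blast
    then show "y = z" using C[of G] unfolding hom_graph_def single_valued_def by blast
  qed
  have sf: "subfield (Domain G) R" if "G \<in> C" for G using C[OF that] unfolding hom_graph_def by blast
  have "subfield (Domain (\<Union>C)) R"
  proof (rule subfieldI'[OF subringI])
    show "Domain (\<Union>C) \<subseteq> carrier R" using subfieldE(3)[OF sf] by blast
    show "\<one>\<^bsub>R\<^esub> \<in> Domain (\<Union>C)" using C assms(1) unfolding hom_graph_def by blast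
    show "\<ominus>\<^bsub>R\<^esub> x \<in> Domain (\<Union>C)" if "x \<in> Domain (\<Union>C)" for x
      using that subringE(5)[OF subfieldE(1)[OF sf]] by blast
    show "inv\<^bsub>R\<^esub> x \<in> Domain (\<Union>C)" if "x \<in> Domain (\<Union>C) - {\<zero>\<^bsub>R\<^esub>}" for x
      using that subfield_m_inv(1)[OF sf] by blast
    show "x \<otimes>\<^bsub>R\<^esub> y \<in> Domain (\<Union>C)" "x \<oplus>\<^bsub>R\<^esub> y \<in> Domain (\<Union>C)" if "x \<in> Domain (\<Union>C)" "y \<in> Domain (\<Union>C)" for x y
      using that cl by blast+
  qed
  moreover have "Range (\<Union>C) \<subseteq> carrier S" "(\<one>\<^bsub>R\<^esub>, \<one>\<^bsub>S\<^esub>) \<in> \<Union>C"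
    using C assms(1) unfolding hom_graph_def by blast+
  ultimately show ?thesis unfolding hom_graph_def using sv cl by blast
qed

text \<open>A homomorphism from a field has trivial kernel, so the leading coefficient stays nonzero
  and the mapped list is again a normalized polynomial.\<close>

lemma hom_map_poly:
  fixes R (structure) and S
  assumes R: "field R" and S: "field S" and E: "subfield E R" and h: "h \<in> ring_hom (R\<lparr>carrier := E\<rparr>) S"
    and p: "p \<in> carrier (E[X])"
  shows "map h p \<in> carrier (poly_ring S)" "h x = \<zero>\<^bsub>S\<^esub> \<Longrightarrow> x \<in> E \<Longrightarrow> x = \<zero>"
proof -
  interpret R: field R by fact
  interpret S: field S by fact
  interpret E: field "R\<lparr>carrier := E\<rparr>" by (rule R.subfield_iff(2)[OF E])
  interpret H: ring_hom_cring "R\<lparr>carrier := E\<rparr>" S h by (rule ring_hom_cringI[OF E.is_cring S.is_cring h])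
  show z: "x = \<zero>" if hx: "h x = \<zero>\<^bsub>S\<^esub>" "x \<in> E" for x
  proof (rule ccontr)
    assume "x \<noteq> \<zero>"
    then have i: "inv x \<in> E" "x \<otimes> inv x = \<one>" using R.subfield_m_inv[OF E, of x] hx by auto
    have "h (x \<otimes> inv x) = h x \<otimes>\<^bsub>S\<^esub> h (inv x)" using ring_hom_mult[OF h, of x "inv x"] hx i by simp
    then have "\<one>\<^bsub>S\<^esub> = \<zero>\<^bsub>S\<^esub> \<otimes>\<^bsub>S\<^esub> h (inv x)" unfolding i hx using ring_hom_one[OF h] by simp
    then show False using ring_hom_closed[OF h, of "inv x"] i by simp
  qed
  show "map h p \<in> carrier (poly_ring S)"
  proof (cases p)
    case Nil then show ?thesis by (simp add: univ_poly_carrier[symmetric] polynomial_def)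
  next
    case (Cons a q)
    have "set p \<subseteq> E" "a \<noteq> \<zero>" using p Cons unfolding univ_poly_carrier[symmetric] polynomial_def by auto
    then show ?thesis
      using Cons z[of a] ring_hom_closed[OF h] unfolding univ_poly_carrier[symmetric] polynomial_def by auto
  qed
qed

text \<open>Polynomial operations normalize their results while \<open>map h\<close> acts entrywise.
  The two are reconciled because evaluation ignores leading zeros and an injective \<open>h\<close>
  creates none.\<close>

lemma hom_eval_add_mult:
  fixes R (structure) and S
  assumes R: "field R" and S: "field S" and E: "subfield E R" and h: "h \<in> ring_hom (R\<lparr>carrier := E\<rparr>) S"
    and p: "p \<in> carrier (E[X])" "q \<in> carrier (E[X])" and y: "y \<in> carrier S"
  shows "ring.eval S (map h (p \<oplus>\<^bsub>E[X]\<^esub> q)) y = ring.eval S (map h p) y \<oplus>\<^bsub>S\<^esub> ring.eval S (map h q) y"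
    and "ring.eval S (map h (p \<otimes>\<^bsub>E[X]\<^esub> q)) y = ring.eval S (map h p) y \<otimes>\<^bsub>S\<^esub> ring.eval S (map h q) y"
    and "map h (p \<otimes>\<^bsub>E[X]\<^esub> q) = map h p \<otimes>\<^bsub>poly_ring S\<^esub> map h q"
proof -
  interpret R: field R by fact
  interpret S: field S by fact
  interpret E: field "R\<lparr>carrier := E\<rparr>" by (rule R.subfield_iff(2)[OF E])
  interpret H: ring_hom_ring "R\<lparr>carrier := E\<rparr>" S h by (rule ring_hom_ringI2[OF E.ring_axioms S.ring_axioms h])
  note sub = subfieldE(1)[OF E]
  have set: "set p \<subseteq> E" "set q \<subseteq> E" using p unfolding univ_poly_carrier[symmetric] polynomial_def by auto
  have sc: "set (map h p) \<subseteq> carrier S" "set (map h q) \<subseteq> carrier S" using set ring_hom_closed[OF h] by auto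
  have cl: "p \<oplus>\<^bsub>E[X]\<^esub> q \<in> carrier (E[X])" "p \<otimes>\<^bsub>E[X]\<^esub> q \<in> carrier (E[X])"
    using R.univ_poly_is_ring[OF sub] p ring.ring_simprules(1,5) by metis+
  have eqs: "p \<oplus>\<^bsub>E[X]\<^esub> q = R.poly_add p q" "p \<otimes>\<^bsub>E[X]\<^esub> q = R.poly_mult p q"
    by (simp_all add: univ_poly_add univ_poly_mult)
  have c1: "set (map h (R.poly_add p q)) \<subseteq> carrier S" "set (map h (R.poly_mult p q)) \<subseteq> carrier S"
  proof -
    have "set (R.poly_add p q) \<subseteq> E" "set (R.poly_mult p q) \<subseteq> E"
      using cl unfolding eqs univ_poly_carrier[symmetric] polynomial_def by auto
    then show "set (map h (R.poly_add p q)) \<subseteq> carrier S" "set (map h (R.poly_mult p q)) \<subseteq> carrier S"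
      using ring_hom_closed[OF h] by auto
  qed
  have a: "S.normalize (map h (R.poly_add p q)) = S.poly_add (map h p) (map h q)"
    using H.poly_add_hom'[of p q] set by (simp add: R.poly_add_consistent[OF sub])
  have m: "S.normalize (map h (R.poly_mult p q)) = S.poly_mult (map h p) (map h q)"
    using H.poly_mult_hom'[of p q] set by (simp add: R.poly_mult_consistent[OF sub])
  show "ring.eval S (map h (p \<oplus>\<^bsub>E[X]\<^esub> q)) y = ring.eval S (map h p) y \<oplus>\<^bsub>S\<^esub> ring.eval S (map h q) y"
    using S.eval_normalize[OF c1(1) y] S.eval_poly_add[OF sc y] unfolding a eqs by simp
  show "ring.eval S (map h (p \<otimes>\<^bsub>E[X]\<^esub> q)) y = ring.eval S (map h p) y \<otimes>\<^bsub>S\<^esub> ring.eval S (map h q) y"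
    using S.eval_normalize[OF c1(2) y] S.eval_poly_mult[OF sc y] unfolding m eqs by simp
  have "map h (p \<otimes>\<^bsub>E[X]\<^esub> q) \<in> carrier (poly_ring S)" by (rule hom_map_poly(1)[OF R S E h cl(2)])
  then have "S.normalize (map h (R.poly_mult p q)) = map h (R.poly_mult p q)"
    unfolding eqs univ_poly_carrier[symmetric] by (rule S.normalize_polynomial)
  then show "map h (p \<otimes>\<^bsub>E[X]\<^esub> q) = map h p \<otimes>\<^bsub>poly_ring S\<^esub> map h q"
    using m unfolding eqs by (simp add: univ_poly_mult)
qed

text \<open>The extension sends p(x) to the value at \<open>y\<close> of the polynomial p mapped by
  \<open>h\<close>. It is well defined because polynomials vanishing at \<open>x\<close> are
  multiples of the minimal polynomial, whose image vanishes at \<open>y\<close>.\<close>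

lemma hom_extend_simple:
  fixes R (structure) and S
  assumes R: "field R" and S: "field S" and E: "subfield E R" and h: "h \<in> ring_hom (R\<lparr>carrier := E\<rparr>) S"
    and x: "x \<in> carrier R" "(ring.algebraic R over E) x"
    and y: "y \<in> carrier S" "ring.eval S (map h (ring.Irr R E x)) y = \<zero>\<^bsub>S\<^esub>"
  obtains E' h' where "subfield E' R" "E \<subseteq> E'" "x \<in> E'" "h' \<in> ring_hom (R\<lparr>carrier := E'\<rparr>) S"
    "\<And>z. z \<in> E \<Longrightarrow> h' z = h z" "h' x = y"
proof -
  interpret R: field R by fact
  interpret S: field S by fact
  note sub = subfieldE(1)[OF E]
  let ?E' = "R.simple_extension E x"
  \<comment> \<open>The graph of the intended map, indexed by polynomials; the work lies in showing
    that it is single-valued.\<close>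
  let ?G = "(\<lambda>p. (R.eval p x, S.eval (map h p) y)) ` carrier (E[X])"
  have EC: "E \<subseteq> carrier R" using subfieldE(3)[OF E] .
  have dom: "Domain ?G = ?E'" unfolding R.simple_extension_as_eval_img[OF EC x(1)] by auto
  have sE': "subfield ?E' R" using R.simple_extension_is_subfield[OF E x(1)] x(2) by simp
  interpret EX: domain "E[X]" using R.univ_poly_is_domain[OF sub] .
  have hz: "h \<zero> = \<zero>\<^bsub>S\<^esub>"
  proof -
    interpret E: field "R\<lparr>carrier := E\<rparr>" by (rule R.subfield_iff(2)[OF E])
    interpret H: ring_hom_ring "R\<lparr>carrier := E\<rparr>" S h by (rule ring_hom_ringI2[OF E.ring_axioms S.ring_axioms h])
    show ?thesis using H.hom_zero by simp
  qed
  have kill: "S.eval (map h p) y = \<zero>\<^bsub>S\<^esub>" if p: "p \<in> carrier (E[X])" "R.eval p x = \<zero>" for p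
  proof -
    have i: "R.Irr E x \<in> carrier (E[X])" by (rule R.IrrE(1)[OF E x])
    have "(R.Irr E x) pdivides\<^bsub>R\<^esub> p" by (rule R.Irr_minimal[OF E x p])
    then have "(R.Irr E x) divides\<^bsub>E[X]\<^esub> p" using R.pdivides_iff_shell[OF E i p(1)] by simp
    then obtain r where r: "r \<in> carrier (E[X])" "p = (R.Irr E x) \<otimes>\<^bsub>E[X]\<^esub> r" unfolding factor_def by auto
    have "set (map h r) \<subseteq> carrier S" using r ring_hom_closed[OF h] unfolding univ_poly_carrier[symmetric] polynomial_def by auto
    then show ?thesis using hom_eval_add_mult(2)[OF R S E h i r(1) y(1)] y(2) r(2) S.eval_in_carrier[of "map h r" y] y(1) by simp
  qed
  have add: "R.eval (p \<oplus>\<^bsub>E[X]\<^esub> q) x = R.eval p x \<oplus> R.eval q x" and mult: "R.eval (p \<otimes>\<^bsub>E[X]\<^esub> q) x = R.eval p x \<otimes> R.eval q x"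
    if "p \<in> carrier (E[X])" "q \<in> carrier (E[X])" for p q
    using ring_hom_add[OF R.eval_is_hom[OF sub x(1)] that] ring_hom_mult[OF R.eval_is_hom[OF sub x(1)] that] by auto
  have ec: "R.eval p x \<in> carrier R" "S.eval (map h p) y \<in> carrier S" if "p \<in> carrier (E[X])" for p
    using that R.eval_in_carrier[of p x] S.eval_in_carrier[of "map h p" y] x y EC ring_hom_closed[OF h] unfolding univ_poly_carrier[symmetric] polynomial_def by auto
  have sv: "single_valued ?G"
  proof (rule single_valuedI)
    fix u v w assume "(u, v) \<in> ?G" "(u, w) \<in> ?G"
    then obtain p q where pq: "p \<in> carrier (E[X])" "q \<in> carrier (E[X])" "R.eval p x = R.eval q x" "v = S.eval (map h p) y" "w = S.eval (map h q) y"
      by auto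
    let ?m = "\<ominus>\<^bsub>E[X]\<^esub> q"
    have mc: "?m \<in> carrier (E[X])" using pq by simp
    have "R.eval (q \<oplus>\<^bsub>E[X]\<^esub> ?m) x = \<zero>" using EX.r_neg[OF pq(2)] by (simp add: univ_poly_zero)
    then have e0: "R.eval q x \<oplus> R.eval ?m x = \<zero>" using add[OF pq(2) mc] by simp
    have "S.eval (map h (q \<oplus>\<^bsub>E[X]\<^esub> ?m)) y = \<zero>\<^bsub>S\<^esub>" using EX.r_neg[OF pq(2)] by (simp add: univ_poly_zero)
    then have e1: "w \<oplus>\<^bsub>S\<^esub> S.eval (map h ?m) y = \<zero>\<^bsub>S\<^esub>" using hom_eval_add_mult(1)[OF R S E h pq(2) mc y(1)] pq by simp
    have "R.eval (p \<oplus>\<^bsub>E[X]\<^esub> ?m) x = \<zero>" using add[OF pq(1) mc] e0 pq(3) by simp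
    then have "S.eval (map h (p \<oplus>\<^bsub>E[X]\<^esub> ?m)) y = \<zero>\<^bsub>S\<^esub>" using kill pq mc by simp
    then have "v \<oplus>\<^bsub>S\<^esub> S.eval (map h ?m) y = \<zero>\<^bsub>S\<^esub>" using hom_eval_add_mult(1)[OF R S E h pq(1) mc y(1)] pq by simp
    then show "v = w" using e1 ec pq mc by (metis S.add.r_cancel)
  qed
  have const: "(z, h z) \<in> ?G" if "z \<in> E" for z
  proof (cases "z = \<zero>")
    case True
    have "[] \<in> carrier (E[X])" by (simp add: univ_poly_carrier[symmetric] polynomial_def)
    then have "(R.eval [] x, S.eval (map h []) y) \<in> ?G" by (rule imageI)
    then show ?thesis using True hz by simp
  next
    case False
    have "[z] \<in> carrier (E[X])" using False that by (simp add: univ_poly_carrier[symmetric] polynomial_def)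
    then have "(R.eval [z] x, S.eval (map h [z]) y) \<in> ?G" by (rule imageI)
    moreover have "R.eval [z] x = z" "S.eval (map h [z]) y = h z" using that EC x(1) y(1) ring_hom_closed[OF h, of z] by auto
    ultimately show ?thesis by simp
  qed
  have var: "(x, y) \<in> ?G"
  proof -
    have "[\<one>, \<zero>] \<in> carrier (E[X])" using subringE[OF sub] by (simp add: univ_poly_carrier[symmetric] polynomial_def)
    then have "(R.eval [\<one>, \<zero>] x, S.eval (map h [\<one>, \<zero>]) y) \<in> ?G" by (rule imageI)
    moreover have "R.eval [\<one>, \<zero>] x = x" "S.eval (map h [\<one>, \<zero>]) y = y" using x(1) y(1) ring_hom_one[OF h] hz by auto
    ultimately show ?thesis by (simp only:)
  qed
  have "hom_graph R S ?G"
    unfolding hom_graph_def dom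
  proof (intro conjI sE' sv allI impI)
    show "Range ?G \<subseteq> carrier S" using ec by auto
    show "(\<one>, \<one>\<^bsub>S\<^esub>) \<in> ?G" using const[of \<one>] subringE(3)[OF sub] ring_hom_one[OF h] by simp
    fix u v u' v' assume "(u, v) \<in> ?G" "(u', v') \<in> ?G"
    then obtain p q where pq: "p \<in> carrier (E[X])" "q \<in> carrier (E[X])" "u = R.eval p x" "u' = R.eval q x" "v = S.eval (map h p) y" "v' = S.eval (map h q) y"
      by auto
    have cl: "p \<oplus>\<^bsub>E[X]\<^esub> q \<in> carrier (E[X])" "p \<otimes>\<^bsub>E[X]\<^esub> q \<in> carrier (E[X])" using pq by auto
    show "(u \<oplus> u', v \<oplus>\<^bsub>S\<^esub> v') \<in> ?G"
      unfolding pq(3-6) add[OF pq(1,2), symmetric] hom_eval_add_mult(1)[OF R S E h pq(1,2) y(1), symmetric] using cl(1) by (rule imageI)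
    show "(u \<otimes> u', v \<otimes>\<^bsub>S\<^esub> v') \<in> ?G"
      unfolding pq(3-6) mult[OF pq(1,2), symmetric] hom_eval_add_mult(2)[OF R S E h pq(1,2) y(1), symmetric] using cl(2) by (rule imageI)
  qed
  then obtain h' where h': "h' \<in> ring_hom (R\<lparr>carrier := Domain ?G\<rparr>) S" "?G = (\<lambda>x. (x, h' x)) ` Domain ?G"
    by (rule hom_of_hom_graph)
  have val: "h' u = v" if "(u, v) \<in> ?G" for u v
  proof -
    have "(u, v) \<in> (\<lambda>x. (x, h' x)) ` Domain ?G" using that h'(2) by simp
    then show ?thesis by blast
  qed
  show thesis
  proof (rule that[OF sE'])
    show "E \<subseteq> ?E'" by (rule R.simple_extension_incl[OF EC x(1)])
    show "x \<in> ?E'" by (rule R.simple_extension_mem[OF sub x(1)])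
    show "h' \<in> ring_hom (R\<lparr>carrier := ?E'\<rparr>) S" using h'(1) unfolding dom .
    show "h' z = h z" if "z \<in> E" for z using val[OF const[OF that]] .
    show "h' x = y" using val[OF var] .
  qed
qed

text \<open>A maximal extension is defined everywhere: for \<open>x\<close> outside its domain, the
  image of the minimal polynomial of \<open>x\<close> would have a root in \<open>S\<close>, and
  \<open>hom_extend_simple\<close> would enlarge the graph.\<close>

theorem hom_extend:
  fixes R (structure) and S
  assumes R: "field R" and S: "field S" and k: "subfield k R" and alg: "\<And>x. x \<in> carrier R \<Longrightarrow> (ring.algebraic R over k) x"
    and E: "subfield E R" "k \<subseteq> E" and h: "h \<in> ring_hom (R\<lparr>carrier := E\<rparr>) S"
    and split: "\<And>x. x \<in> carrier R \<Longrightarrow> ring.splitted S (map h (ring.Irr R k x))"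
  obtains h' where "h' \<in> ring_hom R S" "\<And>x. x \<in> E \<Longrightarrow> h' x = h x"
proof -
  interpret R: field R by fact
  interpret S: field S by fact
  let ?g = "\<lambda>h E. (\<lambda>x. (x, h x)) ` E"
  let ?A = "{G. hom_graph R S G \<and> ?g h E \<subseteq> G}"
  have "\<exists>M\<in>?A. \<forall>Z\<in>?A. M \<subseteq> Z \<longrightarrow> Z = M"
  proof (rule subset_Zorn_nonempty)
    show "?A \<noteq> {}" using hom_graph_of_hom[OF E(1) h] by blast
    fix C assume C: "C \<noteq> {}" "subset.chain ?A C"
    have "hom_graph R S (\<Union>C)"
      by (rule hom_graph_Union[OF C(1) _ _ R]) (use C(2) in \<open>unfold subset.chain_def, blast+\<close>)
    moreover have "?g h E \<subseteq> \<Union>C" using C unfolding subset.chain_def by blast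
    ultimately show "\<Union>C \<in> ?A" by blast
  qed
  then obtain M where M': "M \<in> ?A" "\<forall>Z\<in>?A. M \<subseteq> Z \<longrightarrow> Z = M" ..
  then have M: "hom_graph R S M" "?g h E \<subseteq> M" by simp_all
  have max: "Z = M" if "hom_graph R S Z" "M \<subseteq> Z" for Z
    using M'(2) that subset_trans[OF M(2) that(2)] by simp
  obtain f where f: "f \<in> ring_hom (R\<lparr>carrier := Domain M\<rparr>) S" "M = ?g f (Domain M)" using hom_of_hom_graph[OF M(1)] by blast
  let ?D = "Domain M"
  have D: "subfield ?D R" using M(1) unfolding hom_graph_def by blast
  have ED: "E \<subseteq> ?D" using M(2) by auto
  have fh: "f x = h x" if "x \<in> E" for x
  proof -
    have "(x, h x) \<in> ?g f ?D" using M(2) f(2) that by auto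
    then show ?thesis by auto
  qed
  have "?D = carrier R"
  proof (rule ccontr)
    assume "?D \<noteq> carrier R"
    then obtain x where x: "x \<in> carrier R" "x \<notin> ?D" using subfieldE(3)[OF D] by blast
    have algD: "(R.algebraic over ?D) x" using R.algebraic_mono[of k ?D x] alg[OF x(1)] E(2) ED by blast
    let ?q = "R.Irr ?D x" and ?f = "R.Irr k x"
    have q: "?q \<in> carrier (?D[X])" by (rule R.IrrE(1)[OF D x(1) algD])
    have fk: "?f \<in> carrier (k[X])" by (rule R.IrrE(1)[OF k x(1) alg[OF x(1)]])
    have fD: "?f \<in> carrier (?D[X])" using fk E(2) ED unfolding univ_poly_carrier[symmetric] polynomial_def by auto
    \<comment> \<open>The minimal polynomial over the larger domain divides the one over
      \<open>k\<close>. The image of the latter splits by hypothesis, hence so does that of the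
      former.\<close>
    have "?q pdivides\<^bsub>R\<^esub> ?f" by (rule R.Irr_minimal[OF D x(1) algD fD R.IrrE(4)[OF k x(1) alg[OF x(1)]]])
    then have "?q divides\<^bsub>?D[X]\<^esub> ?f" using R.pdivides_iff_shell[OF D q fD] by simp
    then obtain r where r: "r \<in> carrier (?D[X])" "?f = ?q \<otimes>\<^bsub>?D[X]\<^esub> r" unfolding factor_def by auto
    have mq: "map f ?q \<in> carrier (poly_ring S)" "map f r \<in> carrier (poly_ring S)" "map f ?f \<in> carrier (poly_ring S)"
      using hom_map_poly(1)[OF R S D f(1)] q r(1) fD by auto
    have "map f ?f = map f ?q \<otimes>\<^bsub>poly_ring S\<^esub> map f r" using hom_eval_add_mult(3)[OF R S D f(1) q r(1) S.zero_closed] r(2) by simp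
    then have dv: "map f ?q pdivides\<^bsub>S\<^esub> map f ?f" using mq unfolding pdivides_def factor_def by auto
    have "map f ?f = map h ?f" using fk E(2) fh unfolding univ_poly_carrier[symmetric] polynomial_def by auto
    then have spl: "S.splitted (map f ?f)" using split[OF x(1)] by (simp only:)
    have ne: "?f \<noteq> []" using R.pirreducibleE(1)[OF subfieldE(1)[OF k] fk R.IrrE(2)[OF k x(1) alg[OF x(1)]]] .
    have "S.splitted (map f ?q)" by (rule S.pdivides_imp_splitted[OF mq(1,3) _ spl dv]) (use ne in simp)
    moreover have "Polynomials.degree ?q \<ge> 1" by (rule R.pirreducible_degree[OF D q R.IrrE(2)[OF D x(1) algD]])
    ultimately have "S.roots (map f ?q) \<noteq> {#}" unfolding S.splitted_def by auto
    then obtain y where "y \<in># S.roots (map f ?q)" by blast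
    then have y: "y \<in> carrier S" "S.eval (map f ?q) y = \<zero>\<^bsub>S\<^esub>" using S.roots_mem_iff_is_root[OF mq(1)] unfolding S.is_root_def by auto
    obtain E' h' where E': "subfield E' R" "?D \<subseteq> E'" "x \<in> E'" "h' \<in> ring_hom (R\<lparr>carrier := E'\<rparr>) S" "\<And>z. z \<in> ?D \<Longrightarrow> h' z = f z"
      using hom_extend_simple[OF R S D f(1) x(1) algD y] by metis
    have "M \<subseteq> ?g h' E'"
    proof
      fix z assume "z \<in> M"
      then obtain u where "u \<in> ?D" "z = (u, f u)" using f(2) by blast
      then have "z = (u, h' u)" "u \<in> E'" using E'(2) E'(5)[of u] by auto
      then show "z \<in> ?g h' E'" by blast
    qed
    then have "?g h' E' = M" using max[OF hom_graph_of_hom[OF E'(1,4)]] by blast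
    then have "x \<in> ?D" using E'(3) by blast
    then show False using x(2) by blast
  qed
  then show thesis using that[of f] f(1) fh by simp
qed

section \<open>Normal subfields\<close>

text \<open>The top two coefficients of (X - x)^m. The second is -m x, from which \<open>x\<close>
  can be read off when \<open>m\<close> is invertible.\<close>

lemma (in field) linear_pow_coeff:
  assumes x: "x \<in> carrier R"
  shows "coeff ([\<one>, \<ominus> x] [^]\<^bsub>poly_ring R\<^esub> m) m = \<one> \<and> (\<forall>i>m. coeff ([\<one>, \<ominus> x] [^]\<^bsub>poly_ring R\<^esub> m) i = \<zero>)
     \<and> (1 \<le> m \<longrightarrow> coeff ([\<one>, \<ominus> x] [^]\<^bsub>poly_ring R\<^esub> m) (m - 1) = \<ominus> ([(m::nat)] \<cdot> x))"
proof (induction m)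
  case 0
  show ?case by (simp add: univ_poly_one)
next
  case (Suc m)
  interpret UP: domain "poly_ring R" using univ_poly_is_domain[OF carrier_is_subring] .
  let ?q = "[\<one>, \<ominus> x]" and ?p = "[\<one>, \<ominus> x] [^]\<^bsub>poly_ring R\<^esub> m"
  have q: "?q \<in> carrier (poly_ring R)" using x by (simp add: univ_poly_carrier[symmetric] polynomial_def)
  have p: "?p \<in> carrier (poly_ring R)" using q by (rule UP.nat_pow_closed)
  have sp: "set ?p \<subseteq> carrier R" using p unfolding univ_poly_carrier[symmetric] polynomial_def by auto
  have sq: "set ?q \<subseteq> carrier R" using x by auto
  have cp: "coeff ?p i \<in> carrier R" for i by (rule coeff_in_carrier[OF sp])
  have eq: "[\<one>, \<ominus> x] [^]\<^bsub>poly_ring R\<^esub> Suc m = poly_mult ?p ?q" by (simp add: univ_poly_mult)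
  have cq: "coeff ?q j = (if j = 1 then \<one> else if j = 0 then \<ominus> x else \<zero>)" for j by auto
  have S: "coeff (poly_mult ?p ?q) (Suc i) = coeff ?p (Suc i) \<otimes> (\<ominus> x) \<oplus> coeff ?p i" for i
  proof -
    let ?t = "\<lambda>j. coeff ?p j \<otimes> coeff ?q (Suc i - j)"
    have tc: "?t j \<in> carrier R" for j using cp x by (auto simp: cq)
    have set: "{..Suc i} = insert (Suc i) (insert i {..<i})" by auto
    have split: "finsum R u {..Suc i} = u (Suc i) \<oplus> (u i \<oplus> finsum R u {..<i})" if "\<And>j. u j \<in> carrier R" for u
      unfolding set using that by (simp add: finsum_insert)
    have "finsum R ?t {..Suc i} = ?t (Suc i) \<oplus> (?t i \<oplus> finsum R ?t {..<i})"
      by (rule split[OF tc])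
    moreover have "finsum R ?t {..<i} = (\<Oplus>j\<in>{..<i}. \<zero>)"
      by (rule finsum_cong') (use cp in \<open>auto simp: cq\<close>)
    ultimately show ?thesis unfolding poly_mult_coeff[OF sp sq] using cp x by (simp add: cq)
  qed
  have Z: "coeff (poly_mult ?p ?q) 0 = coeff ?p 0 \<otimes> (\<ominus> x)"
    unfolding poly_mult_coeff[OF sp sq] using cp x by (simp add: cq)
  show ?case
  proof (intro conjI allI impI)
    show "coeff (?q [^]\<^bsub>poly_ring R\<^esub> Suc m) (Suc m) = \<one>"
      unfolding eq S using Suc x by simp
    show "coeff (?q [^]\<^bsub>poly_ring R\<^esub> Suc m) i = \<zero>" if im: "i > Suc m" for i
    proof -
      obtain j where "i = Suc j" "m < j" using im by (cases i) auto
      then show ?thesis unfolding eq using S[of j] Suc x by simp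
    qed
    show "coeff (?q [^]\<^bsub>poly_ring R\<^esub> Suc m) (Suc m - 1) = \<ominus> ([Suc m] \<cdot> x)"
    proof (cases m)
      case 0
      then show ?thesis unfolding eq using Z Suc x by (simp add: univ_poly_one)
    next
      case (Suc m')
      then show ?thesis unfolding eq using S[of m'] Suc.IH x by (simp add: minus_add a_comm)
    qed
  qed
qed

text \<open>In characteristic zero an element that is the only root of a split polynomial is rational: compare the
  two leading coefficients.\<close>

lemma (in field) unique_root_mem_subfield:
  assumes k: "subfield k R" and g: "g \<in> carrier (k[X])" "1 \<le> degree g" "splitted g"
    and x: "x \<in> carrier R" and uniq: "\<And>y. y \<in> carrier R \<Longrightarrow> eval g y = \<zero> \<Longrightarrow> y = x"
    and char: "\<And>n::nat. 0 < n \<Longrightarrow> [n] \<cdot> \<one> \<noteq> \<zero>"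
  shows "x \<in> k"
proof -
  interpret UP: domain "poly_ring R" using univ_poly_is_domain[OF carrier_is_subring] .
  note sub = subfieldE(1)[OF k]
  let ?m = "degree g" and ?q = "[\<one>, \<ominus> x]"
  let ?p = "?q [^]\<^bsub>poly_ring R\<^esub> ?m"
  have gR: "g \<in> carrier (poly_ring R)" by (rule carrier_polynomial_shell[OF sub g(1)])
  have g0: "g \<noteq> []" using g(2) by auto
  have "y = x" if "y \<in># roots g" for y using that uniq roots_mem_iff_is_root[OF gR] unfolding is_root_def by auto
  then have "roots g = replicate_mset (size (roots g)) x" by (metis set_mset_subset_singletonD singleton_iff subsetI)
  then have "count (roots g) x = size (roots g)" by (metis count_replicate_mset)
  then have "alg_mult g x = ?m" using g(3) alg_mult_eq_count_roots[OF gR] unfolding splitted_def by simp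
  then have "?p pdivides g" using alg_multE(1)[OF x gR g0] by simp
  then obtain r where r: "r \<in> carrier (poly_ring R)" "g = ?p \<otimes>\<^bsub>poly_ring R\<^esub> r" unfolding pdivides_def factor_def by auto
  have q: "?q \<in> carrier (poly_ring R)" using x by (simp add: univ_poly_carrier[symmetric] polynomial_def)
  have p: "?p \<in> carrier (poly_ring R)" using q by (rule UP.nat_pow_closed)
  have sp: "set ?p \<subseteq> carrier R" "polynomial (carrier R) ?p" using p unfolding univ_poly_carrier[symmetric] polynomial_def by auto
  note lc = linear_pow_coeff[OF x, of ?m]
  have p0: "?p \<noteq> []" using lc by (metis coeff.simps(1) one_not_zero)
  have degp: "degree ?p = ?m"
  proof (rule antisym)
    show "?m \<le> degree ?p" using lc coeff_degree[of ?p ?m] by (metis not_le one_not_zero)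
    show "degree ?p \<le> ?m"
    proof (rule ccontr)
      assume "\<not> degree ?p \<le> ?m"
      then have "coeff ?p (degree ?p) = \<zero>" using lc by auto
      then show False using lead_coeff_simp[OF p0] sp(2) p0 unfolding polynomial_def by auto
    qed
  qed
  have r0: "r \<noteq> []" using r g0 UP.r_null[OF p] by (auto simp: univ_poly_zero)
  have "degree g = degree ?p + degree r"
    using poly_mult_degree_eq[OF carrier_is_subring, of ?p r] sp(2) r p0 r0
    by (simp add: univ_poly_mult univ_poly_carrier)
  \<comment> \<open>The power of X - x already has the full degree, so the cofactor is a constant
    \<open>c\<close>.\<close>
  then have "length r = 1" using degp r0 by (cases r) auto
  then obtain c where c: "r = [c]" by (metis One_nat_def length_0_conv length_Suc_conv)
  have cc: "c \<in> carrier R" "c \<noteq> \<zero>" using r(1) unfolding c univ_poly_carrier[symmetric] polynomial_def by auto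
  have "g = poly_mult [c] ?p" using r UP.m_comm[OF p r(1)] unfolding c by (simp add: univ_poly_mult)
  also have "\<dots> = poly_add (map ((\<otimes>) c) ?p) []" by simp
  also have "\<dots> = normalize (map ((\<otimes>) c) ?p)"
    by (rule poly_add_zero'(1)) (use sp cc in auto)
  finally have "coeff g = coeff (map ((\<otimes>) c) ?p)" using normalize_coeff by metis
  then have cg: "coeff g i = c \<otimes> coeff ?p i" for i using scalar_coeff[OF cc(1), of ?p] by simp
  have ck: "coeff g i \<in> k" for i
  proof -
    have "set g \<subseteq> k" using g(1) unfolding univ_poly_carrier[symmetric] polynomial_def by auto
    moreover have "coeff g i \<in> set g \<union> {\<zero>}" using coeff_img(3)[of g] by blast
    ultimately show ?thesis using subringE(2)[OF sub] by auto
  qed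
  \<comment> \<open>The leading coefficients of \<open>g\<close> are \<open>c\<close> and -c m x.
    Both lie in \<open>k\<close>, and division by \<open>c\<close> and by the integer
    \<open>m\<close>, nonzero in characteristic zero, leaves \<open>x\<close>.\<close>
  have "c \<in> k" using ck[of ?m] cg[of ?m] lc cc by simp
  moreover have "c \<otimes> (\<ominus> ([?m] \<cdot> x)) \<in> k" using ck[of "?m - 1"] cg[of "?m - 1"] lc g(2) by simp
  ultimately have "\<ominus> ([?m] \<cdot> x) \<in> k" using subfield_m_inv_simprule[OF k, of c "\<ominus> ([?m] \<cdot> x)"] cc x by auto
  then have "\<ominus> (\<ominus> ([?m] \<cdot> x)) \<in> k" by (rule subringE(5)[OF sub])
  then have "([?m] \<cdot> \<one>) \<otimes> x \<in> k" using x by (simp add: add_pow_ldistr)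
  moreover have "[n] \<cdot> \<one> \<in> k" for n :: nat by (induction n) (use subringE[OF sub] in auto)
  ultimately show "x \<in> k" using subfield_m_inv_simprule[OF k, of "[?m] \<cdot> \<one>" x] char[of ?m] g(2) x by auto
qed

lemma (in field) subfield_subfield:
  assumes "subfield k R" "subfield N R" "k \<subseteq> N"
  shows "subfield k (R\<lparr>carrier := N\<rparr>)"
proof -
  interpret N: field "R\<lparr>carrier := N\<rparr>" by (rule subfield_iff(2)[OF assms(2)])
  show ?thesis by (rule N.subfield_iff(1)) (use subfield_iff(2)[OF assms(1)] assms(3) in auto)
qed

lemma (in ring) Irr_consistent:
  assumes "subring N R" shows "ring.Irr (R\<lparr>carrier := N\<rparr>) = Irr"
  unfolding ring.Irr_def[OF subring_is_ring[OF assms]] Irr_def univ_poly_consistent[OF assms] eval_consistent[OF assms]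
  by simp

text \<open>An automorphism over \<open>k\<close> is determined by the images of a finite basis, and
  each image is a root of the minimal polynomial of the basis element.\<close>

lemma finite_Gal:
  fixes E (structure)
  assumes E: "field E" and k: "subfield k E" and fin: "ring.finite_dimension E k (carrier E)"
  shows "finite (carrier (Gal E k))"
proof -
  interpret field E by fact
  obtain n where n: "dimension n k (carrier E)" using fin by auto
  obtain us where us: "set us \<subseteq> carrier E" "independent k us" "length us = n" "Span k us = carrier E"
    using exists_base[OF k n] by auto
  have alg: "(algebraic over k) x" if "x \<in> carrier E" for x
    using finite_dimension_imp_algebraic[OF k carrier_is_subring fin that] .
  let ?R = "\<Union>u\<in>set us. {y. is_root (Irr k u) y}"
  have "Irr k u \<in> carrier (poly_ring E)" if "u \<in> set us" for u
    using IrrE(1)[OF k _ alg] carrier_polynomial_shell[OF subfieldE(1)[OF k]] that us(1) by blast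
  then have finR: "finite ?R" using finite_number_of_roots by blast
  have "inj_on (\<lambda>\<phi>. map \<phi> us) (carrier (Gal E k))"
  proof (rule inj_onI)
    fix f g assume fg: "f \<in> carrier (Gal E k)" "g \<in> carrier (Gal E k)" "map f us = map g us"
    have im: "f (combine Ks us) = combine Ks (map f us)" if "f \<in> carrier (Gal E k)" "set Ks \<subseteq> k" for f Ks
    proof -
      interpret H: ring_hom_ring E E f by (rule ring_hom_ringI2[OF ring_axioms ring_axioms Gal_hom[OF that(1)]])
      have "map f Ks = Ks" using Gal_fix[OF that(1)] that(2) by (simp add: map_idI subsetD)
      then show ?thesis using H.combine_hom[of Ks us] that(2) us(1) subfieldE(3)[OF k] by auto
    qed
    have "f x = g x" if x: "x \<in> carrier E" for x
    proof -
      obtain Ks where Ks: "set Ks \<subseteq> k" "x = combine Ks us" using Span_mem_iff_length_version[OF k us(1)] x us(4) by blast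
      show ?thesis unfolding Ks(2) im[OF fg(1) Ks(1)] im[OF fg(2) Ks(1)] fg(3) ..
    qed
    moreover have "f \<in> extensional (carrier E)" "g \<in> extensional (carrier E)" using fg by (auto simp: Gal_simps Bij_def)
    ultimately show "f = g" by (metis extensionalityI)
  qed
  moreover have "(\<lambda>\<phi>. map \<phi> us) ` carrier (Gal E k) \<subseteq> {l. set l \<subseteq> ?R \<and> length l = n}"
  proof clarsimp
    fix f assume f: "f \<in> carrier (Gal E k)"
    interpret H: ring_hom_ring E E f by (rule ring_hom_ringI2[OF ring_axioms ring_axioms Gal_hom[OF f]])
    have "f u \<in> ?R" if u: "u \<in> set us" for u
    proof -
      have uc: "u \<in> carrier E" using u us by auto
      note I = IrrE[OF k uc alg[OF uc]]
      have "set (Irr k u) \<subseteq> k" using I(1) unfolding univ_poly_carrier[symmetric] polynomial_def by auto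
      then have "map f (Irr k u) = Irr k u" using Gal_fix[OF f] by (simp add: map_idI subsetD)
      then have "eval (Irr k u) (f u) = \<zero>" using H.eval_hom[OF subfieldE(1)[OF k] uc I(1)] I(4) by simp
      moreover have "Irr k u \<noteq> []" using I(3) pirreducibleE(1)[OF subfieldE(1)[OF k] I(1,2)] by simp
      ultimately show ?thesis using u uc H.hom_closed unfolding is_root_def by auto
    qed
    then show "f ` set us \<subseteq> (\<Union>u\<in>set us. {y. is_root (Irr k u) y}) \<and> length us = n" using us(3) by blast
  qed
  ultimately show ?thesis using finite_subset[OF _ finite_lists_length_eq[OF finR, of n]] finite_imageD by blast
qed

text \<open>Normality of N/k expressed on a set \<open>T\<close> of generators: each is a root of
  some polynomial over \<open>k\<close> all of whose roots in \<open>R\<close> lie in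
  \<open>N\<close>. Composita are given by generators, so this is the form that can be
  verified.\<close>

locale normal_subfield = field R for R (structure) +
  fixes k N T :: "'a set"
  assumes k: "subfield k R" and N: "subfield N R" and kN: "k \<subseteq> N"
    and TN: "T \<subseteq> N" and gen: "\<lbrakk>subfield F R; k \<subseteq> F; T \<subseteq> F\<rbrakk> \<Longrightarrow> N \<subseteq> F"
    and roots_T: "s \<in> T \<Longrightarrow> \<exists>f\<in>carrier (k[X]). f \<noteq> [] \<and> eval f s = \<zero> \<and> (\<forall>y\<in>carrier R. eval f y = \<zero> \<longrightarrow> y \<in> N)"
begin

abbreviation NN where "NN \<equiv> R\<lparr>carrier := N\<rparr>"

lemma field_NN: "field NN" by (rule subfield_iff(2)[OF N])

text \<open>The elements of \<open>N\<close> sent into \<open>N\<close> form a subfield containing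
  \<open>k\<close> and \<open>T\<close>, hence all of \<open>N\<close>. For surjectivity,
  \<open>h\<close> permutes the finite set of roots of each polynomial belonging to
  \<open>T\<close>, so its image contains \<open>T\<close>.\<close>

lemma hom_image:
  assumes h: "h \<in> ring_hom NN R" and fx: "\<And>x. x \<in> k \<Longrightarrow> h x = x"
  shows "bij_betw h N N"
proof -
  interpret NN: field NN by (rule field_NN)
  interpret H: ring_hom_ring NN R h by (rule ring_hom_ringI2[OF NN.ring_axioms ring_axioms h])
  note NC = subfieldE(3)[OF N]
  have img: "inj_on h N" "subfield (h ` N) R" using H.img_is_subfield[OF NN.carrier_is_subfield] by auto
  have ev: "eval f (h s) = h (eval f s)" if "f \<in> carrier (k[X])" "s \<in> N" for f s
  proof -
    have sf: "set f \<subseteq> k" using that(1) unfolding univ_poly_carrier[symmetric] polynomial_def by auto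
    then have "map h f = f" using fx by (simp add: map_idI subsetD)
    then show ?thesis using H.eval_hom'[of s f] that(2) sf kN by (simp add: eval_consistent[OF subfieldE(1)[OF N]] subset_trans)
  qed
  have hz: "h \<zero> = \<zero>" using H.hom_zero by simp
  let ?P = "{z \<in> N. h z \<in> N}"
  note s = subringE[OF subfieldE(1)[OF N]]
  have "subfield ?P R"
  proof (rule subfieldI'[OF subringI])
    show "?P \<subseteq> carrier R" using NC by auto
    show "\<one> \<in> ?P" using s(3) H.hom_one by simp
    have min: "\<ominus>\<^bsub>NN\<^esub> x = \<ominus> x" if "x \<in> N" for x
      using NN.minus_equality[of "\<ominus> x" x] that s(5) NC l_neg by auto
    show "\<ominus> x \<in> ?P" if "x \<in> ?P" for x
    proof -
      have "h (\<ominus> x) = \<ominus> h x" using H.hom_a_inv[of x] min[of x] that by simp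
      then show ?thesis using that s(5) by auto
    qed
    show "x \<otimes> y \<in> ?P" "x \<oplus> y \<in> ?P" if "x \<in> ?P" "y \<in> ?P" for x y
      using that s(6,7) H.hom_mult[of x y] H.hom_add[of x y] by auto
    fix x assume x: "x \<in> ?P - {\<zero>}"
    then have i: "inv x \<in> N" "x \<otimes> inv x = \<one>" using subfield_m_inv[OF N, of x] by auto
    have "h x \<noteq> \<zero>" using x img(1) s(2) hz unfolding inj_on_def by auto
    then have i': "inv (h x) \<in> N" "h x \<in> Units R" using subfield_m_inv[OF N, of "h x"] x NC field_Units by auto
    have "h x \<otimes> h (inv x) = \<one>" using H.hom_mult[of x "inv x"] x i H.hom_one by simp
    then have "h (inv x) = inv (h x)" using comm_inv_char[of "h x" "h (inv x)"] i' i H.hom_closed[of "inv x"] by auto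
    then show "inv x \<in> ?P" using i i' by simp
  qed
  moreover have "k \<subseteq> ?P" using kN fx by auto
  moreover have "T \<subseteq> ?P"
  proof
    fix s assume sT: "s \<in> T"
    then obtain f where f: "f \<in> carrier (k[X])" "eval f s = \<zero>" "\<And>y. y \<in> carrier R \<Longrightarrow> eval f y = \<zero> \<Longrightarrow> y \<in> N"
      using roots_T by blast
    have sN: "s \<in> N" using sT TN by auto
    then have "h s \<in> N" using f(3)[of "h s"] ev[OF f(1) sN] f(2) hz H.hom_closed[of s] by simp
    then show "s \<in> ?P" using sN by simp
  qed
  ultimately have into: "h z \<in> N" if "z \<in> N" for z using gen[of ?P] that by auto
  have "N \<subseteq> h ` N"
  proof (rule gen[OF img(2)])
    show "k \<subseteq> h ` N" using fx kN by force
    show "T \<subseteq> h ` N"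
    proof
      fix s assume sT: "s \<in> T"
      then obtain f where f: "f \<in> carrier (k[X])" "f \<noteq> []" "eval f s = \<zero>" "\<And>y. y \<in> carrier R \<Longrightarrow> eval f y = \<zero> \<Longrightarrow> y \<in> N"
        using roots_T by blast
      \<comment> \<open>An injective map of a finite set into itself is onto, so \<open>s\<close> is
        the image of some root.\<close>
      let ?Z = "{y \<in> carrier R. eval f y = \<zero>}"
      have fR: "f \<in> carrier (poly_ring R)" by (rule carrier_polynomial_shell[OF subfieldE(1)[OF k] f(1)])
      have "?Z \<subseteq> {y. is_root f y}" using f(2) unfolding is_root_def by auto
      then have fin: "finite ?Z" using finite_number_of_roots[OF fR] finite_subset by blast
      have ZN: "?Z \<subseteq> N" using f(4) by auto
      have "h ` ?Z \<subseteq> ?Z"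
      proof
        fix w assume "w \<in> h ` ?Z"
        then obtain y where y: "y \<in> carrier R" "eval f y = \<zero>" "w = h y" by auto
        then have yN: "y \<in> N" using f(4) by auto
        then show "w \<in> ?Z" using ev[OF f(1) yN] y hz H.hom_closed[of y] by simp
      qed
      then have "h ` ?Z = ?Z" using endo_inj_surj[OF fin] inj_on_subset[OF img(1) ZN] by blast
      moreover have "s \<in> ?Z" using sT TN NC f(3) by auto
      ultimately show "s \<in> h ` N" using ZN by blast
    qed
  qed
  then show ?thesis using img(1) into unfolding bij_betw_def by auto
qed

end

locale normal_closed = algebraically_closed R + normal_subfield R k N T for R (structure) and k N T +
  assumes algN: "x \<in> N \<Longrightarrow> (algebraic over k) x"
    and char: "0 < (n::nat) \<Longrightarrow> [n] \<cdot> \<one> \<noteq> \<zero>"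
begin

text \<open>In characteristic zero an element \<open>x\<close> outside \<open>k\<close> has a
  conjugate \<open>y\<close> different from it. The map sending \<open>x\<close> to \<open>y\<close>
  extends to \<open>N\<close> because everything splits in \<open>R\<close>, it maps
  \<open>N\<close> onto itself by normality, and the resulting automorphism moves
  \<open>x\<close>.\<close>

theorem fixed_field_Gal: "fixed_field NN (carrier (Gal NN k)) = k"
proof
  interpret NN: field NN by (rule field_NN)
  note NC = subfieldE(3)[OF N] and sN = subfieldE(1)[OF N]
  show "k \<subseteq> fixed_field NN (carrier (Gal NN k))"
    using Gal_fix kN by (intro subsetI fixed_fieldI) auto
  show "fixed_field NN (carrier (Gal NN k)) \<subseteq> k"
  proof
    fix x assume x: "x \<in> fixed_field NN (carrier (Gal NN k))"
    then have xN: "x \<in> N" using fixed_fieldD(1) by fastforce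
    then have xc: "x \<in> carrier R" using NC by auto
    show "x \<in> k"
    proof (rule ccontr)
      assume nx: "x \<notin> k"
      note I = IrrE[OF k xc algN[OF xN]]
      have deg: "1 \<le> degree (Irr k x)" by (rule pirreducible_degree[OF k I(1,2)])
      have spl: "splitted (Irr k x)" by (rule roots_over_carrier[OF carrier_polynomial_shell[OF subfieldE(1)[OF k] I(1)]])
      obtain y where y: "y \<in> carrier R" "eval (Irr k x) y = \<zero>" "y \<noteq> x"
        using unique_root_mem_subfield[OF k I(1) deg spl xc _ char] nx by blast
      have kNN: "subfield k NN" by (rule subfield_subfield[OF k N kN])
      have idh: "(\<lambda>z. z) \<in> ring_hom (NN\<lparr>carrier := k\<rparr>) R" using subfieldE(3)[OF k] by (auto simp: ring_hom_def)
      have algNN: "(ring.algebraic NN over k) z" if "z \<in> carrier NN" for z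
        using algN[of z] that unfolding over_def transcendental_consistent[OF sN, symmetric] by simp
      obtain E' h' where E': "subfield E' NN" "k \<subseteq> E'" "x \<in> E'" "h' \<in> ring_hom (NN\<lparr>carrier := E'\<rparr>) R"
        "\<And>z. z \<in> k \<Longrightarrow> h' z = z" "h' x = y"
        by (rule hom_extend_simple[OF field_NN field_axioms kNN idh, of x y])
          (use xN algNN y in \<open>auto simp: Irr_consistent[OF sN]\<close>)
      have split: "splitted (map h' (ring.Irr NN k z))" if z: "z \<in> carrier NN" for z
      proof (rule roots_over_carrier, rule hom_map_poly(1)[OF field_NN field_axioms E'(1,4)])
        have "ring.Irr NN k z \<in> carrier (k[X]\<^bsub>NN\<^esub>)" by (rule NN.IrrE(1)[OF kNN z algNN[OF z]])
        then show "ring.Irr NN k z \<in> carrier (E'[X]\<^bsub>NN\<^esub>)" using E'(2) unfolding univ_poly_carrier[symmetric] polynomial_def by auto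
      qed
      obtain h where h: "h \<in> ring_hom NN R" "\<And>z. z \<in> E' \<Longrightarrow> h z = h' z"
        using hom_extend[OF field_NN field_axioms kNN algNN E'(1,2,4) split] by blast
      have hk: "h z = z" if "z \<in> k" for z using h(2)[of z] E'(2,5) that by auto
      have bij: "bij_betw h N N" by (rule hom_image[OF h(1) hk])
      have "h \<in> ring_hom (R\<lparr>carrier := N, carrier := N\<rparr>) (R\<lparr>carrier := N\<rparr>)"
        by (rule ring_hom_carrier_restrict[of h NN R N N, OF h(1)]) (use bij in \<open>auto simp: bij_betw_def\<close>)
      then have "h \<in> ring_hom NN NN" by simp
      then have "restrict h (carrier NN) \<in> carrier (Gal NN k)"
        by (rule GalI) (use bij hk kN field_NN in auto)
      then have "restrict h (carrier NN) x = x" using fixed_fieldD(2)[OF x] by blast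
      then have "h x = x" using xN by simp
      then show False using h(2)[OF E'(3)] E'(6) y(3) by simp
    qed
  qed
qed

end

section \<open>Transport along homomorphisms\<close>

lemma lattice_hom_image:
  fixes R (structure) and S
  assumes L: "padic_lattice R \<pi> A q" and S: "field S" and h: "h \<in> ring_hom R S"
  shows "padic_lattice S (h \<pi>) (h ` A) q"
proof -
  interpret padic_lattice R \<pi> A q by fact
  interpret S: field S by fact
  interpret H: ring_hom_ring R S h by (rule ring_hom_ringI2[OF ring_axioms S.ring_axioms h])
  have inj: "inj_on h (carrier R)" using H.img_is_subfield(1)[OF carrier_is_subfield] by simp
  have hp: "h \<pi> [^]\<^bsub>S\<^esub> n = h (\<pi> [^] n)" for n :: nat by (simp add: H.hom_nat_pow)
  have im: "(\<lambda>y. h \<pi> [^]\<^bsub>S\<^esub> n \<otimes>\<^bsub>S\<^esub> y) ` (h ` A) = h ` lv n" for n :: nat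
    unfolding lv_def image_image hp using I_carrier by (intro image_cong) auto
  have im1: "(\<lambda>y. h \<pi> \<otimes>\<^bsub>S\<^esub> y) ` (h ` A) = h ` lv 1" using im[of 1] by simp
  have minus: "h (x \<ominus> y) = h x \<ominus>\<^bsub>S\<^esub> h y" if "x \<in> carrier R" "y \<in> carrier R" for x y
    using that by (simp add: a_minus_def)
  show ?thesis
  proof (intro padic_lattice.intro padic_lattice_axioms.intro, goal_cases)
    case 1 show ?case by (rule S)
  next
    case 2 show ?case by simp
  next
    case 3
    show ?case using inj pi_nonzero H.hom_zero by (metis inj_onD pi_closed zero_closed)
  next
    case 4
    show ?case
    proof (rule S.add.subgroupI)
      show "h ` A \<subseteq> carrier S" using I_carrier by auto
      show "h ` A \<noteq> {}" using zero_I by auto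
      show "\<ominus>\<^bsub>S\<^esub> x \<in> h ` A" if x: "x \<in> h ` A" for x
      proof -
        obtain a where a: "a \<in> A" "x = h a" using x by auto
        then have "\<ominus>\<^bsub>S\<^esub> x = h (\<ominus> a)" using I_carrier by simp
        then show ?thesis using I_neg[OF a(1)] by auto
      qed
      show "x \<oplus>\<^bsub>S\<^esub> y \<in> h ` A" if xy: "x \<in> h ` A" "y \<in> h ` A" for x y
      proof -
        obtain a b where a: "a \<in> A" "x = h a" "b \<in> A" "y = h b" using xy by auto
        then have "x \<oplus>\<^bsub>S\<^esub> y = h (a \<oplus> b)" using I_carrier by simp
        then show ?thesis using I_add[OF a(1,3)] by auto
      qed
    qed
  next
    case (5 x)
    then obtain a where a: "a \<in> A" "x = h a" by auto
    then have "h \<pi> \<otimes>\<^bsub>S\<^esub> x = h (\<pi> \<otimes> a)" using I_carrier by simp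
    then show ?case using pi_mult[OF a(1)] by auto
  next
    case (6 x)
    then have ex: "x \<in> h ` lv n" for n unfolding im by blast
    obtain a where a: "a \<in> lv 0" "x = h a" using ex[of 0] by auto
    have "a \<in> lv n" for n
    proof -
      obtain a' where "a' \<in> lv n" "x = h a'" using ex[of n] by auto
      then show ?thesis using a inj lv_carrier by (metis inj_onD)
    qed
    then have "a = \<zero>" by (rule lv_separated)
    then show ?case using a by simp
  next
    case (7 s)
    then have "\<forall>i. \<exists>a. a \<in> lv i \<and> s (Suc i) \<ominus>\<^bsub>S\<^esub> s i = h a" unfolding im by blast
    then obtain a where a: "\<And>i. a i \<in> lv i" "\<And>i. s (Suc i) \<ominus>\<^bsub>S\<^esub> s i = h (a i)" by metis
    have ac: "a i \<in> carrier R" for i using a(1) lv_carrier by blast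
    define f where "f = rec_nat \<zero> (\<lambda>i y. y \<oplus> a i)"
    have f: "f 0 = \<zero>" "f (Suc i) = f i \<oplus> a i" for i unfolding f_def by auto
    have fc: "f i \<in> carrier R" for i by (induction i) (use f ac in auto)
    have "f (Suc i) \<ominus> f i = a i" for i unfolding f using fc[of i] ac[of i] by algebra
    then obtain l where l: "l \<in> carrier R" "\<And>i. l \<ominus> f i \<in> lv i" using lv_complete[of f] fc a(1) by auto
    have sc: "s i \<in> carrier S" for i using 7(1) .
    have hc: "h l \<in> carrier S" "h (f i) \<in> carrier S" "h (a i) \<in> carrier S" for i using l fc ac by auto
    have s: "s i = s 0 \<oplus>\<^bsub>S\<^esub> h (f i)" for i
    proof (induction i)
      case 0 show ?case using f sc by simp
    next
      case (Suc i)
      have "s (Suc i) = s i \<oplus>\<^bsub>S\<^esub> (s (Suc i) \<ominus>\<^bsub>S\<^esub> s i)" using sc[of i] sc[of "Suc i"] by algebra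
      also have "\<dots> = s 0 \<oplus>\<^bsub>S\<^esub> h (f i) \<oplus>\<^bsub>S\<^esub> h (a i)" unfolding a(2) Suc.IH[symmetric] ..
      also have "\<dots> = s 0 \<oplus>\<^bsub>S\<^esub> h (f (Suc i))" unfolding f using sc fc ac by (simp add: S.a_assoc)
      finally show ?case .
    qed
    let ?x = "s 0 \<oplus>\<^bsub>S\<^esub> h l"
    have "?x \<ominus>\<^bsub>S\<^esub> s i \<in> h ` lv i" for i
    proof -
      have "?x \<ominus>\<^bsub>S\<^esub> (s 0 \<oplus>\<^bsub>S\<^esub> h (f i)) = h l \<ominus>\<^bsub>S\<^esub> h (f i)" using sc[of 0] hc by algebra
      then have "?x \<ominus>\<^bsub>S\<^esub> s i = h (l \<ominus> f i)" using s[of i] minus[OF l(1) fc] by simp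
      then show ?thesis using l(2) by auto
    qed
    moreover have "?x \<in> carrier S" using sc hc by simp
    ultimately show ?case unfolding im by blast
  next
    case 8
    obtain T where T: "finite T" "card T \<le> q" "T \<subseteq> A" "\<And>x. x \<in> A \<Longrightarrow> \<exists>t\<in>T. x \<ominus> t \<in> lv 1"
      using cover unfolding lv_def by auto
    have "card (h ` T) \<le> q" using card_image_le[OF T(1), of h] T(2) by linarith
    moreover have "\<exists>t\<in>h ` T. x \<ominus>\<^bsub>S\<^esub> t \<in> h ` lv 1" if x: "x \<in> h ` A" for x
    proof -
      obtain a where a: "a \<in> A" "x = h a" using x by auto
      obtain t where t: "t \<in> T" "a \<ominus> t \<in> lv 1" using T(4)[OF a(1)] by auto
      have "x \<ominus>\<^bsub>S\<^esub> h t = h (a \<ominus> t)" using minus[of a t] a t T(3) I_carrier by auto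
      then show ?thesis using t by blast
    qed
    ultimately show ?case unfolding im1 using T(1,3) by (intro exI[of _ "h ` T"]) auto
  qed
qed

lemma (in ring_hom_ring) hom_nat_one: "h ([(n::nat)] \<cdot>\<^bsub>R\<^esub> \<one>\<^bsub>R\<^esub>) = [n] \<cdot>\<^bsub>S\<^esub> \<one>\<^bsub>S\<^esub>"
  by (induction n) auto

lemma padic_base_hom_image:
  fixes R (structure) and S
  assumes P: "padic_base R p A k0" and S: "field S" and h: "h \<in> ring_hom R S"
  shows "padic_base S p (h ` A) (h ` k0)"
proof -
  interpret padic_base R p A k0 by fact
  interpret S: field S by fact
  interpret H: ring_hom_ring R S h by (rule ring_hom_ringI2[OF ring_axioms S.ring_axioms h])
  have inj: "inj_on h (carrier R)" using H.img_is_subfield(1)[OF carrier_is_subfield] by simp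
  have L: "padic_lattice S ([p] \<cdot>\<^bsub>S\<^esub> \<one>\<^bsub>S\<^esub>) (h ` A) p"
    using lattice_hom_image[OF padic_lattice_axioms S h] unfolding H.hom_nat_one .
  show ?thesis
  proof (intro padic_base.intro padic_base_axioms.intro L)
    show "subfield (h ` k0) S" by (rule H.img_is_subfield(2)[OF k0]) simp
    show "h ` A \<subseteq> h ` k0" using A_sub by auto
    show "\<one>\<^bsub>S\<^esub> \<in> h ` A" using A_one H.hom_one by force
    show "x \<otimes>\<^bsub>S\<^esub> y \<in> h ` A" if "x \<in> h ` A" "y \<in> h ` A" for x y
    proof -
      obtain a b where a: "a \<in> A" "b \<in> A" "x = h a" "y = h b" using \<open>x \<in> h ` A\<close> \<open>y \<in> h ` A\<close> by auto
      then have "x \<otimes>\<^bsub>S\<^esub> y = h (a \<otimes> b)" using I_carrier by simp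
      then show ?thesis using A_mult a by auto
    qed
    show "\<exists>n::nat. [p] \<cdot>\<^bsub>S\<^esub> \<one>\<^bsub>S\<^esub> [^]\<^bsub>S\<^esub> n \<otimes>\<^bsub>S\<^esub> x \<in> h ` A" if "x \<in> h ` k0" for x
    proof -
      obtain a where a: "a \<in> k0" "x = h a" using \<open>x \<in> h ` k0\<close> by auto
      obtain n where n: "\<pi> [^] (n::nat) \<otimes> a \<in> A" using A_frac[OF a(1)] by auto
      have "[p] \<cdot>\<^bsub>S\<^esub> \<one>\<^bsub>S\<^esub> [^]\<^bsub>S\<^esub> n \<otimes>\<^bsub>S\<^esub> x = h (\<pi> [^] n \<otimes> a)"
        using a k0_carrier by (simp add: H.hom_nat_one H.hom_nat_pow)
      then show ?thesis using n by (intro exI[of _ n]) auto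
    qed
    show "Factorial_Ring.prime p" by (rule p_prime)
    show "\<exists>y\<in>h ` A. [c] \<cdot>\<^bsub>S\<^esub> \<one>\<^bsub>S\<^esub> \<otimes>\<^bsub>S\<^esub> y = \<one>\<^bsub>S\<^esub>" if cop: "coprime c p" for c
    proof -
      obtain y where y: "y \<in> A" "([c] \<cdot> \<one>) \<otimes> y = \<one>" using A_unit[OF cop] by auto
      have "[c] \<cdot>\<^bsub>S\<^esub> \<one>\<^bsub>S\<^esub> \<otimes>\<^bsub>S\<^esub> h y = h (([c] \<cdot> \<one>) \<otimes> y)" using I_carrier[OF y(1)] by (simp add: H.hom_nat_one)
      then show ?thesis using y by auto
    qed
    show "[n] \<cdot>\<^bsub>S\<^esub> \<one>\<^bsub>S\<^esub> \<noteq> \<zero>\<^bsub>S\<^esub>" if "0 < n" for n :: nat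
    proof
      assume "[n] \<cdot>\<^bsub>S\<^esub> \<one>\<^bsub>S\<^esub> = \<zero>\<^bsub>S\<^esub>"
      then have "h ([n] \<cdot> \<one>) = h \<zero>" by (simp add: H.hom_nat_one)
      then have "[n] \<cdot> \<one> = \<zero>" using inj by (metis add.nat_pow_closed inj_onD one_closed zero_closed)
      then show False using char_zero[OF that] by simp
    qed
  qed
qed

section \<open>Counting roots of unity, and roots of polynomials under homomorphisms\<close>

lemma (in field) coeff_mult_linear:
  assumes p: "set p \<subseteq> carrier R" and x: "x \<in> carrier R"
  shows "coeff (poly_mult p [\<one>, \<ominus> x]) (Suc i) = coeff p (Suc i) \<otimes> (\<ominus> x) \<oplus> coeff p i"
    and "coeff (poly_mult p [\<one>, \<ominus> x]) 0 = coeff p 0 \<otimes> (\<ominus> x)"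
proof -
  let ?q = "[\<one>, \<ominus> x]"
  have sq: "set ?q \<subseteq> carrier R" using x by auto
  have cp: "coeff p i \<in> carrier R" for i by (rule coeff_in_carrier[OF p])
  have cq: "coeff ?q j = (if j = 1 then \<one> else if j = 0 then \<ominus> x else \<zero>)" for j by auto
  let ?t = "\<lambda>j. coeff p j \<otimes> coeff ?q (Suc i - j)"
  have tc: "?t j \<in> carrier R" for j using cp x by (auto simp: cq)
  have set: "{..Suc i} = insert (Suc i) (insert i {..<i})" by auto
  have split: "finsum R u {..Suc i} = u (Suc i) \<oplus> (u i \<oplus> finsum R u {..<i})" if "\<And>j. u j \<in> carrier R" for u
    unfolding set using that by (simp add: finsum_insert)
  have "finsum R ?t {..Suc i} = ?t (Suc i) \<oplus> (?t i \<oplus> finsum R ?t {..<i})"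
    by (rule split[OF tc])
  moreover have "finsum R ?t {..<i} = (\<Oplus>j\<in>{..<i}. \<zero>)"
    by (rule finsum_cong') (use cp in \<open>auto simp: cq\<close>)
  ultimately show "coeff (poly_mult p [\<one>, \<ominus> x]) (Suc i) = coeff p (Suc i) \<otimes> (\<ominus> x) \<oplus> coeff p i"
    unfolding poly_mult_coeff[OF p sq] using cp x by (simp add: cq)
  show "coeff (poly_mult p [\<one>, \<ominus> x]) 0 = coeff p 0 \<otimes> (\<ominus> x)"
    unfolding poly_mult_coeff[OF p sq] using cp x by (simp add: cq)
qed

text \<open>X^b - 1 splits, so the roots only have to be shown simple. The quotient by X - a takes
  at \<open>a\<close> the value b a^(b-1), which is nonzero; this is the derivative criterion
  without derivatives.\<close>

lemma (in algebraically_closed) card_roots_of_unity_eq: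
  fixes b :: nat
  assumes b: "0 < b" "[b] \<cdot> \<one> \<noteq> \<zero>"
  shows "card {x \<in> carrier L. x [^] b = \<one>} = b"
proof -
  interpret UP: domain "poly_ring L" using univ_poly_is_domain[OF carrier_is_subring] .
  let ?p = "monom \<one> (b - 1) @ [\<ominus> \<one>]"
  have p: "?p \<in> carrier (poly_ring L)"
    unfolding univ_poly_carrier[symmetric] polynomial_def monom_def by auto
  have p0: "?p \<noteq> []" by simp
  have deg: "degree ?p = b" using b by (simp add: monom_def)
  have ev: "eval ?p x = x [^] b \<ominus> \<one>" if "x \<in> carrier L" for x
    using eval_append_aux[of "monom \<one> (b - 1)" "\<ominus> \<one>" x] eval_monom[of \<one> x "b - 1"] that b(1)
      monom_in_carrier[of \<one> "b - 1"] nat_pow_Suc[of x "b - 1"]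
    by (simp add: a_minus_def)
  have cp: "coeff ?p i = (if i = b then \<one> else if i = 0 then \<ominus> \<one> else \<zero>)" for i
    unfolding append_coeff using b(1) by (auto simp: monom_coeff)
  have mult1: "count (roots ?p) a \<le> 1" for a
  proof (rule ccontr)
    assume "\<not> count (roots ?p) a \<le> 1"
    then have m: "2 \<le> alg_mult ?p a" "a \<in># roots ?p"
    proof -
      have c2: "2 \<le> count (roots ?p) a" using \<open>\<not> count (roots ?p) a \<le> 1\<close> by linarith
      then show "2 \<le> alg_mult ?p a" unfolding alg_mult_eq_count_roots[OF p] .
      show "a \<in># roots ?p" using c2 by (metis count_eq_zero_iff not_numeral_le_zero)
    qed
    have ra: "a \<in> carrier L" "a [^] b = \<one>"
    proof -
      have "is_root ?p a" using m(2) roots_mem_iff_is_root[OF p] by simp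
      then show a: "a \<in> carrier L" unfolding is_root_def by auto
      have "a [^] b \<ominus> \<one> = \<zero>" using \<open>is_root ?p a\<close> ev[OF a] unfolding is_root_def by simp
      then show "a [^] b = \<one>" using a by (simp add: r_right_minus_eq)
    qed
    let ?q = "[\<one>, \<ominus> a]"
    have q: "?q \<in> carrier (poly_ring L)" using ra by (simp add: univ_poly_carrier[symmetric] polynomial_def)
    \<comment> \<open>The quotient of X^b - 1 by X - a, with coefficients 1, a, ..., a^(b-1) from
      the leading one down.\<close>
    define s where "s = map (\<lambda>i. a [^] i) [0..<b]"
    have s: "s \<in> carrier (poly_ring L)" unfolding univ_poly_carrier[symmetric] polynomial_def s_def
      using b(1) ra by (auto simp: hd_map)
    have ss: "set s \<subseteq> carrier L" unfolding s_def using ra by auto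
    have ls: "length s = b" unfolding s_def by simp
    have cs: "coeff s i = (if i < b then a [^] (b - 1 - i) else \<zero>)" for i
    proof (cases "i < b")
      case True
      then show ?thesis using coeff_nth[of i s] ls unfolding s_def by simp
    next
      case False
      then show ?thesis using coeff_length[of s i] ls by simp
    qed
    have "?p = poly_mult s ?q"
    proof -
      have pc: "polynomial (carrier L) (poly_mult s ?q)" by (rule poly_mult_is_polynomial[OF carrier_is_subring ss]) (use ra in auto)
      have "coeff ?p i = coeff (poly_mult s ?q) i" for i
      proof (cases i)
        case 0
        have "a [^] (b - 1) \<otimes> (\<ominus> a) = \<ominus> (a [^] Suc (b - 1))" using ra by (simp add: r_minus)
        then have "a [^] (b - 1) \<otimes> (\<ominus> a) = \<ominus> \<one>" using ra b(1) by simp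
        then show ?thesis unfolding cp using 0 b(1) coeff_mult_linear(2)[OF ss ra(1)] by (simp add: cs)
      next
        case (Suc j)
        show ?thesis
        proof (cases "Suc j < b")
          case True
          have "b - 1 - j = Suc (b - 1 - Suc j)" using True by simp
          then have "a [^] (b - 1 - j) = a [^] (b - 1 - Suc j) \<otimes> a" by simp
          then show ?thesis unfolding cp using Suc True coeff_mult_linear(1)[OF ss ra(1), of j] ra by (simp add: cs r_minus l_neg)
        next
          case False
          then show ?thesis unfolding cp using Suc coeff_mult_linear(1)[OF ss ra(1), of j] ra b(1) by (cases "Suc j = b") (auto simp: cs)
        qed
      qed
      then show ?thesis using coeff_iff_polynomial_cond[OF _ pc, of ?p] p unfolding univ_poly_carrier by blast
    qed
    then have ps: "?p = s \<otimes>\<^bsub>poly_ring L\<^esub> ?q" by (simp add: univ_poly_mult)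
    have "(?q [^]\<^bsub>poly_ring L\<^esub> (2::nat)) pdivides ?p" by (rule le_alg_mult_imp_pdivides[OF ra(1) p m(1)])
    then obtain r where r: "r \<in> carrier (poly_ring L)" "?p = ?q [^]\<^bsub>poly_ring L\<^esub> (2::nat) \<otimes>\<^bsub>poly_ring L\<^esub> r"
      unfolding pdivides_def factor_def by auto
    \<comment> \<open>A double root puts (X - a)^2 into X^b - 1; cancelling one linear factor leaves
      \<open>a\<close> as a root of \<open>s\<close>.\<close>
    have "?q \<otimes>\<^bsub>poly_ring L\<^esub> (?q \<otimes>\<^bsub>poly_ring L\<^esub> r) = ?q \<otimes>\<^bsub>poly_ring L\<^esub> s"
    proof -
      have "?q [^]\<^bsub>poly_ring L\<^esub> (2::nat) = ?q \<otimes>\<^bsub>poly_ring L\<^esub> ?q" using q by (simp only: numeral_2_eq_2 UP.nat_pow_Suc UP.nat_pow_0 UP.l_one)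
      then have "?q \<otimes>\<^bsub>poly_ring L\<^esub> (?q \<otimes>\<^bsub>poly_ring L\<^esub> r) = ?p" using r(2) UP.m_assoc[OF q q r(1)] by (simp only:)
      then show ?thesis unfolding ps UP.m_comm[OF s q] .
    qed
    moreover have "?q \<noteq> \<zero>\<^bsub>poly_ring L\<^esub>" by (simp add: univ_poly_zero)
    ultimately have "?q \<otimes>\<^bsub>poly_ring L\<^esub> r = s" using UP.m_lcancel q r(1) s by auto
    then have "eval s a = eval ?q a \<otimes> eval r a"
      using ring_hom_mult[OF eval_is_hom[OF carrier_is_subring ra(1)] q r(1)] by simp
    moreover have "eval ?q a = \<zero>" using ra by (simp add: r_neg)
    moreover have "eval r a \<in> carrier L"
      using r(1) ra eval_in_carrier unfolding univ_poly_carrier[symmetric] polynomial_def by auto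
    ultimately have z: "eval s a = \<zero>" by simp
    \<comment> \<open>Horner evaluation adds one copy of the same power of \<open>a\<close> for each
      coefficient. For \<open>j = b\<close> this reads a s(a) = b a^b, contradicting that
      \<open>a\<close> is a root of \<open>s\<close>.\<close>
    have "eval (map (\<lambda>i. a [^] i) [0..<j]) a \<otimes> a = [j] \<cdot> (a [^] j)" for j
    proof (induction j)
      case (Suc j)
      have "eval (map (\<lambda>i. a [^] i) [0..<Suc j]) a = eval (map (\<lambda>i. a [^] i) [0..<j]) a \<otimes> a \<oplus> a [^] j"
        using eval_append_aux[of "map (\<lambda>i. a [^] i) [0..<j]" "a [^] j" a] ra by auto
      also have "\<dots> = [Suc j] \<cdot> (a [^] j)" using Suc.IH ra by simp
      finally show ?case using ra by (simp add: add_pow_ldistr[symmetric] del: add.nat_pow_Suc)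
    qed (use ra in simp)
    then have "[b] \<cdot> (a [^] b) = \<zero>" using z ra unfolding s_def by (metis l_null)
    then show False using b(2) ra by simp
  qed
  have "size (roots ?p) = b" using roots_over_carrier[OF p] deg unfolding splitted_def by simp
  moreover have "roots ?p = mset_set (set_mset (roots ?p))"
  proof (rule multiset_eqI)
    fix a show "count (roots ?p) a = count (mset_set (set_mset (roots ?p))) a"
      using mult1[of a] by (cases "a \<in># roots ?p") (auto simp: count_mset_set not_in_iff count_greater_zero_iff[symmetric] simp del: count_greater_zero_iff)
  qed
  ultimately have "card (set_mset (roots ?p)) = b" by (metis size_mset_set)
  moreover have "set_mset (roots ?p) = {x \<in> carrier L. x [^] b = \<one>}"
    using roots_mem_iff_is_root[OF p] ev p0 unfolding is_root_def by (auto simp: r_right_minus_eq)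
  ultimately show ?thesis by simp
qed

text \<open>A span that is closed under products is a subring with algebraic elements, and it
  coincides with the field extension generated by its generators. This keeps the generating list
  visible, and with it the bound on the dimension.\<close>

lemma (in field) Span_subfield:
  assumes k: "subfield k R" and us: "set us \<subseteq> carrier R" and one: "\<one> \<in> Span k us"
    and mult: "\<And>u v. \<lbrakk>u \<in> set us; v \<in> set us\<rbrakk> \<Longrightarrow> u \<otimes> v \<in> Span k us"
  shows "subfield (Span k us) R"
proof -
  let ?V = "Span k us"
  have VC: "?V \<subseteq> carrier R" by (rule Span_in_carrier[OF subfieldE(3)[OF k] us])
  note P = Span_subgroup_props[OF k us] and Sm = Span_smult_closed[OF k us] and kc = subfieldE(3)[OF k]
  have sa: "subalgebra k {x \<in> carrier R. x \<otimes> y \<in> ?V} R" if y: "y \<in> carrier R" for y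
    unfolding subalgebra_def subalgebra_axioms_def
  proof (intro conjI allI impI)
    show "subgroup {x \<in> carrier R. x \<otimes> y \<in> ?V} (add_monoid R)"
      by (rule add.subgroupI) (use y P in \<open>auto simp: l_distr l_minus intro!: exI[of _ \<zero>]\<close>)
    show "c \<otimes> v \<in> {x \<in> carrier R. x \<otimes> y \<in> ?V}" if "c \<in> k" "v \<in> {x \<in> carrier R. x \<otimes> y \<in> ?V}" for c v
      using that y kc Sm[of c "v \<otimes> y"] by (auto simp: m_assoc)
  qed
  have 1: "x \<otimes> v \<in> ?V" if "x \<in> ?V" "v \<in> set us" for x v
    using subalgebra_Span_incl[OF k sa[of v], of us] that us mult by auto
  have 2: "x \<otimes> y \<in> ?V" if x: "x \<in> ?V" and y: "y \<in> ?V" for x y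
  proof -
    have xc: "x \<in> carrier R" using x VC by auto
    have "set us \<subseteq> {z \<in> carrier R. z \<otimes> x \<in> ?V}" 
    proof
      fix z assume z: "z \<in> set us"
      then have zc: "z \<in> carrier R" using us by auto
      then show "z \<in> {z \<in> carrier R. z \<otimes> x \<in> ?V}" using 1[OF x z] m_comm[OF zc xc] by (simp del: Span.simps)
    qed
    then have "y \<in> {z \<in> carrier R. z \<otimes> x \<in> ?V}" using subalgebra_Span_incl[OF k sa[OF xc]] y by blast
    then show ?thesis using m_comm xc by auto
  qed
  have sub: "subring ?V R" by (rule subringI) (use VC one P 2 in auto)
  have kV: "k \<subseteq> ?V"
  proof
    fix c assume "c \<in> k"
    then show "c \<in> ?V" using Sm[of c \<one>] one kc by auto
  qed
  have alg: "(algebraic over k) x" if "x \<in> ?V" for x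
    using finite_dimension_imp_algebraic[OF k sub Span_finite_dimension[OF k us] that] .
  have usV: "set us \<subseteq> ?V" by (rule Span_base_incl[OF k us])
  have fe: "subfield (finite_extension k us) R" by (rule finite_extension_is_subfield[OF k us]) (use alg usV in auto)
  have "finite_extension k us \<subseteq> ?V" by (rule finite_extension_subring_incl[OF sub kV usV])
  moreover have "?V \<subseteq> finite_extension k us"
  proof (rule subalgebra_Span_incl[OF k])
    note s = subringE[OF subfieldE(1)[OF fe]]
    have kf: "k \<subseteq> finite_extension k us" by (rule finite_extension_incl[OF kc us])
    show "subalgebra k (finite_extension k us) R"
      unfolding subalgebra_def subalgebra_axioms_def using subring.axioms(1)[OF subfieldE(1)[OF fe]] s(6) kf by auto
    show "set us \<subseteq> finite_extension k us" by (rule finite_extension_mem[OF subfieldE(1)[OF k] us])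
  qed
  ultimately show ?thesis using fe by simp
qed

text \<open>Splitting off one linear factor at a time shows that roots are carried over with
  multiplicity, so no further roots can appear in \<open>S\<close>.\<close>

lemma roots_hom:
  fixes R (structure) and S
  assumes R: "field R" and S: "field S" and h: "h \<in> ring_hom R S"
    and f: "f \<in> carrier (poly_ring R)" "f \<noteq> []" "ring.splitted R f"
  shows "ring.roots S (map h f) = image_mset h (ring.roots R f)"
  using f
proof (induction "length f" arbitrary: f rule: less_induct)
  case less
  interpret R: field R by fact
  interpret S: field S by fact
  interpret H: ring_hom_ring R S h by (rule ring_hom_ringI2[OF R.ring_axioms S.ring_axioms h])
  interpret UP: domain "poly_ring R" using R.univ_poly_is_domain[OF R.carrier_is_subring] .
  have h': "h \<in> ring_hom (R\<lparr>carrier := carrier R\<rparr>) S" using h by simp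
  note mp = hom_map_poly(1)[OF R S R.carrier_is_subfield h']
  show ?case
  proof (cases "Polynomials.degree f = 0")
    case True
    then show ?thesis
      using R.degree_zero_imp_empty_roots[OF less.prems(1)] S.degree_zero_imp_empty_roots[OF mp[OF less.prems(1)]] by simp
  next
    case False
    then have "R.roots f \<noteq> {#}" using less.prems(3) unfolding R.splitted_def by auto
    then obtain a where a: "a \<in> carrier R" "[\<one>, \<ominus> a] \<in> carrier (poly_ring R)" "[\<one>, \<ominus> a] pdivides f"
      using R.not_empty_rootsE[OF less.prems(1)] by metis
    then obtain r where r: "r \<in> carrier (poly_ring R)" "f = [\<one>, \<ominus> a] \<otimes>\<^bsub>poly_ring R\<^esub> r"
      unfolding pdivides_def factor_def by auto
    have r0: "r \<noteq> []" using r less.prems(2) UP.r_null[OF a(2)] by (auto simp: univ_poly_zero)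
    have "Polynomials.degree f = Polynomials.degree [\<one>, \<ominus> a] + Polynomials.degree r"
      using R.poly_mult_degree_eq[OF R.carrier_is_subring, of "[\<one>, \<ominus> a]" r] r r0 a(2)
      by (simp add: univ_poly_mult univ_poly_carrier)
    then have len: "length r < length f" using r0 less.prems(2) by (cases r; cases f) auto
    have "r pdivides f" using r(2) UP.m_comm[OF a(2) r(1)] a(2) unfolding pdivides_def factor_def by auto
    then have spl: "R.splitted r" using R.pdivides_imp_splitted[OF r(1) less.prems(1,2,3)] by simp
    have "map h f = [\<one>\<^bsub>S\<^esub>, \<ominus>\<^bsub>S\<^esub> h a] \<otimes>\<^bsub>poly_ring S\<^esub> map h r"
      using hom_eval_add_mult(3)[OF R S R.carrier_is_subfield h' a(2) r(1) H.hom_closed[OF a(1)]] a(1) r(2) by simp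
    then have "S.roots (map h f) = add_mset (h a) (S.roots (map h r))"
      using S.poly_mult_degree_one_monic_imp_same_roots[OF H.hom_closed[OF a(1)] mp[OF r(1)]] r0 by simp
    moreover have "R.roots f = add_mset a (R.roots r)"
      using R.poly_mult_degree_one_monic_imp_same_roots[OF a(1) r(1) r0] r(2) by simp
    ultimately show ?thesis using less.hyps[OF len r(1) r0 spl] by simp
  qed
qed

lemma splitted_hom:
  assumes R: "field R" and S: "field S" and h: "h \<in> ring_hom R S"
    and f: "f \<in> carrier (poly_ring R)" "f \<noteq> []" "ring.splitted R f"
  shows "ring.splitted S (map h f)"
proof -
  interpret R: field R by fact
  interpret S: field S by fact
  show ?thesis using roots_hom[OF assms] f(3) unfolding R.splitted_def S.splitted_def by simp
qed

text \<open>Traps roots found in a larger field inside the image of the smaller one. Normality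
  reaches the algebraic closure and the completions in this way.\<close>

lemma splitted_hom_roots:
  assumes R: "field R" and S: "field S" and h: "h \<in> ring_hom R S"
    and f: "f \<in> carrier (poly_ring R)" "f \<noteq> []" "ring.splitted R f"
    and y: "y \<in> carrier S" "ring.eval S (map h f) y = \<zero>\<^bsub>S\<^esub>"
  shows "y \<in> h ` carrier R"
proof -
  interpret R: field R by fact
  interpret S: field S by fact
  have h': "h \<in> ring_hom (R\<lparr>carrier := carrier R\<rparr>) S" using h by simp
  have "map h f \<in> carrier (poly_ring S)" by (rule hom_map_poly(1)[OF R S R.carrier_is_subfield h' f(1)])
  then have "y \<in># image_mset h (R.roots f)"
    using S.roots_mem_iff_is_root y f(2) unfolding roots_hom[OF R S h f, symmetric] S.is_root_def by simp
  then obtain x where "x \<in># R.roots f" "y = h x" by auto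
  then show ?thesis using R.roots_mem_iff_is_root[OF f(1)] unfolding R.is_root_def by blast
qed

section \<open>The local degree bound\<close>

text \<open>A chain restricts along an injective group homomorphism. Triviality of the kernel makes
  the preimage of the bottom term trivial; the other conditions come from elements of
  \<open>G\<close> that are forced to be images.\<close>

lemma abelian_chain_pullback:
  assumes G: "group G" and G': "group G'" and chain: "abelian_chain G n H"
    and r: "\<And>x. x \<in> carrier G' \<Longrightarrow> \<rho> x \<in> carrier G"
    and mult: "\<And>x y. \<lbrakk>x \<in> carrier G'; y \<in> carrier G'\<rbrakk> \<Longrightarrow> \<rho> (x \<otimes>\<^bsub>G'\<^esub> y) = \<rho> x \<otimes>\<^bsub>G\<^esub> \<rho> y"
    and ker: "\<And>x. \<lbrakk>x \<in> carrier G'; \<rho> x = \<one>\<^bsub>G\<^esub>\<rbrakk> \<Longrightarrow> x = \<one>\<^bsub>G'\<^esub>"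
  shows "abelian_chain G' n (\<lambda>i. {x \<in> carrier G'. \<rho> x \<in> H i})"
proof -
  interpret G: group G by fact
  interpret G': group G' by fact
  interpret h: group_hom G' G \<rho> by (unfold_locales) (use r mult in \<open>auto simp: hom_def\<close>)
  have c: "H 0 = {\<one>\<^bsub>G\<^esub>}" "H n = carrier G"
    "\<And>i. i < n \<Longrightarrow> subgroup (H (Suc i)) G" "\<And>i. i < n \<Longrightarrow> H i \<subseteq> H (Suc i)"
    "\<And>i x c. \<lbrakk>i < n; x \<in> H (Suc i); c \<in> H i\<rbrakk> \<Longrightarrow> \<exists>c'\<in>H i. c \<otimes>\<^bsub>G\<^esub> x = x \<otimes>\<^bsub>G\<^esub> c'"
    "\<And>i x y. \<lbrakk>i < n; x \<in> H (Suc i); y \<in> H (Suc i)\<rbrakk> \<Longrightarrow> \<exists>c\<in>H i. x \<otimes>\<^bsub>G\<^esub> y = c \<otimes>\<^bsub>G\<^esub> (y \<otimes>\<^bsub>G\<^esub> x)"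
    using chain by (simp_all add: abelian_chain_def)
  show ?thesis
    unfolding abelian_chain_def
  proof (intro conjI allI impI)
    show "{x \<in> carrier G'. \<rho> x \<in> H 0} = {\<one>\<^bsub>G'\<^esub>}"
      unfolding c(1) using ker h.hom_one G'.one_closed by blast
    show "{x \<in> carrier G'. \<rho> x \<in> H n} = carrier G'" unfolding c(2) using r by blast
    fix i assume i: "i < n"
    show "subgroup {x \<in> carrier G'. \<rho> x \<in> H (Suc i)} G'"
      using subgroup.one_closed[OF c(3)[OF i]] subgroup.m_closed[OF c(3)[OF i]] subgroup.m_inv_closed[OF c(3)[OF i]]
      by (intro G'.subgroupI) (auto intro!: exI[of _ "\<one>\<^bsub>G'\<^esub>"])
    show "{x \<in> carrier G'. \<rho> x \<in> H i} \<subseteq> {x \<in> carrier G'. \<rho> x \<in> H (Suc i)}" using c(4)[OF i] by auto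
    show "\<forall>x\<in>{x \<in> carrier G'. \<rho> x \<in> H (Suc i)}. \<forall>a\<in>{x \<in> carrier G'. \<rho> x \<in> H i}. \<exists>c'\<in>{x \<in> carrier G'. \<rho> x \<in> H i}. a \<otimes>\<^bsub>G'\<^esub> x = x \<otimes>\<^bsub>G'\<^esub> c'"
    proof (intro ballI)
      fix x a assume "x \<in> {x \<in> carrier G'. \<rho> x \<in> H (Suc i)}" "a \<in> {x \<in> carrier G'. \<rho> x \<in> H i}"
      then have x: "x \<in> carrier G'" "\<rho> x \<in> H (Suc i)" and a: "a \<in> carrier G'" "\<rho> a \<in> H i" by auto
      obtain c' where c': "c' \<in> H i" "\<rho> a \<otimes>\<^bsub>G\<^esub> \<rho> x = \<rho> x \<otimes>\<^bsub>G\<^esub> c'" using c(5)[OF i x(2) a(2)] by blast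
      have c'c: "c' \<in> carrier G" using c' c(4)[OF i] subgroup.subset[OF c(3)[OF i]] by auto
      \<comment> \<open>The conjugate is formed in \<open>G'\<close>, and its image is computed to
        be the witness found in \<open>G\<close>.\<close>
      let ?c = "inv\<^bsub>G'\<^esub> x \<otimes>\<^bsub>G'\<^esub> (a \<otimes>\<^bsub>G'\<^esub> x)"
      have "\<rho> ?c = inv\<^bsub>G\<^esub> \<rho> x \<otimes>\<^bsub>G\<^esub> (\<rho> x \<otimes>\<^bsub>G\<^esub> c')" using x a c'(2) by simp
      then have "\<rho> ?c = c'" using x r[OF x(1)] c'c by (simp add: G.m_assoc[symmetric])
      moreover have "a \<otimes>\<^bsub>G'\<^esub> x = x \<otimes>\<^bsub>G'\<^esub> ?c" using x a by (simp add: G'.m_assoc[symmetric])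
      ultimately show "\<exists>c'\<in>{x \<in> carrier G'. \<rho> x \<in> H i}. a \<otimes>\<^bsub>G'\<^esub> x = x \<otimes>\<^bsub>G'\<^esub> c'"
        using c'(1) x a by (intro bexI[of _ ?c]) auto
    qed
    show "\<forall>x\<in>{x \<in> carrier G'. \<rho> x \<in> H (Suc i)}. \<forall>y\<in>{x \<in> carrier G'. \<rho> x \<in> H (Suc i)}. \<exists>c\<in>{x \<in> carrier G'. \<rho> x \<in> H i}. x \<otimes>\<^bsub>G'\<^esub> y = c \<otimes>\<^bsub>G'\<^esub> (y \<otimes>\<^bsub>G'\<^esub> x)"
    proof (intro ballI)
      fix x y assume "x \<in> {x \<in> carrier G'. \<rho> x \<in> H (Suc i)}" "y \<in> {x \<in> carrier G'. \<rho> x \<in> H (Suc i)}"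
      then have x: "x \<in> carrier G'" "\<rho> x \<in> H (Suc i)" and y: "y \<in> carrier G'" "\<rho> y \<in> H (Suc i)" by auto
      obtain c' where c': "c' \<in> H i" "\<rho> x \<otimes>\<^bsub>G\<^esub> \<rho> y = c' \<otimes>\<^bsub>G\<^esub> (\<rho> y \<otimes>\<^bsub>G\<^esub> \<rho> x)" using c(6)[OF i x(2) y(2)] by blast
      have c'c: "c' \<in> carrier G" using c' c(4)[OF i] subgroup.subset[OF c(3)[OF i]] by auto
      let ?z = "y \<otimes>\<^bsub>G'\<^esub> x"
      have zc: "?z \<in> carrier G'" using x y by simp
      let ?c = "(x \<otimes>\<^bsub>G'\<^esub> y) \<otimes>\<^bsub>G'\<^esub> inv\<^bsub>G'\<^esub> ?z"
      have "\<rho> ?c = (\<rho> x \<otimes>\<^bsub>G\<^esub> \<rho> y) \<otimes>\<^bsub>G\<^esub> inv\<^bsub>G\<^esub> (\<rho> ?z)" using x y zc by simp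
      also have "\<dots> = c'" unfolding c'(2) using x y r c'c zc by (simp add: G.m_assoc mult)
      finally have "\<rho> ?c = c'" .
      moreover have "x \<otimes>\<^bsub>G'\<^esub> y = ?c \<otimes>\<^bsub>G'\<^esub> ?z" using x y zc by (simp add: G'.m_assoc)
      ultimately show "\<exists>c\<in>{x \<in> carrier G'. \<rho> x \<in> H i}. x \<otimes>\<^bsub>G'\<^esub> y = c \<otimes>\<^bsub>G'\<^esub> (y \<otimes>\<^bsub>G'\<^esub> x)"
        using c'(1) x y zc by (intro bexI[of _ ?c]) auto
    qed
  qed
qed

lemma (in field) subfield_trans:
  assumes "subfield N R" "subfield F (R\<lparr>carrier := N\<rparr>)"
  shows "subfield F R"
proof -
  interpret N: field "R\<lparr>carrier := N\<rparr>" by (rule subfield_iff(2)[OF assms(1)])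
  have "F \<subseteq> N" using subfieldE(3)[OF assms(2)] by simp
  moreover have "field (R\<lparr>carrier := F\<rparr>)" using N.subfield_iff(2)[OF assms(2)] by simp
  ultimately show ?thesis using subfield_iff(1) subfieldE(3)[OF assms(1)] by blast
qed

lemma ring_hom_funpow:
  assumes "h \<in> ring_hom R R" shows "(h ^^ n) \<in> ring_hom R R"
proof (induction n)
  case 0 show ?case by (auto simp: ring_hom_def)
next
  case (Suc n) then show ?case using ring_hom_trans[OF Suc.IH assms] by (simp only: funpow.simps)
qed

lemma (in ring_hom_ring) subfield_preimage:
  assumes "field R" "field S" "subfield F S"
  shows "subfield {x \<in> carrier R. h x \<in> F} R"
proof -
  interpret R: field R by fact
  interpret S: field S by fact
  note s = subringE[OF subfieldE(1)[OF assms(3)]]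
  show ?thesis
  proof (rule R.subfieldI'[OF R.subringI])
    fix x assume x: "x \<in> {x \<in> carrier R. h x \<in> F} - {\<zero>\<^bsub>R\<^esub>}"
    then have u: "x \<in> Units R" "x \<in> carrier R" using R.field_Units by auto
    have e: "h x \<otimes>\<^bsub>S\<^esub> h (inv\<^bsub>R\<^esub> x) = \<one>\<^bsub>S\<^esub>" using u hom_mult[of x "inv\<^bsub>R\<^esub> x"] hom_one by simp
    have "h x \<noteq> \<zero>\<^bsub>S\<^esub>"
    proof
      assume "h x = \<zero>\<^bsub>S\<^esub>"
      then have "\<zero>\<^bsub>S\<^esub> = \<one>\<^bsub>S\<^esub>" using e hom_closed[of "inv\<^bsub>R\<^esub> x"] u by simp
      then show False by simp
    qed
    then have i: "inv\<^bsub>S\<^esub> (h x) \<in> F" "h x \<in> Units S" using S.subfield_m_inv(1)[OF assms(3), of "h x"] x S.field_Units u by auto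
    have "h (inv\<^bsub>R\<^esub> x) = inv\<^bsub>S\<^esub> (h x)" using S.comm_inv_char[of "h x" "h (inv\<^bsub>R\<^esub> x)"] e u i by auto
    then show "inv\<^bsub>R\<^esub> x \<in> {x \<in> carrier R. h x \<in> F}" using i u by simp
  qed (use s hom_one in auto)
qed

text \<open>Kummer theory is applied to \<open>N = R(\<mu>\<^sub>b)\<close> over \<open>k = k0(\<mu>\<^sub>b)\<close>, both inside an algebraically closed field;
  restriction embeds its Galois group into that of \<open>R\<close> over \<open>k0\<close>.\<close>

lemma (in padic_base) local_degree_bound_closed:
  fixes \<Omega> :: "('c, 'd) ring_scheme" and h :: "'a \<Rightarrow> 'c" and n b :: nat and H T
  assumes Om: "algebraically_closed \<Omega>" and h: "h \<in> ring_hom R \<Omega>"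
    and b: "0 < b" and fin: "finite_dimension k0 (carrier R)"
    and T: "T \<subseteq> carrier R" and gen: "\<And>F. \<lbrakk>subfield F R; k0 \<subseteq> F; T \<subseteq> F\<rbrakk> \<Longrightarrow> F = carrier R"
    and roots: "\<And>s. s \<in> T \<Longrightarrow> \<exists>f\<in>carrier (k0[X]). f \<noteq> [] \<and> eval f s = \<zero> \<and> splitted f"
    and exponent: "\<And>\<phi> x. \<phi> \<in> carrier (Gal R k0) \<Longrightarrow> x \<in> carrier R \<Longrightarrow> (\<phi> ^^ b) x = x"
    and chain: "abelian_chain (Gal R k0) n H"
  shows "\<exists>e\<le>(\<Prod>i=0..n. degree_factor b i). dimension e k0 (carrier R)"
proof -
  interpret O: algebraically_closed \<Omega> by fact
  interpret H: ring_hom_ring R \<Omega> h by (rule ring_hom_ringI2[OF ring_axioms O.ring_axioms h])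
  have one0: "\<one>\<^bsub>\<Omega>\<^esub> \<noteq> \<zero>\<^bsub>\<Omega>\<^esub>" by simp
  have inj: "inj_on h (carrier R)" and sL: "subfield (h ` carrier R) \<Omega>"
    using H.img_is_subfield[OF carrier_is_subfield one0] by auto
  define L' where "L' = h ` carrier R"
  define k1 where "k1 = h ` k0"
  define T' where "T' = h ` T"
  have sL': "subfield L' \<Omega>" unfolding L'_def by (rule sL)
  have sk1: "subfield k1 \<Omega>" unfolding k1_def by (rule H.img_is_subfield(2)[OF k0 one0])
  have k1L: "k1 \<subseteq> L'" unfolding k1_def L'_def using k0_carrier by auto
  have TL: "T' \<subseteq> L'" unfolding T'_def L'_def using T by auto
  have PO: "padic_base \<Omega> p (h ` A) k1" unfolding k1_def by (rule padic_base_hom_image[OF padic_base_axioms O.field_axioms h])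
  have char: "[n] \<cdot>\<^bsub>\<Omega>\<^esub> \<one>\<^bsub>\<Omega>\<^esub> \<noteq> \<zero>\<^bsub>\<Omega>\<^esub>" if "0 < n" for n :: nat by (rule padic_base.char_zero[OF PO that])
  obtain m where m: "dimension m k0 (carrier R)" using fin by auto
  obtain us where us: "set us \<subseteq> carrier R" "independent k0 us" "length us = m" "Span k0 us = carrier R"
    using exists_base[OF k0 m] by auto
  have LSpan: "O.Span k1 (map h us) = L'"
    unfolding k1_def L'_def using H.Span_hom[of k0 us] us k0_carrier by auto
  have husL: "set (map h us) \<subseteq> L'" using us(1) unfolding L'_def by auto
  have husc: "set (map h us) \<subseteq> carrier \<Omega>" using husL subfieldE(3)[OF sL'] by auto
  have finL: "O.finite_dimension k1 L'" using O.Span_finite_dimension[OF sk1 husc] unfolding LSpan .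
  have algL: "(O.algebraic over k1) x" if "x \<in> L'" for x
    by (rule O.finite_dimension_imp_algebraic[OF sk1 subfieldE(1)[OF sL'] finL that])
  let ?\<mu> = "{x \<in> carrier \<Omega>. x [^]\<^bsub>\<Omega>\<^esub> b = \<one>\<^bsub>\<Omega>\<^esub>}"
  have cmu: "card ?\<mu> = b" by (rule O.card_roots_of_unity_eq[OF b char[OF b]])
  have fmu: "finite ?\<mu>" by (rule O.card_roots_of_unity(1)[OF b])
  obtain ms where ms: "set ms = ?\<mu>" "length ms = b" using finite_distinct_list[OF fmu] distinct_card cmu by metis
  have msc: "set ms \<subseteq> carrier \<Omega>" using ms by auto
  \<comment> \<open>Defined as a span and not as a generated field, so that its degree over
    \<open>k1\<close> is at most the number \<open>b\<close> of spanning roots. It is a field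
    because products of roots of unity are again roots of unity.\<close>
  define k where "k = O.Span k1 ms"
  have msk: "set ms \<subseteq> k" unfolding k_def by (rule O.Span_base_incl[OF sk1 msc])
  have onek: "\<one>\<^bsub>\<Omega>\<^esub> \<in> k" using msk ms by auto
  have sk: "subfield k \<Omega>" unfolding k_def
  proof (rule O.Span_subfield[OF sk1 msc])
    show "\<one>\<^bsub>\<Omega>\<^esub> \<in> O.Span k1 ms" using onek unfolding k_def .
    show "u \<otimes>\<^bsub>\<Omega>\<^esub> v \<in> O.Span k1 ms" if "u \<in> set ms" "v \<in> set ms" for u v
    proof -
      have "u \<otimes>\<^bsub>\<Omega>\<^esub> v \<in> ?\<mu>" using that unfolding ms(1) by (auto simp: O.nat_pow_distrib)
      then show ?thesis using msk ms(1) unfolding k_def by auto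
    qed
  qed
  have k1k: "k1 \<subseteq> k"
  proof
    fix c assume c: "c \<in> k1"
    have "c \<otimes>\<^bsub>\<Omega>\<^esub> \<one>\<^bsub>\<Omega>\<^esub> \<in> k" unfolding k_def using O.Span_smult_closed[OF sk1 msc c] onek unfolding k_def by blast
    then show "c \<in> k" using c subfieldE(3)[OF sk1] by auto
  qed
  \<comment> \<open>The compositum of \<open>k\<close> and \<open>L'\<close>.\<close>
  define N where "N = O.finite_extension k (map h us)"
  have algk: "(O.algebraic over k) x" if "x \<in> set (map h us)" for x
    using O.algebraic_mono[OF k1k algL] husL that by blast
  have sN: "subfield N \<Omega>" unfolding N_def by (rule O.finite_extension_is_subfield[OF sk husc algk])
  have finN: "O.finite_dimension k N" unfolding N_def by (rule O.finite_extension_finite_dimension(1)[OF sk husc algk])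
  have kN: "k \<subseteq> N" unfolding N_def by (rule O.finite_extension_incl[OF subfieldE(3)[OF sk] husc])
  have husN: "set (map h us) \<subseteq> N" unfolding N_def by (rule O.finite_extension_mem[OF subfieldE(1)[OF sk] husc])
  have LN: "L' \<subseteq> N"
    unfolding LSpan[symmetric]
  proof (rule O.subalgebra_Span_incl[OF sk1 _ husN])
    show "subalgebra k1 N \<Omega>" unfolding subalgebra_def subalgebra_axioms_def
      using subring.axioms(1)[OF subfieldE(1)[OF sN]] subringE(6)[OF subfieldE(1)[OF sN]] k1k kN by blast
  qed
  have genL: "L' \<subseteq> F" if F: "subfield F \<Omega>" "k1 \<subseteq> F" "T' \<subseteq> F" for F
  proof -
    have "{x \<in> carrier R. h x \<in> F} = carrier R"
      by (rule gen[OF H.subfield_preimage[OF field_axioms O.field_axioms F(1)]])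
        (use F(2,3) k0_carrier T in \<open>auto simp: k1_def T'_def\<close>)
    then show ?thesis unfolding L'_def by blast
  qed
  have genN: "N \<subseteq> F" if F: "subfield F \<Omega>" "k \<subseteq> F" "T' \<subseteq> F" for F
    unfolding N_def
    by (rule O.finite_extension_subring_incl[OF subfieldE(1)[OF F(1)] F(2)])
      (use genL[OF F(1) _ F(3)] k1k F(2) husL in blast)
  have rootsL: "\<exists>f\<in>carrier (k1[X]\<^bsub>\<Omega>\<^esub>). f \<noteq> [] \<and> O.eval f s = \<zero>\<^bsub>\<Omega>\<^esub> \<and> (\<forall>y\<in>carrier \<Omega>. O.eval f y = \<zero>\<^bsub>\<Omega>\<^esub> \<longrightarrow> y \<in> L')" if s: "s \<in> T'" for s
  proof -
    obtain t where t: "t \<in> T" "s = h t" using s unfolding T'_def by auto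
    obtain f where f: "f \<in> carrier (k0[X])" "f \<noteq> []" "eval f t = \<zero>" "splitted f" using roots[OF t(1)] by auto
    have fR: "f \<in> carrier (poly_ring R)" by (rule carrier_polynomial_shell[OF subfieldE(1)[OF k0] f(1)])
    have tc: "t \<in> carrier R" using t T by auto
    have "map h f \<in> carrier (k1[X]\<^bsub>\<Omega>\<^esub>)" unfolding k1_def by (rule H.subfield_polynomial_hom[OF k0 one0 f(1)])
    moreover have "O.eval (map h f) s = \<zero>\<^bsub>\<Omega>\<^esub>"
      using H.eval_hom[OF subfieldE(1)[OF k0] tc f(1)] f(3) t(2) by simp
    moreover have "y \<in> L'" if "y \<in> carrier \<Omega>" "O.eval (map h f) y = \<zero>\<^bsub>\<Omega>\<^esub>" for y
      unfolding L'_def by (rule splitted_hom_roots[OF field_axioms O.field_axioms h fR f(2,4) that])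
    ultimately show ?thesis using f(2) by (intro bexI[of _ "map h f"]) auto
  qed
  interpret NC: normal_closed \<Omega> k N T'
  proof (intro normal_closed.intro normal_subfield.intro normal_subfield_axioms.intro normal_closed_axioms.intro)
    show "(O.algebraic over k) x" if "x \<in> N" for x
      by (rule O.finite_dimension_imp_algebraic[OF sk subfieldE(1)[OF sN] finN that])
    show "\<exists>f\<in>carrier (k[X]\<^bsub>\<Omega>\<^esub>). f \<noteq> [] \<and> O.eval f s = \<zero>\<^bsub>\<Omega>\<^esub> \<and> (\<forall>y\<in>carrier \<Omega>. O.eval f y = \<zero>\<^bsub>\<Omega>\<^esub> \<longrightarrow> y \<in> N)" if "s \<in> T'" for s
    proof -
      obtain f where f: "f \<in> carrier (k1[X]\<^bsub>\<Omega>\<^esub>)" "f \<noteq> []" "O.eval f s = \<zero>\<^bsub>\<Omega>\<^esub>" "\<And>y. y \<in> carrier \<Omega> \<Longrightarrow> O.eval f y = \<zero>\<^bsub>\<Omega>\<^esub> \<Longrightarrow> y \<in> L'"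
        using rootsL[OF \<open>s \<in> T'\<close>] by blast
      have "f \<in> carrier (k[X]\<^bsub>\<Omega>\<^esub>)" using f(1) k1k unfolding univ_poly_carrier[symmetric] polynomial_def by auto
      then show ?thesis using f LN by blast
    qed
  qed (use Om O.field_axioms sk sN kN char TL LN genN in auto)
  interpret NL: normal_closed \<Omega> k1 L' T'
    by (intro normal_closed.intro normal_subfield.intro normal_subfield_axioms.intro normal_closed_axioms.intro)
      (use Om O.field_axioms sk1 sL' k1L char TL genL rootsL algL in auto)
  let ?NN = "\<Omega>\<lparr>carrier := N\<rparr>"
  have fN: "field ?NN" by (rule O.subfield_iff(2)[OF sN])
  interpret NF: field ?NN by (rule fN)
  have hN: "h \<in> ring_hom R ?NN"
    using ring_hom_carrier_restrict[OF h, of "carrier R" N] LN unfolding L'_def by simp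
  interpret HN: ring_hom_ring R ?NN h by (rule ring_hom_ringI2[OF ring_axioms NF.ring_axioms hN])
  interpret PN: padic_base ?NN p "h ` A" k1 unfolding k1_def by (rule padic_base_hom_image[OF padic_base_axioms fN hN])
  have kNN: "subfield k ?NN" by (rule O.subfield_subfield[OF sk sN kN])
  have SpanN: "NF.Span = O.Span" by (rule O.Span_consistent[OF subfieldE(1)[OF sN]])
  have k1N: "subfield k1 ?NN" using PN.k0 .
  have dk: "\<exists>d\<le>b. NF.dimension d k1 k"
    using NF.Span_dimension_le[OF k1N, of ms] msk kN ms(2) unfolding SpanN k_def[symmetric] by auto
  then obtain d where d: "d \<le> b" "NF.dimension d k1 k" by auto
  \<comment> \<open>The tower starts from \<open>degree_factor b 0\<close>, which is
    \<open>b ^ 3\<close>; the degree at most \<open>b\<close> fits with room to spare.\<close>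
  have d3: "d \<le> b ^ 3" using d(1) self_le_power[of b 3] b by simp
  have muN: "{x \<in> carrier ?NN. x [^]\<^bsub>?NN\<^esub> b = \<one>\<^bsub>?NN\<^esub>} = ?\<mu>"
    using msk kN ms(1) subfieldE(3)[OF sN] by (auto simp: nat_pow_def)
  let ?G = "Gal ?NN k"
  have finG: "finite (carrier ?G)"
  proof (rule finite_Gal[OF fN kNN])
    obtain j where j: "O.dimension j k N" using finN by auto
    obtain vs where vs: "set vs \<subseteq> carrier \<Omega>" "O.Span k vs = N" using O.exists_base[OF sk j] by auto
    have "set vs \<subseteq> N" using O.Span_base_incl[OF sk vs(1)] vs(2) by simp
    then show "NF.finite_dimension k (carrier ?NN)" using NF.Span_finite_dimension[OF kNN, of vs] vs(2) unfolding SpanN by simp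
  qed
  \<comment> \<open>\<open>N\<close> is generated by \<open>k\<close> and \<open>L'\<close>, so an
    endomorphism trivial on both is trivial. This gives the injectivity of restriction and carries
    the exponent condition from \<open>L'\<close> to \<open>N\<close>.\<close>
  have agree: "\<phi> z = z" if ph: "\<phi> \<in> ring_hom ?NN ?NN" "\<And>x. x \<in> k \<Longrightarrow> \<phi> x = x" "\<And>x. x \<in> L' \<Longrightarrow> \<phi> x = x" and z: "z \<in> N" for \<phi> z
  proof -
    have sf: "subfield (fixed_field ?NN {\<phi>}) ?NN" by (rule fixed_field_subfield[OF fN]) (use ph(1) in simp)
    have "N \<subseteq> fixed_field ?NN {\<phi>}"
    proof (rule genN[OF O.subfield_trans[OF sN sf]])
      show "k \<subseteq> fixed_field ?NN {\<phi>}" using ph(2) kN by (auto simp: fixed_field_def)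
      show "T' \<subseteq> fixed_field ?NN {\<phi>}" using ph(3) TL LN by (auto simp: fixed_field_def)
    qed
    then show ?thesis using z by (auto simp: fixed_field_def)
  qed
  \<comment> \<open>Restriction of an automorphism of \<open>N\<close> to \<open>L'\<close>,
    transported back to \<open>R\<close> along \<open>h\<close>; it makes sense because
    \<open>L'\<close> is normal over \<open>k1\<close>.\<close>
  define \<rho> where "\<rho> \<gamma> = restrict (\<lambda>x. inv_into (carrier R) h (\<gamma> (h x))) (carrier R)" for \<gamma>
  have bijL: "bij_betw \<gamma> L' L'" if g: "\<gamma> \<in> carrier ?G" for \<gamma>
  proof (rule NL.hom_image)
    have "\<gamma> \<in> ring_hom ?NN ?NN" by (rule Gal_hom[OF g])
    then have "\<gamma> \<in> ring_hom (?NN\<lparr>carrier := L'\<rparr>) (?NN\<lparr>carrier := carrier \<Omega>\<rparr>)"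
      by (rule ring_hom_carrier_restrict)
        (use LN ring_hom_closed[OF Gal_hom[OF g]] subfieldE(3)[OF sN] in auto)
    then show "\<gamma> \<in> ring_hom (\<Omega>\<lparr>carrier := L'\<rparr>) \<Omega>" by simp
    show "\<gamma> x = x" if "x \<in> k1" for x using Gal_fix[OF g] that k1k by auto
  qed
  have hr: "h (\<rho> \<gamma> x) = \<gamma> (h x)" "\<rho> \<gamma> x \<in> carrier R" if g: "\<gamma> \<in> carrier ?G" and x: "x \<in> carrier R" for \<gamma> x
  proof -
    have "\<gamma> (h x) \<in> h ` carrier R" using bijL[OF g] x unfolding L'_def bij_betw_def by auto
    then show "h (\<rho> \<gamma> x) = \<gamma> (h x)" "\<rho> \<gamma> x \<in> carrier R" using x unfolding \<rho>_def by (auto simp: f_inv_into_f inv_into_into)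
  qed
  have heq: "x = y" if "h x = h y" "x \<in> carrier R" "y \<in> carrier R" for x y using inj that by (auto dest: inj_onD)
  have rG: "\<rho> \<gamma> \<in> carrier (Gal R k0)" if g: "\<gamma> \<in> carrier ?G" for \<gamma>
  proof -
    define g0 where "g0 = (\<lambda>x. inv_into (carrier R) h (\<gamma> (h x)))"
    have f: "h (g0 x) = \<gamma> (h x)" "g0 x \<in> carrier R" if "x \<in> carrier R" for x using hr[OF g that] that unfolding \<rho>_def g0_def by auto
    have hh: "h x \<in> N" if "x \<in> carrier R" for x using LN that unfolding L'_def by auto
    show ?thesis unfolding \<rho>_def g0_def[symmetric]
    proof (rule GalI)
      show "g0 \<in> ring_hom R R"
      proof (rule ring_hom_memI)
        show "g0 x \<in> carrier R" if "x \<in> carrier R" for x using f(2)[OF that] .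
        fix x y assume xy: "x \<in> carrier R" "y \<in> carrier R"
        show "g0 (x \<otimes> y) = g0 x \<otimes> g0 y"
          by (rule heq) (use xy f hh ring_hom_mult[OF Gal_hom[OF g], of "h x" "h y"] in auto)
        show "g0 (x \<oplus> y) = g0 x \<oplus> g0 y"
          by (rule heq) (use xy f hh ring_hom_add[OF Gal_hom[OF g], of "h x" "h y"] in auto)
      next
        show "g0 \<one> = \<one>" by (rule heq) (use f ring_hom_one[OF Gal_hom[OF g]] H.hom_one in auto)
      qed
      have "bij_betw h (carrier R) L'" using inj unfolding L'_def bij_betw_def by auto
      then have "bij_betw (inv_into (carrier R) h \<circ> (\<gamma> \<circ> h)) (carrier R) (carrier R)"
        using bij_betw_trans[OF bij_betw_trans[OF _ bijL[OF g]] bij_betw_inv_into] by blast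
      then show "bij_betw g0 (carrier R) (carrier R)" unfolding g0_def by (simp add: comp_def)
      show "g0 x = x" if "x \<in> k0" for x
      proof (rule heq)
        have xc: "x \<in> carrier R" using that k0_carrier by auto
        show "h (g0 x) = h x" using f(1)[OF xc] Gal_fix[OF g, of "h x"] that k1k unfolding k1_def by auto
        show "g0 x \<in> carrier R" "x \<in> carrier R" using f(2)[OF xc] xc by auto
      qed
      show "k0 \<subseteq> carrier R" using k0_carrier by auto
      show "field R" by (rule field_axioms)
    qed
  qed
  have rmult: "\<rho> (\<gamma> \<otimes>\<^bsub>?G\<^esub> \<delta>) = \<rho> \<gamma> \<otimes>\<^bsub>Gal R k0\<^esub> \<rho> \<delta>" if g: "\<gamma> \<in> carrier ?G" "\<delta> \<in> carrier ?G" for \<gamma> \<delta>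
  proof -
    have gd: "\<gamma> \<otimes>\<^bsub>?G\<^esub> \<delta> \<in> carrier ?G"
      using group.is_monoid[OF group_Gal[OF fN, of k]] kN g monoid.m_closed by fastforce
    have "\<rho> (\<gamma> \<otimes>\<^bsub>?G\<^esub> \<delta>) x = compose (carrier R) (\<rho> \<gamma>) (\<rho> \<delta>) x" if x: "x \<in> carrier R" for x
    proof (rule heq)
      have hx: "h x \<in> N" using LN x unfolding L'_def by auto
      show "h (\<rho> (\<gamma> \<otimes>\<^bsub>?G\<^esub> \<delta>) x) = h (compose (carrier R) (\<rho> \<gamma>) (\<rho> \<delta>) x)"
        using hr[OF gd x] hr[OF g(2) x] hr[OF g(1), of "\<rho> \<delta> x"] Gal_mult[OF g] x hx by (simp add: compose_def)
      show "\<rho> (\<gamma> \<otimes>\<^bsub>?G\<^esub> \<delta>) x \<in> carrier R" by (rule hr(2)[OF gd x])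
      show "compose (carrier R) (\<rho> \<gamma>) (\<rho> \<delta>) x \<in> carrier R"
        using hr(2)[OF g(1) hr(2)[OF g(2) x]] x by (simp add: compose_def)
    qed
    then have "\<rho> (\<gamma> \<otimes>\<^bsub>?G\<^esub> \<delta>) = compose (carrier R) (\<rho> \<gamma>) (\<rho> \<delta>)"
      by (intro extensionalityI[of _ "carrier R"]) (auto simp: \<rho>_def compose_def)
    then show ?thesis unfolding Gal_mult[OF rG[OF g(1)] rG[OF g(2)]] .
  qed
  have ker: "\<gamma> = \<one>\<^bsub>?G\<^esub>" if g: "\<gamma> \<in> carrier ?G" "\<rho> \<gamma> = \<one>\<^bsub>Gal R k0\<^esub>" for \<gamma>
  proof -
    have "\<gamma> y = y" if y: "y \<in> L'" for y
    proof -
      obtain x where x: "x \<in> carrier R" "y = h x" using y unfolding L'_def by auto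
      then show ?thesis using hr(1)[OF g(1) x(1)] g(2) by (simp add: Gal_simps)
    qed
    then have id: "\<gamma> z = z" if "z \<in> N" for z using agree[OF Gal_hom[OF g(1)] Gal_fix[OF g(1)]] that by blast
    show ?thesis unfolding Gal_simps
      by (rule extensionalityI[of _ N]) (use id g(1) in \<open>auto simp: Gal_simps Bij_def\<close>)
  qed
  \<comment> \<open>The b-th iterate fixes \<open>k\<close> pointwise, and on \<open>L'\<close> it
    is the b-th iterate of an automorphism of \<open>R\<close> over \<open>k0\<close>.\<close>
  have expN: "(\<gamma> ^^ b) z = z" if g: "\<gamma> \<in> carrier ?G" and z: "z \<in> carrier ?NN" for \<gamma> z
  proof (rule agree[OF ring_hom_funpow[OF Gal_hom[OF g]]])
    show "(\<gamma> ^^ b) x = x" if "x \<in> k" for x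
    proof -
      have "(\<gamma> ^^ j) x = x" for j by (induction j) (use Gal_fix[OF g that] in auto)
      then show ?thesis .
    qed
    show "(\<gamma> ^^ b) y = y" if "y \<in> L'" for y
    proof -
      obtain x where x: "x \<in> carrier R" "y = h x" using \<open>y \<in> L'\<close> unfolding L'_def by auto
      have "(\<gamma> ^^ j) y = h ((\<rho> \<gamma> ^^ j) x) \<and> (\<rho> \<gamma> ^^ j) x \<in> carrier R" for j
        by (induction j) (use x hr[OF g] in auto)
      then show ?thesis using exponent[OF rG[OF g] x(1)] x(2) by simp
    qed
    show "z \<in> N" using z by simp
  qed
  have chN: "abelian_chain ?G n (\<lambda>i. {x \<in> carrier ?G. \<rho> x \<in> H i})"
  proof (rule abelian_chain_pullback[OF _ _ chain rG rmult ker])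
    show "group (Gal R k0)" by (rule group_Gal[OF field_axioms]) (use k0_carrier in auto)
    show "group ?G" by (rule group_Gal[OF fN]) (use kN in auto)
  qed
  obtain e where e: "e \<le> (\<Prod>i=0..n. degree_factor b i)" "NF.dimension e k1 (carrier ?NN)"
    using PN.kummer_tower[OF kNN d(2) d3 k1k b _ _ finG NC.fixed_field_Gal expN chN] cmu msk ms(1)
    unfolding muN by auto
  \<comment> \<open>The bound was obtained for \<open>N\<close>; a basis of \<open>R\<close> stays
    independent in \<open>N\<close>, so \<open>R\<close> has no larger degree over the base
    field.\<close>
  have "NF.independent (h ` k0) (map h us)"
    by (rule HN.inj_hom_preserves_independent[OF k0 _ _ us(2)]) (use us(4) inj in auto)
  then have "length (map h us) \<le> e"
    using NF.independent_length_le_dimension[OF k1N e(2), of "map h us"] husN unfolding k1_def by auto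
  then show ?thesis using m us(3) e(1) by (intro exI[of _ m]) auto
qed

text \<open>An algebraic closure of \<open>R\<close> supplies the ambient field in which the roots
  of unity are adjoined.\<close>

theorem (in padic_base) local_degree_bound:
  fixes n b :: nat and H T
  assumes "0 < b" and "finite_dimension k0 (carrier R)"
    and "T \<subseteq> carrier R" and "\<And>F. \<lbrakk>subfield F R; k0 \<subseteq> F; T \<subseteq> F\<rbrakk> \<Longrightarrow> F = carrier R"
    and "\<And>s. s \<in> T \<Longrightarrow> \<exists>f\<in>carrier (k0[X]). f \<noteq> [] \<and> eval f s = \<zero> \<and> splitted f"
    and "\<And>\<phi> x. \<phi> \<in> carrier (Gal R k0) \<Longrightarrow> x \<in> carrier R \<Longrightarrow> (\<phi> ^^ b) x = x"
    and "abelian_chain (Gal R k0) n H"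
  shows "\<exists>e\<le>(\<Prod>i=0..n. degree_factor b i). dimension e k0 (carrier R)"
proof -
  interpret C: algebraic_closure alg_closure "indexed_const ` carrier R" by (rule alg_closureE(1))
  show ?thesis
    by (rule local_degree_bound_closed[OF C.algebraically_closed_axioms alg_closureE(2) assms])
qed

section \<open>Completions\<close>

locale valued = field E for E (structure) +
  fixes v :: "'a \<Rightarrow> ereal"
  assumes val: "valuation E v"
begin

lemma v_finite: "x \<in> carrier E \<Longrightarrow> x \<noteq> \<zero> \<Longrightarrow> \<exists>r. v x = ereal r"
  using val unfolding valuation_def by (cases "v x") auto

lemma v_zero: "v \<zero> = \<infinity>" using val unfolding valuation_def by auto

lemma v_mult: "x \<in> carrier E \<Longrightarrow> y \<in> carrier E \<Longrightarrow> v (x \<otimes> y) = v x + v y"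
  using val unfolding valuation_def by auto

lemma v_one: "v \<one> = 0"
proof -
  obtain r where r: "v \<one> = ereal r" using v_finite[of \<one>] by auto
  have "v (\<one> \<otimes> \<one>) = v \<one> + v \<one>" by (rule v_mult) auto
  then have "v \<one> = v \<one> + v \<one>" by simp
  then show ?thesis unfolding r by simp
qed

lemma v_minus: assumes "x \<in> carrier E" shows "v (\<ominus> x) = v x"
proof -
  obtain r where r: "v (\<ominus> \<one>) = ereal r"
  proof (rule exE[OF v_finite[of "\<ominus> \<one>"]])
    show "\<ominus> \<one> \<noteq> \<zero>" by (metis add.inv_eq_1_iff one_closed one_not_zero)
  qed auto
  have "v (\<ominus> \<one> \<otimes> \<ominus> \<one>) = v (\<ominus> \<one>) + v (\<ominus> \<one>)" by (rule v_mult) auto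
  moreover have "\<ominus> \<one> \<otimes> \<ominus> \<one> = \<one>" by (simp add: l_minus r_minus)
  ultimately have "v (\<ominus> \<one>) = 0" using v_one r by (simp add: zero_ereal_def)
  moreover have "\<ominus> x = \<ominus> \<one> \<otimes> x" using assms by (simp add: l_minus)
  ultimately show ?thesis using v_mult[of "\<ominus> \<one>" x] assms by simp
qed

abbreviation V :: "real \<Rightarrow> 'a \<Rightarrow> bool" where "V c x \<equiv> ereal c \<le> v x"

lemma V_zero: "V c \<zero>" using v_zero by simp

lemma V_all_zero: assumes "x \<in> carrier E" "\<And>c. V c x" shows "x = \<zero>"
proof (rule ccontr)
  assume "x \<noteq> \<zero>"
  then obtain r where "v x = ereal r" using v_finite assms by auto
  then show False using assms(2)[of "r + 1"] by simp
qed

lemma V_ex: "x \<in> carrier E \<Longrightarrow> \<exists>c. V c x"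
  using v_finite[of x] v_zero by (cases "x = \<zero>") auto

lemma V_mono: "V c x \<Longrightarrow> d \<le> c \<Longrightarrow> V d x"
  by (meson ereal_less_eq(3) order_trans)

lemma V_add: assumes "x \<in> carrier E" "y \<in> carrier E" "V c x" "V c y" shows "V c (x \<oplus> y)"
proof -
  have "ereal c \<le> min (v x) (v y)" using assms by simp
  also have "\<dots> \<le> v (x \<oplus> y)" using val assms(1,2) unfolding valuation_def by blast
  finally show ?thesis .
qed

lemma V_minus: "x \<in> carrier E \<Longrightarrow> V c (\<ominus> x) = V c x" using v_minus by simp

lemma V_diff: "x \<in> carrier E \<Longrightarrow> y \<in> carrier E \<Longrightarrow> V c x \<Longrightarrow> V c y \<Longrightarrow> V c (x \<ominus> y)"
  unfolding a_minus_def using V_add V_minus by simp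

lemma V_shift: "x \<in> carrier E \<Longrightarrow> y \<in> carrier E \<Longrightarrow> V c (x \<ominus> y) \<Longrightarrow> V c y \<Longrightarrow> V c x"
proof -
  assume c: "x \<in> carrier E" "y \<in> carrier E" and V: "V c (x \<ominus> y)" "V c y"
  have "x = (x \<ominus> y) \<oplus> y" using c by algebra
  then show ?thesis using V_add[of "x \<ominus> y" y c] V c by simp
qed

lemma V_mult: "x \<in> carrier E \<Longrightarrow> y \<in> carrier E \<Longrightarrow> V c x \<Longrightarrow> V d y \<Longrightarrow> V (c + d) (x \<otimes> y)"
  using v_mult[of x y] add_mono[of "ereal c" "v x" "ereal d" "v y"] by simp

lemma V_inv: assumes "x \<in> carrier E" "x \<noteq> \<zero>" "\<not> V c x" shows "V (- c) (inv x)"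
proof -
  obtain r where r: "v x = ereal r" using v_finite assms by auto
  have i: "inv x \<in> carrier E" "x \<otimes> inv x = \<one>" using assms field_Units by auto
  have "v x + v (inv x) = 0" using v_mult[of x "inv x"] i assms(1) v_one by simp
  then have "v (inv x) = ereal (- r)" unfolding r by (cases "v (inv x)") (auto simp: zero_ereal_def)
  then show ?thesis using assms(3) r by simp
qed

lemma cauchy_iff:
  "s \<in> cauchy_seqs E v \<longleftrightarrow> (\<forall>i. s i \<in> carrier E) \<and> (\<forall>C. \<exists>N. \<forall>i\<ge>N. \<forall>j\<ge>N. V C (s i \<ominus> s j))"
proof -
  have "(\<forall>C. \<exists>N. \<forall>i\<ge>N. \<forall>j\<ge>N. ereal C < v (s i \<ominus> s j)) = (\<forall>C. \<exists>N. \<forall>i\<ge>N. \<forall>j\<ge>N. V C (s i \<ominus> s j))" (is "?l = ?r")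
  proof
    assume ?l then show ?r using less_imp_le by meson
  next
    assume r: ?r
    show ?l
    proof
      fix C
      obtain N where N: "\<And>i j. i \<ge> N \<Longrightarrow> j \<ge> N \<Longrightarrow> V (C + 1) (s i \<ominus> s j)" using r by meson
      have "ereal C < ereal (C + 1)" by simp
      then show "\<exists>N. \<forall>i\<ge>N. \<forall>j\<ge>N. ereal C < v (s i \<ominus> s j)" using N by (meson less_le_trans)
    qed
  qed
  then show ?thesis unfolding cauchy_seqs_def by simp
qed

text \<open>Only the tail of the sequence is tested, so that the condition depends on the class
  modulo null sequences alone.\<close>

definition ball :: "real \<Rightarrow> (nat \<Rightarrow> 'a) \<Rightarrow> bool" where
  "ball c s \<longleftrightarrow> (\<exists>N. \<forall>i\<ge>N. V c (s i))"

lemma null_iff: "s \<in> null_seqs E v \<longleftrightarrow> (\<forall>i. s i \<in> carrier E) \<and> (\<forall>c. ball c s)"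
proof -
  have "((\<lambda>i. v (s i)) \<longlonglongrightarrow> \<infinity>) = (\<forall>c. ball c s)"
    unfolding tendsto_PInfty ball_def eventually_sequentially
  proof (intro iffI allI)
    fix c assume a: "\<forall>r. \<exists>N. \<forall>n\<ge>N. ereal r < v (s n)"
    then show "\<exists>N. \<forall>i\<ge>N. V c (s i)" by (meson less_imp_le)
  next
    fix r assume a: "\<forall>c. \<exists>N. \<forall>i\<ge>N. V c (s i)"
    obtain N where "\<And>i. i \<ge> N \<Longrightarrow> V (r + 1) (s i)" using a by meson
    moreover have "ereal r < ereal (r + 1)" by simp
    ultimately show "\<exists>N. \<forall>n\<ge>N. ereal r < v (s n)" by (meson less_le_trans)
  qed
  then show ?thesis unfolding null_seqs_def by simp
qed

lemma cauchyD: "s \<in> cauchy_seqs E v \<Longrightarrow> s i \<in> carrier E" by (simp add: cauchy_iff)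

lemma cauchyE:
  assumes "s \<in> cauchy_seqs E v"
  obtains N where "\<And>i j. i \<ge> N \<Longrightarrow> j \<ge> N \<Longrightarrow> V c (s i \<ominus> s j)"
  using assms unfolding cauchy_iff by meson

lemma cauchy_bounded:
  assumes s: "s \<in> cauchy_seqs E v"
  shows "\<exists>B. \<forall>i. V B (s i)"
proof -
  have sc: "s i \<in> carrier E" for i by (rule cauchyD[OF s])
  obtain N where N: "\<And>i j. i \<ge> N \<Longrightarrow> j \<ge> N \<Longrightarrow> V 0 (s i \<ominus> s j)" using cauchyE[OF s] by blast
  obtain f where f: "\<And>i. V (f i) (s i)" using V_ex[OF sc] by metis
  let ?B = "Min (insert 0 (f ` {..N}))"
  have small: "V ?B (s i)" if "i \<le> N" for i
  proof (rule V_mono[OF f])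
    show "?B \<le> f i" by (rule Min_le) (use that in auto)
  qed
  have "V ?B (s i)" for i
  proof (cases "i \<le> N")
    case False
    then have "V 0 (s i \<ominus> s N)" using N by auto
    then have "V ?B (s i \<ominus> s N)" by (rule V_mono) simp
    then show ?thesis using V_shift[OF sc sc _ small[of N]] by blast
  qed (rule small)
  then show ?thesis by blast
qed

lemma cauchy_const: "x \<in> carrier E \<Longrightarrow> (\<lambda>_. x) \<in> cauchy_seqs E v"
  by (simp add: cauchy_iff a_minus_def r_neg v_zero)

lemma cauchy_add:
  assumes s: "s \<in> cauchy_seqs E v" and t: "t \<in> cauchy_seqs E v"
  shows "(\<lambda>i. s i \<oplus> t i) \<in> cauchy_seqs E v"
  unfolding cauchy_iff
proof (intro conjI allI)
  fix C
  obtain N where N: "\<And>i j. i \<ge> N \<Longrightarrow> j \<ge> N \<Longrightarrow> V C (s i \<ominus> s j)" using cauchyE[OF s] by blast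
  obtain M where M: "\<And>i j. i \<ge> M \<Longrightarrow> j \<ge> M \<Longrightarrow> V C (t i \<ominus> t j)" using cauchyE[OF t] by blast
  have "V C ((s i \<oplus> t i) \<ominus> (s j \<oplus> t j))" if "i \<ge> max N M" "j \<ge> max N M" for i j
  proof -
    have c: "s i \<in> carrier E" "t i \<in> carrier E" "s j \<in> carrier E" "t j \<in> carrier E" using cauchyD s t by auto
    have "(s i \<oplus> t i) \<ominus> (s j \<oplus> t j) = (s i \<ominus> s j) \<oplus> (t i \<ominus> t j)" using c by algebra
    then show ?thesis using V_add[of "s i \<ominus> s j" "t i \<ominus> t j" C] N[of i j] M[of i j] that c by simp
  qed
  then show "\<exists>N. \<forall>i\<ge>N. \<forall>j\<ge>N. V C ((s i \<oplus> t i) \<ominus> (s j \<oplus> t j))" by blast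
qed (use cauchyD s t in auto)

lemma cauchy_mult:
  assumes s: "s \<in> cauchy_seqs E v" and t: "t \<in> cauchy_seqs E v"
  shows "(\<lambda>i. s i \<otimes> t i) \<in> cauchy_seqs E v"
  unfolding cauchy_iff
proof (intro conjI allI)
  fix C
  obtain B where B: "\<And>i. V B (s i)" using cauchy_bounded[OF s] by blast
  obtain D where D: "\<And>i. V D (t i)" using cauchy_bounded[OF t] by blast
  obtain N where N: "\<And>i j. i \<ge> N \<Longrightarrow> j \<ge> N \<Longrightarrow> V (C - D) (s i \<ominus> s j)" using cauchyE[OF s] by blast
  obtain M where M: "\<And>i j. i \<ge> M \<Longrightarrow> j \<ge> M \<Longrightarrow> V (C - B) (t i \<ominus> t j)" using cauchyE[OF t] by blast
  have "V C ((s i \<otimes> t i) \<ominus> (s j \<otimes> t j))" if "i \<ge> max N M" "j \<ge> max N M" for i j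
  proof -
    have c: "s i \<in> carrier E" "t i \<in> carrier E" "s j \<in> carrier E" "t j \<in> carrier E" using cauchyD s t by auto
    have eq: "(s i \<otimes> t i) \<ominus> (s j \<otimes> t j) = s i \<otimes> (t i \<ominus> t j) \<oplus> (s i \<ominus> s j) \<otimes> t j" using c by algebra
    have "V (B + (C - B)) (s i \<otimes> (t i \<ominus> t j))" by (rule V_mult) (use c B M that in auto)
    moreover have "V ((C - D) + D) ((s i \<ominus> s j) \<otimes> t j)" by (rule V_mult) (use c D N that in auto)
    ultimately show ?thesis unfolding eq using V_add c by simp
  qed
  then show "\<exists>N. \<forall>i\<ge>N. \<forall>j\<ge>N. V C ((s i \<otimes> t i) \<ominus> (s j \<otimes> t j))" by blast
qed (use cauchyD s t in auto)

lemma cauchy_minus: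
  assumes s: "s \<in> cauchy_seqs E v"
  shows "(\<lambda>i. \<ominus> s i) \<in> cauchy_seqs E v"
  using cauchy_mult[OF cauchy_const[of "\<ominus> \<one>"] s] cauchyD[OF s] by (simp add: l_minus)

text \<open>A Cauchy sequence that is not null is eventually bounded away from zero: one late term
  outside the ball of level \<open>C\<close> keeps all later terms outside it. The value
  \<open>\<one>\<close> at zero terms affects only finitely many indices.\<close>

lemma cauchy_inverse:
  assumes s: "s \<in> cauchy_seqs E v" and nn: "s \<notin> null_seqs E v"
  shows "(\<lambda>i. if s i = \<zero> then \<one> else inv (s i)) \<in> cauchy_seqs E v" (is "?t \<in> _")
    and "\<exists>N. \<forall>i\<ge>N. s i \<noteq> \<zero>"
proof -
  have sc: "s i \<in> carrier E" for i by (rule cauchyD[OF s])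
  obtain C where C: "\<not> ball C s" using nn sc unfolding null_iff by blast
  obtain N where N: "\<And>i j. i \<ge> N \<Longrightarrow> j \<ge> N \<Longrightarrow> V C (s i \<ominus> s j)" using cauchyE[OF s] by blast
  obtain i0 where i0: "i0 \<ge> N" "\<not> V C (s i0)" using C unfolding ball_def by blast
  have up: "\<not> V C (s j)" if "j \<ge> N" for j
    using V_shift[OF sc sc N[OF i0(1) that]] i0(2) by blast
  have nz: "s j \<noteq> \<zero>" if "j \<ge> N" for j using up[OF that] V_zero by auto
  then show "\<exists>N. \<forall>i\<ge>N. s i \<noteq> \<zero>" by blast
  have tc: "?t i \<in> carrier E" for i using sc field_Units by auto
  show "?t \<in> cauchy_seqs E v"
    unfolding cauchy_iff
  proof (intro conjI allI)
    fix D
    obtain M where M: "\<And>i j. i \<ge> M \<Longrightarrow> j \<ge> M \<Longrightarrow> V (D + C + C) (s i \<ominus> s j)" using cauchyE[OF s] by blast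
    have "V D (?t i \<ominus> ?t j)" if ij: "i \<ge> max N M" "j \<ge> max N M" for i j
    proof -
      have n: "s i \<noteq> \<zero>" "s j \<noteq> \<zero>" using nz ij by auto
      then have u: "s i \<in> Units E" "s j \<in> Units E" using sc field_Units by auto
      then have ic: "inv (s i) \<in> carrier E" "inv (s j) \<in> carrier E" by auto
      have "(inv (s i) \<otimes> inv (s j)) \<otimes> (s j \<ominus> s i) = inv (s i) \<otimes> (inv (s j) \<otimes> s j) \<ominus> (inv (s i) \<otimes> s i) \<otimes> inv (s j)"
        using ic sc[of i] sc[of j] by algebra
      then have eq: "?t i \<ominus> ?t j = (inv (s i) \<otimes> inv (s j)) \<otimes> (s j \<ominus> s i)" using n u ic by simp
      have "V (- C + - C) (inv (s i) \<otimes> inv (s j))"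
        by (rule V_mult) (use ic V_inv[OF sc n(1) up] V_inv[OF sc n(2) up] ij in auto)
      then have "V ((- C + - C) + (D + C + C)) ((inv (s i) \<otimes> inv (s j)) \<otimes> (s j \<ominus> s i))"
        by (rule V_mult[rotated 2]) (use M ic sc ij in auto)
      then show ?thesis unfolding eq by simp
    qed
    then show "\<exists>N. \<forall>i\<ge>N. \<forall>j\<ge>N. V D (?t i \<ominus> ?t j)" by blast
  qed (rule tc)
qed

lemma null_cauchy: "s \<in> null_seqs E v \<Longrightarrow> s \<in> cauchy_seqs E v"
proof -
  assume s: "s \<in> null_seqs E v"
  have sc: "s i \<in> carrier E" for i using s null_iff by auto
  have "\<exists>N. \<forall>i\<ge>N. \<forall>j\<ge>N. V C (s i \<ominus> s j)" for C
  proof -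
    obtain N where "\<And>i. i \<ge> N \<Longrightarrow> V C (s i)" using s unfolding null_iff ball_def by meson
    then show ?thesis using V_diff[OF sc sc] by blast
  qed
  then show ?thesis unfolding cauchy_iff using sc by blast
qed

section \<open>The quotient of Cauchy sequences by null sequences and its balls\<close>

abbreviation CR where "CR \<equiv> cauchy_ring E v"
abbreviation NS where "NS \<equiv> null_seqs E v"
abbreviation CE where "CE \<equiv> completion E v"

lemma CR_simps [simp]:
  "carrier CR = cauchy_seqs E v" "s \<otimes>\<^bsub>CR\<^esub> t = (\<lambda>i. s i \<otimes> t i)" "\<one>\<^bsub>CR\<^esub> = (\<lambda>i. \<one>)"
  "\<zero>\<^bsub>CR\<^esub> = (\<lambda>i. \<zero>)" "s \<oplus>\<^bsub>CR\<^esub> t = (\<lambda>i. s i \<oplus> t i)"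
  by (simp_all add: cauchy_ring_def)

lemma cring_CR: "cring CR"
proof (rule cringI)
  show "abelian_group CR"
  proof (rule abelian_groupI)
    fix s assume s: "s \<in> carrier CR"
    show "\<exists>t\<in>carrier CR. t \<oplus>\<^bsub>CR\<^esub> s = \<zero>\<^bsub>CR\<^esub>"
      by (rule bexI[of _ "\<lambda>i. \<ominus> s i"]) (use s cauchy_minus cauchyD in \<open>auto simp: l_neg\<close>)
  qed (use cauchy_add cauchy_const cauchyD in \<open>auto simp: a_ac\<close>)
  show "comm_monoid CR"
    by (rule comm_monoidI) (use cauchy_mult cauchy_const cauchyD in \<open>auto simp: m_ac\<close>)
qed (use cauchyD in \<open>auto simp: l_distr\<close>)

lemma CR_minus: "s \<in> cauchy_seqs E v \<Longrightarrow> \<ominus>\<^bsub>CR\<^esub> s = (\<lambda>i. \<ominus> s i)"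
proof -
  interpret C: cring CR by (rule cring_CR)
  assume s: "s \<in> cauchy_seqs E v"
  show ?thesis by (rule C.minus_equality) (use s cauchy_minus[OF s] cauchyD in \<open>auto simp: l_neg\<close>)
qed

lemma ball_add: "(\<And>i. s i \<in> carrier E) \<Longrightarrow> (\<And>i. t i \<in> carrier E) \<Longrightarrow> ball c s \<Longrightarrow> ball c t \<Longrightarrow> ball c (\<lambda>i. s i \<oplus> t i)"
  unfolding ball_def
proof -
  assume c: "\<And>i. s i \<in> carrier E" "\<And>i. t i \<in> carrier E" and "\<exists>N. \<forall>i\<ge>N. V c (s i)" "\<exists>N. \<forall>i\<ge>N. V c (t i)"
  then obtain N M where "\<And>i. i \<ge> N \<Longrightarrow> V c (s i)" "\<And>i. i \<ge> M \<Longrightarrow> V c (t i)" by blast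
  then have "\<forall>i\<ge>max N M. V c (s i \<oplus> t i)" using V_add[OF c] by simp
  then show "\<exists>N. \<forall>i\<ge>N. V c (s i \<oplus> t i)" by blast
qed

lemma ball_mult: "(\<And>i. s i \<in> carrier E) \<Longrightarrow> (\<And>i. t i \<in> carrier E) \<Longrightarrow> ball c s \<Longrightarrow> ball d t \<Longrightarrow> ball (c + d) (\<lambda>i. s i \<otimes> t i)"
  unfolding ball_def
proof -
  assume c: "\<And>i. s i \<in> carrier E" "\<And>i. t i \<in> carrier E" and "\<exists>N. \<forall>i\<ge>N. V c (s i)" "\<exists>N. \<forall>i\<ge>N. V d (t i)"
  then obtain N M where "\<And>i. i \<ge> N \<Longrightarrow> V c (s i)" "\<And>i. i \<ge> M \<Longrightarrow> V d (t i)" by blast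
  then have "\<forall>i\<ge>max N M. V (c + d) (s i \<otimes> t i)" using V_mult[OF c] by simp
  then show "\<exists>N. \<forall>i\<ge>N. V (c + d) (s i \<otimes> t i)" by blast
qed

lemma ball_minus: "(\<And>i. s i \<in> carrier E) \<Longrightarrow> ball c (\<lambda>i. \<ominus> s i) = ball c s"
  unfolding ball_def using V_minus by simp

lemma ideal_NS: "ideal NS CR"
proof (rule idealI)
  interpret C: cring CR by (rule cring_CR)
  show "ring CR" by (rule C.ring_axioms)
  have c: "s i \<in> carrier E" if "s \<in> NS" for s i using that null_iff by auto
  have l: "x \<otimes>\<^bsub>CR\<^esub> s \<in> NS" if s: "s \<in> NS" and x: "x \<in> carrier CR" for s x
    unfolding null_iff
  proof (intro conjI allI)
    have xc: "x i \<in> carrier E" for i using cauchyD x by auto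
    obtain B where "\<And>i. V B (x i)" using cauchy_bounded[of x] x by auto
    then have b: "ball B x" unfolding ball_def by blast
    show "(x \<otimes>\<^bsub>CR\<^esub> s) i \<in> carrier E" for i using xc c[OF s] by simp
    fix d
    have "ball (B + (d - B)) (\<lambda>i. x i \<otimes> s i)" by (rule ball_mult[OF xc c[OF s] b]) (use s null_iff in auto)
    then show "ball d (x \<otimes>\<^bsub>CR\<^esub> s)" by simp
  qed
  then show "s \<otimes>\<^bsub>CR\<^esub> x \<in> NS" if "s \<in> NS" "x \<in> carrier CR" for s x
    using that C.m_comm[of s x] null_cauchy by auto
  show "x \<otimes>\<^bsub>CR\<^esub> s \<in> NS" if "s \<in> NS" "x \<in> carrier CR" for s x using l that .
  show "subgroup NS (add_monoid CR)"
  proof (rule C.add.subgroupI)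
    show "NS \<subseteq> carrier CR" using null_cauchy by auto
    show "NS \<noteq> {}" using null_iff[of "\<lambda>_. \<zero>"] V_zero unfolding ball_def by auto
    show "\<ominus>\<^bsub>CR\<^esub> s \<in> NS" if "s \<in> NS" for s
      using CR_minus[OF null_cauchy[OF that]] that c[OF that] ball_minus[of s] by (simp add: null_iff)
    show "s \<oplus>\<^bsub>CR\<^esub> t \<in> NS" if "s \<in> NS" "t \<in> NS" for s t
      using that c ball_add[of s t] by (simp add: null_iff)
  qed
qed

definition cls :: "(nat \<Rightarrow> 'a) \<Rightarrow> (nat \<Rightarrow> 'a) set" where "cls s = NS +>\<^bsub>CR\<^esub> s"

definition emb :: "'a \<Rightarrow> (nat \<Rightarrow> 'a) set" where "emb x = cls (\<lambda>_. x)"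

lemma cls_hom: "ring_hom_ring CR CE cls"
proof -
  interpret I: ideal NS CR by (rule ideal_NS)
  show ?thesis using I.rcos_ring_hom_ring unfolding cls_def[abs_def] completion_def .
qed

lemma CE_carrier: "carrier CE = cls ` cauchy_seqs E v"
  unfolding completion_def FactRing_def A_RCOSETS_def RCOSETS_def cls_def a_r_coset_def by auto

lemma cls_zero_iff: assumes "s \<in> cauchy_seqs E v" shows "cls s = \<zero>\<^bsub>CE\<^esub> \<longleftrightarrow> s \<in> NS"
proof -
  interpret I: ideal NS CR by (rule ideal_NS)
  have z: "\<zero>\<^bsub>CE\<^esub> = NS" by (simp add: completion_def FactRing_def)
  show ?thesis unfolding z cls_def
    using I.rcos_const_imp_mem[of s] I.a_rcos_const[of s] assms by auto
qed

lemma cls_inverse: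
  assumes s: "s \<in> cauchy_seqs E v" and nn: "s \<notin> null_seqs E v"
  shows "cls s \<otimes>\<^bsub>CE\<^esub> cls (\<lambda>i. if s i = \<zero> then \<one> else inv (s i)) = \<one>\<^bsub>CE\<^esub>"
proof -
  interpret C: cring CR by (rule cring_CR)
  interpret I: ideal NS CR by (rule ideal_NS)
  interpret Q: cring CE unfolding completion_def by (rule I.quotient_is_cring[OF C.is_cring])
  interpret H: ring_hom_ring CR CE cls by (rule cls_hom)
  let ?t = "\<lambda>i. if s i = \<zero> then \<one> else inv (s i)"
  have t: "?t \<in> cauchy_seqs E v" by (rule cauchy_inverse(1)[OF s nn])
  obtain N where N: "\<And>i. i \<ge> N \<Longrightarrow> s i \<noteq> \<zero>" using cauchy_inverse(2)[OF s nn] by blast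
  let ?d = "\<lambda>i. s i \<otimes> ?t i \<oplus> \<ominus> \<one>"
  have dc: "?d \<in> cauchy_seqs E v" by (rule cauchy_add[OF cauchy_mult[OF s t] cauchy_const]) simp
  have "?d i = \<zero>" if "i \<ge> N" for i using N[OF that] cauchyD[OF s, of i] field_Units by (simp add: r_neg)
  then have "V c (?d i)" if "i \<ge> N" for c i using that V_zero[of c] by (simp only:)
  then have "ball c ?d" for c unfolding ball_def by blast
  then have "?d \<in> NS" unfolding null_iff using cauchyD[OF dc] by blast
  then have "cls ?d = \<zero>\<^bsub>CE\<^esub>" using cls_zero_iff[OF dc] by simp
  moreover have "?d = (s \<otimes>\<^bsub>CR\<^esub> ?t) \<oplus>\<^bsub>CR\<^esub> (\<ominus>\<^bsub>CR\<^esub> \<one>\<^bsub>CR\<^esub>)" using CR_minus[OF cauchy_const[OF one_closed]] by simp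
  ultimately have "(cls s \<otimes>\<^bsub>CE\<^esub> cls ?t) \<oplus>\<^bsub>CE\<^esub> (\<ominus>\<^bsub>CE\<^esub> \<one>\<^bsub>CE\<^esub>) = \<zero>\<^bsub>CE\<^esub>"
    using H.hom_add[of "s \<otimes>\<^bsub>CR\<^esub> ?t" "\<ominus>\<^bsub>CR\<^esub> \<one>\<^bsub>CR\<^esub>"] H.hom_mult[of s ?t] H.hom_a_inv[of "\<one>\<^bsub>CR\<^esub>"] H.hom_one s t cauchy_mult[OF s t] C.a_inv_closed[of "\<one>\<^bsub>CR\<^esub>"] C.one_closed
    by simp
  then show ?thesis
    using Q.r_right_minus_eq[of "cls s \<otimes>\<^bsub>CE\<^esub> cls ?t" "\<one>\<^bsub>CE\<^esub>"] s t H.hom_closed[of s] H.hom_closed[of ?t]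
    unfolding a_minus_def by simp
qed

lemma field_CE: "field CE"
proof -
  interpret C: cring CR by (rule cring_CR)
  interpret I: ideal NS CR by (rule ideal_NS)
  interpret Q: cring CE unfolding completion_def by (rule I.quotient_is_cring[OF C.is_cring])
  interpret H: ring_hom_ring CR CE cls by (rule cls_hom)
  show ?thesis
  proof (rule Q.cring_fieldI2)
    have "(\<lambda>_. \<one>) \<notin> NS" unfolding null_iff ball_def using V_all_zero[of \<one>] by auto
    then have "cls (\<lambda>_. \<one>) \<noteq> \<zero>\<^bsub>CE\<^esub>" using cls_zero_iff[OF cauchy_const] by auto
    then show "\<zero>\<^bsub>CE\<^esub> \<noteq> \<one>\<^bsub>CE\<^esub>" using H.hom_one by simp
    fix a assume a: "a \<in> carrier CE" "a \<noteq> \<zero>\<^bsub>CE\<^esub>"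
    then obtain s where s: "s \<in> cauchy_seqs E v" "a = cls s" unfolding CE_carrier by auto
    then have nn: "s \<notin> NS" using a cls_zero_iff by auto
    then show "\<exists>b\<in>carrier CE. a \<otimes>\<^bsub>CE\<^esub> b = \<one>\<^bsub>CE\<^esub>"
      using cls_inverse[OF s(1)] cauchy_inverse(1)[OF s(1)] s(2) CE_carrier by blast
  qed
qed

lemma emb_hom: "emb \<in> ring_hom E CE"
proof -
  interpret H: ring_hom_ring CR CE cls by (rule cls_hom)
  show ?thesis
    by (rule ring_hom_memI)
      (use H.hom_closed H.hom_add[OF _ _ , of "\<lambda>_. _" "\<lambda>_. _"] H.hom_mult[of "\<lambda>_. _" "\<lambda>_. _"] H.hom_one cauchy_const in \<open>auto simp: emb_def\<close>)
qed

text \<open>The ball of level \<open>c\<close> in the completion, defined through representatives;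
  these balls carry the topology in place of a valuation on the completion.\<close>

definition Bc :: "real \<Rightarrow> (nat \<Rightarrow> 'a) set set" where
  "Bc c = cls ` {s \<in> cauchy_seqs E v. ball c s}"

text \<open>Two representatives differ by a null sequence, which eventually lies in every ball, so
  membership can be tested on any of them.\<close>

lemma cls_Bc: assumes "s \<in> cauchy_seqs E v" shows "cls s \<in> Bc c \<longleftrightarrow> ball c s"
proof
  assume "ball c s" then show "cls s \<in> Bc c" using assms unfolding Bc_def by auto
next
  interpret C: cring CR by (rule cring_CR)
  interpret H: ring_hom_ring CR CE cls by (rule cls_hom)
  assume "cls s \<in> Bc c"
  then obtain t where t: "t \<in> cauchy_seqs E v" "ball c t" "cls s = cls t" unfolding Bc_def by auto
  have d: "(\<lambda>i. s i \<oplus> \<ominus> t i) \<in> cauchy_seqs E v" by (rule cauchy_add[OF assms cauchy_minus[OF t(1)]])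
  have "cls (s \<oplus>\<^bsub>CR\<^esub> (\<ominus>\<^bsub>CR\<^esub> t)) = cls t \<oplus>\<^bsub>CE\<^esub> (\<ominus>\<^bsub>CE\<^esub> cls t)"
    using H.hom_add[of s "\<ominus>\<^bsub>CR\<^esub> t"] H.hom_a_inv[of t] assms t C.a_inv_closed[of t] by simp
  also have "\<dots> = \<zero>\<^bsub>CE\<^esub>" using H.S.r_neg[of "cls t"] H.hom_closed[of t] t by simp
  finally have "cls (\<lambda>i. s i \<oplus> \<ominus> t i) = \<zero>\<^bsub>CE\<^esub>" using CR_minus[OF t(1)] by simp
  then have "(\<lambda>i. s i \<oplus> \<ominus> t i) \<in> NS" using cls_zero_iff[OF d] by simp
  then have "ball c (\<lambda>i. s i \<oplus> \<ominus> t i)" by (simp add: null_iff)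
  then have "ball c (\<lambda>i. (s i \<oplus> \<ominus> t i) \<oplus> t i)" by (rule ball_add[rotated 2]) (use cauchyD assms t in auto)
  moreover have "(s i \<oplus> \<ominus> t i) \<oplus> t i = s i" for i
    using cauchyD[OF assms, of i] cauchyD[OF t(1), of i] by algebra
  ultimately show "ball c s" by simp
qed

lemma Bc_carrier: "x \<in> Bc c \<Longrightarrow> x \<in> carrier CE" unfolding Bc_def CE_carrier by auto

lemma Bc_add: assumes "x \<in> Bc c" "y \<in> Bc c" shows "x \<oplus>\<^bsub>CE\<^esub> y \<in> Bc c"
proof -
  interpret H: ring_hom_ring CR CE cls by (rule cls_hom)
  obtain s t where st: "s \<in> cauchy_seqs E v" "ball c s" "x = cls s" "t \<in> cauchy_seqs E v" "ball c t" "y = cls t"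
    using assms unfolding Bc_def by auto
  have "x \<oplus>\<^bsub>CE\<^esub> y = cls (\<lambda>i. s i \<oplus> t i)" using H.hom_add[of s t] st by simp
  moreover have "ball c (\<lambda>i. s i \<oplus> t i)" by (rule ball_add) (use st cauchyD in auto)
  ultimately show ?thesis using cls_Bc[OF cauchy_add[OF st(1,4)]] by simp
qed

lemma Bc_mult: assumes "x \<in> Bc c" "y \<in> Bc d" shows "x \<otimes>\<^bsub>CE\<^esub> y \<in> Bc (c + d)"
proof -
  interpret H: ring_hom_ring CR CE cls by (rule cls_hom)
  obtain s t where st: "s \<in> cauchy_seqs E v" "ball c s" "x = cls s" "t \<in> cauchy_seqs E v" "ball d t" "y = cls t"
    using assms unfolding Bc_def by auto
  have "x \<otimes>\<^bsub>CE\<^esub> y = cls (\<lambda>i. s i \<otimes> t i)" using H.hom_mult[of s t] st by simp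
  moreover have "ball (c + d) (\<lambda>i. s i \<otimes> t i)" by (rule ball_mult) (use st cauchyD in auto)
  ultimately show ?thesis using cls_Bc[OF cauchy_mult[OF st(1,4)]] by simp
qed

lemma Bc_mono: assumes "d \<le> c" shows "Bc c \<subseteq> Bc d"
proof -
  have "ball c s \<Longrightarrow> ball d s" for s unfolding ball_def using V_mono assms by blast
  then show ?thesis unfolding Bc_def by auto
qed

lemma emb_Bc: "x \<in> carrier E \<Longrightarrow> emb x \<in> Bc c \<longleftrightarrow> V c x"
  unfolding emb_def using cls_Bc[OF cauchy_const] by (auto simp: ball_def)

lemma Bc_minus: assumes "x \<in> Bc c" shows "\<ominus>\<^bsub>CE\<^esub> x \<in> Bc c"
proof -
  interpret F: field CE by (rule field_CE)
  interpret e: ring_hom_ring E CE emb by (rule ring_hom_ringI2[OF ring_axioms F.ring_axioms emb_hom])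
  have "emb (\<ominus> \<one>) \<in> Bc 0" using emb_Bc[of "\<ominus> \<one>" 0] v_minus[of \<one>] v_one by (simp add: zero_ereal_def)
  then have "emb (\<ominus> \<one>) \<otimes>\<^bsub>CE\<^esub> x \<in> Bc (0 + c)" by (rule Bc_mult[OF _ assms])
  then show ?thesis using e.hom_one Bc_carrier[OF assms] by (simp add: F.l_minus)
qed

lemma Bc_all_zero: assumes "x \<in> carrier CE" "\<And>n::nat. x \<in> Bc (real n)" shows "x = \<zero>\<^bsub>CE\<^esub>"
proof -
  obtain s where s: "s \<in> cauchy_seqs E v" "x = cls s" using assms unfolding CE_carrier by auto
  have "ball c s" for c
  proof -
    obtain n :: nat where "c \<le> real n" using real_arch_simple by blast
    then have "x \<in> Bc c" using assms(2)[of n] Bc_mono by blast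
    then show ?thesis using cls_Bc[OF s(1)] s(2) by simp
  qed
  then have "s \<in> NS" unfolding null_iff using cauchyD[OF s(1)] by blast
  then show ?thesis using cls_zero_iff[OF s(1)] s(2) by simp
qed

lemma Bc_ex: assumes "x \<in> carrier CE" shows "\<exists>c. x \<in> Bc c"
proof -
  obtain s where s: "s \<in> cauchy_seqs E v" "x = cls s" using assms unfolding CE_carrier by auto
  then show ?thesis using cauchy_bounded[OF s(1)] cls_Bc[OF s(1)] unfolding ball_def by blast
qed

lemma cls_approx:
  assumes s: "s \<in> cauchy_seqs E v" and N: "\<And>i. i \<ge> N \<Longrightarrow> V c (s i \<ominus> e)" and e: "e \<in> carrier E"
  shows "cls s \<ominus>\<^bsub>CE\<^esub> emb e \<in> Bc c"
proof -
  interpret C: cring CR by (rule cring_CR)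
  interpret H: ring_hom_ring CR CE cls by (rule cls_hom)
  have ec: "(\<lambda>_. e) \<in> cauchy_seqs E v" by (rule cauchy_const[OF e])
  have "cls s \<ominus>\<^bsub>CE\<^esub> emb e = cls (\<lambda>i. s i \<oplus> \<ominus> e)"
    using H.hom_add[of s "\<ominus>\<^bsub>CR\<^esub> (\<lambda>_. e)"] H.hom_a_inv[of "\<lambda>_. e"] CR_minus[OF ec] s ec C.a_inv_closed[of "\<lambda>_. e"]
    by (simp add: a_minus_def emb_def)
  moreover have "ball c (\<lambda>i. s i \<oplus> \<ominus> e)" using N unfolding ball_def a_minus_def by blast
  ultimately show ?thesis using cls_Bc[OF cauchy_add[OF s cauchy_const[of "\<ominus> e"]]] e by simp
qed

lemma dense:
  assumes s: "s \<in> cauchy_seqs E v"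
  shows "\<exists>N. cls s \<ominus>\<^bsub>CE\<^esub> emb (s N) \<in> Bc c"
proof -
  obtain N where N: "\<And>i j. i \<ge> N \<Longrightarrow> j \<ge> N \<Longrightarrow> V c (s i \<ominus> s j)" using cauchyE[OF s] by blast
  then have "cls s \<ominus>\<^bsub>CE\<^esub> emb (s N) \<in> Bc c" by (intro cls_approx[OF s, of N]) (use cauchyD[OF s] in auto)
  then show ?thesis ..
qed

text \<open>By the ultrametric inequality a bound on consecutive differences bounds all later ones.
  The explicit rate shows how far each term is from the limit.\<close>

lemma slow_cauchy:
  assumes r: "\<And>j. r j \<in> carrier E" and d: "\<And>j::nat. V (real j) (r (Suc j) \<ominus> r j)"
  shows "r \<in> cauchy_seqs E v" and "\<And>j. cls r \<ominus>\<^bsub>CE\<^esub> emb (r j) \<in> Bc (real j)"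
proof -
  have st: "V (real j) (r (j + k) \<ominus> r j)" for j k
  proof (induction k)
    case 0 then show ?case using r v_zero by (simp add: a_minus_def r_neg)
  next
    case (Suc k)
    have "r (j + Suc k) \<ominus> r j = (r (Suc (j + k)) \<ominus> r (j + k)) \<oplus> (r (j + k) \<ominus> r j)"
      using r[of "j + k"] r[of "Suc (j + k)"] r[of j] by (simp, algebra)
    moreover have "V (real j) (r (Suc (j + k)) \<ominus> r (j + k))" by (rule V_mono[OF d]) simp
    ultimately show ?case using V_add Suc r by simp
  qed
  have ge: "V (real j) (r i \<ominus> r j)" if "j \<le> i" for i j using st[of j "i - j"] that by simp
  show cs: "r \<in> cauchy_seqs E v"
    unfolding cauchy_iff
  proof (intro conjI allI)
    fix C
    obtain n :: nat where n: "C \<le> real n" using real_arch_simple by blast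
    have "V C (r i \<ominus> r j)" if "i \<ge> n" "j \<ge> n" for i j
    proof -
      have "r i \<ominus> r j = (r i \<ominus> r n) \<ominus> (r j \<ominus> r n)" using r[of i] r[of j] r[of n] by algebra
      then show ?thesis using V_diff[of "r i \<ominus> r n" "r j \<ominus> r n" "real n"] ge that r V_mono[OF _ n] by simp
    qed
    then show "\<exists>N. \<forall>i\<ge>N. \<forall>j\<ge>N. V C (r i \<ominus> r j)" by blast
  qed (rule r)
  show "cls r \<ominus>\<^bsub>CE\<^esub> emb (r j) \<in> Bc (real j)" for j
    by (rule cls_approx[OF cs ge r])
qed

end

section \<open>Closedness of finite-dimensional subspaces\<close>

text \<open>A topology on \<open>R\<close> given by additive groups of balls. \<open>B_scale\<close>
  says that \<open>\<pi>\<close> shifts levels by exactly one, which allows comparison with the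
  filtration of a lattice.\<close>

locale padic_balls = padic_base +
  fixes B :: "real \<Rightarrow> 'a set"
  assumes B_carrier: "x \<in> B c \<Longrightarrow> x \<in> carrier R"
    and B_add: "x \<in> B c \<Longrightarrow> y \<in> B c \<Longrightarrow> x \<oplus> y \<in> B c"
    and B_minus: "x \<in> B c \<Longrightarrow> \<ominus> x \<in> B c"
    and B_mult: "x \<in> B c \<Longrightarrow> y \<in> B d \<Longrightarrow> x \<otimes> y \<in> B (c + d)"
    and B_mono: "d \<le> c \<Longrightarrow> B c \<subseteq> B d"
    and B_separated: "x \<in> carrier R \<Longrightarrow> (\<And>n::nat. x \<in> B (real n)) \<Longrightarrow> x = \<zero>"
    and B_exhausting: "x \<in> carrier R \<Longrightarrow> \<exists>c. x \<in> B c"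
    and B_zero: "\<zero> \<in> B c"
    and A_B: "A \<subseteq> B 0"
    and B_scale: "x \<in> carrier R \<Longrightarrow> \<pi> \<otimes> x \<in> B (c + 1) \<longleftrightarrow> x \<in> B c"
begin

lemma B_scale_pow: "x \<in> carrier R \<Longrightarrow> \<pi> [^] (n::nat) \<otimes> x \<in> B (c + real n) \<longleftrightarrow> x \<in> B c"
proof (induction n)
  case (Suc n)
  have "\<pi> [^] Suc n \<otimes> x = \<pi> \<otimes> (\<pi> [^] n \<otimes> x)"
    using Suc.prems by (simp add: m_assoc m_comm m_lcomm)
  moreover have "c + real (Suc n) = (c + real n) + 1" by simp
  ultimately show ?case using Suc B_scale[of "\<pi> [^] n \<otimes> x" "c + real n"] by (simp only: m_closed nat_pow_closed pi_closed)
qed simp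

lemma B_sub: "x \<in> B c \<Longrightarrow> y \<in> B c \<Longrightarrow> x \<ominus> y \<in> B c"
  unfolding a_minus_def using B_add B_minus by simp

lemma lat_bounded:
  assumes us: "set us \<subseteq> carrier R"
  shows "\<exists>d. lat us \<subseteq> B d"
proof -
  have "\<exists>d. set us \<subseteq> B d" using us
  proof (induction us)
    case (Cons u us)
    obtain d where "set us \<subseteq> B d" using Cons by auto
    moreover obtain e where "u \<in> B e" using B_exhausting[of u] Cons.prems by auto
    ultimately have "set (u # us) \<subseteq> B (min d e)" using B_mono[of "min d e" d] B_mono[of "min d e" e] by auto
    then show ?case by blast
  qed simp
  then obtain d where d: "set us \<subseteq> B d" ..
  have "lat us \<subseteq> B d"
  proof (rule lat_min)
    fix a u assume "a \<in> A" "u \<in> set us"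
    then show "a \<otimes> u \<in> B d" using B_mult[of a 0 u d] A_B d by auto
  qed (use B_zero B_add in auto)
  then show ?thesis ..
qed

text \<open>Equivalence of norms: on the compact lattice spanned by \<open>us\<close>, the two topologies agree.\<close>

lemma Span_closed:
  assumes us: "independent k0 us" and y: "y \<in> carrier R"
    and approx: "\<And>c. \<exists>x\<in>Span k0 us. y \<ominus> x \<in> B c"
  shows "y \<in> Span k0 us"
proof -
  have usc: "set us \<subseteq> carrier R" using independent_in_carrier[OF us] .
  interpret L: padic_lattice R \<pi> "lat us" "p ^ length us" by (rule lat_lattice[OF us])
  obtain d where d: "lat us \<subseteq> B d" using lat_bounded[OF usc] by blast
  have lvB: "L.lv n \<subseteq> B (d + real n)" for n
    using d B_scale_pow[of _ n d] L.I_carrier unfolding L.lv_def by auto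
  \<comment> \<open>Compactness: lattice elements outside \<open>lv 1\<close> lying in ever smaller
    balls would accumulate at a point of all balls, that is at zero, and would then enter
    \<open>lv 1\<close>.\<close>
  have "\<exists>c. \<forall>x\<in>lat us. x \<in> B (real c) \<longrightarrow> x \<in> L.lv 1"
  proof (rule ccontr)
    assume "\<not> ?thesis"
    then have "\<forall>c::nat. \<exists>x. x \<in> lat us \<and> x \<in> B (real c) \<and> x \<notin> L.lv 1" by blast
    then obtain s where s: "\<And>k::nat. s k \<in> lat us" "\<And>k. s k \<in> B (real k)" "\<And>k. s k \<notin> L.lv 1" by metis
    obtain x where x: "x \<in> lat us" "\<And>n. infinite {k. s k \<ominus> x \<in> L.lv n}" using L.accumulation_point[of s, OF s(1)] by blast
    have c: "x \<in> carrier R" "s k \<in> carrier R" for k using L.I_carrier s x by auto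
    have eq: "x = s k \<ominus> (s k \<ominus> x)" "s k = (s k \<ominus> x) \<oplus> x" for k using c(1) c(2)[of k] by algebra+
    have "x \<in> B (real n)" for n
    proof -
      obtain m :: nat where m: "real n - d \<le> real m" using real_arch_simple by blast
      obtain k where k: "k \<ge> n" "s k \<ominus> x \<in> L.lv m" using x(2)[of m] unfolding infinite_nat_iff_unbounded_le by blast
      then have "s k \<in> B (real n)" "s k \<ominus> x \<in> B (real n)"
        using s(2)[of k] B_mono[of "real n" "real k"] lvB[of m] B_mono[of "real n" "d + real m"] m by auto
      then show ?thesis using B_sub eq(1)[of k] by metis
    qed
    then have "x = \<zero>" using B_separated c(1) by blast
    moreover obtain k where "s k \<ominus> x \<in> L.lv 1" using x(2)[of 1] not_finite_existsD by blast
    ultimately show False using s(3)[of k] eq(2)[of k] L.lv_add[OF _ L.lv_zero] by metis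
  qed
  then obtain c where c: "\<And>x. x \<in> lat us \<Longrightarrow> x \<in> B (real c) \<Longrightarrow> x \<in> L.lv 1" by blast
  \<comment> \<open>Scaling carries the single comparison at \<open>c\<close> to all levels: write a
    multiple of \<open>x\<close> as a power of \<open>\<pi>\<close> times a primitive lattice
    element; smallness of \<open>x\<close> forces that power to be large.\<close>
  have strong: "x \<in> L.lv n" if x: "x \<in> Span k0 us" "x \<in> B (real (c + n))" for x n
  proof (cases "x = \<zero>")
    case True then show ?thesis using L.lv_zero by simp
  next
    case nz: False
    have xc: "x \<in> carrier R" using B_carrier x(2) .
    obtain m :: nat where m: "\<pi> [^] m \<otimes> x \<in> lat us" using lat_exhausting[OF usc x(1)] by blast
    have "\<pi> [^] m \<noteq> \<zero>" by (rule pow_nonzero[OF pi_closed pi_nonzero])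
    then have "\<pi> [^] m \<otimes> x \<noteq> \<zero>" using integral[of "\<pi> [^] m" x] xc nz by auto
    then obtain x' j where j: "x' \<in> lat us" "x' \<notin> L.lv 1" "\<pi> [^] m \<otimes> x = \<pi> [^] (j::nat) \<otimes> x'"
      using L.primitive_part[OF m] by blast
    have "m + n \<le> j"
    proof (rule ccontr)
      assume "\<not> m + n \<le> j"
      then have le: "j \<le> m + n" by simp
      have "\<pi> [^] j \<otimes> x' \<in> B (real (c + n) + real m)"
        using B_scale_pow[OF xc, of m "real (c + n)"] x(2) j(3) by simp
      moreover have "real (c + n) + real m = real (c + (m + n - j)) + real j" using le by simp
      ultimately have "x' \<in> B (real (c + (m + n - j)))" using B_scale_pow[of x' j] L.I_carrier[OF j(1)] by metis
      then show False using c[OF j(1)] j(2) B_mono[of "real c" "real (c + (m + n - j))"] by auto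
    qed
    moreover have "\<pi> [^] m \<otimes> x \<in> L.lv j" unfolding j(3) L.lv_def using j(1) by blast
    ultimately have "\<pi> [^] m \<otimes> x \<in> L.lv (m + n)" using L.lv_mono by blast
    then show ?thesis using L.lv_shift[OF xc] by simp
  qed
  \<comment> \<open>The shift by \<open>c\<close> makes consecutive approximations differ by an
    element of \<open>lv n\<close>, so the sequence converges in the lattice topology.\<close>
  have "\<exists>x. \<forall>n. x n \<in> Span k0 us \<and> y \<ominus> x n \<in> B (real (c + n))"
    by (rule choice) (use approx in blast)
  then obtain x where x: "\<And>n. x n \<in> Span k0 us" "\<And>n. y \<ominus> x n \<in> B (real (c + n))" by blast
  have SpanC: "Span k0 us \<subseteq> carrier R" using Span_in_carrier[OF _ usc] k0_carrier by blast
  then have xc: "x n \<in> carrier R" for n using x(1) by blast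
  have dS: "a \<ominus> b \<in> Span k0 us" "a \<oplus> b \<in> Span k0 us" if "a \<in> Span k0 us" "b \<in> Span k0 us" for a b
    using that Span_subgroup_props(3,4)[OF k0 usc] unfolding a_minus_def by auto
  have "x (Suc i) \<ominus> x i \<in> L.lv i" for i
  proof (rule strong)
    have eq: "x (Suc i) \<ominus> x i = (y \<ominus> x i) \<ominus> (y \<ominus> x (Suc i))" using xc[of i] xc[of "Suc i"] y by algebra
    show "x (Suc i) \<ominus> x i \<in> B (real (c + i))" unfolding eq
      by (rule B_sub) (use x(2)[of i] x(2)[of "Suc i"] B_mono[of "real (c + i)" "real (c + Suc i)"] in auto)
  qed (use dS x(1) in blast)
  then obtain z where z: "z \<in> carrier R" "\<And>i. z \<ominus> x i \<in> L.lv i" using L.lv_complete[of x] xc by blast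
  \<comment> \<open>Deep lattice levels lie in small balls, so the limit \<open>z\<close> taken in
    the lattice topology is also the limit for the balls, which is \<open>y\<close>.\<close>
  have "y \<ominus> z \<in> B (real n)" for n
  proof -
    obtain m :: nat where m: "real n - d \<le> real m" using real_arch_simple by blast
    let ?m = "max n m"
    have eq: "y \<ominus> z = (y \<ominus> x ?m) \<ominus> (z \<ominus> x ?m)" using xc[of ?m] y z(1) by algebra
    show ?thesis unfolding eq
    proof (rule B_sub)
      have "real n \<le> real (c + ?m)" by linarith
      then show "y \<ominus> x ?m \<in> B (real n)" using x(2)[of ?m] B_mono by blast
      have "real n \<le> d + real ?m" using m by linarith
      then show "z \<ominus> x ?m \<in> B (real n)" using z(2)[of ?m] lvB[of ?m] B_mono by blast
    qed
  qed
  then have "y \<ominus> z = \<zero>" using B_separated y z(1) by simp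
  then have "y = z" using y z(1) by simp
  moreover have "z = (z \<ominus> x 0) \<oplus> x 0" using z(1) xc[of 0] by algebra
  moreover have "z \<ominus> x 0 \<in> Span k0 us" using z(2)[of 0] L.lv_I lat_Span[OF usc] by blast
  ultimately show ?thesis using dS(2) x(1)[of 0] by metis
qed

end

section \<open>The field of p-adic numbers in a completion\<close>

context cring
begin

lemma diff_telescope:
  assumes "a \<in> carrier R" "b \<in> carrier R" "z \<in> carrier R"
  shows "(a \<ominus> z) \<ominus> (b \<ominus> z) = a \<ominus> b"
  using assms by algebra

lemma diff_cancel:
  assumes "a \<in> carrier R" "b \<in> carrier R"
  shows "(a \<ominus> b) \<oplus> b = a" "a \<ominus> (a \<ominus> b) = b"
  using assms by (algebra, algebra)

lemma diff_chain:
  assumes "a \<in> carrier R" "b \<in> carrier R" "c \<in> carrier R"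
  shows "(a \<ominus> b) \<oplus> (b \<ominus> c) = a \<ominus> c" "(a \<oplus> b) \<ominus> c = b \<ominus> (c \<ominus> a)"
  using assms by (algebra, algebra)

lemma diff_zigzag:
  assumes "a \<in> carrier R" "b \<in> carrier R" "c \<in> carrier R" "e \<in> carrier R"
  shows "((a \<ominus> b) \<oplus> (b \<ominus> c)) \<ominus> (a \<ominus> e) = e \<ominus> c"
  using assms by algebra

end

locale padic_valued = valued +
  fixes p :: nat
  assumes p_prime: "Factorial_Ring.prime p"
    and v_int: "v ([(m::int)] \<cdot> \<one>) = (if m = 0 then \<infinity> else ereal (real (multiplicity (int p) m)))"
    and rationals: "subfield (rationals E) E"
begin

section \<open>Integers and rationals in the valued field\<close>

lemma int_closed [simp]: "[(m::int)] \<cdot> \<one> \<in> carrier E"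
  unfolding add_pow_def using group.int_pow_closed[OF a_group, of \<one> m] by simp

lemma nat_closed [simp]: "[(m::nat)] \<cdot> \<one> \<in> carrier E" by simp

lemma int_of_nat: "[(int n)] \<cdot> \<one> = [n] \<cdot> \<one>" by (simp add: add_pow_int_ge)

lemma int_one: "[(1::int)] \<cdot> \<one> = \<one>"
  using int_of_nat[of 1] by simp

lemma int_mult: "[(a * b::int)] \<cdot> \<one> = ([a] \<cdot> \<one>) \<otimes> ([b] \<cdot> \<one>)"
proof -
  have "([a] \<cdot> \<one>) \<otimes> ([b] \<cdot> \<one>) = [a] \<cdot> (\<one> \<otimes> ([b] \<cdot> \<one>))" by (rule add_pow_ldistr_int) auto
  also have "\<dots> = [a] \<cdot> ([b] \<cdot> \<one>)" by simp
  also have "\<dots> = [(a * b)] \<cdot> \<one>"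
    using add.int_pow_pow[of \<one> a b] unfolding add_pow_def by (simp add: mult.commute)
  finally show ?thesis by simp
qed

lemma int_diff: "[(a - b::int)] \<cdot> \<one> = ([a] \<cdot> \<one>) \<ominus> ([b] \<cdot> \<one>)"
  using add.int_pow_diff[of \<one> a b] unfolding add_pow_def a_minus_def a_inv_def by simp

lemma int_nonzero: "m \<noteq> 0 \<Longrightarrow> [(m::int)] \<cdot> \<one> \<noteq> \<zero>"
  using v_int[of m] v_zero by auto

lemma nat_nonzero: "0 < n \<Longrightarrow> [(n::nat)] \<cdot> \<one> \<noteq> \<zero>"
  using int_nonzero[of "int n"] int_of_nat by simp

lemma v_int_nonneg: "0 \<le> v ([(m::int)] \<cdot> \<one>)"
  using v_int[of m] by simp

lemma v_p: "v ([p] \<cdot> \<one>) = 1"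
  using v_int[of "int p"] p_prime int_of_nat by (simp add: one_ereal_def not_prime_0 prime_gt_0_nat)

lemma int_unit: assumes "\<not> int p dvd m" shows "v ([m] \<cdot> \<one>) = 0" "v (inv ([m] \<cdot> \<one>)) = 0"
proof -
  have m: "m \<noteq> 0" using assms by auto
  then show 0: "v ([m] \<cdot> \<one>) = 0" using v_int[of m] assms by (simp add: not_dvd_imp_multiplicity_0)
  have "v ([m] \<cdot> \<one> \<otimes> inv ([m] \<cdot> \<one>)) = v ([m] \<cdot> \<one>) + v (inv ([m] \<cdot> \<one>))"
    by (rule v_mult) (use int_nonzero[OF m] field_Units in auto)
  then show "v (inv ([m] \<cdot> \<one>)) = 0" using 0 v_one int_nonzero[OF m] field_Units by simp
qed

lemma rat_embed_closed: "rat_embed E q \<in> carrier E"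
  unfolding rat_embed_def using int_nonzero quotient_of_denom_pos'[of q] field_Units by auto

lemma rationals_carrier: "x \<in> rationals E \<Longrightarrow> x \<in> carrier E"
  using rat_embed_closed unfolding rationals_def by auto

lemma int_rational: "[(m::int)] \<cdot> \<one> \<in> rationals E"
proof -
  have "rat_embed E (rat_of_int m) = [m] \<cdot> \<one>"
    unfolding rat_embed_def by (simp add: int_one)
  then show ?thesis unfolding rationals_def by (metis rangeI)
qed

lemma nat_rational: "[(m::nat)] \<cdot> \<one> \<in> rationals E"
  using int_rational[of "int m"] int_of_nat by simp

text \<open>A rational number that is integral at p has a denominator \<open>b\<close> prime to p,
  so it is congruent to a times an inverse of b modulo p. This bounds the residue ring of Z_p by p
  elements.\<close>

lemma rational_residue:
  assumes r: "r \<in> rationals E" "V 0 r"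
  shows "\<exists>c<p. V 1 (r \<ominus> [c] \<cdot> \<one>)"
proof -
  obtain q where q: "r = rat_embed E q" using r(1) unfolding rationals_def by auto
  obtain a b where ab: "quotient_of q = (a, b)" by (cases "quotient_of q")
  have b: "b > 0" "coprime a b" using quotient_of_denom_pos[OF ab] quotient_of_coprime[OF ab] .
  let ?a = "[a] \<cdot> \<one>" and ?b = "[b] \<cdot> \<one>"
  have req: "r = ?a \<otimes> inv ?b" unfolding q rat_embed_def ab by simp
  have bn: "?b \<noteq> \<zero>" using int_nonzero b(1) by simp
  then have bu: "?b \<in> Units E" "inv ?b \<in> carrier E" using field_Units by auto
  have pp: "Factorial_Ring.prime (int p)" using p_prime by simp
  \<comment> \<open>If p divided \<open>b\<close>, the numerator would be prime to p and of
    valuation zero, while the product of \<open>b\<close> with the integral \<open>r\<close> has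
    valuation at least one.\<close>
  have nd: "\<not> int p dvd b"
  proof
    assume d: "int p dvd b"
    then have "\<not> int p dvd a" using b(2) pp by (meson coprime_common_divisor not_prime_unit)
    then have va: "v ?a = 0" by (rule int_unit)
    have "v (?b \<otimes> r) = v ?b + v r" by (rule v_mult) (use req bu in auto)
    moreover have "?b \<otimes> r = ?a" unfolding req using bu by (simp add: m_lcomm)
    ultimately have eq: "v ?b + v r = 0" using va by simp
    have "1 \<le> multiplicity (int p) b" using d b(1) pp by (metis less_one multiplicity_eq_zero_iff not_less not_prime_unit less_irrefl)
    then have "ereal 1 \<le> v ?b" using v_int[of b] b(1) by simp
    then have "ereal 1 + 0 \<le> v ?b + v r" using r(2) by (intro add_mono) (auto simp: zero_ereal_def)
    then show False using eq by simp
  qed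
  then have "coprime b (int p)" using prime_imp_coprime[OF pp] by (simp add: coprime_commute)
  \<comment> \<open>Bezout's identity makes \<open>u\<close> an inverse of \<open>b\<close> modulo
    p; the residue wanted is a u reduced modulo p.\<close>
  then obtain u w where u: "u * b + w * int p = 1" using bezout_int[of b "int p"] by auto
  define c where "c = nat ((a * u) mod int p)"
  have p0: "0 < int p" using p_prime prime_gt_0_nat by auto
  have ci: "int c = (a * u) mod int p" unfolding c_def using p0 by simp
  then have "c < p" using p0 by (metis pos_mod_bound of_nat_less_iff)
  have cu: "int c = a * u - int p * ((a * u) div int p)" unfolding ci by (rule minus_mult_div_eq_mod[symmetric])
  have "a - int c * b = a * (u * b + w * int p) - int c * b" using u by simp
  also have "\<dots> = int p * (a * w + (a * u) div int p * b)" unfolding cu by (simp add: algebra_simps)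
  finally obtain m where m: "a - int c * b = int p * m" by blast
  have "r \<ominus> [c] \<cdot> \<one> = ([(a - int c * b)] \<cdot> \<one>) \<otimes> inv ?b"
  proof -
    have "[c] \<cdot> \<one> = ([(int c)] \<cdot> \<one>) \<otimes> (?b \<otimes> inv ?b)" using bu int_of_nat[of c] by simp
    moreover have "?a \<otimes> inv ?b \<ominus> ([(int c)] \<cdot> \<one>) \<otimes> (?b \<otimes> inv ?b) = (?a \<ominus> ([(int c)] \<cdot> \<one>) \<otimes> ?b) \<otimes> inv ?b"
      using bu int_closed[of a] int_closed[of b] int_closed[of "int c"] by algebra
    ultimately show ?thesis unfolding req int_diff int_mult by simp
  qed
  also have "\<dots> = ([p] \<cdot> \<one>) \<otimes> (([m] \<cdot> \<one>) \<otimes> inv ?b)"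
    unfolding m int_mult int_of_nat using bu by (simp add: m_assoc)
  finally have eq: "r \<ominus> [c] \<cdot> \<one> = ([p] \<cdot> \<one>) \<otimes> (([m] \<cdot> \<one>) \<otimes> inv ?b)" .
  have "V (1 + (0 + 0)) (r \<ominus> [c] \<cdot> \<one>)" unfolding eq
    by (intro V_mult) (use bu v_p v_int_nonneg[of m] int_unit(2)[OF nd] in \<open>auto simp: zero_ereal_def one_ereal_def\<close>)
  then show ?thesis using \<open>c < p\<close> by auto
qed

section \<open>The field of p-adic numbers inside the completion\<close>

abbreviation QQ where "QQ \<equiv> padics_in E v"

lemma rationals_minus: "x \<in> rationals E \<Longrightarrow> \<ominus>\<^bsub>E\<lparr>carrier := rationals E\<rparr>\<^esub> x = \<ominus> x"
proof -
  assume x: "x \<in> rationals E"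
  interpret S: field "E\<lparr>carrier := rationals E\<rparr>" by (rule subfield_iff(2)[OF rationals])
  have "\<ominus> x \<in> rationals E" using x subringE(5)[OF subfieldE(1)[OF rationals]] by blast
  then show ?thesis by (intro S.minus_equality) (use x rationals_carrier in \<open>auto simp: l_neg\<close>)
qed

lemma rational_cauchy:
  "cauchy_seqs (E\<lparr>carrier := rationals E\<rparr>) v = {s \<in> cauchy_seqs E v. \<forall>i. s i \<in> rationals E}"
proof -
  have "s i \<ominus>\<^bsub>E\<lparr>carrier := rationals E\<rparr>\<^esub> s j = s i \<ominus> s j" if "\<forall>i. s i \<in> rationals E" for s :: "nat \<Rightarrow> 'a" and i j
    using that rationals_minus unfolding a_minus_def by simp
  then have "(s \<in> cauchy_seqs (E\<lparr>carrier := rationals E\<rparr>) v) = (s \<in> cauchy_seqs E v \<and> (\<forall>i. s i \<in> rationals E))" for s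
    unfolding cauchy_seqs_def using rationals_carrier by (cases "\<forall>i. s i \<in> rationals E") (simp, auto)
  then show ?thesis by blast
qed

lemma QQ_def: "QQ = cls ` {s \<in> cauchy_seqs E v. \<forall>i. s i \<in> rationals E}"
  unfolding padics_in_def rational_cauchy cls_def ..

lemma emb_QQ: "x \<in> rationals E \<Longrightarrow> emb x \<in> QQ"
  unfolding QQ_def emb_def using cauchy_const rationals_carrier by auto

lemma emb_ring_hom: "ring_hom_ring E CE emb"
proof -
  interpret F: field CE by (rule field_CE)
  show ?thesis by (rule ring_hom_ringI2[OF ring_axioms F.ring_axioms emb_hom])
qed

lemma subfield_QQ: "subfield QQ CE"
proof -
  interpret C: cring CR by (rule cring_CR)
  interpret H: ring_hom_ring CR CE cls by (rule cls_hom)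
  interpret F: field CE by (rule field_CE)
  note R = subringE[OF subfieldE(1)[OF rationals]]
  let ?S = "{s \<in> cauchy_seqs E v. \<forall>i. s i \<in> rationals E}"
  have S: "subring ?S CR"
  proof (rule C.subringI)
    show "\<one>\<^bsub>CR\<^esub> \<in> ?S" using cauchy_const R(3) by simp
    show "\<ominus>\<^bsub>CR\<^esub> s \<in> ?S" if "s \<in> ?S" for s using that CR_minus cauchy_minus R(5) by simp
    show "s \<otimes>\<^bsub>CR\<^esub> t \<in> ?S" "s \<oplus>\<^bsub>CR\<^esub> t \<in> ?S" if "s \<in> ?S" "t \<in> ?S" for s t
      using that cauchy_mult cauchy_add R(6,7) by auto
  qed auto
  show ?thesis
  proof (rule F.subfieldI')
    show "subring QQ CE" unfolding QQ_def by (rule H.img_is_subring[OF S])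
    fix x assume x: "x \<in> QQ - {\<zero>\<^bsub>CE\<^esub>}"
    then obtain s where s: "s \<in> ?S" "x = cls s" unfolding QQ_def by auto
    have sc: "s \<in> cauchy_seqs E v" using s(1) by simp
    have nn: "s \<notin> NS" using x s(2) cls_zero_iff[OF sc] by auto
    let ?t = "\<lambda>i. if s i = \<zero> then \<one> else inv (s i)"
    have t: "?t \<in> cauchy_seqs E v" by (rule cauchy_inverse(1)[OF sc nn])
    have tQ: "?t i \<in> rationals E" for i
      using s(1) R(3) subfield_m_inv(1)[OF rationals, of "s i"] by auto
    have xt: "x \<otimes>\<^bsub>CE\<^esub> cls ?t = \<one>\<^bsub>CE\<^esub>"
      unfolding s(2) by (rule cls_inverse[OF sc nn])
    have "x \<in> carrier CE" "cls ?t \<in> carrier CE" using s(2) sc t CE_carrier by auto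
    then have "inv\<^bsub>CE\<^esub> x = cls ?t" using F.comm_inv_char xt by blast
    then show "inv\<^bsub>CE\<^esub> x \<in> QQ" unfolding QQ_def using t tQ by blast
  qed
qed

lemma emb_nat: "emb ([(m::nat)] \<cdot> \<one>) = [m] \<cdot>\<^bsub>CE\<^esub> \<one>\<^bsub>CE\<^esub>"
proof -
  interpret F: field CE by (rule field_CE)
  interpret e: ring_hom_ring E CE emb by (rule emb_ring_hom)
  show ?thesis by (rule e.hom_nat_one)
qed

text \<open>The image of p lies in the ball of level 1 and that of its inverse in the ball of level
  -1; multiplication by either gives the two directions.\<close>

lemma Bc_scale: assumes "x \<in> carrier CE"
  shows "([p] \<cdot>\<^bsub>CE\<^esub> \<one>\<^bsub>CE\<^esub>) \<otimes>\<^bsub>CE\<^esub> x \<in> Bc (c + 1) \<longleftrightarrow> x \<in> Bc c"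
proof -
  interpret F: field CE by (rule field_CE)
  interpret e: ring_hom_ring E CE emb by (rule emb_ring_hom)
  let ?p = "[p] \<cdot> \<one>"
  have pn: "?p \<noteq> \<zero>" using nat_nonzero p_prime prime_gt_0_nat by blast
  then have pu: "inv ?p \<in> carrier E" "inv ?p \<otimes> ?p = \<one>" using field_Units by auto
  have "v (inv ?p \<otimes> ?p) = v (inv ?p) + v ?p" by (rule v_mult) (use pu in auto)
  then have "v (inv ?p) + 1 = 0" using v_p v_one pu by simp
  then have vi: "v (inv ?p) = ereal (-1)" by (cases "v (inv ?p)") (auto simp: one_ereal_def zero_ereal_def)
  have B: "emb ?p \<in> Bc 1" "emb (inv ?p) \<in> Bc (-1)"
    using emb_Bc[of ?p 1] emb_Bc[OF pu(1), of "-1"] v_p vi by (auto simp: one_ereal_def)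
  show ?thesis
  proof
    assume "x \<in> Bc c"
    then have "emb ?p \<otimes>\<^bsub>CE\<^esub> x \<in> Bc (1 + c)" by (rule Bc_mult[OF B(1)])
    then show "([p] \<cdot>\<^bsub>CE\<^esub> \<one>\<^bsub>CE\<^esub>) \<otimes>\<^bsub>CE\<^esub> x \<in> Bc (c + 1)" unfolding emb_nat by (simp add: add.commute)
  next
    assume "([p] \<cdot>\<^bsub>CE\<^esub> \<one>\<^bsub>CE\<^esub>) \<otimes>\<^bsub>CE\<^esub> x \<in> Bc (c + 1)"
    then have "emb (inv ?p) \<otimes>\<^bsub>CE\<^esub> (emb ?p \<otimes>\<^bsub>CE\<^esub> x) \<in> Bc (-1 + (c + 1))" unfolding emb_nat by (rule Bc_mult[OF B(2)])
    moreover have "emb (inv ?p) \<otimes>\<^bsub>CE\<^esub> (emb ?p \<otimes>\<^bsub>CE\<^esub> x) = emb (inv ?p \<otimes> ?p) \<otimes>\<^bsub>CE\<^esub> x"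
      using e.hom_mult[OF pu(1), of ?p] e.hom_closed[OF pu(1)] e.hom_closed[of ?p] assms by (simp add: F.m_assoc)
    ultimately show "x \<in> Bc c" using assms pu(2) by simp
  qed
qed

lemma QQ_approx: assumes "x \<in> QQ" shows "\<exists>r\<in>rationals E. x \<ominus>\<^bsub>CE\<^esub> emb r \<in> Bc c"
  using assms dense unfolding QQ_def by blast

text \<open>Identifies the algebraic filtration of Z_p by powers of p with its filtration by balls,
  so lattice properties can be checked metrically.\<close>

lemma padic_levels:
  "(\<lambda>y. ([p] \<cdot>\<^bsub>CE\<^esub> \<one>\<^bsub>CE\<^esub>) [^]\<^bsub>CE\<^esub> (n::nat) \<otimes>\<^bsub>CE\<^esub> y) ` (QQ \<inter> Bc 0) = QQ \<inter> Bc (real n)"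
proof (induction n)
  case 0
  interpret F: field CE by (rule field_CE)
  have "(\<lambda>y. \<one>\<^bsub>CE\<^esub> \<otimes>\<^bsub>CE\<^esub> y) ` (QQ \<inter> Bc 0) = (\<lambda>y. y) ` (QQ \<inter> Bc 0)"
    by (rule image_cong) (use Bc_carrier in auto)
  then show ?case by simp
next
  case (Suc n)
  interpret F: field CE by (rule field_CE)
  let ?\<pi> = "[p] \<cdot>\<^bsub>CE\<^esub> \<one>\<^bsub>CE\<^esub>"
  have pc: "?\<pi> \<in> carrier CE" by simp
  have pn: "?\<pi> \<noteq> \<zero>\<^bsub>CE\<^esub>"
  proof -
    interpret e: ring_hom_ring E CE emb by (rule emb_ring_hom)
    have "inj_on emb (carrier E)" by (rule non_trivial_field_hom_is_inj[OF emb_hom field_axioms field_CE])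
    then show ?thesis using nat_nonzero[of p] p_prime prime_gt_0_nat emb_nat[of p] e.hom_zero by (metis inj_onD nat_closed zero_closed)
  qed
  have pQ: "?\<pi> \<in> QQ" using emb_QQ[OF nat_rational[of p]] emb_nat by simp
  have "(\<lambda>y. ?\<pi> [^]\<^bsub>CE\<^esub> Suc n \<otimes>\<^bsub>CE\<^esub> y) ` (QQ \<inter> Bc 0) = (\<lambda>y. ?\<pi> \<otimes>\<^bsub>CE\<^esub> y) ` ((\<lambda>y. ?\<pi> [^]\<^bsub>CE\<^esub> n \<otimes>\<^bsub>CE\<^esub> y) ` (QQ \<inter> Bc 0))"
    unfolding image_image by (rule image_cong) (use Bc_carrier in \<open>auto simp: F.m_assoc F.m_comm F.m_lcomm\<close>)
  also have "\<dots> = (\<lambda>y. ?\<pi> \<otimes>\<^bsub>CE\<^esub> y) ` (QQ \<inter> Bc (real n))" unfolding Suc ..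
  also have "\<dots> = QQ \<inter> Bc (real (Suc n))"
  proof (intro subset_antisym subsetI)
    fix z assume "z \<in> (\<lambda>y. ?\<pi> \<otimes>\<^bsub>CE\<^esub> y) ` (QQ \<inter> Bc (real n))"
    then obtain y where y: "y \<in> QQ" "y \<in> Bc (real n)" "z = ?\<pi> \<otimes>\<^bsub>CE\<^esub> y" by auto
    then have "z \<in> Bc (real n + 1)" using Bc_scale[of y "real n"] Bc_carrier by blast
    then show "z \<in> QQ \<inter> Bc (real (Suc n))" using y pQ subringE(6)[OF subfieldE(1)[OF subfield_QQ]] by (simp add: add.commute)
  next
    fix z assume z: "z \<in> QQ \<inter> Bc (real (Suc n))"
    have zc: "z \<in> carrier CE" using z Bc_carrier by blast
    let ?y = "inv\<^bsub>CE\<^esub> ?\<pi> \<otimes>\<^bsub>CE\<^esub> z"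
    have i: "inv\<^bsub>CE\<^esub> ?\<pi> \<in> QQ" using F.subfield_m_inv(1)[OF subfield_QQ, of ?\<pi>] pQ pn by auto
    have ic: "inv\<^bsub>CE\<^esub> ?\<pi> \<in> carrier CE" "?\<pi> \<otimes>\<^bsub>CE\<^esub> inv\<^bsub>CE\<^esub> ?\<pi> = \<one>\<^bsub>CE\<^esub>" using pn pc F.field_Units by auto
    have yz: "?\<pi> \<otimes>\<^bsub>CE\<^esub> ?y = z"
    proof -
      have "?\<pi> \<otimes>\<^bsub>CE\<^esub> ?y = (?\<pi> \<otimes>\<^bsub>CE\<^esub> inv\<^bsub>CE\<^esub> ?\<pi>) \<otimes>\<^bsub>CE\<^esub> z" using pc ic(1) zc by (rule F.m_assoc[symmetric])
      then show ?thesis unfolding ic(2) using zc by simp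
    qed
    moreover have "?y \<in> QQ" using i z subringE(6)[OF subfieldE(1)[OF subfield_QQ]] by simp
    moreover have "?y \<in> Bc (real n)" using Bc_scale[of ?y "real n"] yz z ic(1) zc by (simp add: add.commute)
    ultimately show "z \<in> (\<lambda>y. ?\<pi> \<otimes>\<^bsub>CE\<^esub> y) ` (QQ \<inter> Bc (real n))" by (metis IntI image_eqI)
  qed
  finally show ?case .
qed

lemma padic_balls: "padic_balls CE p (QQ \<inter> Bc 0) QQ Bc"
proof -
  interpret F: field CE by (rule field_CE)
  interpret e: ring_hom_ring E CE emb by (rule emb_ring_hom)
  let ?\<pi> = "[p] \<cdot>\<^bsub>CE\<^esub> \<one>\<^bsub>CE\<^esub>"
  let ?A = "QQ \<inter> Bc 0"
  note Q = subringE[OF subfieldE(1)[OF subfield_QQ]]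
  have nz: "[n] \<cdot>\<^bsub>CE\<^esub> \<one>\<^bsub>CE\<^esub> \<noteq> \<zero>\<^bsub>CE\<^esub>" if "0 < n" for n :: nat
  proof -
    have "inj_on emb (carrier E)" by (rule non_trivial_field_hom_is_inj[OF emb_hom field_axioms field_CE])
    then show ?thesis using nat_nonzero[OF that] emb_nat[of n] e.hom_zero by (metis inj_onD nat_closed zero_closed)
  qed
  have p0: "0 < p" using p_prime prime_gt_0_nat by blast
  have \<pi>: "?\<pi> \<in> QQ" "?\<pi> \<in> Bc 1"
    using emb_QQ[OF nat_rational[of p]] emb_Bc[of "[p] \<cdot> \<one>" 1] v_p emb_nat[of p] by (auto simp: one_ereal_def)
  have B0: "\<zero>\<^bsub>CE\<^esub> \<in> Bc c" for c using emb_Bc[of \<zero> c] V_zero e.hom_zero by simp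
  have B1: "\<one>\<^bsub>CE\<^esub> \<in> Bc 0" using emb_Bc[of \<one> 0] v_one e.hom_one by (simp add: zero_ereal_def)
  have Bs: "x \<ominus>\<^bsub>CE\<^esub> y \<in> Bc c" if "x \<in> Bc c" "y \<in> Bc c" for x y c
    unfolding a_minus_def by (rule Bc_add[OF that(1) Bc_minus[OF that(2)]])
  have Qs: "x \<ominus>\<^bsub>CE\<^esub> y \<in> QQ" if "x \<in> QQ" "y \<in> QQ" for x y
    unfolding a_minus_def by (rule Q(7)[OF that(1) Q(5)[OF that(2)]])
  have Qc: "x \<in> QQ \<Longrightarrow> x \<in> carrier CE" for x using Q(1) by blast
  have ec: "x \<in> rationals E \<Longrightarrow> emb x \<in> carrier CE" for x using rationals_carrier e.hom_closed by blast
  have em: "emb (x \<ominus> y) = emb x \<ominus>\<^bsub>CE\<^esub> emb y" if "x \<in> carrier E" "y \<in> carrier E" for x y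
    using that by (simp add: a_minus_def)
  note telescope = F.diff_telescope and cancel = F.diff_cancel and chain = F.diff_chain and zigzag = F.diff_zigzag
  have padic_lattice: "padic_lattice CE ?\<pi> ?A p"
  proof (intro padic_lattice.intro padic_lattice_axioms.intro, goal_cases)
    case 1 show ?case by (rule field_CE)
  next
    case 2 show ?case by simp
  next
    case 3 show ?case by (rule nz[OF p0])
  next
    case 4 show ?case
    proof (rule F.add.subgroupI)
      show "?A \<noteq> {}" using B0 Q(2) by blast
    qed (use Qc Bc_add Bc_minus Q(5,7) in auto)
  next
    case (5 x)
    then have "?\<pi> \<otimes>\<^bsub>CE\<^esub> x \<in> Bc (1 + 0)" using Bc_mult[OF \<pi>(2)] by blast
    then show ?case using Bc_mono[of 0 "1 + 0"] Q(6)[OF \<pi>(1)] 5 by auto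
  next
    case (6 x)
    then have "x \<in> QQ \<inter> Bc (real n)" for n unfolding padic_levels .
    then show ?case using Bc_all_zero Bc_carrier by blast
  next
    case (7 s)
    \<comment> \<open>The terms \<open>s i\<close> range over the whole completion and only their
      increments are p-adic numbers; subtracting \<open>s 0\<close> moves the sequence into
      \<open>QQ\<close>.\<close>
    define d where "d i = s i \<ominus>\<^bsub>CE\<^esub> s 0" for i
    have step: "s (Suc i) \<ominus>\<^bsub>CE\<^esub> s i \<in> QQ \<inter> Bc (real i)" for i using 7(2)[of i] unfolding padic_levels .
    have dc: "d i \<in> carrier CE" for i unfolding d_def using 7(1) by simp
    have ds: "d (Suc i) \<ominus>\<^bsub>CE\<^esub> d i = s (Suc i) \<ominus>\<^bsub>CE\<^esub> s i" for i
      unfolding d_def using telescope 7(1) by blast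
    have dQ: "d i \<in> QQ" for i
    proof (induction i)
      case 0 then show ?case using 7(1)[of 0] Q(2) by (simp add: d_def F.r_right_minus_eq[THEN iffD2])
    next
      case (Suc i)
      have "d (Suc i) = (d (Suc i) \<ominus>\<^bsub>CE\<^esub> d i) \<oplus>\<^bsub>CE\<^esub> d i" using cancel(1)[OF dc dc] by simp
      then show ?case using Q(7)[OF _ Suc, of "d (Suc i) \<ominus>\<^bsub>CE\<^esub> d i"] step[of i] ds[of i] by auto
    qed
    \<comment> \<open>A diagonal choice: approximating the i-th term by a rational up to level i
      yields one Cauchy sequence of rationals, whose class is the limit.\<close>
    have "\<forall>i. \<exists>r. r \<in> rationals E \<and> d i \<ominus>\<^bsub>CE\<^esub> emb r \<in> Bc (real i)" using QQ_approx[OF dQ] by blast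
    then obtain r where r: "\<And>i. r i \<in> rationals E" "\<And>i. d i \<ominus>\<^bsub>CE\<^esub> emb (r i) \<in> Bc (real i)" by metis
    have rc: "r i \<in> carrier E" "emb (r i) \<in> carrier CE" for i using r(1) rationals_carrier ec by auto
    have rs: "V (real i) (r (Suc i) \<ominus> r i)" for i
    proof -
      have "emb (r (Suc i)) \<ominus>\<^bsub>CE\<^esub> emb (r i) = ((d (Suc i) \<ominus>\<^bsub>CE\<^esub> d i) \<oplus>\<^bsub>CE\<^esub> (d i \<ominus>\<^bsub>CE\<^esub> emb (r i))) \<ominus>\<^bsub>CE\<^esub> (d (Suc i) \<ominus>\<^bsub>CE\<^esub> emb (r (Suc i)))"
        by (rule zigzag[OF dc dc rc(2) rc(2), symmetric])
      moreover have "d (Suc i) \<ominus>\<^bsub>CE\<^esub> d i \<in> Bc (real i)" using step[of i] ds[of i] by simp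
      moreover have "d (Suc i) \<ominus>\<^bsub>CE\<^esub> emb (r (Suc i)) \<in> Bc (real i)" using r(2)[of "Suc i"] Bc_mono[of "real i" "real (Suc i)"] by auto
      ultimately have "emb (r (Suc i)) \<ominus>\<^bsub>CE\<^esub> emb (r i) \<in> Bc (real i)" using Bs Bc_add r(2)[of i] by metis
      then show ?thesis using em[OF rc(1) rc(1)] emb_Bc[of "r (Suc i) \<ominus> r i"] rc(1) by simp
    qed
    note cr = slow_cauchy[of r, OF rc(1) rs]
    have rQ: "cls r \<in> QQ" unfolding QQ_def using cr(1) r(1) by blast
    have "(s 0 \<oplus>\<^bsub>CE\<^esub> cls r) \<ominus>\<^bsub>CE\<^esub> s i \<in> QQ \<inter> Bc (real i)" for i
    proof -
      have "(s 0 \<oplus>\<^bsub>CE\<^esub> cls r) \<ominus>\<^bsub>CE\<^esub> s i = cls r \<ominus>\<^bsub>CE\<^esub> d i"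
        unfolding d_def by (rule chain(2)[OF 7(1) Qc[OF rQ] 7(1)])
      moreover have "cls r \<ominus>\<^bsub>CE\<^esub> d i = (cls r \<ominus>\<^bsub>CE\<^esub> emb (r i)) \<ominus>\<^bsub>CE\<^esub> (d i \<ominus>\<^bsub>CE\<^esub> emb (r i))"
        by (rule telescope[OF Qc[OF rQ] dc rc(2), symmetric])
      ultimately show ?thesis using Qs[OF rQ dQ[of i]] Bs[OF cr(2)[of i] r(2)[of i]] by simp
    qed
    then show ?case unfolding padic_levels using 7(1)[of 0] Qc[OF rQ] by blast
  next
    case 8
    \<comment> \<open>The residues 0, ..., p - 1.\<close>
    let ?T = "(\<lambda>c. emb ([(c::nat)] \<cdot> \<one>)) ` {..<p}"
    have "\<exists>t\<in>?T. x \<ominus>\<^bsub>CE\<^esub> t \<in> (\<otimes>\<^bsub>CE\<^esub>) ?\<pi> ` ?A" if x: "x \<in> ?A" for x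
    proof -
      obtain r where r: "r \<in> rationals E" "x \<ominus>\<^bsub>CE\<^esub> emb r \<in> Bc 1" using QQ_approx[of x 1] x by auto
      have rc: "r \<in> carrier E" "emb r \<in> carrier CE" "x \<in> carrier CE" using r(1) rationals_carrier ec x Qc by auto
      have "emb r = x \<ominus>\<^bsub>CE\<^esub> (x \<ominus>\<^bsub>CE\<^esub> emb r)" by (rule cancel(2)[OF rc(3,2), symmetric])
      moreover have "x \<ominus>\<^bsub>CE\<^esub> emb r \<in> Bc 0" using r(2) Bc_mono[of 0 1] by auto
      ultimately have "emb r \<in> Bc 0" using Bs x by (metis IntD2)
      then have "V 0 r" using emb_Bc rc(1) by blast
      then obtain c where c: "c < p" "V 1 (r \<ominus> [c] \<cdot> \<one>)" using rational_residue[OF r(1)] by blast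
      let ?c = "emb ([c] \<cdot> \<one>)"
      have cc: "?c \<in> carrier CE" "?c \<in> QQ" using ec nat_rational emb_QQ by auto
      have "emb r \<ominus>\<^bsub>CE\<^esub> ?c \<in> Bc 1" using em[OF rc(1), of "[c] \<cdot> \<one>"] emb_Bc[of "r \<ominus> [c] \<cdot> \<one>" 1] c(2) rc(1) by simp
      moreover have "x \<ominus>\<^bsub>CE\<^esub> ?c = (x \<ominus>\<^bsub>CE\<^esub> emb r) \<oplus>\<^bsub>CE\<^esub> (emb r \<ominus>\<^bsub>CE\<^esub> ?c)" by (rule chain(1)[OF rc(3,2) cc(1), symmetric])
      ultimately have "x \<ominus>\<^bsub>CE\<^esub> ?c \<in> Bc 1" using Bc_add[OF r(2)] by simp
      then have "x \<ominus>\<^bsub>CE\<^esub> ?c \<in> QQ \<inter> Bc (real 1)" using Qs[of x ?c] x cc(2) by simp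
      then have "x \<ominus>\<^bsub>CE\<^esub> ?c \<in> (\<otimes>\<^bsub>CE\<^esub>) ?\<pi> ` ?A" unfolding padic_levels[symmetric] by simp
      then show ?thesis using c(1) by blast
    qed
    moreover have "?T \<subseteq> ?A"
      using emb_QQ nat_rational emb_Bc[OF nat_closed, of _ 0] v_int_nonneg[of "int _"] int_of_nat by (auto simp: zero_ereal_def)
    moreover have "card ?T \<le> p" using card_image_le[of "{..<p}" "\<lambda>c. emb ([(c::nat)] \<cdot> \<one>)"] by simp
    ultimately show ?case by (intro exI[of _ ?T]) auto
  qed
  show ?thesis
  proof (intro padic_balls.intro padic_base.intro padic_base_axioms.intro padic_balls_axioms.intro, goal_cases)
    case 1 show ?case by (rule padic_lattice)
  next
    case 2 show ?case by (rule subfield_QQ)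
  next
    case 3 show ?case by blast
  next
    case 4 show ?case using Q(3) B1 by blast
  next
    case (5 x y) then show ?case using Q(6) Bc_mult[of x 0 y 0] by auto
  next
    case (6 x)
    then have xc: "x \<in> carrier CE" using Qc by blast
    obtain c where c: "x \<in> Bc c" using Bc_ex[OF xc] by blast
    obtain n :: nat where n: "- c \<le> real n" using real_arch_simple by blast
    have "?\<pi> [^]\<^bsub>CE\<^esub> m \<otimes>\<^bsub>CE\<^esub> x \<in> QQ \<and> ?\<pi> [^]\<^bsub>CE\<^esub> m \<otimes>\<^bsub>CE\<^esub> x \<in> Bc (c + real m)" for m :: nat
    proof (induction m)
      case 0 then show ?case using c 6 xc by simp
    next
      case (Suc m)
      have eq: "?\<pi> [^]\<^bsub>CE\<^esub> Suc m \<otimes>\<^bsub>CE\<^esub> x = ?\<pi> \<otimes>\<^bsub>CE\<^esub> (?\<pi> [^]\<^bsub>CE\<^esub> m \<otimes>\<^bsub>CE\<^esub> x)"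
        using xc by (simp add: F.m_assoc F.m_comm F.m_lcomm)
      show ?case unfolding eq
        using Q(6)[OF \<pi>(1)] Bc_mult[OF \<pi>(2), of "?\<pi> [^]\<^bsub>CE\<^esub> m \<otimes>\<^bsub>CE\<^esub> x" "c + real m"] Suc by (simp add: algebra_simps)
    qed
    then show ?case using Bc_mono[of 0 "c + real n"] n by (intro exI[of _ n]) auto
  next
    case 7 show ?case by (rule p_prime)
  next
    case (8 c)
    have "\<not> int p dvd int c" using 8 p_prime by (metis coprime_absorb_right int_dvd_int_iff not_prime_unit)
    note u = int_unit[OF this]
    let ?c = "[c] \<cdot> \<one>"
    have "0 < c" using 8 p_prime by (cases c) auto
    then have cn: "?c \<noteq> \<zero>" by (rule nat_nonzero)
    have ic: "inv ?c \<in> rationals E" using subfield_m_inv(1)[OF rationals, of ?c] nat_rational cn by auto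
    have icc: "inv ?c \<in> carrier E" "?c \<otimes> inv ?c = \<one>" using cn field_Units by auto
    have "emb (inv ?c) \<in> ?A" using emb_QQ[OF ic] emb_Bc[OF icc(1), of 0] u(2) int_of_nat[of c] by (simp add: zero_ereal_def)
    moreover have "([c] \<cdot>\<^bsub>CE\<^esub> \<one>\<^bsub>CE\<^esub>) \<otimes>\<^bsub>CE\<^esub> emb (inv ?c) = \<one>\<^bsub>CE\<^esub>"
      unfolding emb_nat[symmetric] using e.hom_mult[of ?c "inv ?c"] icc e.hom_one by simp
    ultimately show ?case by blast
  next
    case (9 n) then show ?case by (rule nz)
  next
    case (10 x c) then show ?case by (rule Bc_carrier)
  next
    case (11 x c y) then show ?case by (rule Bc_add)
  next
    case (12 x c) then show ?case by (rule Bc_minus)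
  next
    case (13 x c y d) then show ?case by (rule Bc_mult)
  next
    case (14 d c) then show ?case by (rule Bc_mono)
  next
    case (15 x) then show ?case by (rule Bc_all_zero)
  next
    case (16 x) then show ?case by (rule Bc_ex)
  next
    case (17 c) show ?case by (rule B0)
  next
    case 18 show ?case by blast
  next
    case (19 x c) then show ?case by (rule Bc_scale)
  qed
qed

text \<open>A finite-dimensional span is closed; containing the dense image of \<open>E\<close>, it
  is everything.\<close>

lemma Span_completion:
  assumes us: "ring.independent CE QQ us" and sub: "emb ` carrier E \<subseteq> ring.Span CE QQ us"
  shows "ring.Span CE QQ us = carrier CE"
proof -
  interpret P: padic_balls CE p "QQ \<inter> Bc 0" QQ Bc by (rule padic_balls)
  have "y \<in> P.Span QQ us" if y: "y \<in> carrier CE" for y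
  proof (rule P.Span_closed[OF us y])
    fix c
    obtain s where s: "s \<in> cauchy_seqs E v" "y = cls s" using y unfolding CE_carrier by auto
    then show "\<exists>x\<in>P.Span QQ us. y \<ominus>\<^bsub>CE\<^esub> x \<in> Bc c" using dense[OF s(1), of c] sub cauchyD[OF s(1)] by blast
  qed
  then show ?thesis using P.Span_in_carrier[OF P.k0_carrier[THEN subsetI] P.independent_in_carrier[OF us]] by blast
qed

end

section \<open>Finite Galois subextensions\<close>

text \<open>Divisibility between polynomials over \<open>F\<close> can be tested over
  \<open>R\<close>, so multiplicities of roots in \<open>F\<close> do not depend on the
  field.\<close>

lemma (in field) alg_mult_consistent:
  assumes F: "subfield F R" and p: "p \<in> carrier (F[X])" and x: "x \<in> F"
  shows "ring.alg_mult (R\<lparr>carrier := F\<rparr>) p x = alg_mult p x"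
proof -
  interpret F: field "R\<lparr>carrier := F\<rparr>" by (rule subfield_iff(2)[OF F])
  note s = subringE[OF subfieldE(1)[OF F]]
  interpret UF: ring "F[X]" by (rule univ_poly_is_ring[OF subfieldE(1)[OF F]])
  have neg: "\<ominus>\<^bsub>R\<lparr>carrier := F\<rparr>\<^esub> x = \<ominus> x"
    by (rule F.minus_equality) (use x s(1,5) in \<open>auto simp: l_neg\<close>)
  have xc: "x \<in> carrier R" using x s(1) by blast
  have UP: "poly_ring (R\<lparr>carrier := F\<rparr>) = F[X]" using univ_poly_consistent[OF subfieldE(1)[OF F]] by simp
  have q: "[\<one>, \<ominus> x] \<in> carrier (F[X])" using x s(3,5) unfolding univ_poly_carrier[symmetric] polynomial_def by auto
  have pow: "a [^]\<^bsub>F[X]\<^esub> (n::nat) = a [^]\<^bsub>poly_ring R\<^esub> n" for a n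
    by (simp add: univ_poly_def nat_pow_def)
  have "([\<one>, \<ominus> x] [^]\<^bsub>F[X]\<^esub> n) pdivides\<^bsub>R\<lparr>carrier := F\<rparr>\<^esub> p \<longleftrightarrow> ([\<one>, \<ominus> x] [^]\<^bsub>poly_ring R\<^esub> n) pdivides p" for n :: nat
    using pdivides_iff_shell[OF F UF.nat_pow_closed[OF q] p, of n] unfolding pdivides_def UP pow by simp
  then show ?thesis unfolding F.alg_mult_def alg_mult_def UP using x xc neg by simp
qed

text \<open>When all roots in \<open>R\<close> lie in \<open>F\<close>, multiplicities agree on
  \<open>F\<close> and vanish outside it, so the multisets of roots coincide.\<close>

lemma (in field) splitted_consistent:
  assumes F: "subfield F R" and p: "p \<in> carrier (F[X])" "p \<noteq> []" "splitted p"
    and roots: "\<And>y. y \<in> carrier R \<Longrightarrow> eval p y = \<zero> \<Longrightarrow> y \<in> F"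
  shows "ring.splitted (R\<lparr>carrier := F\<rparr>) p"
proof -
  interpret F: field "R\<lparr>carrier := F\<rparr>" by (rule subfield_iff(2)[OF F])
  have pR: "p \<in> carrier (poly_ring R)" by (rule carrier_polynomial_shell[OF subfieldE(1)[OF F] p(1)])
  have "F.alg_mult p y = alg_mult p y" for y
  proof (cases "y \<in> F")
    case True then show ?thesis by (rule alg_mult_consistent[OF F p(1)])
  next
    case False
    then have "\<not> is_root p y" using roots unfolding is_root_def by blast
    then have "alg_mult p y = 0" using alg_mult_gt_zero_iff_is_root[OF pR, of y] by simp
    then show ?thesis using False p(2) unfolding F.alg_mult_def by simp
  qed
  then have "F.alg_mult p = alg_mult p" ..
  then show ?thesis using p(3) unfolding F.splitted_def splitted_def F.roots_def roots_def by simp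
qed

locale galois_char_zero = field K for K (structure) +
  assumes char_zero: "0 < (n::nat) \<Longrightarrow> [n] \<cdot> \<one> \<noteq> \<zero>"
    and galois: "galois_extension K (rationals K)"
begin

abbreviation k where "k \<equiv> rationals K"

lemma k: "subfield k K" using galois unfolding galois_extension_def by blast

lemma algebraic_k: "x \<in> carrier K \<Longrightarrow> (algebraic over k) x"
  using galois unfolding galois_extension_def normal_extension_def over_def by blast

lemma Irr_root: "x \<in> carrier K \<Longrightarrow> is_root (Irr k x) x"
  using IrrE[OF k _ algebraic_k] pirreducible_degree[OF k IrrE(1,2)[OF k _ algebraic_k]] unfolding is_root_def by fastforce

lemma Irr_splitted: "x \<in> carrier K \<Longrightarrow> splitted (Irr k x)"
  using galois IrrE(1,2)[OF k _ algebraic_k] Irr_root unfolding galois_extension_def normal_extension_def by blast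

lemma Irr_nonzero: "x \<in> carrier K \<Longrightarrow> Irr k x \<noteq> []"
  using Irr_root unfolding is_root_def by blast

lemma map_fixing:
  assumes "f \<in> carrier (k[X])" "\<And>x. x \<in> k \<Longrightarrow> h x = x" shows "map h f = f"
proof (rule map_idI)
  fix x assume "x \<in> set f"
  then have "x \<in> k" using assms(1) unfolding univ_poly_carrier[symmetric] polynomial_def by auto
  then show "h x = x" by (rule assms(2))
qed

lemma extend_hom:
  assumes E: "subfield E K" "k \<subseteq> E" and h: "h \<in> ring_hom (K\<lparr>carrier := E\<rparr>) K" and hk: "\<And>x. x \<in> k \<Longrightarrow> h x = x"
  obtains h' where "h' \<in> ring_hom K K" "\<And>x. x \<in> E \<Longrightarrow> h' x = h x"
proof (rule hom_extend[OF field_axioms field_axioms k algebraic_k E h])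
  fix x assume "x \<in> carrier K"
  then show "splitted (map h (Irr k x))"
    using map_fixing[OF IrrE(1)[OF k _ algebraic_k] hk] Irr_splitted by simp
qed (use that in auto)

text \<open>Taking the whole field as its own generating set makes \<open>hom_image\<close>
  applicable, also when \<open>K\<close> is infinite over \<open>k\<close>; surjectivity is decided
  on the finite sets of conjugates.\<close>

lemma hom_bij:
  assumes h: "h \<in> ring_hom K K" and hk: "\<And>x. x \<in> k \<Longrightarrow> h x = x"
  shows "bij_betw h (carrier K) (carrier K)"
proof -
  interpret normal_subfield K k "carrier K" "carrier K"
  proof (intro normal_subfield.intro normal_subfield_axioms.intro field_axioms k carrier_is_subfield subfieldE(3)[OF k] subset_refl)
    fix s assume s: "s \<in> carrier K"
    then show "\<exists>f\<in>carrier (k[X]). f \<noteq> [] \<and> eval f s = \<zero> \<and> (\<forall>y\<in>carrier K. eval f y = \<zero> \<longrightarrow> y \<in> carrier K)"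
      using IrrE[OF k s algebraic_k[OF s]] Irr_nonzero[OF s] by blast
  qed
  show ?thesis using hom_image[of h] h hk by simp
qed

text \<open>By normality \<open>h\<close> extends to an automorphism of \<open>K\<close>, where the
  exponent applies; since \<open>h\<close> preserves \<open>F\<close>, the iterates of the extension
  agree with those of \<open>h\<close> there.\<close>

lemma hom_exponent:
  assumes exp: "has_exponent (Gal K k) b" and F: "subfield F K" "k \<subseteq> F"
    and h: "h \<in> ring_hom (K\<lparr>carrier := F\<rparr>) K" "h ` F \<subseteq> F" and hk: "\<And>x. x \<in> k \<Longrightarrow> h x = x" and x: "x \<in> F"
  shows "(h ^^ b) x = x"
proof -
  obtain h' where h': "h' \<in> ring_hom K K" "\<And>x. x \<in> F \<Longrightarrow> h' x = h x"
    using extend_hom[OF F h(1) hk] by blast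
  let ?g = "restrict h' (carrier K)"
  have h'k: "h' z = z" if "z \<in> k" for z using h'(2) hk F(2) that by auto
  have kc: "k \<subseteq> carrier K" by (rule subfieldE(3)[OF k])
  have g: "?g \<in> carrier (Gal K k)"
    by (rule GalI[OF h'(1) hom_bij[OF h'(1) h'k] h'k kc field_axioms])
  have xc: "x \<in> carrier K" using x subfieldE(3)[OF F(1)] by blast
  have "?g [^]\<^bsub>Gal K k\<^esub> b = \<one>\<^bsub>Gal K k\<^esub>" using exp g unfolding has_exponent_def by blast
  then have "(?g ^^ b) x = x" using Gal_pow_apply[OF field_axioms kc g xc, of b] xc by (simp add: Gal_simps)
  moreover have "(?g ^^ n) x = (h ^^ n) x \<and> (h ^^ n) x \<in> F" for n
  proof (induction n)
    case (Suc n)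
    then have "(h ^^ n) x \<in> F" by blast
    then show ?case using Suc h(2) h'(2) subfieldE(3)[OF F(1)] by auto
  qed (use x in simp)
  ultimately show ?thesis by metis
qed

text \<open>Adjoins all conjugates of the elements of \<open>A\<close>. The polynomials that define
  the generators then have all their roots in the field, which is the hypothesis of
  \<open>normal_subfield\<close>.\<close>

lemma finite_galois_subextension:
  assumes A: "finite A" "A \<subseteq> carrier K"
  obtains F where "subfield F K" "k \<subseteq> F" "A \<subseteq> F" "finite_dimension k F" "galois_extension (K\<lparr>carrier := F\<rparr>) k"
proof -
  let ?Z = "\<Union>a\<in>A. {y. is_root (Irr k a) y}"
  have IrrK: "Irr k a \<in> carrier (poly_ring K)" if "a \<in> carrier K" for a
    by (rule carrier_polynomial_shell[OF subfieldE(1)[OF k] IrrE(1)[OF k that algebraic_k[OF that]]])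
  have "finite ?Z" using A finite_number_of_roots[OF IrrK] by auto
  then obtain xs where xs: "set xs = ?Z" using finite_list by blast
  have xsc: "set xs \<subseteq> carrier K" unfolding xs is_root_def by auto
  define F where "F = finite_extension k xs"
  note sk = subfieldE(1)[OF k]
  have F: "subfield F K" unfolding F_def by (rule finite_extension_is_subfield[OF k xsc algebraic_k]) (use xsc in blast)
  have kF: "k \<subseteq> F" unfolding F_def by (rule finite_extension_incl[OF subfieldE(3)[OF k] xsc])
  have xF: "set xs \<subseteq> F" unfolding F_def by (rule finite_extension_mem[OF sk xsc])
  have AF: "A \<subseteq> F" using xF A(2) Irr_root unfolding xs by blast
  have fin: "finite_dimension k F" unfolding F_def by (rule finite_extension_finite_dimension(1)[OF k xsc algebraic_k]) (use xsc in blast)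
  interpret N: normal_subfield K k F ?Z
  proof (intro normal_subfield.intro normal_subfield_axioms.intro field_axioms k F kF)
    show "?Z \<subseteq> F" using xF xs by simp
    show "F \<subseteq> F'" if "subfield F' K" "k \<subseteq> F'" "?Z \<subseteq> F'" for F'
      unfolding F_def by (rule finite_extension_subring_incl[OF subfieldE(1)[OF that(1)] that(2)]) (use that xs in simp)
    fix s assume "s \<in> ?Z"
    then obtain a where a: "a \<in> A" "is_root (Irr k a) s" by blast
    have "y \<in> F" if "y \<in> carrier K" "eval (Irr k a) y = \<zero>" for y
      using that a xF unfolding xs is_root_def by blast
    then show "\<exists>f\<in>carrier (k[X]). f \<noteq> [] \<and> eval f s = \<zero> \<and> (\<forall>y\<in>carrier K. eval f y = \<zero> \<longrightarrow> y \<in> F)"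
      using a IrrE(1)[OF k _ algebraic_k] A(2) unfolding is_root_def by blast
  qed
  let ?E = "K\<lparr>carrier := F\<rparr>"
  interpret E: field ?E by (rule N.field_NN)
  have Fc: "F \<subseteq> carrier K" by (rule subfieldE(3)[OF F])
  note sF = subfieldE(1)[OF F]
  have kE: "subfield k ?E" by (rule subfield_subfield[OF k F kF])
  have algE: "(ring.algebraic ?E over k) z" if "z \<in> carrier ?E" for z
    using algebraic_k[of z] that Fc unfolding over_def transcendental_consistent[OF sF, symmetric] by auto
  have kFX: "f \<in> carrier (F[X])" if "f \<in> carrier (k[X])" for f
    using that kF unfolding univ_poly_carrier[symmetric] polynomial_def by auto
  \<comment> \<open>Normality for arbitrary elements, not just for generators: the map sending
    \<open>y\<close> to its conjugate \<open>y'\<close> extends to \<open>K\<close>, and every such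
    extension preserves \<open>F\<close>.\<close>
  have norm: "y' \<in> F" if y: "y \<in> F" and y': "y' \<in> carrier K" "eval (Irr k y) y' = \<zero>" for y y'
  proof -
    have yc: "y \<in> carrier K" using y Fc by blast
    have idh: "(\<lambda>z. z) \<in> ring_hom (K\<lparr>carrier := k\<rparr>) K" using subfieldE(3)[OF k] by (auto simp: ring_hom_def)
    obtain E' h where E': "subfield E' K" "k \<subseteq> E'" "y \<in> E'" "h \<in> ring_hom (K\<lparr>carrier := E'\<rparr>) K"
      "\<And>z. z \<in> k \<Longrightarrow> h z = z" "h y = y'"
      by (rule hom_extend_simple[OF field_axioms field_axioms k idh yc algebraic_k[OF yc], of y']) (use y' in auto)
    obtain h' where h': "h' \<in> ring_hom K K" "\<And>x. x \<in> E' \<Longrightarrow> h' x = h x"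
      using extend_hom[OF E'(1,2,4,5)] by blast
    have "h' \<in> ring_hom (K\<lparr>carrier := F\<rparr>) (K\<lparr>carrier := carrier K\<rparr>)"
      by (rule ring_hom_carrier_restrict[OF h'(1) Fc]) (use Fc ring_hom_closed[OF h'(1)] in auto)
    moreover have "h' z = z" if "z \<in> k" for z using h'(2)[of z] E'(2,5) that by auto
    ultimately have "bij_betw h' F F" using N.hom_image[of h'] by simp
    then show ?thesis using bij_betwE y h'(2)[OF E'(3)] E'(6) by metis
  qed
  have "galois_extension ?E k"
    unfolding galois_extension_def
  proof (intro conjI)
    show "field ?E" by (rule E.field_axioms)
    show "subfield k ?E" by (rule kE)
    show "normal_extension ?E k"
      unfolding normal_extension_def
    proof (intro conjI ballI impI)
      show "ring.algebraic ?E k x" if "x \<in> carrier ?E" for x using algE[OF that] unfolding over_def .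
      fix f assume "f \<in> carrier (k[X]\<^bsub>?E\<^esub>)" and pr: "pirreducible\<^bsub>?E\<^esub> k f \<and> (\<exists>x. E.is_root f x)"
      then have f: "f \<in> carrier (k[X])" "pirreducible k f" using pr unfolding univ_poly_consistent[OF sF] by auto
      obtain x where x: "x \<in> F" "eval f x = \<zero>" "f \<noteq> []" using pr unfolding E.is_root_def by (auto simp: eval_consistent[OF sF])
      have xc: "x \<in> carrier K" using x(1) Fc by blast
      have spl: "splitted f" using galois f x xc unfolding galois_extension_def normal_extension_def is_root_def by blast
      have dv: "Irr k x pdivides f" by (rule Irr_minimal[OF k xc algebraic_k[OF xc] f(1) x(2)])
      note I = IrrE(1,2)[OF k xc algebraic_k[OF xc]]
      interpret UP: domain "k[X]" by (rule univ_poly_is_domain[OF sk])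
      obtain r where r: "r \<in> carrier (k[X])" "f = Irr k x \<otimes>\<^bsub>k[X]\<^esub> r"
        using dv unfolding pdivides_iff_shell[OF k I(1) f(1)] factor_def by auto
      have "Irr k x \<notin> Units (k[X])" by (rule pirreducibleE(2)[OF sk I])
      \<comment> \<open>An irreducible \<open>f\<close> with root \<open>x\<close> is associated to
        the minimal polynomial of \<open>x\<close>; the two have the same roots, so
        \<open>norm\<close> covers \<open>f\<close>.\<close>
      then have ru: "r \<in> Units (k[X])" using pirreducibleE(3)[OF sk f I(1) r] by blast
      have "y \<in> F" if y: "y \<in> carrier K" "eval f y = \<zero>" for y
      proof (rule norm[OF x(1) y(1)])
        obtain q where q: "q \<in> carrier (k[X])" "Irr k x = f \<otimes>\<^bsub>k[X]\<^esub> q"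
        proof
          show "inv\<^bsub>k[X]\<^esub> r \<in> carrier (k[X])" using ru by simp
          show "Irr k x = f \<otimes>\<^bsub>k[X]\<^esub> inv\<^bsub>k[X]\<^esub> r" using r ru I(1) by (simp add: UP.m_assoc)
        qed
        have "eval (f \<otimes>\<^bsub>k[X]\<^esub> q) y = eval f y \<otimes> eval q y"
          using ring_hom_mult[OF eval_is_hom[OF sk y(1)] f(1) q(1)] .
        then show "eval (Irr k x) y = \<zero>"
          using q y eval_in_carrier[OF _ y(1), of q] carrier_polynomial_shell[OF sk q(1)] unfolding univ_poly_carrier[symmetric] polynomial_def by auto
      qed
      then show "E.splitted f" by (rule splitted_consistent[OF F kFX[OF f(1)] x(3) spl])
    qed
    show "separable_extension ?E k"
      unfolding separable_extension_def
    proof (intro ballI conjI)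
      fix x assume x: "x \<in> carrier ?E"
      show "ring.algebraic ?E k x" using algE[OF x] unfolding over_def .
      have xc: "x \<in> carrier K" "x \<in> F" using x Fc by auto
      have "alg_mult (Irr k x) x = 1" using galois xc(1) unfolding galois_extension_def separable_extension_def by blast
      then show "E.alg_mult (E.Irr k x) x = 1"
        unfolding Irr_consistent[OF sF] using alg_mult_consistent[OF F kFX[OF IrrE(1)[OF k xc(1) algebraic_k[OF xc(1)]]] xc(2)] by simp
    qed
  qed
  then show ?thesis using that F kF AF fin by blast
qed

end

section \<open>From finite subextensions to the completion\<close>

lemma (in valued) cls_eq_iff:
  assumes "s \<in> cauchy_seqs E v" "t \<in> cauchy_seqs E v"
  shows "cls s = cls t \<longleftrightarrow> (\<lambda>i. s i \<oplus> \<ominus> t i) \<in> NS"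
proof -
  interpret F: field CE by (rule field_CE)
  interpret H: ring_hom_ring CR CE cls by (rule cls_hom)
  have c: "cls s \<in> carrier CE" "cls t \<in> carrier CE" using assms CE_carrier by auto
  have m: "\<ominus>\<^bsub>CR\<^esub> t \<in> carrier CR" "\<ominus>\<^bsub>CR\<^esub> t = (\<lambda>i. \<ominus> t i)" using CR_minus[OF assms(2)] cauchy_minus[OF assms(2)] by auto
  have "cls (\<lambda>i. s i \<oplus> \<ominus> t i) = cls s \<ominus>\<^bsub>CE\<^esub> cls t"
    using H.hom_add[of s "\<ominus>\<^bsub>CR\<^esub> t"] H.hom_a_inv[of t] assms m unfolding a_minus_def by simp
  then show ?thesis
    using cls_zero_iff[OF cauchy_add[OF assms(1) cauchy_minus[OF assms(2)]]] F.r_right_minus_eq[OF c] by simp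
qed

locale galois_valued = galois_char_zero +
  fixes w :: "'a \<Rightarrow> ereal" and p :: nat
  assumes prime: "Factorial_Ring.prime p" and valuation: "valuation K w" and extends: "extends_padic K w p"
begin

lemma int_pow_consistent: "subfield F K \<Longrightarrow> [(m::int)] \<cdot>\<^bsub>K\<lparr>carrier := F\<rparr>\<^esub> \<one> = [m] \<cdot> \<one>"
proof -
  assume F: "subfield F K"
  have "subgroup F (add_monoid K)" "\<one> \<in> F" using subring.axioms(1)[OF subfieldE(1)[OF F]] subringE(3)[OF subfieldE(1)[OF F]] by auto
  from group.int_pow_consistent[OF a_group this, of m] show ?thesis by (simp add: add_pow_def)
qed

lemma int_pow_mem: "subfield F K \<Longrightarrow> [(m::int)] \<cdot> \<one> \<in> F"
proof -
  assume F: "subfield F K"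
  have "subgroup F (add_monoid K)" "\<one> \<in> F" using subring.axioms(1)[OF subfieldE(1)[OF F]] subringE(3)[OF subfieldE(1)[OF F]] by auto
  from group.subgroup_int_pow_closed[OF a_group this, of m] show ?thesis by (simp add: add_pow_def)
qed

lemma int_pow_nonzero: "0 < (m::int) \<Longrightarrow> [m] \<cdot> \<one> \<noteq> \<zero>"
  using char_zero[of "nat m"] add_pow_int_ge[of m K \<one>] by simp

lemma denominator: "[snd (quotient_of q)] \<cdot> \<one> \<noteq> \<zero>"
  using int_pow_nonzero quotient_of_denom_pos'[of q] by blast

lemma rat_embed_consistent:
  assumes F: "subfield F K" shows "rat_embed (K\<lparr>carrier := F\<rparr>) = rat_embed K"
proof
  fix q
  let ?b = "[snd (quotient_of q)] \<cdot> \<one>"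
  interpret E: field "K\<lparr>carrier := F\<rparr>" by (rule subfield_iff(2)[OF F])
  have "?b \<in> Units (K\<lparr>carrier := F\<rparr>)" using E.field_Units int_pow_mem[OF F] denominator by simp
  then have "inv\<^bsub>K\<lparr>carrier := F\<rparr>\<^esub> ?b = inv ?b"
    by (rule m_inv_monoid_consistent[OF _ subring.axioms(2)[OF subfieldE(1)[OF F]]])
  then show "rat_embed (K\<lparr>carrier := F\<rparr>) q = rat_embed K q"
    unfolding rat_embed_def by (simp add: int_pow_consistent[OF F])
qed

lemma rationals_consistent: "subfield F K \<Longrightarrow> rationals (K\<lparr>carrier := F\<rparr>) = k"
  unfolding rationals_def by (simp add: rat_embed_consistent)

lemma k_subset: assumes F: "subfield F K" shows "k \<subseteq> F"
proof
  fix x assume "x \<in> k"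
  then obtain q where q: "x = rat_embed K q" unfolding rationals_def by auto
  have "inv ([snd (quotient_of q)] \<cdot> \<one>) \<in> F" using subfield_m_inv(1)[OF F] int_pow_mem[OF F] denominator by blast
  then show "x \<in> F" unfolding q rat_embed_def using int_pow_mem[OF F] subringE(6)[OF subfieldE(1)[OF F]] by blast
qed

lemma w_int: "w ([(m::int)] \<cdot> \<one>) = (if m = 0 then \<infinity> else ereal (real (multiplicity (int p) m)))"
proof -
  have "rat_embed K (rat_of_int m) = [m] \<cdot> \<one>"
    using int_pow_mem[OF carrier_is_subfield, of m] add_pow_int_ge[of 1 K \<one>] unfolding rat_embed_def by simp
  moreover have "w (rat_embed K (rat_of_int m)) = padic_valuation p (rat_of_int m)" using extends unfolding extends_padic_def by blast
  ultimately show ?thesis unfolding padic_valuation_def by simp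
qed

lemma valuation_restrict: "subfield F K \<Longrightarrow> valuation (K\<lparr>carrier := F\<rparr>) w"
  using valuation subfieldE(3)[of F K] unfolding valuation_def by (auto simp: subset_iff)

lemma lies_above_restrict: "subfield F K \<Longrightarrow> lies_above (K\<lparr>carrier := F\<rparr>) w p"
  using extends unfolding lies_above_def extends_padic_def
  by (intro exI[of _ 1]) (simp add: rat_embed_consistent one_ereal_def[symmetric])

lemma padic_valued_restrict: assumes F: "subfield F K" shows "padic_valued (K\<lparr>carrier := F\<rparr>) w p"
proof (intro padic_valued.intro valued.intro valued_axioms.intro padic_valued_axioms.intro)
  show "field (K\<lparr>carrier := F\<rparr>)" by (rule subfield_iff(2)[OF F])
  show "valuation (K\<lparr>carrier := F\<rparr>) w" by (rule valuation_restrict[OF F])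
  show "w ([m] \<cdot>\<^bsub>K\<lparr>carrier := F\<rparr>\<^esub> \<one>\<^bsub>K\<lparr>carrier := F\<rparr>\<^esub>) = (if m = 0 then \<infinity> else ereal (real (multiplicity (int p) m)))" for m
    using w_int[of m] by (simp add: int_pow_consistent[OF F])
  show "subfield (rationals (K\<lparr>carrier := F\<rparr>)) (K\<lparr>carrier := F\<rparr>)"
    unfolding rationals_consistent[OF F] by (rule subfield_subfield[OF k F k_subset[OF F]])
qed (rule prime)

lemma padic_valued_K: "padic_valued K w p"
  using padic_valued_restrict[OF carrier_is_subfield] by simp

lemma galois_char_zero_restrict:
  assumes F: "subfield F K" and gal: "galois_extension (K\<lparr>carrier := F\<rparr>) k"
  shows "galois_char_zero (K\<lparr>carrier := F\<rparr>)"
proof (intro galois_char_zero.intro galois_char_zero_axioms.intro)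
  show "field (K\<lparr>carrier := F\<rparr>)" by (rule subfield_iff(2)[OF F])
  show "galois_extension (K\<lparr>carrier := F\<rparr>) (rationals (K\<lparr>carrier := F\<rparr>))" using gal rationals_consistent[OF F] by simp
  show "[n] \<cdot>\<^bsub>K\<lparr>carrier := F\<rparr>\<^esub> \<one>\<^bsub>K\<lparr>carrier := F\<rparr>\<^esub> \<noteq> \<zero>\<^bsub>K\<lparr>carrier := F\<rparr>\<^esub>" if "0 < n" for n :: nat
    using int_pow_consistent[OF F, of "int n"] char_zero[OF that] by (simp add: add_pow_int_ge)
qed

text \<open>Cauchy and null sequences of \<open>F\<close> remain so in \<open>K\<close>, so passing
  to classes gives a map of completions that extends the inclusion and respects the closures of the
  rationals.\<close>

lemma completion_embedding:
  assumes F: "subfield F K"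
  obtains j where "j \<in> ring_hom (completion (K\<lparr>carrier := F\<rparr>) w) (completion K w)"
    "j ` padics_in (K\<lparr>carrier := F\<rparr>) w \<subseteq> padics_in K w"
    "\<And>x. x \<in> F \<Longrightarrow> j (valued.emb (K\<lparr>carrier := F\<rparr>) w x) = valued.emb K w x"
proof -
  let ?E = "K\<lparr>carrier := F\<rparr>"
  interpret VE: padic_valued ?E w p by (rule padic_valued_restrict[OF F])
  interpret VK: padic_valued K w p by (rule padic_valued_K)
  interpret HE: ring_hom_ring VE.CR VE.CE VE.cls by (rule VE.cls_hom)
  interpret HK: ring_hom_ring VK.CR VK.CE VK.cls by (rule VK.cls_hom)
  note Fc = subfieldE(3)[OF F]
  have neg: "\<ominus>\<^bsub>?E\<^esub> x = \<ominus> x" if "x \<in> F" for x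
    by (rule VE.minus_equality) (use that Fc subringE(5)[OF subfieldE(1)[OF F]] in \<open>auto simp: l_neg\<close>)
  have cauchy: "s \<in> cauchy_seqs K w" if "s \<in> cauchy_seqs ?E w" for s
  proof -
    have sF: "s i \<in> F" for i using VE.cauchyD[OF that] by simp
    have "s i \<ominus>\<^bsub>?E\<^esub> s j = s i \<ominus> s j" for i j using neg[OF sF] by (simp add: a_minus_def)
    then show ?thesis using that Fc unfolding cauchy_seqs_def by auto
  qed
  \<comment> \<open>Defined by a chosen representative; independence of the choice holds because two
    representatives differ by a null sequence in \<open>F\<close>, which is null in
    \<open>K\<close>.\<close>
  define j where "j c = VK.cls (SOME s. s \<in> cauchy_seqs ?E w \<and> VE.cls s = c)" for c
  have j: "j (VE.cls s) = VK.cls s" if s: "s \<in> cauchy_seqs ?E w" for s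
  proof -
    define t where "t = (SOME t. t \<in> cauchy_seqs ?E w \<and> VE.cls t = VE.cls s)"
    have "t \<in> cauchy_seqs ?E w \<and> VE.cls t = VE.cls s" unfolding t_def by (rule someI[of _ s]) (use s in simp)
    then have t: "t \<in> cauchy_seqs ?E w" "VE.cls t = VE.cls s" by auto
    then have "(\<lambda>i. t i \<oplus>\<^bsub>?E\<^esub> \<ominus>\<^bsub>?E\<^esub> s i) \<in> null_seqs ?E w" using VE.cls_eq_iff[OF t(1) s] by simp
    moreover have "\<ominus>\<^bsub>?E\<^esub> s i = \<ominus> s i" for i using neg VE.cauchyD[OF s] by simp
    ultimately have "(\<lambda>i. t i \<oplus> \<ominus> s i) \<in> null_seqs K w" using Fc unfolding null_seqs_def by auto
    then show ?thesis unfolding j_def t_def[symmetric] using VK.cls_eq_iff[OF cauchy[OF t(1)] cauchy[OF s]] by simp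
  qed
  have jh: "j \<in> ring_hom VE.CE VK.CE"
  proof (rule ring_hom_memI)
    fix x assume "x \<in> carrier VE.CE"
    then obtain s where s: "s \<in> cauchy_seqs ?E w" "x = VE.cls s" unfolding VE.CE_carrier by auto
    show "j x \<in> carrier VK.CE" unfolding s(2) j[OF s(1)] VK.CE_carrier using cauchy[OF s(1)] by blast
    fix y assume "y \<in> carrier VE.CE"
    then obtain t where t: "t \<in> cauchy_seqs ?E w" "y = VE.cls t" unfolding VE.CE_carrier by auto
    have "x \<otimes>\<^bsub>VE.CE\<^esub> y = VE.cls (\<lambda>i. s i \<otimes> t i)" using HE.hom_mult[of s t] s t by simp
    then show "j (x \<otimes>\<^bsub>VE.CE\<^esub> y) = j x \<otimes>\<^bsub>VK.CE\<^esub> j y"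
      using HK.hom_mult[of s t] cauchy s t j VE.cauchy_mult[OF s(1) t(1)] by simp
    have "x \<oplus>\<^bsub>VE.CE\<^esub> y = VE.cls (\<lambda>i. s i \<oplus> t i)" using HE.hom_add[of s t] s t by simp
    then show "j (x \<oplus>\<^bsub>VE.CE\<^esub> y) = j x \<oplus>\<^bsub>VK.CE\<^esub> j y"
      using HK.hom_add[of s t] cauchy s t j VE.cauchy_add[OF s(1) t(1)] by simp
  next
    have "\<one>\<^bsub>VE.CE\<^esub> = VE.cls (\<lambda>i. \<one>)" using HE.hom_one by simp
    then show "j \<one>\<^bsub>VE.CE\<^esub> = \<one>\<^bsub>VK.CE\<^esub>" using j[OF VE.cauchy_const[OF VE.one_closed]] HK.hom_one by simp
  qed
  show ?thesis
  proof (rule that[OF jh])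
    show "j ` padics_in ?E w \<subseteq> padics_in K w"
    proof
      fix x assume "x \<in> j ` padics_in ?E w"
      then obtain s where s: "s \<in> cauchy_seqs ?E w" "\<forall>i. s i \<in> k" "x = j (VE.cls s)"
        unfolding VE.QQ_def rationals_consistent[OF F] by auto
      then show "x \<in> padics_in K w" unfolding VK.QQ_def s(3) j[OF s(1)] using cauchy[OF s(1)] by blast
    qed
    show "j (VE.emb x) = VK.emb x" if "x \<in> F" for x
      unfolding VE.emb_def VK.emb_def using j VE.cauchy_const that by simp
  qed
qed

text \<open>A relation over the smaller completion is carried by the injective map \<open>j\<close>
  to a relation over the larger one, where its coefficients must vanish.\<close>

lemma independent_restrict:
  assumes F: "subfield F K" and xs: "set xs \<subseteq> F"
    and ind: "ring.independent (completion K w) (padics_in K w) (map (valued.emb K w) xs)"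
  shows "ring.independent (completion (K\<lparr>carrier := F\<rparr>) w) (padics_in (K\<lparr>carrier := F\<rparr>) w)
    (map (valued.emb (K\<lparr>carrier := F\<rparr>) w) xs)"
proof -
  let ?E = "K\<lparr>carrier := F\<rparr>"
  interpret VE: padic_valued ?E w p by (rule padic_valued_restrict[OF F])
  interpret VK: padic_valued K w p by (rule padic_valued_K)
  interpret CE: field VE.CE by (rule VE.field_CE)
  interpret CK: field VK.CE by (rule VK.field_CE)
  obtain j where j: "j \<in> ring_hom VE.CE VK.CE" "j ` VE.QQ \<subseteq> VK.QQ" "\<And>x. x \<in> F \<Longrightarrow> j (VE.emb x) = VK.emb x"
    using completion_embedding[OF F] by blast
  interpret J: ring_hom_ring VE.CE VK.CE j by (rule ring_hom_ringI2[OF CE.ring_axioms CK.ring_axioms j(1)])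
  interpret e: ring_hom_ring ?E VE.CE VE.emb by (rule VE.emb_ring_hom)
  have inj: "inj_on j (carrier VE.CE)" by (rule non_trivial_field_hom_is_inj[OF j(1) CE.field_axioms CK.field_axioms])
  have ec: "set (map VE.emb xs) \<subseteq> carrier VE.CE" using xs e.hom_closed by auto
  have QC: "VE.QQ \<subseteq> carrier VE.CE" by (rule subfieldE(3)[OF VE.subfield_QQ])
  have jx: "map j (map VE.emb xs) = map VK.emb xs" using j(3) xs by auto
  show ?thesis
  proof (rule CE.trivial_combine_imp_independent[OF VE.subfield_QQ ec])
    fix Ks assume Ks: "set Ks \<subseteq> VE.QQ" "CE.combine Ks (map VE.emb xs) = \<zero>\<^bsub>VE.CE\<^esub>"
    have KC: "set Ks \<subseteq> carrier VE.CE" using Ks(1) QC by blast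
    have "CK.combine (map j Ks) (map VK.emb xs) = \<zero>\<^bsub>VK.CE\<^esub>"
      using J.combine_hom[OF KC ec] unfolding jx Ks(2) J.hom_zero .
    then have "set (take (length (map VK.emb xs)) (map j Ks)) \<subseteq> {\<zero>\<^bsub>VK.CE\<^esub>}"
      by (rule CK.independent_imp_trivial_combine[OF VK.subfield_QQ ind, rotated]) (use Ks(1) j(2) in auto)
    then have z: "j ` set (take (length xs) Ks) \<subseteq> {\<zero>\<^bsub>VK.CE\<^esub>}" by (simp add: take_map)
    have "y = \<zero>\<^bsub>VE.CE\<^esub>" if y: "y \<in> set (take (length xs) Ks)" for y
    proof (rule inj_onD[OF inj])
      show "y \<in> carrier VE.CE" using KC y set_take_subset by fast
      show "j y = j \<zero>\<^bsub>VE.CE\<^esub>" using z y J.hom_zero by auto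
    qed simp
    then show "set (take (length (map VE.emb xs)) Ks) \<subseteq> {\<zero>\<^bsub>VE.CE\<^esub>}" by auto
  qed
qed

text \<open>\<open>local_degree_bound\<close> is applied with the image of \<open>F\<close> as
  generating set. Finiteness, splitting and the exponent are all inherited from F/k along the dense
  embedding.\<close>

lemma local_degree_restrict:
  assumes exp: "has_exponent (Gal K k) b"
    and F: "subfield F K" "finite_dimension k F" "galois_extension (K\<lparr>carrier := F\<rparr>) k"
    and chain: "abelian_chain (Gal (completion (K\<lparr>carrier := F\<rparr>) w) (padics_in (K\<lparr>carrier := F\<rparr>) w)) n H"
  shows "\<exists>e\<le>(\<Prod>i=0..n. degree_factor b i). ring.dimension (completion (K\<lparr>carrier := F\<rparr>) w) e
    (padics_in (K\<lparr>carrier := F\<rparr>) w) (carrier (completion (K\<lparr>carrier := F\<rparr>) w))"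
proof -
  let ?E = "K\<lparr>carrier := F\<rparr>"
  interpret VE: padic_valued ?E w p by (rule padic_valued_restrict[OF F(1)])
  interpret GE: galois_char_zero ?E by (rule galois_char_zero_restrict[OF F(1,3)])
  interpret L: padic_balls VE.CE p "VE.QQ \<inter> VE.Bc 0" VE.QQ VE.Bc by (rule VE.padic_balls)
  interpret e: ring_hom_ring ?E VE.CE VE.emb by (rule VE.emb_ring_hom)
  note kE = rationals_consistent[OF F(1)] and kF = k_subset[OF F(1)] and Fc = subfieldE(3)[OF F(1)]
  have kQ: "VE.emb ` k \<subseteq> VE.QQ" using VE.emb_QQ kE by auto
  have QC: "VE.QQ \<subseteq> carrier VE.CE" by (rule subfieldE(3)[OF VE.subfield_QQ])
  have inj: "inj_on VE.emb F"
    using non_trivial_field_hom_is_inj[OF VE.emb_hom VE.field_axioms L.field_axioms] by simp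
  let ?T = "VE.emb ` F"
  have TC: "?T \<subseteq> carrier VE.CE" using e.hom_closed by auto
  obtain bs where bs: "set bs \<subseteq> carrier K" "Span k bs = F"
    using exists_base[OF k finite_dimensionE[OF k F(2)]] by blast
  have bF: "set bs \<subseteq> F" using Span_base_incl[OF k bs(1)] bs(2) by simp
  have bsT: "set (map VE.emb bs) \<subseteq> ?T" using bF by auto
  then have bsC: "set (map VE.emb bs) \<subseteq> carrier VE.CE" using TC by blast
  have SE: "VE.Span k bs = F" using bs(2) Span_consistent[OF subfieldE(1)[OF F(1)]] by simp
  \<comment> \<open>A basis of \<open>F\<close> over \<open>k\<close> spans the image of
    \<open>F\<close> over the p-adic numbers; by closedness its span is then the whole
    completion.\<close>
  have TS: "?T \<subseteq> L.Span VE.QQ (map VE.emb bs)"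
  proof
    fix y assume "y \<in> ?T"
    then obtain x where x: "x \<in> F" "y = VE.emb x" by auto
    then obtain Ks where Ks: "set Ks \<subseteq> k" "x = VE.combine Ks bs"
      using VE.Span_eq_combine_set[OF GE.k, of bs] bF unfolding kE SE by force
    have "y = L.combine (map VE.emb Ks) (map VE.emb bs)"
      unfolding x(2) Ks(2) by (rule e.combine_hom[symmetric]) (use Ks(1) kF bF in auto)
    then show "y \<in> L.Span VE.QQ (map VE.emb bs)"
      using L.Span_eq_combine_set[OF VE.subfield_QQ bsC] Ks(1) kQ by fastforce
  qed
  obtain us where us: "L.independent VE.QQ us" "L.Span VE.QQ us = L.Span VE.QQ (map VE.emb bs)"
    using L.filter_base[OF VE.subfield_QQ bsC] by metis
  have SC: "L.Span VE.QQ us = carrier VE.CE" by (rule VE.Span_completion[OF us(1)]) (use TS us(2) in simp)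
  have fin: "L.finite_dimension VE.QQ (carrier VE.CE)"
    using L.finite_dimensionI[OF L.dimension_independent[OF us(1)]] SC by simp
  have gen: "F' = carrier VE.CE" if F': "subfield F' VE.CE" "VE.QQ \<subseteq> F'" "?T \<subseteq> F'" for F'
  proof -
    have "subalgebra VE.QQ F' VE.CE"
      unfolding subalgebra_def subalgebra_axioms_def
      using subring.axioms(1)[OF subfieldE(1)[OF F'(1)]] subringE(6)[OF subfieldE(1)[OF F'(1)]] F'(2) by blast
    then have "L.Span VE.QQ (map VE.emb bs) \<subseteq> F'"
      by (rule L.subalgebra_Span_incl[OF VE.subfield_QQ]) (use bsT F'(3) in blast)
    then show ?thesis using SC us(2) subfieldE(3)[OF F'(1)] by blast
  qed
  have Irr: "VE.Irr k x \<in> carrier (k[X]\<^bsub>?E\<^esub>)" "VE.Irr k x \<in> carrier (poly_ring ?E)" "VE.splitted (VE.Irr k x)"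
    "VE.Irr k x \<noteq> []" "VE.eval (VE.Irr k x) x = \<zero>" "set (VE.Irr k x) \<subseteq> k" if "x \<in> F" for x
  proof -
    have x: "x \<in> carrier ?E" using that by simp
    note I = VE.IrrE[OF GE.k x GE.algebraic_k[OF x], unfolded kE]
    show "VE.Irr k x \<in> carrier (k[X]\<^bsub>?E\<^esub>)" "VE.eval (VE.Irr k x) x = \<zero>" using I by auto
    show "VE.Irr k x \<in> carrier (poly_ring ?E)" by (rule VE.carrier_polynomial_shell[OF subfieldE(1)[OF GE.k, unfolded kE] I(1)])
    show "VE.splitted (VE.Irr k x)" "VE.Irr k x \<noteq> []" using GE.Irr_splitted[OF x] GE.Irr_nonzero[OF x] unfolding kE by auto
    show "set (VE.Irr k x) \<subseteq> k" using I(1) unfolding univ_poly_carrier[symmetric] polynomial_def by auto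
  qed
  have ev: "L.eval (map VE.emb (VE.Irr k x)) (VE.emb x) = \<zero>\<^bsub>VE.CE\<^esub>" if "x \<in> F" for x
    using e.eval_hom'[of x "VE.Irr k x"] Irr(5,6)[OF that] that kF e.hom_zero by auto
  have roots: "\<exists>f\<in>carrier (VE.QQ[X]\<^bsub>VE.CE\<^esub>). f \<noteq> [] \<and> L.eval f s = \<zero>\<^bsub>VE.CE\<^esub> \<and> L.splitted f" if "s \<in> ?T" for s
  proof -
    obtain x where x: "x \<in> F" "s = VE.emb x" using \<open>s \<in> ?T\<close> by auto
    let ?f = "map VE.emb (VE.Irr k x)"
    have "lead_coeff ?f \<noteq> \<zero>\<^bsub>VE.CE\<^esub>"
    proof -
      have "lead_coeff (VE.Irr k x) \<in> set (VE.Irr k x)" by (rule hd_in_set[OF Irr(4)[OF x(1)]])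
      then have "lead_coeff (VE.Irr k x) \<in> F" using Irr(6)[OF x(1)] kF by blast
      moreover have "lead_coeff (VE.Irr k x) \<noteq> \<zero>"
        using Irr(1,4)[OF x(1)] unfolding univ_poly_carrier[symmetric] polynomial_def by auto
      ultimately have "VE.emb (lead_coeff (VE.Irr k x)) \<noteq> VE.emb \<zero>"
        using inj subringE(2)[OF subfieldE(1)[OF F(1)]] unfolding inj_on_def by blast
      then show ?thesis using e.hom_zero Irr(4)[OF x(1)] by (simp add: hd_map)
    qed
    then have "?f \<in> carrier (VE.QQ[X]\<^bsub>VE.CE\<^esub>)"
      using Irr(6)[OF x(1)] kQ unfolding univ_poly_carrier[symmetric] polynomial_def by auto
    moreover have "L.splitted ?f" by (rule splitted_hom[OF VE.field_axioms L.field_axioms VE.emb_hom Irr(2,4,3)[OF x(1)]])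
    ultimately show ?thesis using Irr(4)[OF x(1)] ev[OF x(1)] x(2) by blast
  qed
  \<comment> \<open>An automorphism of the completion over the p-adic numbers sends each element of
    \<open>F\<close> to a root of its minimal polynomial over \<open>k\<close>. That polynomial
    already splits in \<open>F\<close>, so \<open>F\<close> is preserved and
    \<open>hom_exponent\<close> applies to the induced map \<open>h\<close>.\<close>
  have exponent: "(\<phi> ^^ b) y = y" if \<phi>: "\<phi> \<in> carrier (Gal VE.CE VE.QQ)" and y: "y \<in> carrier VE.CE" for \<phi> y
  proof -
    have ph: "\<phi> \<in> ring_hom VE.CE VE.CE" by (rule Gal_hom[OF \<phi>])
    interpret P: ring_hom_ring VE.CE VE.CE \<phi> by (rule ring_hom_ringI2[OF L.ring_axioms L.ring_axioms ph])
    have img: "\<phi> (VE.emb x) \<in> VE.emb ` carrier ?E" if x: "x \<in> F" for x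
    proof (rule splitted_hom_roots[OF VE.field_axioms L.field_axioms VE.emb_hom Irr(2,4,3)[OF x]])
      let ?f = "map VE.emb (VE.Irr k x)"
      have "c \<in> set ?f \<Longrightarrow> \<phi> c = c" for c using Irr(6)[OF x] kQ Gal_fix[OF \<phi>] by auto
      then have mf: "map \<phi> ?f = ?f" by (rule map_idI)
      have "set ?f \<subseteq> carrier VE.CE" using Irr(6)[OF x] kQ QC by auto
      then show "L.eval ?f (\<phi> (VE.emb x)) = \<zero>\<^bsub>VE.CE\<^esub>"
        using P.eval_hom'[of "VE.emb x" ?f] TC x unfolding mf ev[OF x] P.hom_zero by blast
      show "\<phi> (VE.emb x) \<in> carrier VE.CE" using TC x by auto
    qed
    have "\<exists>z. z \<in> F \<and> VE.emb z = \<phi> (VE.emb x)" if "x \<in> F" for x using img[OF that] by auto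
    then have "\<forall>x. \<exists>z. x \<in> F \<longrightarrow> z \<in> F \<and> VE.emb z = \<phi> (VE.emb x)" by blast
    then obtain h where h: "\<And>x. x \<in> F \<Longrightarrow> h x \<in> F" "\<And>x. x \<in> F \<Longrightarrow> VE.emb (h x) = \<phi> (VE.emb x)" by metis
    note sF = subringE[OF subfieldE(1)[OF F(1)]]
    have eqI: "x = y" if "x \<in> F" "y \<in> F" "VE.emb x = VE.emb y" for x y using inj_onD[OF inj that(3,1,2)] .
    have ec: "VE.emb x \<in> carrier VE.CE" if "x \<in> F" for x using TC that by blast
    have hh: "h \<in> ring_hom ?E K"
    proof (rule ring_hom_memI)
      fix x assume "x \<in> carrier ?E"
      then have x: "x \<in> F" by simp
      show "h x \<in> carrier K" using h(1)[OF x] Fc by blast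
      fix z assume "z \<in> carrier ?E"
      then have z: "z \<in> F" by simp
      have "h (x \<otimes> z) = h x \<otimes> h z"
        by (rule eqI) (use h x z sF(6) e.hom_mult[of x z] e.hom_mult[of "h x" "h z"] P.hom_mult[OF ec[OF x] ec[OF z]] in auto)
      then show "h (x \<otimes>\<^bsub>?E\<^esub> z) = h x \<otimes> h z" by simp
      have "h (x \<oplus> z) = h x \<oplus> h z"
        by (rule eqI) (use h x z sF(7) e.hom_add[of x z] e.hom_add[of "h x" "h z"] P.hom_add[OF ec[OF x] ec[OF z]] in auto)
      then show "h (x \<oplus>\<^bsub>?E\<^esub> z) = h x \<oplus> h z" by simp
    next
      have "h \<one> = \<one>" by (rule eqI) (use h sF(3) e.hom_one P.hom_one in auto)
      then show "h \<one>\<^bsub>?E\<^esub> = \<one>" by simp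
    qed
    have hk: "h x = x" if x: "x \<in> k" for x
    proof (rule eqI)
      show xF: "x \<in> F" using x kF by blast
      show "h x \<in> F" by (rule h(1)[OF xF])
      show "VE.emb (h x) = VE.emb x" unfolding h(2)[OF xF] by (rule Gal_fix[OF \<phi>]) (use kQ x in blast)
    qed
    have it: "(h ^^ m) x \<in> F \<and> (\<phi> ^^ m) (VE.emb x) = VE.emb ((h ^^ m) x)" if "x \<in> F" for m x
      by (induction m) (use that h in auto)
    have hF: "h ` F \<subseteq> F" using h(1) by blast
    let ?\<psi> = "\<phi> ^^ b"
    \<comment> \<open>The b-th iterate fixes the p-adic numbers and the image of \<open>F\<close>,
      and these generate the completion; no continuity of the automorphism enters.\<close>
    have "fixed_field VE.CE {?\<psi>} = carrier VE.CE"
    proof (rule gen)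
      show "subfield (fixed_field VE.CE {?\<psi>}) VE.CE"
        by (rule fixed_field_subfield[OF L.field_axioms]) (use ring_hom_funpow[OF ph] in auto)
      show "VE.QQ \<subseteq> fixed_field VE.CE {?\<psi>}"
      proof
        fix z assume z: "z \<in> VE.QQ"
        have "(\<phi> ^^ m) z = z" for m by (induction m) (use Gal_fix[OF \<phi> z] in auto)
        then show "z \<in> fixed_field VE.CE {?\<psi>}" using z QC by (intro fixed_fieldI) auto
      qed
      show "?T \<subseteq> fixed_field VE.CE {?\<psi>}"
      proof
        fix z assume "z \<in> ?T"
        then obtain x where x: "x \<in> F" "z = VE.emb x" by auto
        have "?\<psi> z = z" using it[OF x(1), of b] hom_exponent[OF exp F(1) kF hh hF hk x(1)] x(2) by simp
        then show "z \<in> fixed_field VE.CE {?\<psi>}" using ec[OF x(1)] x(2) by (intro fixed_fieldI) auto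
      qed
    qed
    then show ?thesis using fixed_fieldD(2)[of y VE.CE "{?\<psi>}" ?\<psi>] y by simp
  qed
  have "0 < b" using exp unfolding has_exponent_def by blast
  then show ?thesis by (rule L.local_degree_bound[OF _ fin TC gen roots exponent chain])
qed

end

text \<open>The inductive predicate records only that the last group is reached by abelian steps;
  the induction recovers the terms and their number.\<close>

lemma abelian_series_of_solvable_seq:
  assumes "solvable_seq G H"
  shows "\<exists>n S. S 0 = {\<one>\<^bsub>G\<^esub>} \<and> S n = H \<and> (\<forall>i<n. subgroup (S (Suc i)) G \<and> S i \<lhd> G\<lparr>carrier := S (Suc i)\<rparr> \<and>
            comm_group (G\<lparr>carrier := S (Suc i)\<rparr> Mod S i))"
  using assms
proof induction
  case unity
  show ?case by (rule exI[of _ 0], rule exI[of _ "\<lambda>_. {\<one>\<^bsub>G\<^esub>}"]) simp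
next
  case (extension J H)
  then obtain n S where S: "S 0 = {\<one>\<^bsub>G\<^esub>}" "S n = J" "\<And>i. i < n \<Longrightarrow> subgroup (S (Suc i)) G \<and> S i \<lhd> G\<lparr>carrier := S (Suc i)\<rparr> \<and>
            comm_group (G\<lparr>carrier := S (Suc i)\<rparr> Mod S i)" by blast
  let ?S = "S(Suc n := H)"
  have "?S 0 = {\<one>\<^bsub>G\<^esub>} \<and> ?S (Suc n) = H \<and> (\<forall>i<Suc n. subgroup (?S (Suc i)) G \<and> ?S i \<lhd> G\<lparr>carrier := ?S (Suc i)\<rparr> \<and>
            comm_group (G\<lparr>carrier := ?S (Suc i)\<rparr> Mod ?S i))"
    using S extension.hyps by (auto simp: less_Suc_eq)
  then show ?case by blast
qed

text \<open>Solvability makes the set of possible lengths nonempty, so the \<open>LEAST\<close> in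
  \<open>derived_length\<close> is attained.\<close>

lemma abelian_series_derived_length:
  assumes "solvable G" shows "\<exists>H. abelian_series G (derived_length G) H"
proof -
  have "\<exists>n H. abelian_series G n H"
    using abelian_series_of_solvable_seq[of G "carrier G"] assms unfolding solvable_def abelian_series_def by blast
  then show ?thesis unfolding derived_length_def by (rule LeastI_ex)
qed

theorem theorem1p5:
  fixes K :: "('a, 'm) ring_scheme" and b n :: nat
  assumes "field_char_zero K"
    and "galois_extension K (rationals K)"
    and "\<not> ring.finite_dimension K (rationals K) (carrier K)"
    and "has_exponent (Gal K (rationals K)) b"
    and "0 < n"
    and "\<And>F p v. \<lbrakk>subfield F K; ring.finite_dimension K (rationals K) F;
            galois_extension (K\<lparr>carrier := F\<rparr>) (rationals K);
            Factorial_Ring.prime (p::nat); valuation (K\<lparr>carrier := F\<rparr>) v; lies_above (K\<lparr>carrier := F\<rparr>) v p\<rbrakk>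
          \<Longrightarrow> solvable (Gal (completion (K\<lparr>carrier := F\<rparr>) v) (padics_in (K\<lparr>carrier := F\<rparr>) v)) \<and>
              derived_length (Gal (completion (K\<lparr>carrier := F\<rparr>) v)
                                  (padics_in (K\<lparr>carrier := F\<rparr>) v)) \<le> n"
  shows "\<forall>p w. Factorial_Ring.prime (p::nat) \<and> valuation K w \<and> extends_padic K w p \<longrightarrow>
           ring.finite_dimension (completion K w) (padics_in K w) (carrier (completion K w)) \<and>
           ring.dim (completion K w) (padics_in K w) (carrier (completion K w))
             \<le> (\<Prod>i=0..n. degree_factor b i)"
proof (intro allI impI)
  fix p :: nat and w :: "'a \<Rightarrow> ereal"
  assume pw: "Factorial_Ring.prime p \<and> valuation K w \<and> extends_padic K w p"
  interpret galois_valued K w p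
    using assms(1,2) pw unfolding field_char_zero_def
    by (intro galois_valued.intro galois_char_zero.intro galois_char_zero_axioms.intro galois_valued_axioms.intro) auto
  interpret VK: padic_valued K w p by (rule padic_valued_K)
  interpret CK: field VK.CE by (rule VK.field_CE)
  interpret e: ring_hom_ring K VK.CE VK.emb by (rule VK.emb_ring_hom)
  let ?P = "\<Prod>i=0..n. degree_factor b i"
  have b: "0 < b" using assms(4) unfolding has_exponent_def by blast
  \<comment> \<open>A finite list involves only finitely many elements of \<open>K\<close>, which
    lie in one finite Galois subextension; the bound there is the same for every such
    subextension.\<close>
  have bound: "length us \<le> ?P" if us: "CK.independent VK.QQ us" "set us \<subseteq> VK.emb ` carrier K" for us
  proof -
    have "us \<in> map VK.emb ` lists (carrier K)" using us(2) unfolding lists_image[symmetric] by auto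
    then obtain xs where xs: "set xs \<subseteq> carrier K" "us = map VK.emb xs" by auto
    obtain F where F: "subfield F K" "k \<subseteq> F" "set xs \<subseteq> F" "finite_dimension k F" "galois_extension (K\<lparr>carrier := F\<rparr>) k"
      using finite_galois_subextension[of "set xs"] xs(1) by blast
    let ?E = "K\<lparr>carrier := F\<rparr>"
    let ?G = "Gal (completion ?E w) (padics_in ?E w)"
    interpret VE: padic_valued ?E w p by (rule padic_valued_restrict[OF F(1)])
    interpret CE: field VE.CE by (rule VE.field_CE)
    have sol: "solvable ?G" "derived_length ?G \<le> n"
      using assms(6)[OF F(1,4,5) prime valuation_restrict[OF F(1)] lies_above_restrict[OF F(1)]] by auto
    obtain H where "abelian_series ?G (derived_length ?G) H" using abelian_series_derived_length[OF sol(1)] by blast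
    then have "abelian_chain ?G (derived_length ?G) H"
      by (rule abelian_chain_of_series[OF group_Gal[OF CE.field_axioms subfieldE(3)[OF VE.subfield_QQ]]])
    then obtain d where d: "d \<le> (\<Prod>i=0..derived_length ?G. degree_factor b i)" "CE.dimension d VE.QQ (carrier VE.CE)"
      using local_degree_restrict[OF assms(4) F(1,4,5)] by blast
    \<comment> \<open>The derived length may be smaller than \<open>n\<close>; the missing factors
      are positive integers, so the shorter product divides the longer one.\<close>
    have "(\<Prod>i=0..derived_length ?G. degree_factor b i) dvd ?P"
      by (rule prod_dvd_prod_subset) (use sol(2) in auto)
    moreover have "0 < ?P" using degree_factor_pos[OF b] by simp
    ultimately have "(\<Prod>i=0..derived_length ?G. degree_factor b i) \<le> ?P" by (rule dvd_imp_le)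
    moreover have "length xs \<le> d"
    proof -
      interpret eE: ring_hom_ring ?E VE.CE VE.emb by (rule VE.emb_ring_hom)
      have "length (map VE.emb xs) \<le> d"
        by (rule CE.independent_length_le_dimension[OF VE.subfield_QQ d(2) independent_restrict[OF F(1,3)]])
          (use us(1) xs(2) F(3) eE.hom_closed in auto)
      then show ?thesis by simp
    qed
    ultimately show ?thesis using d(1) xs(2) by simp
  qed
  \<comment> \<open>The bound on lengths guarantees a longest independent list of elements of
    \<open>K\<close>. It spans the image of \<open>K\<close>, since any element outside its span
    would lengthen it.\<close>
  let ?S = "\<lambda>us. CK.independent VK.QQ us \<and> set us \<subseteq> VK.emb ` carrier K"
  have "?S []" by simp
  moreover have "\<forall>vs. ?S vs \<longrightarrow> length vs < Suc ?P" using bound by (simp only: less_Suc_eq_le) blast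
  ultimately have "\<exists>us. ?S us \<and> (\<forall>vs. ?S vs \<longrightarrow> length vs \<le> length us)"
    by (rule ex_has_greatest_nat)
  then obtain us where us: "?S us" "\<And>vs. ?S vs \<Longrightarrow> length vs \<le> length us" by blast
  have "VK.emb ` carrier K \<subseteq> CK.Span VK.QQ us"
  proof
    fix y assume y: "y \<in> VK.emb ` carrier K"
    show "y \<in> CK.Span VK.QQ us"
    proof (rule ccontr)
      assume "y \<notin> CK.Span VK.QQ us"
      then have "CK.independent VK.QQ (y # us)" using us(1) y e.hom_closed by (intro CK.li_Cons) auto
      then show False using us(2)[of "y # us"] us(1) y by simp
    qed
  qed
  then have "CK.Span VK.QQ us = carrier VK.CE" using VK.Span_completion us(1) by blast
  then have dim: "CK.dimension (length us) VK.QQ (carrier VK.CE)"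
    using CK.dimension_independent[of VK.QQ us] us(1) by simp
  show "CK.finite_dimension VK.QQ (carrier VK.CE) \<and> CK.dim VK.QQ (carrier VK.CE) \<le> ?P"
    using CK.finite_dimensionI[OF dim] CK.dimI[OF VK.subfield_QQ dim] bound us(1) unfolding over_def by auto
qed

end
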